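(* Let $E$ be a Banach space with the Radon–Nikodym property and with strictly convex norm $\|\cdot\|$, and let $T\in\mathcal M_1(E)$ satisfy $T=V\wedge\mu_T$ for a Borel map $V\colon E\to E$ with $\|V(x)\|=1$ for $\mu_T$-a.e. $x\in E$, in the sense that $$T(f\,d\pi)=\int_Ef(x)\langle V(x),d\pi(x)\rangle\,d\mu_T(x)\quad\text{for }f\,d\pi\in D^1(E),\ \pi\in Q^1(E).$$ Let $\mu$ be a finite Borel measure on $E$ transportable by $T$ through a finite Borel measure $\sigma$ on $C(\mathbb R^+;E)\times\mathbb R^+$ such that $\int_{C(\mathbb R^+;E)}\ell(\theta)\,d(q_\#\sigma)(\theta)<+\infty$ and $q_\#\sigma$ is concentrated on curves $\theta\in C(\mathbb R^+;E)$ parameterized by arclength over $[0,\ell(\theta))$ and constant over $[\ell(\theta),+\infty)$. Let $\mu_t:=\beta_{t\#}\sigma$, $t\in\mathbb R^+$, be the respective flow of $\mu$ (so $\mu_0=\mu$). Then: (i) There is a Borel function $\varphi\colon E\times\mathbb R^+\to[0,1]$, $\varphi_t(x):=\varphi(x,t)$, such that, with $V_t(x):=V(x)(1-\varphi_t(x))$, $$\partial_t\mu_t+\mathrm{div}\,(V_t\mu_t)=0$$ in the weak sense. (ii) There is a $\gamma\in L^1(E,\mu_T)$ such that, with $V_t$ as in (i), every finite Borel measure $\eta$ on $C(\mathbb R^+;E)$ concentrated on (locally) absolutely continuous curves with $(e_t)_\#\eta=\mu_t$ for every $t\in\mathbb R^+$ and $\dot\theta(t)=V_t(\theta(t))$ for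 $\eta$-a.e. $\theta$ and a.e. $t\in\mathbb R^+$ represents the normal current $T\llcorner\gamma$, i.e. $\int_{C(\mathbb R^+;E)}[\![\theta]\!](f\,d\pi)\,d\eta(\theta)=T(\gamma f\,d\pi)$ for all $f\,d\pi\in D^1(E)$.
   Context: Metric currents. $D^1(E)$ is the set of pairs $(f,\pi)$, written $f\,d\pi$, with $f$ bounded Lipschitz and $\pi$ Lipschitz. A metric ($1$-)current $T\in\mathcal M_1(E)$ is a bilinear functional on $D^1(E)$ such that $T(f\,d\pi)=0$ if $\pi$ is constant on a neighbourhood of $\{f\neq0\}$; $T(f\,d\pi_n)\to T(f\,d\pi)$ if $\pi_n\to\pi$ pointwise with bounded Lipschitz constants; and $|T(f\,d\pi)|\le\mathrm{Lip}\,\pi\int|f|\,d\mu$ for some finite Borel measure $\mu$, the minimal one being the mass measure $\mu_T$; $\mathbb M(T):=\mu_T(E)$. $T(f\,d\pi)$ extends to $f\in L^1(E,\mu_T)$; $(T\llcorner\gamma)(f\,d\pi):=T(\gamma f\,d\pi)$. $T$ is normal if $\partial T(\pi):=T(1\,d\pi)$ is a finite signed Borel measure. For a curve $\theta$ of finite length $\ell(\theta)$, $[\![\theta]\!](f\,d\pi):=\int f(\theta(t))\frac{d}{dt}\pi(\theta(t))\,dt$. Finite Borel measures are understood to be concentrated on $\sigma$-compact sets (Ambrosio–Kirchheim convention). $Q^1(E)$. A function $\varphi\colon E\to\mathbb R$ is quasi-differentiable at $x$ if there is a functional $d\varphi(x)\in E'$ such that $\frac{d}{dt}\varphi(\theta(t))=\langle\dot\theta(t),d\varphi(x)\rangle$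 for every continuous curve $\theta$ with $\theta(t)=x$ that is differentiable at $t$. $Q^1(E)$ is the set of everywhere quasi-differentiable functions with $\|d\varphi(\cdot)\|'$ uniformly bounded and $(x,y)\mapsto\langle y,d\varphi(x)\rangle$ continuous on $E\times E$. Transportability. A finite positive Borel measure $\mu$ on $E$ is transportable by $T$ (through $\sigma$) if there are: (a) a ($\sigma$-finite) Borel measure $\bar\eta$ on $C(\mathbb R^+;E)$ concentrated on absolutely continuous nonconstant curves with $T(\omega)=\int[\![\theta]\!](\omega)\,d\bar\eta(\theta)$ for all $\omega\in D^1(E)$ and $\mathbb M(T)=\int\ell(\theta)\,d\bar\eta(\theta)$; and (b) a finite Borel measure $\sigma$ on $C(\mathbb R^+;E)\times\mathbb R^+$ with $\beta_{0\#}\sigma=\mu$ and $q_\#\sigma\ll\bar\eta$, where $\beta_t(\theta,s):=\theta(t+s)$ and $q(\theta,s):=\theta$. The flow of $\mu$ is $\mu_t:=\beta_{t\#}\sigma$. Weak sense in (i): for every bounded $\pi\in Q^1(E)$, $\frac{d}{dt}\int_E\pi\,d\mu_t=\int_E\langle V_t(x),d\pi(x)\rangle\,d\mu_t(x)$ in the sense of distributions on $(0,+\infty)$. $e_t(\theta):=\theta(t)$. *)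

theory Defs
  imports "HOL-Analysis.Analysis"
begin

section \<open>Finite Borel measures\<close>

text \<open>Convention of Ambrosio and Kirchheim: measures are concentrated on a \<open>\<sigma>\<close>-compact set.
  For a non-separable space this is a genuine restriction.\<close>

definition tight_borel :: "'a::topological_space measure \<Rightarrow> bool" where
  "tight_borel M \<longleftrightarrow> sets M = sets borel \<and>
     (\<exists>K::nat \<Rightarrow> 'a set. (\<forall>n. compact (K n)) \<and> (AE x in M. x \<in> (\<Union>n. K n)))"

definition finite_borel :: "'a::topological_space measure \<Rightarrow> bool" where
  "finite_borel M \<longleftrightarrow> tight_borel M \<and> finite_measure M"


section \<open>Metric currents of dimension one\<close>

definition lipschitz_fun :: "('a::metric_space \<Rightarrow> real) \<Rightarrow> bool" where
  "lipschitz_fun f \<longleftrightarrow> (\<exists>L. L-lipschitz_on UNIV f)"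

definition Lip :: "('a::metric_space \<Rightarrow> real) \<Rightarrow> real" where
  "Lip f = Inf {L. L-lipschitz_on UNIV f}"

definition bounded_lipschitz :: "('a::metric_space \<Rightarrow> real) \<Rightarrow> bool" where
  "bounded_lipschitz f \<longleftrightarrow> lipschitz_fun f \<and> bounded (range f)"

text \<open>A functional on pairs \<open>f d\<pi>\<close> is a function of both arguments; its values matter only for
  \<open>f\<close> bounded Lipschitz and \<open>\<pi>\<close> Lipschitz.\<close>

type_synonym 'a functional = "('a \<Rightarrow> real) \<Rightarrow> ('a \<Rightarrow> real) \<Rightarrow> real"

definition bilinear_on_D1 :: "'a::metric_space functional \<Rightarrow> bool" where
  "bilinear_on_D1 T \<longleftrightarrow>
     (\<forall>f g \<pi> a b. bounded_lipschitz f \<longrightarrow> bounded_lipschitz g \<longrightarrow> lipschitz_fun \<pi> \<longrightarrow>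
        T (\<lambda>x. a * f x + b * g x) \<pi> = a * T f \<pi> + b * T g \<pi>) \<and>
     (\<forall>f \<pi> \<rho> a b. bounded_lipschitz f \<longrightarrow> lipschitz_fun \<pi> \<longrightarrow> lipschitz_fun \<rho> \<longrightarrow>
        T f (\<lambda>x. a * \<pi> x + b * \<rho> x) = a * T f \<pi> + b * T f \<rho>)"

definition mass_bound :: "'a::metric_space functional \<Rightarrow> 'a measure \<Rightarrow> bool" where
  "mass_bound T \<mu> \<longleftrightarrow> finite_borel \<mu> \<and>
     (\<forall>f \<pi>. bounded_lipschitz f \<longrightarrow> lipschitz_fun \<pi> \<longrightarrow>
        \<bar>T f \<pi>\<bar> \<le> Lip \<pi> * (\<integral>x. \<bar>f x\<bar> \<partial>\<mu>))"

definition metric_current :: "'a::metric_space functional \<Rightarrow> bool" where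
  "metric_current T \<longleftrightarrow>
     bilinear_on_D1 T \<and>
     (\<forall>f \<pi> U c. bounded_lipschitz f \<longrightarrow> lipschitz_fun \<pi> \<longrightarrow>
        open U \<longrightarrow> {x. f x \<noteq> 0} \<subseteq> U \<longrightarrow> (\<forall>x\<in>U. \<pi> x = c) \<longrightarrow> T f \<pi> = 0) \<and>
     (\<forall>f \<pi> \<pi>s L. bounded_lipschitz f \<longrightarrow> (\<forall>n::nat. L-lipschitz_on UNIV (\<pi>s n)) \<longrightarrow>
        (\<forall>x. (\<lambda>n. \<pi>s n x) \<longlonglongrightarrow> \<pi> x) \<longrightarrow> (\<lambda>n. T f (\<pi>s n)) \<longlonglongrightarrow> T f \<pi>) \<and>
     (\<exists>\<mu>. mass_bound T \<mu>)"

definition mass_measure :: "'a::metric_space functional \<Rightarrow> 'a measure" where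
  "mass_measure T =
     (THE \<mu>. mass_bound T \<mu> \<and>
        (\<forall>\<nu>. mass_bound T \<nu> \<longrightarrow> (\<forall>A\<in>sets borel. emeasure \<mu> A \<le> emeasure \<nu> A)))"

definition mass :: "'a::metric_space functional \<Rightarrow> ennreal" where
  "mass T = emeasure (mass_measure T) UNIV"

text \<open>Extension of \<open>T(f d\<pi>)\<close> to integrable \<open>f\<close>, by \<open>L\<^sup>1\<close>-density of bounded Lipschitz functions.\<close>

definition current_ext :: "'a::metric_space functional \<Rightarrow> 'a functional" where
  "current_ext T g \<pi> =
     (THE c. \<exists>f. (\<forall>n::nat. bounded_lipschitz (f n)) \<and>
        (\<lambda>n. \<integral>\<^sup>+x. ennreal \<bar>f n x - g x\<bar> \<partial>mass_measure T) \<longlonglongrightarrow> 0 \<and>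
        (\<lambda>n. T (f n) \<pi>) \<longlonglongrightarrow> c)"

definition current_restrict :: "'a::metric_space functional \<Rightarrow> ('a \<Rightarrow> real) \<Rightarrow> 'a functional" where
  "current_restrict T \<gamma> f \<pi> = current_ext T (\<lambda>x. \<gamma> x * f x) \<pi>"

text \<open>The finite signed measure \<open>\<partial>T\<close> is given as a difference of two positive ones. As a
  zero-dimensional current it acts on bounded Lipschitz functions.\<close>

definition normal_current :: "'a::metric_space functional \<Rightarrow> bool" where
  "normal_current T \<longleftrightarrow> metric_current T \<and>
     (\<exists>\<nu>1 \<nu>2. finite_borel \<nu>1 \<and> finite_borel \<nu>2 \<and>
        (\<forall>\<pi>. bounded_lipschitz \<pi> \<longrightarrow> T (\<lambda>_. 1) \<pi> = (\<integral>x. \<pi> x \<partial>\<nu>1) - (\<integral>x. \<pi> x \<partial>\<nu>2)))"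


section \<open>The space \<open>C(\<real>\<^sup>+; E)\<close>\<close>

text \<open>A continuous curve on \<open>[0,\<infinity>)\<close> is represented by its constant extension to negative times.\<close>

typedef (overloaded) ('a::topological_space) curve =
  "{\<theta>::real \<Rightarrow> 'a. continuous_on UNIV \<theta> \<and> (\<forall>t\<le>0. \<theta> t = \<theta> 0)}"
  morphisms at_time Abs_curve
proof
  show "(\<lambda>_. undefined) \<in> {\<theta>::real \<Rightarrow> 'a. continuous_on UNIV \<theta> \<and> (\<forall>t\<le>0. \<theta> t = \<theta> 0)}"
    by simp
qed

text \<open>Topology of locally uniform convergence.\<close>

instantiation curve :: (metric_space) t2_space
begin

definition open_curve :: "'a curve set \<Rightarrow> bool" where
  "open_curve U \<longleftrightarrow>
     (\<forall>\<theta>\<in>U. \<exists>b. \<exists>\<epsilon>>0. \<forall>\<kappa>. (\<forall>t\<in>{0..b}. dist (at_time \<theta> t) (at_time \<kappa> t) < \<epsilon>) \<longrightarrow> \<kappa> \<in> U)"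

instance
proof
  show "open (UNIV :: 'a curve set)"
    by (auto simp: open_curve_def intro: exI[of _ 1])
next
  fix U W :: "'a curve set"
  assume U: "open U" and W: "open W"
  show "open (U \<inter> W)"
    unfolding open_curve_def
  proof
    fix \<theta> assume "\<theta> \<in> U \<inter> W"
    then obtain b e c d where
      "e > 0" and hU: "\<And>\<kappa>. (\<forall>t\<in>{0..b}. dist (at_time \<theta> t) (at_time \<kappa> t) < e) \<Longrightarrow> \<kappa> \<in> U"
      and "d > 0" and hW: "\<And>\<kappa>. (\<forall>t\<in>{0..c}. dist (at_time \<theta> t) (at_time \<kappa> t) < d) \<Longrightarrow> \<kappa> \<in> W"
      using U W unfolding open_curve_def by (metis IntD1 IntD2)
    then show "\<exists>b. \<exists>\<epsilon>>0. \<forall>\<kappa>. (\<forall>t\<in>{0..b}. dist (at_time \<theta> t) (at_time \<kappa> t) < \<epsilon>) \<longrightarrow> \<kappa> \<in> U \<inter> W"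
      by - (rule exI[of _ "max b c"], rule exI[of _ "min e d"], auto intro!: hU hW)
  qed
next
  fix \<U> :: "'a curve set set"
  assume "\<forall>U\<in>\<U>. open U"
  then show "open (\<Union>\<U>)"
    unfolding open_curve_def by (meson UnionE UnionI)
next
  fix \<theta> \<kappa> :: "'a curve"
  assume "\<theta> \<noteq> \<kappa>"
  then have "at_time \<theta> \<noteq> at_time \<kappa>"
    by (simp add: at_time_inject)
  then obtain s where "at_time \<theta> s \<noteq> at_time \<kappa> s"
    by blast
  then obtain t where t: "t \<ge> 0" "at_time \<theta> t \<noteq> at_time \<kappa> t"
    using at_time[of \<theta>] at_time[of \<kappa>] by (metis (mono_tags, lifting) linear mem_Collect_eq)
  define r where "r = dist (at_time \<theta> t) (at_time \<kappa> t) / 2"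
  define B where "B = (\<lambda>\<theta>::'a curve. {\<kappa>. dist (at_time \<theta> t) (at_time \<kappa> t) < r})"
  have r: "r > 0"
    using t by (simp add: r_def)
  have op: "open (B \<omega>)" for \<omega>
    unfolding open_curve_def
  proof
    fix \<xi> assume "\<xi> \<in> B \<omega>"
    then have d: "dist (at_time \<omega> t) (at_time \<xi> t) < r"
      by (simp add: B_def)
    show "\<exists>b. \<exists>\<epsilon>>0. \<forall>\<kappa>. (\<forall>t\<in>{0..b}. dist (at_time \<xi> t) (at_time \<kappa> t) < \<epsilon>) \<longrightarrow> \<kappa> \<in> B \<omega>"
    proof (intro exI conjI allI impI)
      show "0 < r - dist (at_time \<omega> t) (at_time \<xi> t)"
        using d by simp
      fix \<zeta> assume "\<forall>u\<in>{0..t}. dist (at_time \<xi> u) (at_time \<zeta> u) < r - dist (at_time \<omega> t) (at_time \<xi> t)"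
      then have "dist (at_time \<xi> t) (at_time \<zeta> t) < r - dist (at_time \<omega> t) (at_time \<xi> t)"
        using t by simp
      moreover have "dist (at_time \<omega> t) (at_time \<zeta> t)
          \<le> dist (at_time \<omega> t) (at_time \<xi> t) + dist (at_time \<xi> t) (at_time \<zeta> t)"
        by (rule dist_triangle)
      ultimately show "\<zeta> \<in> B \<omega>"
        by (simp add: B_def)
    qed
  qed
  have "\<theta> \<in> B \<theta>" "\<kappa> \<in> B \<kappa>"
    using r by (auto simp: B_def)
  moreover have "B \<theta> \<inter> B \<kappa> = {}"
  proof (rule ccontr)
    assume "B \<theta> \<inter> B \<kappa> \<noteq> {}"
    then obtain \<zeta> where "dist (at_time \<theta> t) (at_time \<zeta> t) < r" "dist (at_time \<kappa> t) (at_time \<zeta> t) < r"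
      by (auto simp: B_def)
    then have "dist (at_time \<theta> t) (at_time \<kappa> t) < 2 * r"
      using dist_triangle2[of "at_time \<theta> t" "at_time \<kappa> t" "at_time \<zeta> t"] by linarith
    then show False
      by (simp add: r_def)
  qed
  ultimately show "\<exists>U W. open U \<and> open W \<and> \<theta> \<in> U \<and> \<kappa> \<in> W \<and> U \<inter> W = {}"
    using op by blast
qed

end

definition absolutely_continuous_curve_on :: "real set \<Rightarrow> 'a::metric_space curve \<Rightarrow> bool" where
  "absolutely_continuous_curve_on S \<theta> \<longleftrightarrow>
     (\<forall>\<epsilon>>0. \<exists>\<delta>>0. \<forall>(n::nat) a b.
        (\<forall>i<n. a i \<le> b i \<and> {a i..b i} \<subseteq> S) \<longrightarrow>
        disjoint_family_on (\<lambda>i. {a i<..<b i}) {..<n} \<longrightarrow>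
        (\<Sum>i<n. b i - a i) < \<delta> \<longrightarrow>
        (\<Sum>i<n. dist (at_time \<theta> (a i)) (at_time \<theta> (b i))) < \<epsilon>)"

definition nonconstant_curve :: "'a::metric_space curve \<Rightarrow> bool" where
  "nonconstant_curve \<theta> \<longleftrightarrow> (\<exists>s\<ge>0. \<exists>t\<ge>0. at_time \<theta> s \<noteq> at_time \<theta> t)"

definition length_on :: "real set \<Rightarrow> 'a::metric_space curve \<Rightarrow> ennreal" where
  "length_on S \<theta> =
     (SUP (n, t) \<in> {(n::nat, t::nat \<Rightarrow> real). mono_on {..n} t \<and> t ` {..n} \<subseteq> S}.
        \<Sum>i<n. ennreal (dist (at_time \<theta> (t i)) (at_time \<theta> (t (Suc i)))))"

abbreviation curve_length :: "'a::metric_space curve \<Rightarrow> ennreal" where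
  "curve_length \<equiv> length_on {0..}"

definition arclength_parameterized :: "'a::metric_space curve \<Rightarrow> bool" where
  "arclength_parameterized \<theta> \<longleftrightarrow>
     (\<forall>s t. 0 \<le> s \<longrightarrow> s \<le> t \<longrightarrow> ennreal t < curve_length \<theta> \<longrightarrow> length_on {s..t} \<theta> = ennreal (t - s)) \<and>
     (\<forall>s t. 0 \<le> s \<longrightarrow> 0 \<le> t \<longrightarrow> curve_length \<theta> \<le> ennreal s \<longrightarrow> curve_length \<theta> \<le> ennreal t \<longrightarrow>
        at_time \<theta> s = at_time \<theta> t)"

definition curve_current :: "'a::metric_space curve \<Rightarrow> 'a functional" where
  "curve_current \<theta> f \<pi> =
     (LINT t:{0..}|lebesgue. f (at_time \<theta> t) * deriv (\<lambda>s. \<pi> (at_time \<theta> s)) t)"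

text \<open>\<open>T(\<omega>) = \<integral> [[\<theta>]](\<omega>) d\<eta>(\<theta>)\<close>, including integrability of the integrand. The
  completion occurs because \<open>[[\<theta>]](\<omega>)\<close> is meaningful only for \<open>\<eta>\<close>-almost every \<open>\<theta>\<close>;
  its value on the exceptional null set (a library default) need not be a Borel function.\<close>

definition represents_current :: "'a::metric_space curve measure \<Rightarrow> 'a functional \<Rightarrow> bool" where
  "represents_current \<eta> T \<longleftrightarrow>
     (\<forall>f \<pi>. bounded_lipschitz f \<longrightarrow> lipschitz_fun \<pi> \<longrightarrow>
        has_bochner_integral (completion \<eta>) (\<lambda>\<theta>. curve_current \<theta> f \<pi>) (T f \<pi>))"


section \<open>Transportability\<close>

definition beta :: "real \<Rightarrow> 'a::metric_space curve \<times> real \<Rightarrow> 'a" where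
  "beta t = (\<lambda>(\<theta>, s). at_time \<theta> (t + s))"

definition flow :: "('a::metric_space curve \<times> real) measure \<Rightarrow> real \<Rightarrow> 'a measure" where
  "flow \<sigma> t = distr \<sigma> borel (beta t)"

definition transportable_through ::
  "'a::metric_space functional \<Rightarrow> 'a measure \<Rightarrow> ('a curve \<times> real) measure \<Rightarrow> bool" where
  "transportable_through T \<mu> \<sigma> \<longleftrightarrow> finite_borel \<mu> \<and>
     (\<exists>\<eta>. tight_borel \<eta> \<and> sigma_finite_measure \<eta> \<and>
        (AE \<theta> in \<eta>. absolutely_continuous_curve_on {0..} \<theta> \<and> nonconstant_curve \<theta>) \<and>
        represents_current \<eta> T \<and>
        mass T = (\<integral>\<^sup>+\<theta>. curve_length \<theta> \<partial>\<eta>) \<and>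
        finite_borel \<sigma> \<and> (AE p in \<sigma>. 0 \<le> snd p) \<and>
        distr \<sigma> borel (beta 0) = \<mu> \<and>
        absolutely_continuous \<eta> (distr \<sigma> borel fst))"


section \<open>Geometry of the Banach space and quasi-differentiability\<close>

definition strictly_convex_norm :: "'e::real_normed_vector itself \<Rightarrow> bool" where
  "strictly_convex_norm _ \<longleftrightarrow>
     (\<forall>(x::'e) y u. norm x = 1 \<longrightarrow> norm y = 1 \<longrightarrow> x \<noteq> y \<longrightarrow> 0 < u \<longrightarrow> u < 1 \<longrightarrow>
        norm ((1 - u) *\<^sub>R x + u *\<^sub>R y) < 1)"

text \<open>The Bochner integral, as in the library (\<open>has_bochner_integral\<close>) but without its
  restriction to separable target spaces.\<close>

definition has_strong_integral ::
  "'w measure \<Rightarrow> ('w \<Rightarrow> 'e) \<Rightarrow> 'e::real_normed_vector \<Rightarrow> bool" where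
  "has_strong_integral M g x \<longleftrightarrow> g \<in> borel_measurable M \<and>
     (\<exists>s. (\<forall>i::nat. Bochner_Integration.simple_bochner_integrable M (s i)) \<and>
        (\<lambda>i. \<integral>\<^sup>+w. ennreal (norm (g w - s i w)) \<partial>M) \<longlonglongrightarrow> 0 \<and>
        (\<lambda>i. Bochner_Integration.simple_bochner_integral M (s i)) \<longlonglongrightarrow> x)"

definition vector_measure :: "'w measure \<Rightarrow> ('w set \<Rightarrow> 'e::real_normed_vector) \<Rightarrow> bool" where
  "vector_measure M \<nu> \<longleftrightarrow>
     (\<forall>A::nat \<Rightarrow> 'w set. range A \<subseteq> sets M \<longrightarrow> disjoint_family A \<longrightarrow>
        (\<lambda>i. \<nu> (A i)) sums \<nu> (\<Union>i. A i))"

definition finite_variation :: "'w measure \<Rightarrow> ('w set \<Rightarrow> 'e::real_normed_vector) \<Rightarrow> bool" where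
  "finite_variation M \<nu> \<longleftrightarrow>
     (\<exists>C. \<forall>P. finite P \<longrightarrow> P \<subseteq> sets M \<longrightarrow> disjoint P \<longrightarrow> (\<Sum>A\<in>P. norm (\<nu> A)) \<le> C)"

text \<open>The finite measures range over all \<open>\<sigma>\<close>-algebras on subsets of the real line. This loses no
  generality: the Radon-Nikodym property is already determined by Lebesgue measure on \<open>[0,1]\<close>.\<close>

definition radon_nikodym_property :: "'e::banach itself \<Rightarrow> bool" where
  "radon_nikodym_property _ \<longleftrightarrow>
     (\<forall>(M::real measure) (\<nu>::real set \<Rightarrow> 'e).
        finite_measure M \<longrightarrow> vector_measure M \<nu> \<longrightarrow> finite_variation M \<nu> \<longrightarrow>
        (\<forall>A\<in>null_sets M. \<nu> A = 0) \<longrightarrow>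
        (\<exists>g. \<forall>A\<in>sets M. has_strong_integral M (\<lambda>w. indicat_real A w *\<^sub>R g w) (\<nu> A)))"

definition has_quasi_derivative ::
  "('e::real_normed_vector \<Rightarrow> real) \<Rightarrow> ('e \<Rightarrow>\<^sub>L real) \<Rightarrow> 'e \<Rightarrow> bool" where
  "has_quasi_derivative \<phi> D x \<longleftrightarrow>
     (\<forall>(\<theta>::real \<Rightarrow> 'e) t v. continuous_on UNIV \<theta> \<longrightarrow> \<theta> t = x \<longrightarrow>
        (\<theta> has_vector_derivative v) (at t) \<longrightarrow>
        ((\<lambda>s. \<phi> (\<theta> s)) has_real_derivative blinfun_apply D v) (at t))"

definition quasi_deriv :: "('e::real_normed_vector \<Rightarrow> real) \<Rightarrow> 'e \<Rightarrow> ('e \<Rightarrow>\<^sub>L real)" where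
  "quasi_deriv \<phi> x = (THE D. has_quasi_derivative \<phi> D x)"

definition Q1 :: "('e::real_normed_vector \<Rightarrow> real) set" where
  "Q1 = {\<phi>. (\<forall>x. \<exists>D. has_quasi_derivative \<phi> D x) \<and>
            bounded (range (quasi_deriv \<phi>)) \<and>
            continuous_on UNIV (\<lambda>(x, y). blinfun_apply (quasi_deriv \<phi> x) y)}"

text \<open>\<open>T = V \<and> \<mu>\<^sub>T\<close>. For non-separable \<open>E\<close> the function \<open>x \<mapsto> \<langle>V(x), d\<pi>(x)\<rangle>\<close> is a priori
  Borel only up to null sets, hence the completion. (Functions in \<open>Q\<^sup>1(E)\<close> are Lipschitz.)\<close>

definition current_has_field ::
  "'e::real_normed_vector functional \<Rightarrow> ('e \<Rightarrow> 'e) \<Rightarrow> bool" where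
  "current_has_field T V \<longleftrightarrow>
     (\<forall>f \<pi>. bounded_lipschitz f \<longrightarrow> lipschitz_fun \<pi> \<longrightarrow> \<pi> \<in> Q1 \<longrightarrow>
        has_bochner_integral (completion (mass_measure T))
          (\<lambda>x. f x * blinfun_apply (quasi_deriv \<pi> x) (V x)) (T f \<pi>))"


section \<open>The continuity equation\<close>

definition test_function :: "(real \<Rightarrow> real) \<Rightarrow> bool" where
  "test_function \<psi> \<longleftrightarrow>
     (\<forall>k t. ((deriv ^^ k) \<psi>) differentiable (at t)) \<and>
     (\<exists>a b. 0 < a \<and> (\<forall>t. t \<notin> {a..b} \<longrightarrow> \<psi> t = 0))"

text \<open>The first two conjuncts say that the right-hand side is a locally integrable function of \<open>t\<close>,
  so that it defines a distribution on \<open>(0,\<infinity>)\<close>.\<close>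

definition weak_continuity_equation ::
  "(real \<Rightarrow> 'e::real_normed_vector measure) \<Rightarrow> (real \<Rightarrow> 'e \<Rightarrow> 'e) \<Rightarrow> bool" where
  "weak_continuity_equation \<mu> V \<longleftrightarrow>
     (\<forall>\<pi>\<in>Q1. bounded (range \<pi>) \<longrightarrow>
        (AE t in lebesgue_on {0<..}.
           integrable (completion (\<mu> t)) (\<lambda>x. blinfun_apply (quasi_deriv \<pi> x) (V t x))) \<and>
        (\<forall>a b. 0 < a \<longrightarrow>
           set_integrable lebesgue {a..b}
             (\<lambda>t. \<integral>x. blinfun_apply (quasi_deriv \<pi> x) (V t x) \<partial>completion (\<mu> t))) \<and>
        (\<forall>\<psi>. test_function \<psi> \<longrightarrow>
           - (LINT t:{0<..}|lebesgue. deriv \<psi> t * (\<integral>x. \<pi> x \<partial>\<mu> t)) =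
             (LINT t:{0<..}|lebesgue.
                \<psi> t * (\<integral>x. blinfun_apply (quasi_deriv \<pi> x) (V t x) \<partial>completion (\<mu> t)))))"

end

theory Submission
  imports Defs "HOL-Probability.Distribution_Functions"
begin

text \<open>
  Let \<open>\<mu>T\<close> be the mass measure of \<open>T\<close>, and let \<open>\<eta>\<close> be the decomposition of \<open>T\<close> into curves that
  underlies the transport. By the Radon-Nikodym property absolutely continuous curves are
  differentiable almost everywhere (\<open>ac_differentiable_AE\<close>). Since masses add up, \<open>\<mu>T\<close> is the image
  of \<open>|\<theta>'(t)| dt d\<eta>(\<theta>)\<close> under evaluation (\<open>mass_measure_eq_image\<close>). For a linear functional \<open>y\<close>,
  computing \<open>T(f dy)\<close> from the curves and from the field shows that on average over any Borel set
  \<open>y(\<theta>')\<close> equals \<open>|\<theta>'| y(V)\<close> (\<open>field_average\<close>). If \<open>y\<close> norms a vector close to \<open>V\<close>, then \<open>y(\<theta>')\<close> is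
  close to \<open>|\<theta>'|\<close>, and strict convexity forces \<open>\<theta>' = |\<theta>'| V(\<theta>)\<close> (\<open>curves_tangent_to_field\<close>).
  Countably many functionals suffice, because a Borel map has essentially separable range with
  respect to a measure on a \<open>\<sigma>\<close>-compact set (\<open>borel_map_essentially_separable\<close>).

  Hence for every Lipschitz \<open>\<pi>\<close> the derivative of \<open>\<pi>\<close> along the curves is \<open>|\<theta>'|\<close> times a directional
  derivative \<open>\<partial>\<pi>\<close> along \<open>V\<close>, which is a Borel function of the point (\<open>dird_along_curve\<close>), and the
  restriction of \<open>T\<close> to \<open>\<gamma>\<close> maps \<open>f d\<pi>\<close> to the integral of \<open>\<gamma> f \<partial>\<pi>\<close> with respect to \<open>\<mu>T\<close>
  (\<open>current_restrict_eq\<close>).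

  The curves of the flow have unit speed, so each particle moves with velocity \<open>V\<close> until it
  reaches the end of its curve, where it rests (\<open>flow_curve\<close>). Let \<open>\<zeta>(x, t)\<close> be the fraction of the
  mass at \<open>x\<close> and time \<open>t\<close> that still moves (\<open>survival_density\<close>), and put \<open>\<phi> = 1 - \<zeta>\<close>. Integration
  by parts along each path gives the continuity equation (\<open>continuity_equation\<close>). The total time
  for which particles move is the total length of their paths and thus finite; its distribution
  in space has a density \<open>\<gamma>\<close> with respect to \<open>\<mu>T\<close> (\<open>occupation_density\<close>). The boundary of the
  restriction to \<open>\<gamma>\<close> is the distribution of the end points minus that of the starting points.
  Finally, the action on \<open>f d\<pi>\<close> of any measure on curves with velocity \<open>\<zeta> V\<close> and with the
  marginals of the flow is the integral of \<open>\<zeta> f \<partial>\<pi>\<close> over space-time, which depends on the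
  marginals only. It equals the integral of \<open>f \<partial>\<pi>\<close> over the moving particles, that is, of \<open>\<gamma> f \<partial>\<pi>\<close>
  over space (\<open>representation\<close>).
\<close>

section \<open>Finite Borel measures and Lipschitz functions\<close>

lemma tendsto_zero_obtain_less:
 fixes X :: "nat => real"
 assumes "X \<longlonglongrightarrow> 0" "e > 0"
 obtains n where "X n < e"
 using order_tendstoD(2)[OF assms] by (auto simp: eventually_sequentially)

lemma integral_dominated:
 fixes f g :: "'a => real"
 assumes g: "integrable M g" and f: "f \<in> borel_measurable M" and le: "AE x in M. \<bar>f x\<bar> <= g x"
 shows "integrable M f" "\<bar>integral\<^sup>L M f\<bar> <= integral\<^sup>L M g"
proof -
 show i: "integrable M f"
  by (rule Bochner_Integration.integrable_bound[OF g f]) (use le in \<open>eventually_elim, auto\<close>)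
 have "\<bar>integral\<^sup>L M f\<bar> <= (\<integral>x. \<bar>f x\<bar> \<partial>M)" by (rule integral_abs_bound)
 also have "... <= integral\<^sup>L M g" by (rule integral_mono_AE[OF _ g le]) (use i in simp)
 finally show "\<bar>integral\<^sup>L M f\<bar> <= integral\<^sup>L M g" .
qed

lemma AE_eq_of_nn_integral_eq:
 assumes [measurable]: "f \<in> borel_measurable M" "g \<in> borel_measurable M" and le: "!!x. f x <= g x"
  and ge: "(\<integral>\<^sup>+x. g x \<partial>M) <= (\<integral>\<^sup>+x. f x \<partial>M)" and fin: "(\<integral>\<^sup>+x. f x \<partial>M) < \<infinity>"
 shows "AE x in M. f x = g x"
proof -
 have "(\<integral>\<^sup>+x. g x - f x \<partial>M) = (\<integral>\<^sup>+x. g x \<partial>M) - (\<integral>\<^sup>+x. f x \<partial>M)"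
  using le fin by (intro nn_integral_diff) auto
 also have "... = 0" using ge fin by (simp add: diff_eq_0_iff_ennreal)
 finally have "AE x in M. g x - f x = 0" by (subst (asm) nn_integral_0_iff_AE) auto
 moreover have "AE x in M. f x ~= \<infinity>" using fin by (intro nn_integral_PInf_AE) auto
 ultimately show ?thesis by eventually_elim (auto simp: diff_eq_0_iff_ennreal intro: antisym le)
qed

lemma finite_measure_density:
 assumes M: "sigma_finite_measure M" and N: "finite_measure N" "sets N = sets M" "absolutely_continuous M N"
 obtains D :: "'a => real" where "D \<in> borel_measurable M" "!!x. 0 <= D x" "integrable M D" "N = density M (%x. ennreal (D x))"
proof -
 interpret sigma_finite_measure M by (rule M)
 obtain D where D: "D \<in> borel_measurable M" "AE x in M. RN_deriv M N x = ennreal (D x)" "!!x. 0 <= D x"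
  using real_RN_deriv[OF N(1,3,2)] by metis
 have ND: "N = density M (%x. ennreal (D x))"
  using density_RN_deriv[OF N(3,2)] D(1,2) by (subst density_cong[symmetric, of "RN_deriv M N"]) auto
 have "(\<integral>\<^sup>+x. ennreal (D x) \<partial>M) = emeasure N (space M)"
  unfolding ND emeasure_density[OF measurable_compose[OF D(1) measurable_ennreal] sets.top] by (auto intro!: nn_integral_cong)
 also have "... < \<infinity>" using finite_measure.emeasure_finite[OF N(1)] by (simp add: less_top)
 finally have "integrable M D" using D by (simp add: integrable_iff_bounded)
 then show ?thesis using D(1,3) ND by (intro that)
qed

text \<open>The sets with this approximation property form a sigma-algebra, and it contains every closed
  set, which is the intersection of its open metric neighbourhoods.\<close>
lemma finite_borel_regular:
 fixes M :: "'a::metric_space measure"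
 assumes fin: "finite_measure M" and sM: "sets M = sets borel" and A: "A \<in> sets borel" and e: "e > 0"
 shows "\<exists>C U. closed C \<and> open U \<and> C \<subseteq> A \<and> A \<subseteq> U \<and> measure M (U - C) < e"
proof -
 interpret finite_measure M by fact
 have sp: "space M = UNIV"
  using sets_eq_imp_space_eq[OF sM] by simp
 define P where "P = (%A::'a set. \<forall>e>0. \<exists>C U. closed C \<and> open U \<and> C \<subseteq> A \<and> A \<subseteq> U \<and> measure M (U - C) < e)"
 have meas[measurable]: "open S ==> S \<in> sets M" "closed S ==> S \<in> sets M" for S
  by (auto simp: sM)
 have clP: "P A" if cl: "closed A" for A
  unfolding P_def
 proof (intro allI impI)
  fix e :: real assume e: "e > 0"
  show "\<exists>C U. closed C \<and> open U \<and> C \<subseteq> A \<and> A \<subseteq> U \<and> measure M (U - C) < e"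
  proof (cases "A = {}")
   case True
   then show ?thesis using e by (intro exI[of _ "{}"]) auto
  next
   case False
   define U where "U = (%n::nat. {x. infdist x A < 1 / Suc n})"
   have oU: "open (U n)" for n
    unfolding U_def by (intro open_Collect_less continuous_intros)
   have AU: "A \<subseteq> U n" for n
    unfolding U_def by (auto simp: infdist_zero)
   have int: "(\<Inter>n. U n - A) = {}"
   proof safe
    fix x assume x: "x \<in> (\<Inter>n. U n - A)"
    then have "infdist x A ~= 0"
    using in_closed_iff_infdist_zero[OF cl False] by auto
    then have "infdist x A > 0" using infdist_nonneg[of x A] by linarith
    then obtain n where "1 / Suc n < infdist x A"
    using nat_approx_posE by blast
    then show "x \<in> {}" using x by (auto simp: U_def dest!: spec[of _ n])
   qed
   have "decseq (%n. U n - A)"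
    unfolding decseq_def
   proof (intro allI impI)
    fix m n :: nat assume "m <= n"
    then have "1 / real (Suc n) <= 1 / real (Suc m)" by (simp add: frac_le)
    then show "U n - A \<subseteq> U m - A" unfolding U_def by auto
   qed
   then have "(%n. measure M (U n - A)) \<longlonglongrightarrow> measure M (\<Inter>n. U n - A)"
    by (intro finite_Lim_measure_decseq) (use oU cl in auto)
   then have "(%n. measure M (U n - A)) \<longlonglongrightarrow> 0" unfolding int by simp
   then obtain n where "measure M (U n - A) < e"
    using e by (rule tendsto_zero_obtain_less)
   then show ?thesis using cl oU AU by blast
  qed
 qed
 have gen: "P A" if "A \<in> sigma_sets UNIV {A. closed A}" for A
  using that
 proof (induction A rule: sigma_sets.induct)
  case (Basic a) then show ?case using clP by auto
 next
  case Empty show ?case using clP by auto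
 next
  case (Compl a)
  show ?case unfolding P_def
  proof (intro allI impI)
   fix e :: real assume "e > 0"
   then obtain C U where "closed C" "open U" "C \<subseteq> a" "a \<subseteq> U" "measure M (U - C) < e"
    using Compl.IH[unfolded P_def, rule_format, of e] by blast
   moreover have "(UNIV - C) - (UNIV - U) = U - C" by auto
   ultimately show "\<exists>C U. closed C \<and> open U \<and> C \<subseteq> UNIV - a \<and> UNIV - a \<subseteq> U \<and> measure M (U - C) < e"
    by (intro exI[of _ "UNIV - U"] exI[of _ "UNIV - C"]) (auto simp: open_Diff closed_Diff)
  qed
 next
  case (Union a)
  show ?case unfolding P_def
  proof (intro allI impI)
   fix e :: real assume e: "e > 0"
   have "\<forall>i. \<exists>C U. closed C \<and> open U \<and> C \<subseteq> a i \<and> a i \<subseteq> U \<and> measure M (U - C) < e/2 * (1/2)^Suc i"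
    using e by (intro allI Union.IH[unfolded P_def, rule_format]) simp
   then obtain C U where CU: "!!i. closed (C i)" "!!i. open (U i)" "!!i. C i \<subseteq> a i" "!!i. a i \<subseteq> U i"
    "!!i. measure M (U i - C i) < e/2 * (1/2)^Suc i" by metis
   have geo: "(%i. e/2 * (1/2)^Suc i) sums (e/2)"
    using sums_mult[OF power_half_series, of "e/2"] by simp
   have su: "summable (%i. measure M (U i - C i))"
    by (rule summable_comparison_test'[OF sums_summable[OF geo], of 0])
    (use CU(5) in \<open>auto simp: less_imp_le\<close>)
   have 1: "measure M (\<Union>i. U i - C i) <= e/2"
   proof -
    have "measure M (\<Union>i. U i - C i) <= (\<Sum>i. measure M (U i - C i))"
    by (rule finite_measure_subadditive_countably) (use CU su in auto)
    also have "... <= (\<Sum>i. e/2 * (1/2)^Suc i)"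
    by (rule suminf_le) (use CU(5) su geo in \<open>auto simp: less_imp_le sums_iff\<close>)
    also have "... = e/2" using geo by (simp add: sums_iff)
    finally show ?thesis .
   qed
   define D where "D = (%n. \<Union>i\<le>n. C i)"
   have clD: "closed (D n)" for n unfolding D_def using CU by auto
   have "(%n. measure M ((\<Union>i. C i) - D n)) \<longlonglongrightarrow> measure M (\<Inter>n. (\<Union>i. C i) - D n)"
   proof (intro finite_Lim_measure_decseq)
    have "(\<Union>i. C i) \<in> sets M" using CU by auto
    then show "range (%n. (\<Union>i. C i) - D n) \<subseteq> sets M" using clD by auto
    show "decseq (%n. (\<Union>i. C i) - D n)"
    unfolding decseq_def D_def by (meson Diff_mono UN_mono atMost_subset_iff subset_refl)
   qed
   moreover have int: "(\<Inter>n. (\<Union>i. C i) - D n) = {}" unfolding D_def by auto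
   ultimately have "(%n. measure M ((\<Union>i. C i) - D n)) \<longlonglongrightarrow> 0" unfolding int by simp
   then obtain n where n: "measure M ((\<Union>i. C i) - D n) < e/2"
    using half_gt_zero[OF e] by (rule tendsto_zero_obtain_less)
   have m1: "(\<Union>i. U i - C i) \<in> sets M" "(\<Union>i. C i) - D n \<in> sets M"
    using CU clD by (auto intro!: sets.countable_UN sets.Diff)
   have "measure M ((\<Union>i. U i) - D n) <= measure M ((\<Union>i. U i - C i) \<union> ((\<Union>i. C i) - D n))"
    by (rule finite_measure_mono) (use m1 in auto)
   also have "... <= measure M (\<Union>i. U i - C i) + measure M ((\<Union>i. C i) - D n)"
    by (rule measure_Un_le) (use m1 in auto)
   also have "... < e" using 1 n by simp
   finally have "measure M ((\<Union>i. U i) - D n) < e" .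
   moreover have "D n \<subseteq> (\<Union>i. a i)" unfolding D_def using CU(3) by auto
   moreover have "(\<Union>i. a i) \<subseteq> (\<Union>i. U i)" using CU(4) by auto
   ultimately show "\<exists>C U. closed C \<and> open U \<and> C \<subseteq> (\<Union>i. a i) \<and> (\<Union>i. a i) \<subseteq> U \<and> measure M (U - C) < e"
    using clD[of n] open_UN[of UNIV U] CU(2) by (intro exI[of _ "D n"] exI[of _ "\<Union>i. U i"] conjI) simp_all
  qed
 qed
 have "A \<in> sigma_sets UNIV {A. closed A}"
  using A by (simp add: borel_eq_closed)
 from gen[OF this, unfolded P_def, rule_format, OF e] show ?thesis .
qed

lemma bounded_lipschitz_const [simp]: "bounded_lipschitz (%_. c)"
 unfolding bounded_lipschitz_def lipschitz_fun_def
 by (auto intro!: exI[of _ 0] lipschitz_onI simp: image_constant_conv)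

lemma lipschitz_fun_linear:
 assumes "lipschitz_fun f" "lipschitz_fun g"
 shows "lipschitz_fun (%x. a * f x + b * g x)"
proof -
 obtain L M where L: "L-lipschitz_on UNIV f" and M: "M-lipschitz_on UNIV g"
  using assms by (auto simp: lipschitz_fun_def)
 have "dist (a * f x + b * g x) (a * f y + b * g y) <= (\<bar>a\<bar> * L + \<bar>b\<bar> * M) * dist x y" for x y
 proof -
  have "dist (a * f x + b * g x) (a * f y + b * g y) <= \<bar>a\<bar> * dist (f x) (f y) + \<bar>b\<bar> * dist (g x) (g y)"
   unfolding dist_real_def abs_mult[symmetric] by (simp add: right_diff_distrib abs_le_iff) linarith
  also have "... <= \<bar>a\<bar> * (L * dist x y) + \<bar>b\<bar> * (M * dist x y)"
   by (intro add_mono mult_left_mono lipschitz_onD[OF L] lipschitz_onD[OF M]) auto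
  finally show ?thesis by (simp add: algebra_simps)
 qed
 then show ?thesis unfolding lipschitz_fun_def
  using lipschitz_on_nonneg[OF L] lipschitz_on_nonneg[OF M]
  by (intro exI[of _ "\<bar>a\<bar> * L + \<bar>b\<bar> * M"] lipschitz_onI) auto
qed

lemma bounded_lipschitz_linear:
 assumes "bounded_lipschitz f" "bounded_lipschitz g"
 shows "bounded_lipschitz (%x. a * f x + b * g x)"
proof -
 obtain B C where "!!x. \<bar>f x\<bar> <= B" "!!x. \<bar>g x\<bar> <= C"
  using assms unfolding bounded_lipschitz_def bounded_iff by auto
 then have "\<bar>a * f x + b * g x\<bar> <= \<bar>a\<bar> * B + \<bar>b\<bar> * C" for x
  by (intro order_trans[OF abs_triangle_ineq] add_mono) (auto simp: abs_mult mult_left_mono)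
 then show ?thesis using assms
  unfolding bounded_lipschitz_def bounded_iff by (auto intro!: lipschitz_fun_linear)
qed

lemma bounded_lipschitz_mult:
 assumes "bounded_lipschitz f" "bounded_lipschitz g"
 shows "bounded_lipschitz (%x. f x * g x)"
proof -
 obtain B C where B: "!!x. \<bar>f x\<bar> <= B" and C: "!!x. \<bar>g x\<bar> <= C"
  using assms unfolding bounded_lipschitz_def bounded_iff by auto
 obtain L M where L: "L-lipschitz_on UNIV f" and M: "M-lipschitz_on UNIV g"
  using assms by (auto simp: lipschitz_fun_def bounded_lipschitz_def)
 have B0: "0 <= B" "0 <= C" using B[of undefined] C[of undefined] by linarith+
 have "\<bar>f x * g x\<bar> <= B * C" for x
  using B C B0 by (simp add: abs_mult mult_mono)
 moreover have "dist (f x * g x) (f y * g y) <= (B * M + C * L) * dist x y" for x y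
 proof -
  have "dist (f x * g x) (f y * g y) = \<bar>f x * (g x - g y) + (f x - f y) * g y\<bar>"
   by (simp add: dist_real_def algebra_simps)
  also have "... <= \<bar>f x\<bar> * dist (g x) (g y) + dist (f x) (f y) * \<bar>g y\<bar>"
   by (rule order_trans[OF abs_triangle_ineq]) (simp add: dist_real_def abs_mult)
  also have "... <= B * (M * dist x y) + (L * dist x y) * C"
   using B C B0 lipschitz_on_nonneg[OF L] by (intro add_mono mult_mono lipschitz_onD[OF L] lipschitz_onD[OF M]) auto
  finally show ?thesis by (simp add: algebra_simps)
 qed
 ultimately show ?thesis
  unfolding bounded_lipschitz_def lipschitz_fun_def bounded_iff
  using lipschitz_on_nonneg[OF L] lipschitz_on_nonneg[OF M] B0
  by (intro conjI exI[of _ "B * M + C * L"] exI[of _ "B * C"] lipschitz_onI) auto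
qed

lemma bounded_lipschitz_borel:
 assumes "bounded_lipschitz f" shows "f \<in> borel_measurable borel"
 using assms unfolding bounded_lipschitz_def lipschitz_fun_def
 by (auto intro!: borel_measurable_continuous_onI dest!: lipschitz_on_continuous_on)

lemma lipschitz_fun_borel:
 assumes "lipschitz_fun f" shows "f \<in> borel_measurable borel"
 using assms unfolding lipschitz_fun_def
 by (auto intro!: borel_measurable_continuous_onI dest!: lipschitz_on_continuous_on)

lemma bounded_lipschitz_integrable:
 assumes "bounded_lipschitz f" "finite_measure M" "sets M = sets borel"
 shows "integrable M f"
proof -
 interpret finite_measure M by fact
 obtain B where "!!x. \<bar>f x\<bar> <= B"
  using assms unfolding bounded_lipschitz_def bounded_iff by (auto simp: image_iff)
 then show ?thesis
  using bounded_lipschitz_borel[OF assms(1)]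
  by (intro integrable_const_bound[of _ B]) (auto simp: measurable_cong_sets[OF assms(3) refl])
qed

lemma lipschitz_approx_closed:
 fixes C :: "'a::metric_space set"
 assumes "closed C"
 obtains f :: "nat => 'a => real" where "!!n. bounded_lipschitz (f n)" "!!n x. 0 <= f n x \<and> f n x <= 1"
  "!!x. (%n. f n x) \<longlonglongrightarrow> indicator C x"
proof (cases "C = {}")
 case True
 then show ?thesis by (intro that[of "%n x. 0"]) auto
next
 case False
 define f where "f = (%(n::nat) x. max 0 (1 - real n * infdist x C))"
 have b: "0 <= f n x \<and> f n x <= 1" for n x
  unfolding f_def by (auto simp: infdist_nonneg)
 have l: "dist (f n x) (f n y) <= real n * dist x y" for n x y
 proof -
  have "\<bar>infdist x C - infdist y C\<bar> <= dist x y"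
   using infdist_triangle_abs by blast
  then have "real n * \<bar>infdist x C - infdist y C\<bar> <= real n * dist x y"
   by (intro mult_left_mono) auto
  then have "\<bar>real n * infdist x C - real n * infdist y C\<bar> <= real n * dist x y"
   by (simp add: right_diff_distrib[symmetric] abs_mult)
  then show ?thesis unfolding f_def dist_real_def by linarith
 qed
 have bl: "bounded_lipschitz (f n)" for n
  unfolding bounded_lipschitz_def lipschitz_fun_def bounded_iff
  using b l by (intro conjI exI[of _ "real n"] exI[of _ 1] lipschitz_onI) auto
 have "(%n. f n x) \<longlonglongrightarrow> indicator C x" for x
 proof (cases "x \<in> C")
  case True
  then show ?thesis by (simp add: f_def)
 next
  case nx: False
  then have "infdist x C ~= 0"
   using in_closed_iff_infdist_zero[OF assms False] by auto
  then have pos: "infdist x C > 0" using infdist_nonneg[of x C] by linarith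
  obtain N :: nat where "1 / infdist x C < real N" using reals_Archimedean2 by blast
  then have N: "1 < real N * infdist x C" using pos by (simp add: field_simps)
  have "f n x = 0" if "n >= N" for n
  proof -
   have "real N * infdist x C <= real n * infdist x C"
    using that pos by (intro mult_right_mono) auto
   then show ?thesis using N unfolding f_def by simp
  qed
  then show ?thesis using nx
   by (auto intro!: tendsto_eventually eventually_sequentiallyI[of N])
 qed
 with b bl show ?thesis using that by blast
qed

text \<open>One function has to work for both measures: it approximates the union of two closed subsets of
  \<open>A\<close>, each of them good for one of the measures.\<close>
lemma lipschitz_approx_indicator:
 fixes M N :: "'a::metric_space measure"
 assumes M: "finite_measure M" "sets M = sets borel" and N: "finite_measure N" "sets N = sets borel"
  and A: "A \<in> sets borel" and e: "e > 0"
 shows "\<exists>h. bounded_lipschitz h \<and> (\<forall>x. 0 <= h x \<and> h x <= 1) \<and>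
   (\<integral>x. \<bar>h x - indicator A x\<bar> \<partial>M) < e \<and> (\<integral>x. \<bar>h x - indicator A x\<bar> \<partial>N) < e"
proof -
 obtain C U where CU: "closed C" "open U" "C \<subseteq> A" "A \<subseteq> U" "measure M (U - C) < e/2"
  using finite_borel_regular[OF M A half_gt_zero[OF e]] by auto
 obtain D W where DW: "closed D" "open W" "D \<subseteq> A" "A \<subseteq> W" "measure N (W - D) < e/2"
  using finite_borel_regular[OF N A half_gt_zero[OF e]] by auto
 obtain f :: "nat => 'a => real" where f: "!!n. bounded_lipschitz (f n)" "!!n x. 0 <= f n x \<and> f n x <= 1"
  "!!x. (%n. f n x) \<longlonglongrightarrow> indicator (C \<union> D) x"
  using lipschitz_approx_closed[OF closed_Un[OF CU(1) DW(1)]] by blast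
 have aux: "\<forall>\<^sub>F n in sequentially. (\<integral>x. \<bar>f n x - indicator A x\<bar> \<partial>R) < e"
  if R: "finite_measure R" "sets R = sets borel" and cl: "closed S" "open Z" "S \<subseteq> C \<union> D" "A \<subseteq> Z" "measure R (Z - S) < e/2"
  for R :: "'a measure" and S Z
 proof -
  interpret finite_measure R by fact
  have mf[measurable]: "f n \<in> borel_measurable R" for n
   using bounded_lipschitz_borel[OF f(1)] by (simp add: measurable_cong_sets[OF R(2) refl])
  have [measurable]: "C \<in> sets R" "D \<in> sets R" "A \<in> sets R" "Z \<in> sets R" "S \<in> sets R"
   using CU(1) DW(1) R(2) A cl by auto
  have b: "\<bar>f n x - indicator B x\<bar> <= 1" for n x B
   using f(2)[of n x] by (auto simp: indicator_def)
  have "(%n. \<integral>x. \<bar>f n x - indicator A x\<bar> \<partial>R) \<longlonglongrightarrow> (\<integral>x. \<bar>indicator (C \<union> D) x - indicator A x\<bar> \<partial>R)"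
  proof (rule integral_dominated_convergence[where w="%x. 1"])
   show "AE x in R. (%n. \<bar>f n x - indicator A x\<bar>) \<longlonglongrightarrow> \<bar>indicator (C \<union> D) x - indicator A x\<bar>"
    by (intro AE_I2 tendsto_intros f(3))
   show "AE x in R. norm \<bar>f n x - indicator A x\<bar> <= 1" for n
    using b by (intro AE_I2) auto
  qed auto
  moreover have "(\<integral>x. \<bar>indicator (C \<union> D) x - indicator A x\<bar> \<partial>R) < e"
  proof -
   have "(\<integral>x. \<bar>indicator (C \<union> D) x - indicator A x :: real\<bar> \<partial>R) <= (\<integral>x. indicator (Z - S) x \<partial>R)"
   proof (rule integral_mono)
    show "integrable R (%x. \<bar>indicator (C \<union> D) x - indicator A x :: real\<bar>)"
    by (rule integrable_const_bound[of _ 1]) (measurable, auto simp: indicator_def)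
    show "integrable R (%x. indicator (Z - S) x :: real)"
    by (intro integrable_real_indicator) (measurable, simp add: emeasure_eq_measure)
    show "\<bar>indicator (C \<union> D) x - indicator A x :: real\<bar> <= indicator (Z - S) x" for x
    using CU(3) DW(3) cl by (auto simp: indicator_def)
   qed
   also have "... = measure R (Z - S)" by simp
   finally show ?thesis using cl(5) e by linarith
  qed
  ultimately show ?thesis by (rule order_tendstoD(2))
 qed
 have "\<forall>\<^sub>F n in sequentially. (\<integral>x. \<bar>f n x - indicator A x\<bar> \<partial>M) < e \<and> (\<integral>x. \<bar>f n x - indicator A x\<bar> \<partial>N) < e"
  using aux[OF M CU(1,2) _ CU(4,5)] aux[OF N DW(1,2) _ DW(4,5)] by (intro eventually_conj) auto
 then obtain n where "(\<integral>x. \<bar>f n x - indicator A x\<bar> \<partial>M) < e" "(\<integral>x. \<bar>f n x - indicator A x\<bar> \<partial>N) < e"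
  by (auto simp: eventually_sequentially)
 then show ?thesis using f by blast
qed

lemma bounded_lipschitz_dense_real:
 fixes M :: "'a::metric_space measure" and g :: "'a => real"
 assumes fin: "finite_measure M" and sM: "sets M = sets borel" and g: "integrable M g"
 shows "\<forall>e>0. \<exists>f. bounded_lipschitz f \<and> (\<integral>x. \<bar>f x - g x\<bar> \<partial>M) < e"
 using g
proof (induction g rule: integrable_induct)
 case (base A c)
 show ?case
 proof (intro allI impI)
  fix e :: real assume e: "e > 0"
  define d where "d = e / (\<bar>c\<bar> + 1)"
  have d: "d > 0" "(\<bar>c\<bar> + 1) * d = e" using e by (simp_all add: d_def)
  obtain h where h: "bounded_lipschitz h" "(\<integral>x. \<bar>h x - indicator A x\<bar> \<partial>M) < d"
   using lipschitz_approx_indicator[OF fin sM fin sM _ d(1), of A] base(1)[unfolded sM] by blast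
  have "\<bar>c * h x - indicator A x *\<^sub>R c\<bar> = \<bar>c\<bar> * \<bar>h x - indicator A x\<bar>" for x
   by (simp only: abs_mult[symmetric] right_diff_distrib real_scaleR_def mult.commute[of c])
  then have "(\<integral>x. \<bar>c * h x - indicator A x *\<^sub>R c\<bar> \<partial>M) = \<bar>c\<bar> * (\<integral>x. \<bar>h x - indicator A x\<bar> \<partial>M)" by simp
  also have "... <= \<bar>c\<bar> * d" using h(2) by (intro mult_left_mono) auto
  also have "... < e" using d unfolding distrib_right by simp
  finally have "(\<integral>x. \<bar>c * h x - indicator A x *\<^sub>R c\<bar> \<partial>M) < e" .
  moreover have "bounded_lipschitz (%x. c * h x)"
   using bounded_lipschitz_linear[OF h(1) h(1), of c 0] by simp
  ultimately show "\<exists>f. bounded_lipschitz f \<and> (\<integral>x. \<bar>f x - indicator A x *\<^sub>R c\<bar> \<partial>M) < e"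
   by blast
 qed
next
 case (add f g)
 show ?case
 proof (intro allI impI)
  fix e :: real assume e: "e > 0"
  obtain u v where u: "bounded_lipschitz u" "(\<integral>x. \<bar>u x - f x\<bar> \<partial>M) < e/2"
   and v: "bounded_lipschitz v" "(\<integral>x. \<bar>v x - g x\<bar> \<partial>M) < e/2"
   using add.IH e by (meson half_gt_zero)
  have iu: "integrable M u" "integrable M v"
   by (rule bounded_lipschitz_integrable[OF _ fin sM], fact)+
  have "(\<integral>x. \<bar>(u x + v x) - (f x + g x)\<bar> \<partial>M) <= (\<integral>x. \<bar>u x - f x\<bar> + \<bar>v x - g x\<bar> \<partial>M)"
   using iu add by (intro integral_mono) auto
  also have "... = (\<integral>x. \<bar>u x - f x\<bar> \<partial>M) + (\<integral>x. \<bar>v x - g x\<bar> \<partial>M)"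
   using iu add by (intro Bochner_Integration.integral_add) auto
  also have "... < e" using u v by simp
  finally show "\<exists>h. bounded_lipschitz h \<and> (\<integral>x. \<bar>h x - (f x + g x)\<bar> \<partial>M) < e"
   using bounded_lipschitz_linear[OF u(1) v(1), of 1 1] by (intro exI[of _ "%x. u x + v x"]) auto
 qed
next
 case (lim f s)
 show ?case
 proof (intro allI impI)
  fix e :: real assume e: "e > 0"
  have "(%i. \<integral>x. \<bar>s i x - f x\<bar> \<partial>M) \<longlonglongrightarrow> (\<integral>x. 0 \<partial>M)"
  proof (rule integral_dominated_convergence[where w="%x. 3 * \<bar>f x\<bar>"])
   show "AE x in M. (%i. \<bar>s i x - f x\<bar>) \<longlonglongrightarrow> 0"
   proof (rule AE_I2)
    fix x assume "x \<in> space M"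
    then show "(%i. \<bar>s i x - f x\<bar>) \<longlonglongrightarrow> 0"
    using tendsto_rabs[OF tendsto_diff[OF lim.hyps(2)[of x] tendsto_const[of "f x"]]] by simp
   qed
   show "AE x in M. norm \<bar>s i x - f x\<bar> <= 3 * \<bar>f x\<bar>" for i
    using lim.hyps(3)[of _ i] by (intro AE_I2) fastforce
  qed (use lim in \<open>auto\<close>)
  then have "(%i. \<integral>x. \<bar>s i x - f x\<bar> \<partial>M) \<longlonglongrightarrow> 0" by simp
  then obtain i where i: "(\<integral>x. \<bar>s i x - f x\<bar> \<partial>M) < e/2"
   using half_gt_zero[OF e] by (rule tendsto_zero_obtain_less)
  obtain u where u: "bounded_lipschitz u" "(\<integral>x. \<bar>u x - s i x\<bar> \<partial>M) < e/2"
   using lim.IH e by (meson half_gt_zero)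
  have iu: "integrable M u"
   by (rule bounded_lipschitz_integrable[OF u(1) fin sM])
  have "(\<integral>x. \<bar>u x - f x\<bar> \<partial>M) <= (\<integral>x. \<bar>u x - s i x\<bar> + \<bar>s i x - f x\<bar> \<partial>M)"
   using iu lim by (intro integral_mono) auto
  also have "... = (\<integral>x. \<bar>u x - s i x\<bar> \<partial>M) + (\<integral>x. \<bar>s i x - f x\<bar> \<partial>M)"
   using iu lim by (intro Bochner_Integration.integral_add) auto
  also have "... < e" using u i by simp
  finally show "\<exists>h. bounded_lipschitz h \<and> (\<integral>x. \<bar>h x - f x\<bar> \<partial>M) < e"
   using u by blast
 qed
qed

lemma bounded_lipschitz_dense:
 fixes M :: "'a::metric_space measure" and g :: "'a => real"
 assumes fin: "finite_measure M" and sM: "sets M = sets borel" and g: "integrable M g"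
 obtains f where "!!n::nat. bounded_lipschitz (f n)" "(%n. \<integral>x. \<bar>f n x - g x\<bar> \<partial>M) \<longlonglongrightarrow> 0"
proof -
 have "\<forall>n::nat. \<exists>f. bounded_lipschitz f \<and> (\<integral>x. \<bar>f x - g x\<bar> \<partial>M) < 1 / real (Suc n)"
  using bounded_lipschitz_dense_real[OF assms] by simp
 then obtain f where f: "!!n::nat. bounded_lipschitz (f n)" "!!n. (\<integral>x. \<bar>f n x - g x\<bar> \<partial>M) < 1 / real (Suc n)"
  by metis
 have "(%n. \<integral>x. \<bar>f n x - g x\<bar> \<partial>M) \<longlonglongrightarrow> 0"
  by (rule tendsto_sandwich[OF _ _ tendsto_const LIMSEQ_inverse_real_of_nat])
    (use f(2) in \<open>auto intro!: always_eventually simp: inverse_eq_divide less_imp_le\<close>)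
 then show ?thesis using f that by blast
qed

section \<open>The mass measure of a current\<close>

lemma finite_borelD:
 assumes "finite_borel M"
 shows "finite_measure M" "sets M = sets borel" "space M = UNIV"
 using assms sets_eq_imp_space_eq[of M borel] unfolding finite_borel_def tight_borel_def by auto

lemma finite_borel_density:
 fixes M :: "'a::topological_space measure"
 assumes M: "finite_borel M" and g: "g \<in> borel_measurable M" and fin: "(\<integral>\<^sup>+x. g x \<partial>M) < \<infinity>"
 shows "finite_borel (density M g)"
proof -
 note D = finite_borelD[OF M]
 obtain K :: "nat => 'a set" where K: "!!n. compact (K n)" "AE x in M. x \<in> (\<Union>n. K n)"
  using M unfolding finite_borel_def tight_borel_def by auto
 have "finite_measure (density M g)"
  by (rule finite_measureI) (use fin g in \<open>auto simp: emeasure_density D cong: nn_integral_cong\<close>)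
 moreover have "AE x in density M g. x \<in> (\<Union>n. K n)"
  using K(2) g by (subst AE_density) auto
 ultimately show ?thesis using K(1) D(2) unfolding finite_borel_def tight_borel_def by auto
qed

text \<open>Split \<open>f = f h + f (1 - h)\<close> with a Lipschitz \<open>h\<close> close to the
  indicator of \<open>A\<close>, and use one mass bound for each summand.\<close>
lemma mass_bound_mixture:
 fixes T :: "'a::metric_space functional"
 assumes T: "bilinear_on_D1 T" and M: "mass_bound T M" and N: "mass_bound T N"
  and A: "A \<in> sets borel" and f: "bounded_lipschitz f" and \<pi>: "lipschitz_fun \<pi>"
 shows "\<bar>T f \<pi>\<bar> <= Lip \<pi> * ((\<integral>x. indicator A x * \<bar>f x\<bar> \<partial>M) + (\<integral>x. indicator (- A) x * \<bar>f x\<bar> \<partial>N))"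
proof -
 have fM: "finite_measure M" "sets M = sets borel" and fN: "finite_measure N" "sets N = sets borel"
  using M N finite_borelD unfolding mass_bound_def by blast+
 interpret M: finite_measure M by fact
 interpret N: finite_measure N by fact
 obtain B where B: "!!x. \<bar>f x\<bar> <= B" using f unfolding bounded_lipschitz_def bounded_iff by auto
 have B0: "0 <= B" using B[of undefined] by linarith
 have "\<forall>n. \<exists>h. bounded_lipschitz h \<and> (\<forall>x. 0 <= h x \<and> h x <= 1) \<and>
   (\<integral>x. \<bar>h x - indicator A x\<bar> \<partial>M) < 1 / real (Suc n) \<and> (\<integral>x. \<bar>h x - indicator A x\<bar> \<partial>N) < 1 / real (Suc n)"
  using lipschitz_approx_indicator[OF fM fN A] by simp
 from choice[OF this] obtain h where h: "!!n. bounded_lipschitz (h n)" "!!n x. 0 <= h n x \<and> h n x <= 1"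
  "!!n. (\<integral>x. \<bar>h n x - indicator A x\<bar> \<partial>M) < 1 / real (Suc n)"
  "!!n. (\<integral>x. \<bar>h n x - indicator A x\<bar> \<partial>N) < 1 / real (Suc n)" by auto
 have nA: "- A \<in> sets borel" using A by auto
 have conv: "(%n. \<integral>x. \<bar>f x\<bar> * k n x \<partial>R) \<longlonglongrightarrow> (\<integral>x. indicator S x * \<bar>f x\<bar> \<partial>R)"
  if R: "finite_measure R" "sets R = sets borel" and S: "S \<in> sets borel"
   and k: "!!n. bounded_lipschitz (k n)" "!!n x. 0 <= k n x \<and> k n x <= 1"
    "!!n. (\<integral>x. \<bar>k n x - indicator S x\<bar> \<partial>R) < 1 / real (Suc n)" for R :: "'a measure" and k S
 proof -
  interpret finite_measure R by fact
  have mk[measurable]: "k n \<in> borel_measurable R" for n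
   using bounded_lipschitz_borel[OF k(1)] by (simp add: measurable_cong_sets[OF R(2) refl])
  have mf[measurable]: "f \<in> borel_measurable R"
   using bounded_lipschitz_borel[OF f] by (simp add: measurable_cong_sets[OF R(2) refl])
  have mS[measurable]: "S \<in> sets R" using S R by simp
  have i: "integrable R (%x. \<bar>f x\<bar> * k n x)" for n
  proof (intro integrable_const_bound[of _ B] AE_I2)
   fix x show "norm (\<bar>f x\<bar> * k n x) <= B"
    using mult_mono[OF B[of x], of "k n x" 1] k(2)[of n x] B0 by (simp add: abs_mult)
  qed measurable
  have i2: "integrable R (%x. indicator S x * \<bar>f x\<bar>)"
   using B B0 by (intro integrable_const_bound[of _ B] AE_I2) (auto simp: abs_mult indicator_def)
  have i3: "integrable R (%x. \<bar>k n x - indicator S x\<bar>)" for n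
  proof (intro integrable_const_bound[of _ 1] AE_I2)
   fix x show "norm \<bar>k n x - indicator S x\<bar> <= 1"
    using k(2)[of n x] by (auto simp: indicator_def)
  qed auto
  have "\<bar>(\<integral>x. \<bar>f x\<bar> * k n x \<partial>R) - (\<integral>x. indicator S x * \<bar>f x\<bar> \<partial>R)\<bar> <= B * (1 / real (Suc n))" for n
  proof -
   have "\<bar>(\<integral>x. \<bar>f x\<bar> * k n x \<partial>R) - (\<integral>x. indicator S x * \<bar>f x\<bar> \<partial>R)\<bar>
    = \<bar>\<integral>x. \<bar>f x\<bar> * k n x - indicator S x * \<bar>f x\<bar> \<partial>R\<bar>"
    using i i2 by simp
   also have "... <= (\<integral>x. \<bar>\<bar>f x\<bar> * k n x - indicator S x * \<bar>f x\<bar>\<bar> \<partial>R)"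
    by (rule integral_abs_bound)
   also have "... <= (\<integral>x. B * \<bar>k n x - indicator S x\<bar> \<partial>R)"
   proof (rule integral_mono)
    fix x
    have "\<bar>f x\<bar> * k n x - indicator S x * \<bar>f x\<bar> = \<bar>f x\<bar> * (k n x - indicator S x)"
    by (simp add: algebra_simps)
    then show "\<bar>\<bar>f x\<bar> * k n x - indicator S x * \<bar>f x\<bar>\<bar> <= B * \<bar>k n x - indicator S x\<bar>"
    using B by (simp add: abs_mult mult_right_mono)
   qed (use i i2 i3 in auto)
   also have "... <= B * (1 / real (Suc n))"
    using mult_left_mono[OF less_imp_le[OF k(3)[of n]] B0] by simp
   finally show ?thesis .
  qed
  then show ?thesis
   by (intro LIM_zero_cancel[OF tendsto_rabs_zero_cancel[OF tendsto_sandwich[OF _ _ tendsto_const tendsto_mult_right_zero[OF LIMSEQ_inverse_real_of_nat, of B]]]])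
    (auto intro!: always_eventually simp: inverse_eq_divide)
 qed
 have k1: "bounded_lipschitz (%x. 1 - h n x)" for n
  using bounded_lipschitz_linear[OF bounded_lipschitz_const h(1), of 1 1 "-1" n] by simp
 have c1: "(%n. \<integral>x. \<bar>f x\<bar> * h n x \<partial>M) \<longlonglongrightarrow> (\<integral>x. indicator A x * \<bar>f x\<bar> \<partial>M)"
  by (rule conv[OF fM A h(1,2,3)])
 have c2: "(%n. \<integral>x. \<bar>f x\<bar> * (1 - h n x) \<partial>N) \<longlonglongrightarrow> (\<integral>x. indicator (-A) x * \<bar>f x\<bar> \<partial>N)"
 proof (rule conv[OF fN nA k1])
  show "0 <= 1 - h n x \<and> 1 - h n x <= 1" for n x using h(2)[of n x] by auto
  have "\<bar>1 - h n x - indicator (-A) x\<bar> = \<bar>h n x - indicator A x\<bar>" for n x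
   by (auto simp: indicator_def)
  then show "(\<integral>x. \<bar>1 - h n x - indicator (-A) x\<bar> \<partial>N) < 1 / real (Suc n)" for n
   using h(4)[of n] by simp
 qed
 have "\<bar>T f \<pi>\<bar> <= Lip \<pi> * ((\<integral>x. \<bar>f x\<bar> * h n x \<partial>M) + (\<integral>x. \<bar>f x\<bar> * (1 - h n x) \<partial>N))" for n
 proof -
  have b1: "bounded_lipschitz (%x. f x * h n x)" "bounded_lipschitz (%x. f x * (1 - h n x))"
   using bounded_lipschitz_mult f h(1) k1 by auto
  have "T f \<pi> = T (%x. 1 * (f x * h n x) + 1 * (f x * (1 - h n x))) \<pi>"
   by (simp add: algebra_simps)
  also have "... = T (%x. f x * h n x) \<pi> + T (%x. f x * (1 - h n x)) \<pi>"
   using T[unfolded bilinear_on_D1_def, THEN conjunct1, rule_format, OF b1 \<pi>, of 1 1] by simp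
  finally have "\<bar>T f \<pi>\<bar> <= \<bar>T (%x. f x * h n x) \<pi>\<bar> + \<bar>T (%x. f x * (1 - h n x)) \<pi>\<bar>" by linarith
  also have "... <= Lip \<pi> * (\<integral>x. \<bar>f x * h n x\<bar> \<partial>M) + Lip \<pi> * (\<integral>x. \<bar>f x * (1 - h n x)\<bar> \<partial>N)"
   using M N b1 \<pi> unfolding mass_bound_def by (intro add_mono) auto
  also have "... = Lip \<pi> * ((\<integral>x. \<bar>f x\<bar> * h n x \<partial>M) + (\<integral>x. \<bar>f x\<bar> * (1 - h n x) \<partial>N))"
   using h(2) by (simp add: abs_mult distrib_left)
  finally show ?thesis .
 qed
 moreover have "(%n. Lip \<pi> * ((\<integral>x. \<bar>f x\<bar> * h n x \<partial>M) + (\<integral>x. \<bar>f x\<bar> * (1 - h n x) \<partial>N))) \<longlonglongrightarrow>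
   Lip \<pi> * ((\<integral>x. indicator A x * \<bar>f x\<bar> \<partial>M) + (\<integral>x. indicator (- A) x * \<bar>f x\<bar> \<partial>N))"
  by (intro tendsto_intros c1 c2)
 ultimately show ?thesis by (intro LIMSEQ_le_const) auto
qed

text \<open>Among the mass bounds with a density with respect to \<open>\<nu>\<close>, one of least total
  mass is the limit of a decreasing minimizing sequence, since minima of two densities are again
  mass bounds. It lies below every other mass bound \<open>N\<close>: on the part of the space
  where \<open>N\<close> is smaller according to the Hahn decomposition, it could be replaced by
  \<open>N\<close>, which would decrease the total mass.\<close>
lemma minimal_mass_bound_exists:
 fixes T :: "'a::metric_space functional"
 assumes T: "bilinear_on_D1 T" and ex: "mass_bound T \<nu>"
 shows "\<exists>\<mu>. mass_bound T \<mu> \<and> (\<forall>\<nu>. mass_bound T \<nu> --> (\<forall>A\<in>sets borel. emeasure \<mu> A <= emeasure \<nu> A))"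
proof -
 have fb: "finite_borel \<nu>" using ex by (simp add: mass_bound_def)
 note D = finite_borelD[OF fb]
 interpret finite_measure \<nu> by (rule D)
 define F where "F = {g :: 'a => real. g \<in> borel_measurable \<nu> \<and> (\<forall>x. 0 <= g x) \<and> integrable \<nu> g \<and>
   mass_bound T (density \<nu> (%x. ennreal (g x)))}"
 have FI: "g \<in> F" if g: "g \<in> borel_measurable \<nu>" "!!x. 0 <= g x" "integrable \<nu> g"
  and b: "!!f \<pi>. bounded_lipschitz f ==> lipschitz_fun \<pi> ==> \<bar>T f \<pi>\<bar> <= Lip \<pi> * (\<integral>x. g x * \<bar>f x\<bar> \<partial>\<nu>)" for g :: "'a => real"
 proof -
  have "finite_borel (density \<nu> (%x. ennreal (g x)))"
   using g by (intro finite_borel_density[OF fb]) (auto simp: nn_integral_eq_integral)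
  moreover have "(\<integral>x. \<bar>f x\<bar> \<partial>density \<nu> (%x. ennreal (g x))) = (\<integral>x. g x * \<bar>f x\<bar> \<partial>\<nu>)" if "bounded_lipschitz f" for f :: "'a => real"
   using g bounded_lipschitz_borel[OF that] by (subst integral_density) (auto simp: measurable_cong_sets[OF D(2) refl])
  ultimately show ?thesis using g b unfolding F_def mass_bound_def by auto
 qed
 have FD: "\<bar>T f \<pi>\<bar> <= Lip \<pi> * (\<integral>x. g x * \<bar>f x\<bar> \<partial>\<nu>)" if "g \<in> F" "bounded_lipschitz f" "lipschitz_fun \<pi>" for g f \<pi> :: "'a => real"
 proof -
  have "(\<integral>x. \<bar>f x\<bar> \<partial>density \<nu> (%x. ennreal (g x))) = (\<integral>x. g x * \<bar>f x\<bar> \<partial>\<nu>)"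
   using that(1) bounded_lipschitz_borel[OF that(2)] unfolding F_def
   by (subst integral_density) (auto simp: measurable_cong_sets[OF D(2) refl])
  then show ?thesis using that unfolding F_def mass_bound_def by auto
 qed
 have Fb: "g \<in> borel_measurable \<nu>" "0 <= g x" "integrable \<nu> g" "mass_bound T (density \<nu> (%x. ennreal (g x)))" if "g \<in> F" for g x
  using that unfolding F_def by auto
 have one: "(%x. 1) \<in> F"
  using ex by (intro FI) (auto simp: mass_bound_def)
 have igf: "integrable \<nu> (%x. g x * \<bar>f x\<bar>)" if g: "g \<in> borel_measurable \<nu>" "integrable \<nu> g" and f: "bounded_lipschitz f" for g f :: "'a => real"
 proof -
  obtain B where B: "!!x. \<bar>f x\<bar> <= B" using f unfolding bounded_lipschitz_def bounded_iff by auto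
  have [measurable]: "f \<in> borel_measurable \<nu>" "g \<in> borel_measurable \<nu>"
   using bounded_lipschitz_borel[OF f] g by (auto simp: measurable_cong_sets[OF D(2) refl])
  show ?thesis
   by (rule Bochner_Integration.integrable_bound[OF integrable_mult_right[OF integrable_abs[OF g(2)], of B]])
    (use B order_trans[OF abs_ge_zero B] in \<open>auto simp: abs_mult mult.commute intro!: mult_right_mono\<close>)
 qed
 have minF: "(%x. min (g x) (h x)) \<in> F" if g: "g \<in> F" and h: "h \<in> F" for g h
 proof (rule FI)
  show m[measurable]: "(%x. min (g x) (h x)) \<in> borel_measurable \<nu>"
   using Fb(1)[OF g] Fb(1)[OF h] by measurable
  show "0 <= min (g x) (h x)" for x using Fb(2)[OF g, of x] Fb(2)[OF h, of x] by auto
  show i: "integrable \<nu> (%x. min (g x) (h x))"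
   using Fb(3)[OF g] Fb(3)[OF h] by (rule integrable_min)
  fix f \<pi> :: "'a => real" assume f: "bounded_lipschitz f" and \<pi>: "lipschitz_fun \<pi>"
  define A where "A = {x. g x <= h x}"
  have [measurable]: "g \<in> borel_measurable \<nu>" "h \<in> borel_measurable \<nu>" using Fb(1) g h by auto
  have mf[measurable]: "f \<in> borel_measurable \<nu>"
   using bounded_lipschitz_borel[OF f] by (simp add: measurable_cong_sets[OF D(2) refl])
  have "{x\<in>space \<nu>. g x <= h x} \<in> sets \<nu>" by measurable
  then have Am[measurable]: "A \<in> sets \<nu>" by (simp add: A_def D)
  then have A: "A \<in> sets borel" using D by simp
  have nA[measurable]: "- A \<in> sets \<nu>" using A D by auto
  have 1: "(\<integral>x. indicator A x * \<bar>f x\<bar> \<partial>density \<nu> (%x. ennreal (g x))) = (\<integral>x. g x * (indicator A x * \<bar>f x\<bar>) \<partial>\<nu>)"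
   using Fb(2)[OF g] by (subst integral_density) auto
  have 2: "(\<integral>x. indicator (-A) x * \<bar>f x\<bar> \<partial>density \<nu> (%x. ennreal (h x))) = (\<integral>x. h x * (indicator (-A) x * \<bar>f x\<bar>) \<partial>\<nu>)"
   using Fb(2)[OF h] by (subst integral_density) auto
  have ig: "integrable \<nu> (%x. g x * (indicator A x * \<bar>f x\<bar>))"
   by (rule Bochner_Integration.integrable_bound[OF igf[OF Fb(1)[OF g] Fb(3)[OF g] f]]) (auto simp: indicator_def)
  have ih: "integrable \<nu> (%x. h x * (indicator (-A) x * \<bar>f x\<bar>))"
   by (rule Bochner_Integration.integrable_bound[OF igf[OF Fb(1)[OF h] Fb(3)[OF h] f]]) (auto simp: indicator_def)
  have "\<bar>T f \<pi>\<bar> <= Lip \<pi> * ((\<integral>x. g x * (indicator A x * \<bar>f x\<bar>) \<partial>\<nu>) + (\<integral>x. h x * (indicator (-A) x * \<bar>f x\<bar>) \<partial>\<nu>))"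
   using mass_bound_mixture[OF T Fb(4)[OF g] Fb(4)[OF h] A f \<pi>] unfolding 1 2 .
  also have "(\<integral>x. g x * (indicator A x * \<bar>f x\<bar>) \<partial>\<nu>) + (\<integral>x. h x * (indicator (-A) x * \<bar>f x\<bar>) \<partial>\<nu>)
    = (\<integral>x. g x * (indicator A x * \<bar>f x\<bar>) + h x * (indicator (-A) x * \<bar>f x\<bar>) \<partial>\<nu>)"
   using ig ih by simp
  also have "... = (\<integral>x. min (g x) (h x) * \<bar>f x\<bar> \<partial>\<nu>)"
   by (intro Bochner_Integration.integral_cong) (auto simp: A_def indicator_def min_def)
  finally show "\<bar>T f \<pi>\<bar> <= Lip \<pi> * (\<integral>x. min (g x) (h x) * \<bar>f x\<bar> \<partial>\<nu>)" .
 qed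
 define m where "m = Inf ((%g. \<integral>x. g x \<partial>\<nu>) ` F)"
 have bdd: "bdd_below ((%g. \<integral>x. g x \<partial>\<nu>) ` F)"
  using Fb(2) by (intro bdd_belowI[of _ 0]) (auto intro!: integral_nonneg_AE)
 have mle: "m <= (\<integral>x. g x \<partial>\<nu>)" if "g \<in> F" for g
  unfolding m_def using that bdd by (intro cInf_lower) auto
 have "\<forall>n. \<exists>g\<in>F. (\<integral>x. g x \<partial>\<nu>) < m + 1 / real (Suc n)"
 proof
  fix n
  have "\<exists>y\<in>(%g. \<integral>x. g x \<partial>\<nu>) ` F. y < m + 1 / real (Suc n)"
   unfolding m_def by (rule cInf_lessD) (use one in auto)
  then show "\<exists>g\<in>F. (\<integral>x. g x \<partial>\<nu>) < m + 1 / real (Suc n)" by auto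
 qed
 then obtain g where g: "!!n. g n \<in> F" "!!n. (\<integral>x. g n x \<partial>\<nu>) < m + 1 / real (Suc n)" by metis
 define h where "h = rec_nat (g 0) (%n u x. min (u x) (g (Suc n) x))"
 have h0: "h 0 = g 0" and hS: "h (Suc n) = (%x. min (h n x) (g (Suc n) x))" for n
  by (auto simp: h_def)
 have hF: "h n \<in> F" for n by (induction n) (auto simp: h0 hS g minF)
 have hg: "h n x <= g n x" for n x by (cases n) (auto simp: h0 hS)
 have hdec: "decseq (%n. h n x)" for x by (intro decseq_SucI) (auto simp: hS)
 have hbb: "bdd_below (range (%n. h n x))" for x
  using Fb(2)[OF hF] by (intro bdd_belowI[of _ 0]) auto
 define u where "u = (%x. INF n. h n x)"
 have hu: "(%n. h n x) \<longlonglongrightarrow> u x" for x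
  unfolding u_def by (rule LIMSEQ_decseq_INF[OF hbb hdec])
 have um[measurable]: "u \<in> borel_measurable \<nu>"
  by (rule borel_measurable_LIMSEQ_real[OF hu Fb(1)[OF hF]])
 have u0: "0 <= u x" for x unfolding u_def using Fb(2)[OF hF] by (intro cINF_greatest) auto
 have uh: "u x <= h n x" for n x unfolding u_def using hbb by (intro cINF_lower) auto
 have hh0: "h n x <= h 0 x" for n x using hdec[of x] by (simp add: decseq_def)
 have ui: "integrable \<nu> u"
  by (rule Bochner_Integration.integrable_bound[OF Fb(3)[OF hF[of 0]] um])
    (use u0 uh[of _ 0] Fb(2)[OF hF] in auto)
 have uF: "u \<in> F"
 proof (rule FI[OF um u0 ui])
  fix f \<pi> :: "'a => real" assume f: "bounded_lipschitz f" and \<pi>: "lipschitz_fun \<pi>"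
  have mf[measurable]: "f \<in> borel_measurable \<nu>"
   using bounded_lipschitz_borel[OF f] by (simp add: measurable_cong_sets[OF D(2) refl])
  have [measurable]: "h n \<in> borel_measurable \<nu>" for n using Fb(1) hF by auto
  have "(%n. \<integral>x. h n x * \<bar>f x\<bar> \<partial>\<nu>) \<longlonglongrightarrow> (\<integral>x. u x * \<bar>f x\<bar> \<partial>\<nu>)"
  proof (rule integral_dominated_convergence[OF _ _ igf[OF Fb(1)[OF hF[of 0]] Fb(3)[OF hF[of 0]] f]])
   show "AE x in \<nu>. (%n. h n x * \<bar>f x\<bar>) \<longlonglongrightarrow> u x * \<bar>f x\<bar>"
    by (intro AE_I2 tendsto_intros hu)
   show "AE x in \<nu>. norm (h n x * \<bar>f x\<bar>) <= h 0 x * \<bar>f x\<bar>" for n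
    using Fb(2)[OF hF] hh0 by (intro AE_I2) (auto simp: abs_mult mult_right_mono)
  qed auto
  then have "(%n. Lip \<pi> * (\<integral>x. h n x * \<bar>f x\<bar> \<partial>\<nu>)) \<longlonglongrightarrow> Lip \<pi> * (\<integral>x. u x * \<bar>f x\<bar> \<partial>\<nu>)"
   by (intro tendsto_intros)
  then show "\<bar>T f \<pi>\<bar> <= Lip \<pi> * (\<integral>x. u x * \<bar>f x\<bar> \<partial>\<nu>)"
   by (rule LIMSEQ_le_const) (use FD[OF hF f \<pi>] in auto)
 qed
 have um': "(\<integral>x. u x \<partial>\<nu>) <= m"
 proof (rule field_le_epsilon)
  fix e :: real assume "e > 0"
  then obtain n where n: "1 / real (Suc n) < e" using nat_approx_posE by blast
  have "(\<integral>x. u x \<partial>\<nu>) <= (\<integral>x. g n x \<partial>\<nu>)"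
   using uh[of _ n] hg[of n] by (intro integral_mono ui Fb(3) g) (auto intro: order_trans)
  then show "(\<integral>x. u x \<partial>\<nu>) <= m + e" using g(2)[of n] n by linarith
 qed
 define M where "M = density \<nu> (%x. ennreal (u x))"
 have Mb: "mass_bound T M" using Fb(4)[OF uF] by (simp add: M_def)
 have fM: "finite_measure M" and sM: "sets M = sets borel"
  using finite_borelD Mb unfolding mass_bound_def by blast+
 have "emeasure M A <= emeasure N A" if N: "mass_bound T N" and A: "A \<in> sets borel" for N A
 proof -
  have fN: "finite_measure N" and sN: "sets N = sets borel"
   using finite_borelD N unfolding mass_bound_def by blast+
  interpret M: finite_measure M by fact
  interpret N: finite_measure N by fact
  obtain Y where Y: "Y \<in> sets M" "!!X. X \<in> sets M ==> X \<subseteq> Y ==> N X <= M X"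
   "!!X. X \<in> sets M ==> X \<inter> Y = {} ==> M X <= N X"
   using finite_unsigned_Hahn_decomposition[OF fM fN] sM sN by auto
  have Yb: "Y \<in> sets borel" using Y(1) sM by simp
  have Yn[measurable]: "Y \<in> sets \<nu>" "- Y \<in> sets \<nu>" using Yb D(2) by auto
  define NY where "NY = density N (indicator Y)"
  have sNY: "sets NY = sets \<nu>" by (simp add: NY_def sN D)
  have eNY: "emeasure NY X = emeasure N (X \<inter> Y)" if "X \<in> sets borel" for X
   unfolding NY_def using that Yb sN by (subst emeasure_density) (auto simp: indicator_inter_arith[symmetric] mult.commute Int_commute)
  have ac: "absolutely_continuous \<nu> NY"
   unfolding absolutely_continuous_def
  proof
   fix X assume X: "X \<in> null_sets \<nu>"
   then have Xb: "X \<in> sets borel" using D by auto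
   have "AE x in \<nu>. x \<notin> X \<inter> Y" using AE_not_in[OF X] by eventually_elim auto
   then have "emeasure M (X \<inter> Y) = 0"
    unfolding M_def using Xb Yb D by (subst emeasure_density) (auto simp: nn_integral_0_iff_AE indicator_def elim: eventually_mono)
   then have "emeasure N (X \<inter> Y) = 0" using Y(2)[of "X \<inter> Y"] Xb Yb sM by auto
   then show "X \<in> null_sets NY" using Xb sNY D by (auto simp: null_sets_def eNY)
  qed
  have "finite_measure NY"
   by (rule finite_measureI) (simp add: sets_eq_imp_space_eq[OF sNY] D eNY N.emeasure_eq_measure)
  then obtain r :: "'a => real" where rm[measurable]: "r \<in> borel_measurable \<nu>" and r0: "!!x. 0 <= r x"
   and ri: "integrable \<nu> r" and rd: "NY = density \<nu> (%x. ennreal (r x))"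
   by (rule finite_measure_density[OF sigma_finite_measure_axioms _ sNY ac]) blast
  \<comment> \<open>The density of the measure that is N on Y and M elsewhere.\<close>
  define w where "w = (%x. r x + indicator (-Y) x * u x)"
  have i2: "integrable \<nu> (%x. indicator (-Y) x * u x)"
   using integrable_mult_indicator[OF Yn(2) ui] by simp
  have wF: "w \<in> F"
  proof (rule FI)
   show "w \<in> borel_measurable \<nu>" unfolding w_def by measurable
   show "0 <= w x" for x unfolding w_def using r0 u0 by auto
   show "integrable \<nu> w" unfolding w_def using ri i2 by auto
   fix f \<pi> :: "'a => real" assume f: "bounded_lipschitz f" and \<pi>: "lipschitz_fun \<pi>"
   have mf: "f \<in> borel_measurable borel" by (rule bounded_lipschitz_borel[OF f])
   have mf'[measurable]: "f \<in> borel_measurable \<nu>" using mf by (simp add: measurable_cong_sets[OF D(2) refl])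
   have mfN[measurable]: "f \<in> borel_measurable N" using mf by (simp add: measurable_cong_sets[OF sN refl])
   have YN[measurable]: "Y \<in> sets N" using Yb sN by simp
   have "(\<integral>x. indicator Y x * \<bar>f x\<bar> \<partial>N) = (\<integral>x. \<bar>f x\<bar> \<partial>density N (%x. ennreal (indicator Y x)))"
    by (subst integral_density) auto
   also have "density N (%x. ennreal (indicator Y x)) = NY" by (simp add: NY_def ennreal_indicator)
   also have "(\<integral>x. \<bar>f x\<bar> \<partial>NY) = (\<integral>x. r x * \<bar>f x\<bar> \<partial>\<nu>)"
    unfolding rd using r0 by (subst integral_density) auto
   finally have 1: "(\<integral>x. indicator Y x * \<bar>f x\<bar> \<partial>N) = (\<integral>x. r x * \<bar>f x\<bar> \<partial>\<nu>)" .
   have 2: "(\<integral>x. indicator (-Y) x * \<bar>f x\<bar> \<partial>M) = (\<integral>x. u x * (indicator (-Y) x * \<bar>f x\<bar>) \<partial>\<nu>)"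
    unfolding M_def using u0 by (subst integral_density) auto
   have j1: "integrable \<nu> (%x. r x * \<bar>f x\<bar>)" by (rule igf[OF rm ri f])
   have j2: "integrable \<nu> (%x. u x * (indicator (-Y) x * \<bar>f x\<bar>))"
    by (rule Bochner_Integration.integrable_bound[OF igf[OF um ui f]]) (auto simp: indicator_def)
   have "\<bar>T f \<pi>\<bar> <= Lip \<pi> * ((\<integral>x. r x * \<bar>f x\<bar> \<partial>\<nu>) + (\<integral>x. u x * (indicator (-Y) x * \<bar>f x\<bar>) \<partial>\<nu>))"
    using mass_bound_mixture[OF T N Mb Yb f \<pi>] unfolding 1 2 .
   also have "(\<integral>x. r x * \<bar>f x\<bar> \<partial>\<nu>) + (\<integral>x. u x * (indicator (-Y) x * \<bar>f x\<bar>) \<partial>\<nu>) = (\<integral>x. w x * \<bar>f x\<bar> \<partial>\<nu>)"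
    unfolding Bochner_Integration.integral_add[OF j1 j2, symmetric]
    by (intro Bochner_Integration.integral_cong) (auto simp: w_def algebra_simps)
   finally show "\<bar>T f \<pi>\<bar> <= Lip \<pi> * (\<integral>x. w x * \<bar>f x\<bar> \<partial>\<nu>)" .
  qed
  have eM: "emeasure M X = (\<integral>\<^sup>+x. ennreal (u x) * indicator X x \<partial>\<nu>)" if "X \<in> sets borel" for X
   unfolding M_def using that D by (subst emeasure_density) auto
  have mM: "measure M X = (\<integral>x. indicator X x * u x \<partial>\<nu>)" if X: "X \<in> sets borel" for X
  proof -
   have Xn: "X \<in> sets \<nu>" using X D by simp
   have "integrable \<nu> (%x. indicator X x * u x)"
    using integrable_mult_indicator[OF Xn ui] by simp
   then have "(\<integral>\<^sup>+x. ennreal (indicator X x * u x) \<partial>\<nu>) = ennreal (\<integral>x. indicator X x * u x \<partial>\<nu>)"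
    using u0 by (intro nn_integral_eq_integral) auto
   then have "emeasure M X = ennreal (\<integral>x. indicator X x * u x \<partial>\<nu>)"
    unfolding eM[OF X] by (simp add: ennreal_mult' ennreal_indicator mult.commute u0)
   then show ?thesis using u0 by (simp add: measure_def integral_nonneg_AE)
  qed
  have mN: "measure N Y = (\<integral>x. r x \<partial>\<nu>)"
  proof -
   have "emeasure N Y = (\<integral>\<^sup>+x. ennreal (r x) \<partial>\<nu>)"
    using eNY[of UNIV] D emeasure_density[of "%x. ennreal (r x)" \<nu> UNIV] unfolding rd by simp
   also have "... = ennreal (\<integral>x. r x \<partial>\<nu>)" using ri r0 by (intro nn_integral_eq_integral) auto
   finally show ?thesis using r0 by (simp add: measure_def integral_nonneg_AE)
  qed
  have "(\<integral>x. u x \<partial>\<nu>) <= (\<integral>x. w x \<partial>\<nu>)" using um' mle[OF wF] by linarith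
  then have "measure M UNIV <= measure N Y + measure M (- Y)"
   using mM[of UNIV] mM[of "-Y"] Yb ri i2 by (simp add: mN w_def)
  moreover have "measure M UNIV = measure M Y + measure M (-Y)"
   using M.finite_measure_Union[of Y "-Y"] Yb sM by (simp add: Compl_partition)
  ultimately have NY: "measure M Y <= measure N Y" by linarith
  have 1: "measure M (A \<inter> Y) <= measure N (A \<inter> Y)"
  proof -
   have split: "A \<inter> Y \<union> (Y - A) = Y" by auto
   have "measure N (Y - A) <= measure M (Y - A)"
    using Y(2)[of "Y - A"] A Yb sM by (auto simp: M.emeasure_eq_measure N.emeasure_eq_measure)
   moreover have "measure M Y = measure M (A \<inter> Y) + measure M (Y - A)"
    using M.finite_measure_Union[of "A \<inter> Y" "Y - A"] A Yb sM split by (auto simp: Int_Diff_disjoint)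
   moreover have "measure N Y = measure N (A \<inter> Y) + measure N (Y - A)"
    using N.finite_measure_Union[of "A \<inter> Y" "Y - A"] A Yb sN split by (auto simp: Int_Diff_disjoint)
   ultimately show ?thesis using NY by linarith
  qed
  have 2: "measure M (A - Y) <= measure N (A - Y)"
   using Y(3)[of "A - Y"] A Yb sM by (auto simp: M.emeasure_eq_measure N.emeasure_eq_measure)
  have "measure M A = measure M (A \<inter> Y) + measure M (A - Y)"
   using M.finite_measure_Union[of "A \<inter> Y" "A - Y"] A Yb sM by (simp add: Int_Diff_Un Int_Diff_disjoint)
  moreover have "measure N A = measure N (A \<inter> Y) + measure N (A - Y)"
   using N.finite_measure_Union[of "A \<inter> Y" "A - Y"] A Yb sN by (simp add: Int_Diff_Un Int_Diff_disjoint)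
  ultimately have "measure M A <= measure N A" using 1 2 by linarith
  then show ?thesis by (simp add: M.emeasure_eq_measure N.emeasure_eq_measure)
 qed
 then show ?thesis using Mb by blast
qed

lemma mass_measure_minimal:
 fixes T :: "'a::metric_space functional"
 assumes "metric_current T"
 shows "mass_bound T (mass_measure T)"
  and "mass_bound T \<nu> ==> A \<in> sets borel ==> emeasure (mass_measure T) A <= emeasure \<nu> A"
proof -
 have "bilinear_on_D1 T" "\<exists>\<mu>. mass_bound T \<mu>"
  using assms unfolding metric_current_def by auto
 then obtain \<mu> where \<mu>: "mass_bound T \<mu>" "!!\<nu> A. mass_bound T \<nu> ==> A \<in> sets borel ==> emeasure \<mu> A <= emeasure \<nu> A"
  using minimal_mass_bound_exists by metis
 have "mass_measure T = \<mu>"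
  unfolding mass_measure_def
 proof (rule the_equality)
  show "mass_bound T \<mu> \<and> (\<forall>\<nu>. mass_bound T \<nu> --> (\<forall>A\<in>sets borel. emeasure \<mu> A <= emeasure \<nu> A))"
   using \<mu> by blast
  fix \<kappa> assume \<kappa>: "mass_bound T \<kappa> \<and> (\<forall>\<nu>. mass_bound T \<nu> --> (\<forall>A\<in>sets borel. emeasure \<kappa> A <= emeasure \<nu> A))"
  have s: "sets \<kappa> = sets borel" "sets \<mu> = sets borel"
   using finite_borelD \<kappa> \<mu>(1) unfolding mass_bound_def by blast+
  show "\<kappa> = \<mu>"
   by (rule measure_eqI) (use s \<kappa> \<mu> in \<open>auto intro!: antisym\<close>)
 qed
 then show "mass_bound T (mass_measure T)"
  and "mass_bound T \<nu> ==> A \<in> sets borel ==> emeasure (mass_measure T) A <= emeasure \<nu> A"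
  using \<mu> by auto
qed

section \<open>Essential separability of Borel maps\<close>

text \<open>Vitali's set of representatives modulo the rationals.\<close>
lemma exists_nonmeasurable_set: "\<exists>V::real set. V \<subseteq> {0..1} \<and> V \<notin> sets lebesgue"
proof -
 define c where "c = (%x::real. SOME y. 0 <= y \<and> y <= 1 \<and> x - y \<in> \<rat>)"
 have c: "0 <= c x \<and> c x <= 1 \<and> x - c x \<in> \<rat>" for x
  unfolding c_def
 proof (rule someI_ex)
  have "x - (x - real_of_int \<lfloor>x\<rfloor>) \<in> \<rat>" by simp
  then show "\<exists>y. 0 <= y \<and> y <= 1 \<and> x - y \<in> \<rat>"
   by (intro exI[of _ "x - real_of_int \<lfloor>x\<rfloor>"]) (auto, linarith)
 qed
 have ceq: "c x = c y" if "x - y \<in> \<rat>" for x y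
 proof -
  have "(x - z \<in> \<rat>) = (y - z \<in> \<rat>)" for z
   using Rats_diff[OF _ that, of "x - z"] Rats_add[OF _ that, of "y - z"] by (auto simp: algebra_simps)
  then show ?thesis by (simp add: c_def)
 qed
 have cuniq: "x = y" if "x \<in> range c" "y \<in> range c" "x - y \<in> \<rat>" for x y
 proof -
  note xy = that
  obtain u v where uv: "x = c u" "y = c v" using xy by blast
  have "u - v = (u - c u) + (c u - c v) - (v - c v)" by simp
  then have "u - v \<in> \<rat>" using c xy(3) unfolding uv by (metis Rats_add Rats_diff)
  then show ?thesis using ceq uv by simp
 qed
 define V where "V = range c"
 have V01: "V \<subseteq> {0..1}" using c by (auto simp: V_def)
 have "V \<notin> sets lebesgue"
 proof
  assume V: "V \<in> sets lebesgue"
  have lmV: "V \<in> lmeasurable"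
   by (rule bounded_set_imp_lmeasurable[OF bounded_subset[OF bounded_closed_interval V01] V])
  define W where "W = (%n::nat. (+) (1 / real (Suc n)) ` V)"
  have lmW: "W n \<in> lmeasurable" for n
   unfolding W_def by (rule measurable_translation[OF lmV])
  have mW: "measure lebesgue (W n) = measure lebesgue V" for n
   unfolding W_def by (rule measure_translation)
  have W02: "W n \<subseteq> {0..2}" for n
  proof
   fix x assume "x \<in> W n"
   then obtain v where v: "v \<in> V" "x = 1 / real (Suc n) + v" unfolding W_def by auto
   have "1 / real (Suc n) <= 1" "0 <= 1 / real (Suc n)" by auto
   then show "x \<in> {0..2}" using v V01 by (smt (verit) atLeastAtMost_iff subset_iff)
  qed
  have disj: "W m \<inter> W n = {}" if "m ~= n" for m n
  proof (rule ccontr)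
   assume "W m \<inter> W n ~= {}"
   then obtain u v where uv: "u \<in> V" "v \<in> V" "1 / real (Suc m) + u = 1 / real (Suc n) + v"
    unfolding W_def by auto
   then have e: "u - v = 1 / real (Suc n) - 1 / real (Suc m)" by simp
   have "1 / real (Suc n) - 1 / real (Suc m) \<in> \<rat>" by auto
   then have "u = v" using uv(1,2) unfolding e[symmetric] V_def by (intro cuniq)
   then show False using uv(3) that by simp
  qed
  have "real N * measure lebesgue V <= 2" for N
  proof -
   have "real N * measure lebesgue V = (\<Sum>n<N. measure lebesgue (W n))" by (simp add: mW)
   also have "... = measure lebesgue (\<Union>n<N. W n)"
    by (rule measure_UNION_AE[symmetric]) (use lmW disj in \<open>auto simp: pairwise_def intro!: AE_I2\<close>)
   also have "... <= measure lebesgue {0..2::real}"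
    by (rule measure_mono_fmeasurable) (use W02 lmW in \<open>auto intro!: sets.finite_UN\<close>)
   finally show ?thesis by simp
  qed
  then have "measure lebesgue V <= 0"
   by (metis reals_Archimedean3 not_le mult.commute)
  then have "negligible V" using lmV measure_nonneg[of lebesgue V] by (simp add: negligible_iff_measure)
  then have "negligible (\<Union>q\<in>\<rat>. (+) q ` V)"
   by (intro negligible_countable_Union) (auto intro: negligible_translation simp: countable_rat)
  moreover have "(\<Union>q\<in>\<rat>. (+) q ` V) = UNIV"
  proof safe
   fix x :: real
   have "x = (x - c x) + c x" by simp
   then show "x \<in> (\<Union>q\<in>\<rat>. (+) q ` V)" using c[of x] unfolding V_def by blast
  qed auto
  ultimately show False by simp
 qed
 with V01 show ?thesis by blast
qed

lemma lusin_closed: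
 fixes M :: "'a::metric_space measure" and G :: "'a => real"
 assumes fin: "finite_measure M" and sM: "sets M = sets borel" and G: "G \<in> borel_measurable borel" and e: "e > 0"
 shows "\<exists>S. closed S \<and> measure M (- S) < e \<and> continuous_on S G"
proof -
 interpret finite_measure M by fact
 have sp: "space M = UNIV" using sets_eq_imp_space_eq[OF sM] by simp
 define I where "I = (%n::nat. let (p, q) = (from_nat n :: rat \<times> rat) in {real_of_rat p<..<real_of_rat q})"
 have "G -` I n \<in> sets borel" for n
  using measurable_sets[OF G, of "I n"] by (auto simp: I_def split: prod.split)
 then have "\<forall>n. \<exists>P. closed (fst P) \<and> open (snd P) \<and> fst P \<subseteq> G -` I n \<and> G -` I n \<subseteq> snd P
   \<and> measure M (snd P - fst P) < e/2 * (1/2)^Suc n"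
  using finite_borel_regular[OF fin sM, of _ "e/2 * (1/2)^Suc _"] e by fastforce
 from choice[OF this] obtain P where P: "!!n. closed (fst (P n))" "!!n. open (snd (P n))" "!!n. fst (P n) \<subseteq> G -` I n"
  "!!n. G -` I n \<subseteq> snd (P n)" "!!n. measure M (snd (P n) - fst (P n)) < e/2 * (1/2)^Suc n" by blast
 define S where "S = (\<Inter>n. fst (P n) \<union> - snd (P n))"
 have cl: "closed S" unfolding S_def using P(1,2) by (intro closed_INT ballI closed_Un) auto
 have geo: "(%i. e/2 * (1/2)^Suc i) sums (e/2)"
  using sums_mult[OF power_half_series, of "e/2"] by simp
 have su: "summable (%i. measure M (snd (P i) - fst (P i)))"
  by (rule summable_comparison_test'[OF sums_summable[OF geo], of 0])
    (use P(5) in \<open>auto simp: less_imp_le\<close>)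
 have mP: "snd (P n) - fst (P n) \<in> sets M" for n using P(1,2) sM by auto
 have "measure M (\<Union>i. snd (P i) - fst (P i)) <= (\<Sum>i. measure M (snd (P i) - fst (P i)))"
  by (rule finite_measure_subadditive_countably) (use mP su in auto)
 also have "... <= (\<Sum>i. e/2 * (1/2)^Suc i)"
  by (rule suminf_le[OF less_imp_le[OF P(5)] su sums_summable[OF geo]])
 also have "... = e/2" using geo by (simp add: sums_iff)
 finally have "measure M (\<Union>i. snd (P i) - fst (P i)) <= e/2" .
 moreover have "- S = (\<Union>i. snd (P i) - fst (P i))" unfolding S_def by auto
 ultimately have m: "measure M (- S) < e" using e by simp
 have "continuous_on S G"
  unfolding continuous_on_topological
 proof (intro ballI allI impI)
  fix x B assume x: "x \<in> S" and B: "open B" "G x \<in> B"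
  then obtain d where d: "d > 0" "ball (G x) d \<subseteq> B" using openE by blast
  obtain p where p: "G x - d < real_of_rat p" "real_of_rat p < G x"
   using of_rat_dense[of "G x - d" "G x"] d by auto
  obtain q where q: "G x < real_of_rat q" "real_of_rat q < G x + d"
   using of_rat_dense[of "G x" "G x + d"] d by auto
  define n where "n = to_nat (p, q)"
  have In: "I n = {real_of_rat p<..<real_of_rat q}" by (simp add: I_def n_def)
  have "x \<in> snd (P n)" using P(4)[of n] In p q by auto
  moreover have "G y \<in> B" if "y \<in> S" "y \<in> snd (P n)" for y
  proof -
   have "y \<in> fst (P n)" using that unfolding S_def by auto
   then have "G y \<in> I n" using P(3)[of n] by auto
   then have "G y \<in> ball (G x) d" using In p q by (auto simp: dist_real_def)
   then show ?thesis using d by auto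
  qed
  ultimately show "\<exists>A. open A \<and> x \<in> A \<and> (\<forall>y\<in>S. y \<in> A --> G y \<in> B)"
   using P(2)[of n] by blast
 qed
 with cl m show ?thesis by blast
qed

lemma tight_compact_approx:
 fixes M :: "'a::metric_space measure"
 assumes fb: "finite_borel M" and e: "e > 0"
 shows "\<exists>K. compact K \<and> measure M (- K) < e"
proof -
 note D = finite_borelD[OF fb]
 interpret finite_measure M by (rule D)
 obtain K :: "nat => 'a set" where K: "!!n. compact (K n)" "AE x in M. x \<in> (\<Union>n. K n)"
  using fb unfolding finite_borel_def tight_borel_def by auto
 define L where "L = (%n. \<Union>i\<le>n. K i)"
 have cL: "compact (L n)" for n unfolding L_def using K by auto
 have mL: "- L n \<in> sets M" for n using compact_imp_closed[OF cL[of n]] D(2) by auto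
 have "(%n. measure M (- L n)) \<longlonglongrightarrow> measure M (\<Inter>n. - L n)"
  by (rule finite_Lim_measure_decseq) (use mL in \<open>auto simp: decseq_def L_def intro: order_trans\<close>)
 moreover have "measure M (\<Inter>n. - L n) = 0"
 proof -
  have "AE x in M. x \<notin> (\<Inter>n. - L n)" using K(2) by eventually_elim (auto simp: L_def)
  then show ?thesis
   using AE_iff_null_sets[of "\<Inter>n. - L n" M] mL by (auto simp: measure_def null_sets_def)
 qed
 ultimately have "(%n. measure M (- L n)) \<longlonglongrightarrow> 0" by simp
 then obtain n where "measure M (- L n) < e" using e by (rule tendsto_zero_obtain_less)
 then show ?thesis using cL by blast
qed

text \<open>Otherwise \<open>h\<close>, composed with its distribution function, maps \<open>M\<close> to
  a multiple of Lebesgue measure on the unit interval. By Lusin's theorem and tightness the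
  preimage of any set \<open>B\<close> is exhausted by compact sets with compact images in
  \<open>B\<close>. As all preimages are Borel, this applies to \<open>B\<close> and to its
  complement, and \<open>B\<close> becomes Lebesgue measurable. A nonmeasurable set gives a
  contradiction.\<close>
lemma totally_measurable_map_has_atom:
 fixes M :: "'a::metric_space measure" and h :: "'a => real"
 assumes fb: "finite_borel M" and all: "!!B. h -` B \<in> sets borel" and atom: "!!r. measure M (h -` {r}) = 0"
 shows "measure M UNIV = 0"
proof (rule ccontr)
 assume n0: "measure M UNIV ~= 0"
 note D = finite_borelD[OF fb]
 interpret M: finite_measure M by (rule D)
 define a where "a = measure M UNIV"
 have a: "a > 0" using n0 measure_nonneg[of M UNIV] unfolding a_def by linarith
 have hm[measurable]: "h \<in> borel_measurable M"
  using all by (intro measurableI) (auto simp: D)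
 define \<Lambda> where "\<Lambda> = distr M borel h"
 interpret L: finite_borel_measure \<Lambda>
  unfolding \<Lambda>_def finite_borel_measure_def finite_borel_measure_axioms_def
  by (auto intro!: M.finite_measure_distr)
 have mL: "measure \<Lambda> B = measure M (h -` B)" if "B \<in> sets borel" for B
  unfolding \<Lambda>_def using that by (subst measure_distr) (auto simp: D)
 define F where "F = cdf \<Lambda>"
 have F: "F r = measure M (h -` {..r})" for r by (simp add: F_def cdf_def mL)
 have contF: "isCont F r" for r unfolding F_def using L.isCont_cdf[of r] atom mL[of "{r}"] by simp
 have monoF: "r <= s ==> F r <= F s" for r s unfolding F_def by (rule L.cdf_nondecreasing)
 have spL: "measure \<Lambda> (space \<Lambda>) = a" using mL[of UNIV] by (simp add: L.borel_UNIV a_def)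
 have Fb: "0 <= F r" "F r <= a" for r
  using L.cdf_nonneg[of r] L.cdf_bounded[of r] unfolding F_def by (auto simp: spL)
 have lim_top: "(F \<longlongrightarrow> a) at_top" using L.cdf_lim_at_top unfolding F_def spL .
 have lim_bot: "(F \<longlongrightarrow> 0) at_bot" using L.cdf_lim_at_bot unfolding F_def .
 have key: "measure M (h -` (F -` {..y})) = y" if y: "0 < y" "y < a" for y
 proof -
  obtain r1 where r1: "F r1 < y" using order_tendstoD(2)[OF lim_bot y(1)] by (auto simp: eventually_at_bot_linorder)
  obtain r2 where r2: "F r2 > y" using order_tendstoD(1)[OF lim_top y(2)] by (auto simp: eventually_at_top_linorder)
  define Z where "Z = F -` {..y}"
  have "closed Z" unfolding Z_def
   using contF by (intro continuous_closed_vimage) (auto simp: continuous_at_imp_continuous_on)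
  have r1Z: "r1 \<in> Z" using r1 by (simp add: Z_def)
  have bd: "x <= r2" if "x \<in> Z" for x
  proof (rule ccontr)
   assume "\<not> x <= r2" then have "F r2 <= F x" by (intro monoF) simp
   then show False using that r2 by (simp add: Z_def)
  qed
  define s where "s = Sup Z"
  have sZ: "s \<in> Z" unfolding s_def
   using r1Z bd \<open>closed Z\<close> by (intro closed_contains_Sup) (auto intro!: bdd_aboveI)
  have Zs: "Z = {..s}"
  proof
   show "Z \<subseteq> {..s}" unfolding s_def using bd by (auto intro!: cSup_upper bdd_aboveI)
   show "{..s} \<subseteq> Z" using sZ monoF unfolding Z_def by (auto intro: order_trans)
  qed
  have "F s >= y"
  proof (rule ccontr)
   assume "\<not> y <= F s"
   then have "\<forall>\<^sub>F x in at s. F x < y" using contF[of s] unfolding isCont_def by (intro order_tendstoD) auto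
   then obtain d where d: "d > 0" "!!x. x ~= s ==> dist x s < d ==> F x < y" unfolding eventually_at by auto
   have "F (s + d/2) < y" using d by (intro d(2)) (auto simp: dist_real_def)
   then have "s + d/2 \<in> Z" by (simp add: Z_def)
   then show False using Zs d(1) by auto
  qed
  then have "F s = y" using sZ by (simp add: Z_def)
  then show ?thesis using F[of s] Zs by (simp add: Z_def)
 qed
 define G where "G = (%x. F (h x) / a)"
 have G01: "0 <= G x" "G x <= 1" for x using Fb[of "h x"] a by (auto simp: G_def)
 have allG: "G -` B \<in> sets borel" for B
 proof -
  have "G -` B = h -` ((%r. F r / a) -` B)" by (auto simp: G_def)
  then show ?thesis using all by simp
 qed
 have Gm: "G \<in> borel_measurable borel" using allG by (intro measurableI) auto
 have GmM[measurable]: "G \<in> borel_measurable M" using allG by (intro measurableI) (auto simp: D)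
 have keyG: "measure M (G -` {..y}) = a * y" if "0 < y" "y < 1" for y
 proof -
  have "G -` {..y} = h -` (F -` {..a * y})" using a by (auto simp: G_def field_simps)
  then show ?thesis using key[of "a * y"] that a by simp
 qed
 have keyG': "measure M (G -` {y<..}) = a * (1 - y)" if y: "0 < y" "y < 1" for y
 proof -
  have "measure M (G -` {y<..}) = measure M (space M - G -` {..y})"
   by (rule arg_cong[where f="measure M"]) (auto simp: D)
  also have "... = a - a * y"
   using allG keyG[OF y] by (subst M.finite_measure_compl) (auto simp: D a_def)
  finally show ?thesis by (simp add: algebra_simps)
 qed
 define N where "N = distr M borel G"
 have fN: "finite_measure N" unfolding N_def by (rule M.finite_measure_distr) simp
 interpret N: finite_measure N by (rule fN)
 have mN: "measure N B = measure M (G -` B)" if "B \<in> sets borel" for B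
  unfolding N_def using that by (subst measure_distr) (auto simp: D)
 have NU: "N = density lborel (%x. ennreal a * indicator {0..1} x)"
 proof (rule measure_eqI_lessThan)
  show "sets N = sets borel" by (simp add: N_def)
  show "emeasure N {x<..} < \<infinity>" for x by (simp add: less_top[symmetric])
  show "emeasure N {x<..} = emeasure (density lborel (%x. ennreal a * indicator {0..1} x)) {x<..}" for x
  proof -
   have r: "emeasure (density lborel (%x. ennreal a * indicator {0..1} x)) {x<..} = ennreal a * emeasure lborel ({0..1} \<inter> {x<..})"
    by (subst emeasure_density) (auto simp: mult.assoc nn_integral_cmult indicator_inter_arith[symmetric])
   have mono: "measure M (G -` {u<..}) <= measure M (G -` {v<..})" if "v <= u" for u v
    using that allG by (intro M.finite_measure_mono) (auto simp: D)
   consider "x >= 1" | "0 < x" "x < 1" | "x <= 0" by linarith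
   then show ?thesis
   proof cases
    case 1
    then have "G -` {x<..} = {}" using G01(2) by (auto simp: not_less) (meson order_trans not_le)
    moreover have "{0..1} \<inter> {x<..} = {}" using 1 by auto
    ultimately show ?thesis using mN[of "{x<..}"] unfolding r N.emeasure_eq_measure by simp
   next
    case 2
    then have "{0..1} \<inter> {x<..} = {x<..1}" by auto
    then show ?thesis using mN[of "{x<..}"] keyG'[OF 2] a 2 unfolding r N.emeasure_eq_measure
    by (simp add: ennreal_mult)
   next
    case 3
    have "measure M (G -` {x<..}) = a"
    proof (rule antisym)
    show "measure M (G -` {x<..}) <= a" unfolding a_def by (intro M.finite_measure_mono) (auto simp: D)
    show "a <= measure M (G -` {x<..})"
    proof (rule field_le_epsilon)
    fix e :: real assume e: "e > 0"
    define t where "t = min (1/2) (e/a)"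
    have t: "0 < t" "t < 1" using e a by (auto simp: t_def)
    have "a * t <= e" using a by (auto simp: t_def min_def field_simps)
    then have "a - e <= a * (1 - t)" by (simp add: algebra_simps)
    also have "... = measure M (G -` {t<..})" using keyG'[OF t] by simp
    also have "... <= measure M (G -` {x<..})" using 3 t by (intro mono) simp
    finally show "a <= measure M (G -` {x<..}) + e" by simp
    qed
    qed
    moreover have "ennreal a * emeasure lborel ({0..1} \<inter> {x<..}) = ennreal a"
    proof -
    have "emeasure lborel {0<..1::real} <= emeasure lborel ({0..1} \<inter> {x<..})"
    using 3 by (intro emeasure_mono) auto
    moreover have "emeasure lborel ({0..1} \<inter> {x<..}) <= emeasure lborel {0..1::real}"
    by (intro emeasure_mono) auto
    ultimately have "emeasure lborel ({0..1} \<inter> {x<..}) = 1" by simp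
    then show ?thesis by simp
    qed
    ultimately show ?thesis using mN[of "{x<..}"] unfolding r N.emeasure_eq_measure by simp
   qed
  qed
 qed simp
 have approx: "\<exists>C. C \<in> sets borel \<and> C \<subseteq> B \<and> measure M (G -` B) <= measure N C" for B
 proof -
  have "\<exists>C. compact C \<and> C \<subseteq> B \<and> measure M (G -` B) < measure N C + 1 / real (Suc n)" for n
  proof -
   define e where "e = 1 / (3 * real (Suc n))"
   have e: "e > 0" by (simp add: e_def)
   obtain S where S: "closed S" "measure M (- S) < e" "continuous_on S G"
    using lusin_closed[OF D(1,2) Gm e] by blast
   obtain K where K: "compact K" "measure M (- K) < e" using tight_compact_approx[OF fb e] by blast
   obtain Q U where Q: "closed Q" "open U" "Q \<subseteq> G -` B" "G -` B \<subseteq> U" "measure M (U - Q) < e"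
    using finite_borel_regular[OF D(1,2) allG[of B] e] by blast
   define L where "L = K \<inter> (Q \<inter> S)"
   have cL: "compact L" unfolding L_def using K Q S by (intro compact_Int_closed) auto
   have cGL: "compact (G ` L)"
    by (rule compact_continuous_image[OF continuous_on_subset[OF S(3)] cL]) (auto simp: L_def)
   have GLb: "G ` L \<in> sets borel" using compact_imp_closed[OF cGL] by simp
   have Kc: "closed K" by (rule compact_imp_closed[OF K(1)])
   have sets: "- S \<in> sets M" "- K \<in> sets M" "U - Q \<in> sets M" "L \<in> sets M"
    using S(1) Kc Q(1,2) compact_imp_closed[OF cL] D(2) by auto
   have "measure M (G -` B) <= measure M (L \<union> (- S \<union> (- K \<union> (U - Q))))"
    using Q(4) sets by (intro M.finite_measure_mono) (auto simp: L_def)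
   also have "... <= measure M L + measure M (- S \<union> (- K \<union> (U - Q)))"
    using sets by (intro measure_Un_le) auto
   also have "measure M (- S \<union> (- K \<union> (U - Q))) <= measure M (-S) + measure M (- K \<union> (U - Q))"
    using sets by (intro measure_Un_le) auto
   also have "measure M (- K \<union> (U - Q)) <= measure M (-K) + measure M (U - Q)"
    using sets by (intro measure_Un_le) auto
   finally have "measure M (G -` B) < measure M L + 3 * e" using S(2) K(2) Q(5) by linarith
   moreover have "measure M L <= measure N (G ` L)"
    unfolding mN[OF GLb] using sets allG by (intro M.finite_measure_mono) (auto simp: D)
   moreover have "3 * e = 1 / real (Suc n)" by (simp add: e_def field_simps)
   ultimately have "measure M (G -` B) < measure N (G ` L) + 1 / real (Suc n)" by linarith
   moreover have "G ` L \<subseteq> B" using Q(3) by (auto simp: L_def)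
   ultimately show ?thesis using cGL by blast
  qed
  then have "\<forall>n. \<exists>C. compact C \<and> C \<subseteq> B \<and> measure M (G -` B) < measure N C + 1 / real (Suc n)" by blast
  from choice[OF this] obtain C where C: "!!n. compact (C n)" "!!n. C n \<subseteq> B"
   "!!n. measure M (G -` B) < measure N (C n) + 1 / real (Suc n)" by blast
  have Cb: "(\<Union>n. C n) \<in> sets borel" using compact_imp_closed[OF C(1)] by auto
  have "measure M (G -` B) <= measure N (\<Union>n. C n)"
  proof (rule field_le_epsilon)
   fix e :: real assume "e > 0"
   then obtain n where n: "1 / real (Suc n) < e" using nat_approx_posE by blast
   have "measure N (C n) <= measure N (\<Union>n. C n)"
    using Cb by (intro N.finite_measure_mono) (auto simp: N_def)
   then show "measure M (G -` B) <= measure N (\<Union>n. C n) + e" using C(3)[of n] n by linarith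
  qed
  then show ?thesis using Cb C(2) by blast
 qed
 obtain V :: "real set" where V: "V \<subseteq> {0..1}" "V \<notin> sets lebesgue" using exists_nonmeasurable_set by blast
 obtain C1 where C1: "C1 \<in> sets borel" "C1 \<subseteq> V" "measure M (G -` V) <= measure N C1" using approx by blast
 obtain C2 where C2: "C2 \<in> sets borel" "C2 \<subseteq> {0..1} - V" "measure M (G -` ({0..1} - V)) <= measure N C2" using approx by blast
 define R where "R = {0..1} - C1 - C2"
 have Rb: "R \<in> sets borel" using C1 C2 by (auto simp: R_def)
 have "a = measure M (G -` V \<union> G -` ({0..1} - V))"
  unfolding a_def using G01 V by (intro arg_cong[where f="measure M"]) auto
 also have "... <= measure N C1 + measure N C2"
  using measure_Un_le[of "G -` V" M "G -` ({0..1} - V)"] allG C1(3) C2(3) D(2) by fastforce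
 also have "... = measure N (C1 \<union> C2)"
  using C1 C2 V by (intro N.finite_measure_Union[symmetric]) (auto simp: N_def)
 finally have "a <= measure N (C1 \<union> C2)" .
 moreover have "measure N UNIV = a" using mN[of UNIV] by (simp add: a_def)
 moreover have "measure N UNIV >= measure N (R \<union> (C1 \<union> C2))" using Rb C1 C2
  by (intro N.finite_measure_mono) (auto simp: N_def)
 moreover have "measure N (R \<union> (C1 \<union> C2)) = measure N R + measure N (C1 \<union> C2)"
  using Rb C1 C2 by (intro N.finite_measure_Union) (auto simp: N_def R_def)
 ultimately have "measure N R <= 0" by linarith
 then have "emeasure N R = 0" using measure_nonneg[of N R] unfolding N.emeasure_eq_measure by simp
 then have "(\<integral>\<^sup>+x. ennreal a * indicator {0..1} x * indicator R x \<partial>lborel) = 0"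
  unfolding NU using Rb by (subst (asm) emeasure_density) auto
 also have "(%x. ennreal a * indicator {0..1} x * indicator R x) = (%x. ennreal a * indicator R x)"
  by (auto simp: R_def indicator_def)
 finally have "ennreal a * emeasure lborel R = 0"
  using Rb by (subst (asm) nn_integral_cmult) auto
 then have "emeasure lborel R = 0" using a by simp
 then have "negligible R" using Rb by (intro negligible_iff_null_sets[THEN iffD2]) (auto simp: null_sets_def)
 then have "negligible (V - C1)" by (rule negligible_subset) (use V C2 in \<open>auto simp: R_def\<close>)
 then have "C1 \<union> (V - C1) \<in> sets lebesgue"
  using C1(1) by (intro sets.Un) (auto intro: negligible_imp_sets)
 moreover have "C1 \<union> (V - C1) = V" using C1 by auto
 ultimately show False using V(2) by simp
qed

lemma compact_separable:
 fixes K :: "'a::metric_space set"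
 assumes "compact K"
 obtains D where "countable D" "K \<subseteq> closure D"
proof -
 have "\<forall>n::nat. \<exists>k. finite k \<and> K \<subseteq> (\<Union>x\<in>k. ball x (1 / real (Suc n)))"
  using assms unfolding compact_eq_totally_bounded by auto
 from choice[OF this] obtain k where k: "!!n. finite (k n)" "!!n. K \<subseteq> (\<Union>x\<in>k n. ball x (1 / real (Suc n)))"
  by auto
 have "K \<subseteq> closure (\<Union>n. k n)"
 proof
  fix x assume x: "x \<in> K"
  show "x \<in> closure (\<Union>n. k n)"
   unfolding closure_approachable
  proof (intro allI impI)
   fix e :: real assume "e > 0"
   then obtain n where n: "1 / real (Suc n) < e" using nat_approx_posE by blast
   obtain y where y: "y \<in> k n" "dist y x < 1 / real (Suc n)" using k(2)[of n] x by auto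
   then have "dist y x < e" using n by linarith
   then show "\<exists>y\<in>\<Union> (range k). dist y x < e" using y by blast
  qed
 qed
 moreover have "countable (\<Union>n. k n)" using k(1) by (auto intro: countable_finite)
 ultimately show ?thesis using that by blast
qed

lemma separable_injects_real:
 fixes D :: "'a::metric_space set"
 assumes "countable D"
 shows "\<exists>j::'a => real. inj_on j (closure D)"
proof (cases "D = {}")
 case True then show ?thesis by auto
next
 case False
 define d where "d = from_nat_into D"
 have d: "range d = D" unfolding d_def using range_from_nat_into[OF False assms] .
 define s where "s = (%x. {p. case (from_nat p :: nat \<times> nat) of (n, k) => dist x (d n) < 1 / real (Suc k)})"
 obtain i :: "nat set => real" where i: "inj i"
  using nat_sets_lepoll_reals01 unfolding lepoll_def by auto
 have "inj_on s (closure D)"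
 proof (rule inj_onI, rule ccontr)
  fix x y assume x: "x \<in> closure D" and y: "y \<in> closure D" and eq: "s x = s y" and ne: "x ~= y"
  have "dist x y / 2 > 0" using ne by simp
  then obtain k where k: "1 / real (Suc k) < dist x y / 2" using nat_approx_posE by blast
  obtain z where z: "z \<in> D" "dist z x < 1 / real (Suc k)"
   using x unfolding closure_approachable by (auto dest!: spec[of _ "1 / real (Suc k)"])
  obtain n where n: "z = d n" using z(1) d by auto
  have "to_nat (n, k) \<in> s x" using z(2) n by (simp add: s_def dist_commute)
  then have "to_nat (n, k) \<in> s y" using eq by simp
  then have "dist y z < 1 / real (Suc k)" using n by (simp add: s_def)
  then show False using z(2) k dist_triangle2[of x y z] by (simp add: dist_commute)
 qed
 then have "inj_on (i \<circ> s) (closure D)" using i by (intro comp_inj_on) (auto intro: inj_on_subset)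
 then show ?thesis by blast
qed

lemma finite_borel_separable_support:
 fixes M :: "'a::metric_space measure"
 assumes "finite_borel M"
 obtains D where "countable D" "AE x in M. x \<in> closure D"
proof -
 obtain K :: "nat => 'a set" where K: "!!n. compact (K n)" "AE x in M. x \<in> (\<Union>n. K n)"
  using assms unfolding finite_borel_def tight_borel_def by auto
 have "\<exists>D. countable D \<and> K n \<subseteq> closure D" for n using compact_separable[OF K(1)] by metis
 then have "\<forall>n. \<exists>D. countable D \<and> K n \<subseteq> closure D" by blast
 from choice[OF this] obtain D where D: "!!n. countable (D n)" "!!n. K n \<subseteq> closure (D n)" by auto
 have "closure (D n) \<subseteq> closure (\<Union>n. D n)" for n by (intro closure_mono) auto
 then have "AE x in M. x \<in> closure (\<Union>n. D n)" using K(2) D(2) by (auto elim!: eventually_mono)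
 then show ?thesis using D(1) that[of "\<Union>n. D n"] by auto
qed

text \<open>Sending the points of \<open>A i\<close> to a real number that encodes \<open>i\<close>
  reduces the claim to the real-valued case. Enough codes exist because \<open>M\<close> lives
  on a separable set, so that the indices of the sets that matter embed into the reals.\<close>
lemma totally_measurable_null_family:
 fixes M :: "'a::metric_space measure" and A :: "'i => 'a set"
 assumes fb: "finite_borel M" and disj: "disjoint_family_on A I"
  and all: "!!J. J \<subseteq> I ==> (\<Union>i\<in>J. A i) \<in> sets borel" and null: "!!i. i \<in> I ==> measure M (A i) = 0"
 shows "measure M (\<Union>i\<in>I. A i) = 0"
proof -
 note D = finite_borelD[OF fb]
 interpret finite_measure M by (rule D)
 obtain S where S: "countable S" "AE x in M. x \<in> closure S" using finite_borel_separable_support[OF fb] by blast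
 obtain j :: "'a => real" where j: "inj_on j (closure S)" using separable_injects_real[OF S(1)] by blast
 define I' where "I' = {i\<in>I. A i \<inter> closure S ~= {}}"
 have "\<forall>i\<in>I'. \<exists>x. x \<in> A i \<inter> closure S" by (auto simp: I'_def)
 from bchoice[OF this] obtain p where p: "!!i. i \<in> I' ==> p i \<in> A i \<inter> closure S" by auto
 have pinj: "i = k" if "i \<in> I'" "k \<in> I'" "p i = p k" for i k
  using p[OF that(1)] p[OF that(2)] that disj unfolding disjoint_family_on_def I'_def by auto
 define g where "g = (%x. THE i. i \<in> I' \<and> x \<in> A i)"
 have g: "g x = i" if "i \<in> I'" "x \<in> A i" for x i
  unfolding g_def using that disj by (intro the_equality) (auto simp: disjoint_family_on_def I'_def)
 define U where "U = (\<Union>i\<in>I'. A i)"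
 have sub: "I' \<subseteq> I" by (auto simp: I'_def)
 have Ub: "U \<in> sets borel" unfolding U_def by (rule all[OF sub])
 define h where "h = (%x. if x \<in> U then j (p (g x)) else 0)"
 have pre: "h -` B \<inter> U = (\<Union>i\<in>{i\<in>I'. j (p i) \<in> B}. A i)" for B
 proof (rule set_eqI)
  fix x
  show "x \<in> h -` B \<inter> U \<longleftrightarrow> x \<in> (\<Union>i\<in>{i\<in>I'. j (p i) \<in> B}. A i)"
  proof (cases "x \<in> U")
   case True
   then obtain i where i: "i \<in> I'" "x \<in> A i" by (auto simp: U_def)
   have uni: "x \<in> A k ==> k \<in> I' ==> k = i" for k using g[of k x] g[OF i] by simp
   have "x \<in> (\<Union>i\<in>{i\<in>I'. j (p i) \<in> B}. A i) \<longleftrightarrow> j (p i) \<in> B"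
    using i uni by (metis (no_types, lifting) UN_E UN_I mem_Collect_eq)
   moreover have "h x = j (p i)" using True g[OF i] by (simp add: h_def)
   ultimately show ?thesis using True by simp
  next
   case False
   then show ?thesis by (auto simp: U_def)
  qed
 qed
 have hb: "h -` B \<in> sets borel" for B
 proof -
  have 1: "h -` B \<inter> U \<in> sets borel" unfolding pre using sub by (intro all) auto
  have "h -` B - U = (if 0 \<in> B then - U else {})" by (auto simp: h_def split: if_splits)
  then have 2: "h -` B - U \<in> sets borel" using Ub by auto
  have "h -` B = (h -` B \<inter> U) \<union> (h -` B - U)" by auto
  then show ?thesis using 1 2 by (metis sets.Un)
 qed
 define N where "N = density M (indicator U)"
 have UM: "U \<in> sets M" using Ub D by simp
 have fbN: "finite_borel N"
  unfolding N_def by (rule finite_borel_density[OF fb]) (use UM in \<open>auto simp: less_top[symmetric]\<close>)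
 have mN: "measure N B = measure M (B \<inter> U)" if "B \<in> sets borel" for B
 proof -
  have "emeasure N B = emeasure M (B \<inter> U)"
   unfolding N_def using that UM D by (subst emeasure_density) (auto simp: indicator_inter_arith[symmetric] Int_commute)
  then show ?thesis by (simp add: measure_def)
 qed
 have "measure N (h -` {r}) = 0" for r
 proof -
  have "measure N (h -` {r}) = measure M (\<Union>i\<in>{i\<in>I'. j (p i) \<in> {r}}. A i)" unfolding mN[OF hb] pre ..
  also have "... = 0"
  proof (cases "\<exists>i\<in>I'. j (p i) = r")
   case True
   then obtain i where i: "i \<in> I'" "j (p i) = r" by blast
   have uni: "k = i" if "k \<in> I'" "j (p k) = r" for k
   proof (rule pinj[OF that(1) i(1)])
    have "j (p k) = j (p i)" using that(2) i(2) by simp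
    then show "p k = p i" by (rule inj_onD[OF j]) (rule IntD2[OF p[OF that(1)]] IntD2[OF p[OF i(1)]])+
   qed
   have e: "{i\<in>I'. j (p i) \<in> {r}} = {i}"
   proof (intro equalityI subsetI)
    fix k assume "k \<in> {i\<in>I'. j (p i) \<in> {r}}"
    then show "k \<in> {i}" using uni[of k] by simp
   qed (use i in simp)
   have "i \<in> I" using i(1) sub by blast
   then show ?thesis unfolding e using null by simp
  next
   case False
   then have e: "{i\<in>I'. j (p i) \<in> {r}} = {}" by auto
   show ?thesis unfolding e by simp
  qed
  finally show ?thesis .
 qed
 then have "measure N UNIV = 0" by (rule totally_measurable_map_has_atom[OF fbN hb])
 then have U0: "measure M U = 0" using mN[of UNIV] by simp
 define W where "W = (\<Union>i\<in>I - I'. A i)"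
 have Wb: "W \<in> sets borel" unfolding W_def by (rule all) auto
 have "AE x in M. x \<notin> W" using S(2) by eventually_elim (auto simp: W_def I'_def)
 then have W0: "measure M W = 0" using AE_iff_null_sets[of W M] Wb D by (auto simp: measure_def null_sets_def)
 have "(\<Union>i\<in>I. A i) = U \<union> W" unfolding U_def W_def using sub by auto
 then have "measure M (\<Union>i\<in>I. A i) <= measure M U + measure M W"
  using measure_Un_le[of U M W] UM Wb D by simp
 then show ?thesis using U0 W0 measure_nonneg[of M "\<Union>i\<in>I. A i"] by linarith
qed

text \<open>A well-ordering of the open sets with null preimage refines them to countably many families,
  each of which consists of disjoint open sets at a positive distance from each other (the
  device behind Stone's theorem on paracompactness). All unions within a family are open, so
  their preimages are Borel, and each family is null by the previous lemma.\<close>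
lemma union_of_null_open_preimages:
 fixes M :: "'a::metric_space measure" and V :: "'a => 'b::metric_space"
 assumes fb: "finite_borel M" and V: "V \<in> borel_measurable borel"
 shows "measure M (V -` \<Union>{U. open U \<and> measure M (V -` U) = 0}) = 0"
proof -
 note D = finite_borelD[OF fb]
 interpret finite_measure M by (rule D)
 have Vo: "V -` U \<in> sets borel" if "open U" for U
  using measurable_sets[OF V, of U] that by auto
 define N where "N = {U. open U \<and> measure M (V -` U) = 0}"
 obtain r where r: "well_order_on N r" using well_order_on by blast
 have wf: "wf (r - Id)" and tot: "total_on N r" and refl: "refl_on N r" and anti: "antisym r"
  using r unfolding well_order_on_def linear_order_on_def partial_order_on_def preorder_on_def by auto
 \<comment> \<open>The points of U that belong to no earlier set and lie at distance at least 1/(n+1) from the complement.\<close>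
 define E where "E = (%n U. {v\<in>U. (\<forall>W\<in>N. v \<in> W --> (U, W) \<in> r) \<and> (\<forall>w. w \<notin> U --> dist v w >= 1 / real (Suc n))})"
 define Q where "Q = (%n U. U \<inter> (\<Union>v\<in>E n U. ball v (1 / (3 * real (Suc n)))))"
 have sep: "dist v w >= 1 / real (Suc n)" if "U \<in> N" "W \<in> N" "U ~= W" "v \<in> E n U" "w \<in> E n W" for n U W v w
 proof -
  have aux: "dist v w >= 1 / real (Suc n)" if "U \<in> N" "W \<in> N" "U ~= W" "(U, W) \<in> r" "v \<in> E n U" "w \<in> E n W" for U W v w
  proof -
   have "w \<notin> U"
   proof
    assume "w \<in> U"
    then have "(W, U) \<in> r" using that unfolding E_def by auto
    then show False using anti that unfolding antisym_def by auto
   qed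
   then show ?thesis using that unfolding E_def by auto
  qed
  have "(U, W) \<in> r \<or> (W, U) \<in> r" using tot that unfolding total_on_def by auto
  then show ?thesis using aux[of U W v w] aux[of W U w v] that by (auto simp: dist_commute)
 qed
 have oQ: "open (Q n U)" if "U \<in> N" for n U
  using that unfolding Q_def N_def by auto
 have null: "measure M (\<Union>U\<in>N. V -` Q n U) = 0" for n
 proof (rule totally_measurable_null_family[OF fb])
  show "disjoint_family_on (%U. V -` Q n U) N"
   unfolding disjoint_family_on_def
  proof (intro ballI impI)
   fix U W assume UW: "U \<in> N" "W \<in> N" "U ~= W"
   have "Q n U \<inter> Q n W = {}"
   proof (rule ccontr)
    assume "Q n U \<inter> Q n W ~= {}"
    then obtain z v w where z: "v \<in> E n U" "w \<in> E n W" "dist v z < 1 / (3 * real (Suc n))" "dist w z < 1 / (3 * real (Suc n))"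
    unfolding Q_def by auto
    have "dist v w < 2 * (1 / (3 * real (Suc n)))" using z(3,4) dist_triangle2[of v w z] by linarith
    also have "... <= 1 / real (Suc n)" by (simp add: field_simps)
    finally show False using sep[OF UW z(1,2)] by linarith
   qed
   then show "V -` Q n U \<inter> V -` Q n W = {}" by auto
  qed
  fix J assume "J \<subseteq> N"
  then have "open (\<Union>U\<in>J. Q n U)" using oQ by auto
  then show "(\<Union>U\<in>J. V -` Q n U) \<in> sets borel" using Vo[of "\<Union>U\<in>J. Q n U"] by (simp add: vimage_UN)
 next
  fix U assume U: "U \<in> N"
  have "measure M (V -` Q n U) <= measure M (V -` U)"
   using U Vo[of U] D by (intro finite_measure_mono) (auto simp: N_def Q_def)
  then show "measure M (V -` Q n U) = 0" using U measure_nonneg[of M "V -` Q n U"] unfolding N_def by (auto intro: antisym)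
 qed
 have cover: "V -` \<Union>N \<subseteq> (\<Union>n. \<Union>U\<in>N. V -` Q n U)"
 proof
  fix x assume "x \<in> V -` \<Union>N"
  then have "{U\<in>N. V x \<in> U} ~= {}" by auto
  then obtain U where U: "U \<in> {U\<in>N. V x \<in> U}" "!!W. (W, U) \<in> r - Id ==> W \<notin> {U\<in>N. V x \<in> U}"
   using wf unfolding wf_eq_minimal by (metis (no_types, lifting) ex_in_conv)
  have least: "(U, W) \<in> r" if "W \<in> N" "V x \<in> W" for W
  proof (cases "W = U")
   case True then show ?thesis using refl U(1) unfolding refl_on_def by auto
  next
   case False
   then show ?thesis using tot U that unfolding total_on_def by auto
  qed
  have "open U" "V x \<in> U" using U(1) by (auto simp: N_def)
  then obtain e where e: "e > 0" "ball (V x) e \<subseteq> U" using openE by blast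
  obtain n where n: "1 / real (Suc n) < e" using nat_approx_posE[OF e(1)] by blast
  have "dist (V x) w >= 1 / real (Suc n)" if "w \<notin> U" for w
   using that e(2) n by (auto simp: subset_iff) (meson not_le order_le_less_trans less_trans linorder_not_less)
  then have "V x \<in> E n U" using least U(1) unfolding E_def by auto
  then have "V x \<in> (\<Union>v\<in>E n U. ball v (1 / (3 * real (Suc n))))"
   by (intro UN_I[of "V x"]) auto
  then have "V x \<in> Q n U" using U(1) unfolding Q_def by simp
  then show "x \<in> (\<Union>n. \<Union>U\<in>N. V -` Q n U)" using U(1) by blast
 qed
 have m1: "(\<Union>U\<in>N. V -` Q n U) \<in> null_sets M" for n
 proof -
  have "open (\<Union>U\<in>N. Q n U)" using oQ by auto
  then have "(\<Union>U\<in>N. V -` Q n U) \<in> sets borel" using Vo[of "\<Union>U\<in>N. Q n U"] by (simp add: vimage_UN)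
  then show ?thesis using null[of n] D by (auto simp: null_sets_def emeasure_eq_measure)
 qed
 have "(\<Union>n. \<Union>U\<in>N. V -` Q n U) \<in> null_sets M" using m1 by auto
 moreover have "V -` \<Union>N \<in> sets M" using Vo[of "\<Union>N"] D by (auto simp: N_def)
 ultimately have "V -` \<Union>N \<in> null_sets M" by (rule null_sets_subset[OF _ _ cover])
 then show ?thesis by (auto simp: N_def measure_def null_sets_def)
qed

text \<open>Around a value off the largest open set with null preimage, every ball has a preimage of
  positive measure. For each radius, a disjoint family of balls with preimages of measure more
  than \<open>1/n\<close> is finite, hence maximal such families give countable nets.\<close>
lemma borel_map_essentially_separable:
 fixes M :: "'a::metric_space measure" and V :: "'a => 'b::metric_space"
 assumes fb: "finite_borel M" and V: "V \<in> borel_measurable borel"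
 obtains C where "countable C" "AE x in M. V x \<in> closure C"
proof -
 note D = finite_borelD[OF fb]
 interpret finite_measure M by (rule D)
 have Vo: "V -` U \<in> sets M" if "open U" for U
  using measurable_sets[OF V, of U] that D by auto
 define G where "G = \<Union>{U. open U \<and> measure M (V -` U) = 0}"
 have G0: "AE x in M. V x \<notin> G"
 proof -
  have "V -` G \<in> null_sets M"
   using union_of_null_open_preimages[OF fb V] Vo[of G] unfolding G_def null_sets_def by (auto simp: emeasure_eq_measure)
  from AE_not_in[OF this] show ?thesis by simp
 qed
 define F where "F = (%n k. {v. measure M (V -` ball v (1 / (2 * real (Suc k)))) > 1 / real (Suc n)})"
 define P where "P = (%n k D. finite D \<and> D \<subseteq> F n k \<and> (\<forall>v\<in>D. \<forall>w\<in>D. v ~= w --> dist v w >= 1 / real (Suc k)))"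
 have bound: "real (card C) <= real (Suc n) * measure M UNIV" if "P n k C" for n k C
 proof -
  define B where "B = (%v. V -` ball v (1 / (2 * real (Suc k))))"
  have disj: "disjoint_family_on B C"
   unfolding disjoint_family_on_def
  proof (intro ballI impI, rule ccontr)
   fix v w assume vw: "v \<in> C" "w \<in> C" "v ~= w" "B v \<inter> B w ~= {}"
   then obtain z where "dist v z < 1 / (2 * real (Suc k))" "dist w z < 1 / (2 * real (Suc k))" unfolding B_def by auto
   then have "dist v w < 2 * (1 / (2 * real (Suc k)))" using dist_triangle2[of v w z] by linarith
   moreover have "dist v w >= 1 / real (Suc k)" using that vw unfolding P_def by auto
   moreover have "2 * (1 / (2 * real (Suc k))) = 1 / real (Suc k)" by (simp add: field_simps)
   ultimately show False by simp
  qed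
  have "real (card C) * (1 / real (Suc n)) = (\<Sum>v\<in>C. 1 / real (Suc n))" by simp
  also have "... <= (\<Sum>v\<in>C. measure M (B v))"
   using that by (intro sum_mono) (auto simp: P_def F_def B_def)
  also have "... = measure M (\<Union>v\<in>C. B v)"
   using that disj Vo by (intro finite_measure_finite_Union[symmetric]) (auto simp: P_def B_def)
  also have "... <= measure M UNIV" by (rule finite_measure_mono) (auto simp: D)
  finally show ?thesis by (simp add: field_simps)
 qed
 have "\<exists>C. P n k C \<and> (\<forall>v\<in>F n k. \<exists>c\<in>C. dist c v < 1 / real (Suc k))" for n k
 proof -
  have "P n k {}" by (simp add: P_def)
  moreover have "card C < Suc (nat \<lceil>real (Suc n) * measure M UNIV\<rceil>)" if "P n k C" for C
   using bound[OF that] by linarith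
  ultimately obtain C where C: "P n k C" "!!C'. P n k C' ==> card C' <= card C"
   using ex_has_greatest_nat[of "P n k" "{}" card "Suc (nat \<lceil>real (Suc n) * measure M UNIV\<rceil>)"] by (metis less_imp_le)
  have "\<exists>c\<in>C. dist c v < 1 / real (Suc k)" if v: "v \<in> F n k" for v
  proof (rule ccontr)
   assume "\<not> ?thesis"
   then have far: "\<forall>c\<in>C. dist c v >= 1 / real (Suc k)" by (auto simp: not_less)
   moreover have "1 / real (Suc k) > 0" by simp
   ultimately have "v \<notin> C" by fastforce
   moreover have "P n k (insert v C)" using C(1) far v unfolding P_def by (auto simp: dist_commute)
   ultimately show False using C(2)[of "insert v C"] C(1) by (simp add: P_def)
  qed
  then show ?thesis using C(1) by blast
 qed
 then obtain C where C: "!!n k. P n k (C n k)" "!!n k v. v \<in> F n k ==> \<exists>c\<in>C n k. dist c v < 1 / real (Suc k)"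
  by metis
 define S where "S = (\<Union>n. \<Union>k. C n k)"
 have "countable S" unfolding S_def using C(1) by (intro countable_UN) (auto simp: P_def intro: countable_finite)
 moreover have "v \<in> closure S" if "v \<notin> G" for v
  unfolding closure_approachable
 proof (intro allI impI)
  fix e :: real assume "e > 0"
  then obtain k where k: "1 / real (Suc k) < e" using nat_approx_posE by blast
  have "measure M (V -` ball v (1 / (2 * real (Suc k)))) ~= 0"
  proof
   assume "measure M (V -` ball v (1 / (2 * real (Suc k)))) = 0"
   then have "ball v (1 / (2 * real (Suc k))) \<subseteq> G" unfolding G_def by blast
   then have "v \<in> G" by (rule subsetD) simp
   then show False using that by simp
  qed
  then have "measure M (V -` ball v (1 / (2 * real (Suc k)))) > 0"
   using measure_nonneg less_le by metis
  then obtain n where "1 / real (Suc n) < measure M (V -` ball v (1 / (2 * real (Suc k))))"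
   using nat_approx_posE by blast
  then have "v \<in> F n k" by (simp add: F_def)
  then obtain c where "c \<in> C n k" "dist c v < 1 / real (Suc k)" using C(2) by blast
  then show "\<exists>y\<in>S. dist y v < e" using k unfolding S_def by (intro bexI[of _ c]) auto
 qed
 ultimately show ?thesis using G0 that[of S] by (smt (verit) eventually_mono)
qed

section \<open>Norming functionals\<close>

text \<open>The Hahn-Banach theorem is obtained from minimal sublinear functionals below the norm: a
  minimal one coincides with its slices below and is therefore linear.\<close>
definition sublinear_below_norm :: "('e::real_normed_vector => real) => bool" where
 "sublinear_below_norm p \<longleftrightarrow> (\<forall>x y. p (x + y) <= p x + p y) \<and>
   (\<forall>t x. 0 <= t --> p (t *\<^sub>R x) = t * p x) \<and> (\<forall>x. p x <= norm x)"

text \<open>The largest sublinear functional \<open>q\<close> below \<open>p\<close> with \<open>q (- c)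
  \<le> - p c\<close>.\<close>
definition sublinear_slice :: "('e::real_normed_vector => real) => 'e => 'e => real" where
 "sublinear_slice p c x = (INF t\<in>{0..}. p (x + t *\<^sub>R c) - t * p c)"

lemma sublinear_slice_lower:
 assumes p: "sublinear_below_norm p" and t: "0 <= t"
 shows "- p (- x) <= p (x + t *\<^sub>R c) - t * p c"
proof -
 have "p ((x + t *\<^sub>R c) + (- x)) <= p (x + t *\<^sub>R c) + p (- x)"
  using p unfolding sublinear_below_norm_def by blast
 moreover have "p ((x + t *\<^sub>R c) + (- x)) = t * p c"
  using p t unfolding sublinear_below_norm_def by simp
 ultimately show ?thesis by linarith
qed

lemma sublinear_slice_le:
 assumes p: "sublinear_below_norm p" and t: "0 <= t"
 shows "sublinear_slice p c x <= p (x + t *\<^sub>R c) - t * p c"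
 unfolding sublinear_slice_def
 by (rule cINF_lower) (use sublinear_slice_lower[OF p] t in \<open>auto intro!: bdd_belowI2[of _ "- p (- x)"]\<close>)

lemma sublinear_slice_sublinear:
 assumes p: "sublinear_below_norm p"
 shows "sublinear_below_norm (sublinear_slice p c)"
proof -
 have le: "sublinear_slice p c x <= p x" for x
  using sublinear_slice_le[OF p, of 0 c x] by simp
 have "sublinear_slice p c (x + y) <= sublinear_slice p c x + sublinear_slice p c y" for x y
 proof -
  have 1: "sublinear_slice p c (x + y) <= (p (x + s *\<^sub>R c) - s * p c) + (p (y + t *\<^sub>R c) - t * p c)"
   if "0 <= s" "0 <= t" for s t
  proof -
   have "sublinear_slice p c (x + y) <= p ((x + y) + (s + t) *\<^sub>R c) - (s + t) * p c"
    by (rule sublinear_slice_le[OF p]) (use that in simp)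
   also have "(x + y) + (s + t) *\<^sub>R c = (x + s *\<^sub>R c) + (y + t *\<^sub>R c)" by (simp add: algebra_simps)
   also have "p ... <= p (x + s *\<^sub>R c) + p (y + t *\<^sub>R c)" using p unfolding sublinear_below_norm_def by blast
   finally show ?thesis by (simp add: algebra_simps)
  qed
  have 2: "sublinear_slice p c (x + y) - (p (y + t *\<^sub>R c) - t * p c) <= sublinear_slice p c x" if t: "0 <= t" for t
   unfolding sublinear_slice_def[of p c x]
  proof (rule cINF_greatest)
   fix s :: real assume "s \<in> {0..}"
   then show "sublinear_slice p c (x + y) - (p (y + t *\<^sub>R c) - t * p c) <= p (x + s *\<^sub>R c) - s * p c"
    using 1[of s t] t by simp
  qed simp
  have "sublinear_slice p c (x + y) - sublinear_slice p c x <= sublinear_slice p c y"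
   unfolding sublinear_slice_def[of p c y]
  proof (rule cINF_greatest)
   fix s :: real assume "s \<in> {0..}"
   then show "sublinear_slice p c (x + y) - sublinear_slice p c x <= p (y + s *\<^sub>R c) - s * p c"
    using 2[of s] by simp
  qed simp
  then show ?thesis by simp
 qed
 moreover have "sublinear_slice p c (t *\<^sub>R x) = t * sublinear_slice p c x" if t: "0 <= t" for t x
 proof (cases "t = 0")
  case True
  have p0: "p 0 = 0" using p[unfolded sublinear_below_norm_def] by (metis mult_zero_left order_refl scaleR_zero_left)
  have "sublinear_slice p c 0 <= 0" using le[of 0] p0 by simp
  moreover have "0 <= sublinear_slice p c 0"
   unfolding sublinear_slice_def
   by (rule cINF_greatest) (use sublinear_slice_lower[OF p, of _ 0 c] p0 in auto)
  ultimately show ?thesis using True by simp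
 next
  case False
  then have t: "t > 0" using t by simp
  have aux: "sublinear_slice p c (t *\<^sub>R x) <= t * sublinear_slice p c x" if t: "t > 0" for t x
  proof -
   have "sublinear_slice p c (t *\<^sub>R x) / t <= sublinear_slice p c x"
    unfolding sublinear_slice_def[of p c x]
   proof (rule cINF_greatest)
    fix s :: real assume s: "s \<in> {0..}"
    have "sublinear_slice p c (t *\<^sub>R x) <= p (t *\<^sub>R x + (t * s) *\<^sub>R c) - (t * s) * p c"
    by (rule sublinear_slice_le[OF p]) (use t s in simp)
    also have "t *\<^sub>R x + (t * s) *\<^sub>R c = t *\<^sub>R (x + s *\<^sub>R c)" by (simp add: algebra_simps)
    also have "p ... = t * p (x + s *\<^sub>R c)" using p t unfolding sublinear_below_norm_def by simp
    finally show "sublinear_slice p c (t *\<^sub>R x) / t <= p (x + s *\<^sub>R c) - s * p c"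
    using t by (simp add: field_simps)
   qed simp
   then show ?thesis using t by (simp add: field_simps)
  qed
  have "sublinear_slice p c ((1/t) *\<^sub>R (t *\<^sub>R x)) <= (1/t) * sublinear_slice p c (t *\<^sub>R x)"
   by (rule aux) (use t in simp)
  then have "t * sublinear_slice p c x <= sublinear_slice p c (t *\<^sub>R x)" using t by (simp add: field_simps)
  then show ?thesis using aux[OF t, of x] by linarith
 qed
 moreover have "sublinear_slice p c x <= norm x" for x
  using le[of x] p unfolding sublinear_below_norm_def by (meson order_trans)
 ultimately show ?thesis unfolding sublinear_below_norm_def by blast
qed

text \<open>Zorn's lemma below the slice of the norm in direction \<open>c\<close> yields a minimal
  sublinear functional. Its own slices cannot be smaller, which makes it additive.\<close>
lemma norming_functional_exists:
 fixes c :: "'e::real_normed_vector"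
 shows "\<exists>y::'e \<Rightarrow>\<^sub>L real. (\<forall>x. \<bar>blinfun_apply y x\<bar> <= norm x) \<and> blinfun_apply y c = norm c"
proof -
 have nS: "sublinear_below_norm (norm :: 'e => real)"
  unfolding sublinear_below_norm_def by (auto simp: norm_triangle_ineq)
 define A where "A = {p :: 'e => real. sublinear_below_norm p \<and> p <= sublinear_slice norm c}"
 have lower: "- norm x <= p x" if "p \<in> A" for p x
 proof -
  have p: "sublinear_below_norm p" using that by (simp add: A_def)
  have "p 0 = 0" using p[unfolded sublinear_below_norm_def] by (metis mult_zero_left order_refl scaleR_zero_left)
  moreover have "p (x + - x) <= p x + p (- x)" "p (- x) <= norm (- x)" using p unfolding sublinear_below_norm_def by blast+
  ultimately show ?thesis by simp
 qed
 have "\<exists>m\<in>A. \<forall>a\<in>A. m >= a --> a = m"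
 proof (rule predicate_Zorn[of A "%p q. q <= p"])
  show "partial_order_on A (relation_of (%p q. q <= p) A)"
   by (rule partial_order_on_relation_ofI) auto
  fix C assume C: "C \<in> Chains (relation_of (%p q. q <= p) A)"
  then have CA: "C \<subseteq> A" and tot: "!!p q. p \<in> C ==> q \<in> C ==> p <= q \<or> q <= p"
   unfolding Chains_def relation_of_def by auto
  show "\<exists>u\<in>A. \<forall>a\<in>C. u <= a"
  proof (cases "C = {}")
   case True
   have "sublinear_slice norm c \<in> A" using sublinear_slice_sublinear[OF nS] by (simp add: A_def)
   then show ?thesis using True by auto
  next
   case False
   define u where "u = (%x. INF p\<in>C. p x)"
   have bd: "bdd_below ((%p. p x) ` C)" for x
    using CA lower by (intro bdd_belowI2[of _ "- norm x"]) auto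
   have ul: "u x <= p x" if "p \<in> C" for p x unfolding u_def by (rule cINF_lower[OF bd that])
   obtain p0 where p0: "p0 \<in> C" using False by auto
   have "u (x + y) <= u x + u y" for x y
   proof -
    have 1: "u (x + y) <= p x + q y" if "p \<in> C" "q \<in> C" for p q
    proof -
    note pq = that
    obtain r where r: "r \<in> C" "r <= p" "r <= q" using tot[OF pq] pq by auto
    have "u (x + y) <= r (x + y)" by (rule ul[OF r(1)])
    also have "... <= r x + r y" using r(1) CA unfolding A_def sublinear_below_norm_def by auto
    also have "... <= p x + q y" using r by (intro add_mono) (auto simp: le_fun_def)
    finally show ?thesis .
    qed
    have 2: "u (x + y) - q y <= u x" if "q \<in> C" for q
    unfolding u_def[of] by (rule cINF_greatest[OF False]) (use 1[OF _ that] in \<open>force simp: u_def\<close>)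
    have "u (x + y) - u x <= u y"
    unfolding u_def[of] by (rule cINF_greatest[OF False]) (use 2 in \<open>force simp: u_def\<close>)
    then show ?thesis by simp
   qed
   moreover have "u (t *\<^sub>R x) = t * u x" if t: "0 <= t" for t x
   proof -
    have hom: "p (t *\<^sub>R x) = t * p x" if "p \<in> C" "0 <= t" for p t x
    using that CA unfolding A_def sublinear_below_norm_def by auto
    show ?thesis
    proof (cases "t = 0")
    case True
    have "(%p. p 0) ` C = {0}" using hom[of _ 0 0] p0 by force
    then have "u 0 = 0" unfolding u_def by simp
    then show ?thesis using True by simp
    next
    case F: False
    then have t: "t > 0" using t by simp
    have aux: "u (t *\<^sub>R x) <= t * u x" if t: "t > 0" for t x
    proof -
    have "u (t *\<^sub>R x) / t <= u x"
    unfolding u_def[of]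
    proof (rule cINF_greatest[OF False])
    fix p assume "p \<in> C"
    then show "(INF p\<in>C. p (t *\<^sub>R x)) / t <= p x"
    using ul[of p "t *\<^sub>R x"] hom[of p t x] t by (simp add: u_def field_simps)
    qed
    then show ?thesis using t by (simp add: field_simps)
    qed
    have "u ((1/t) *\<^sub>R (t *\<^sub>R x)) <= (1/t) * u (t *\<^sub>R x)" by (rule aux) (use t in simp)
    then have "t * u x <= u (t *\<^sub>R x)" using t by (simp add: field_simps)
    then show ?thesis using aux[OF t, of x] by linarith
    qed
   qed
   moreover have "u x <= norm x" for x
   proof -
    have "p0 x <= norm x" using subsetD[OF CA p0] unfolding A_def sublinear_below_norm_def by simp
    then show ?thesis using ul[OF p0, of x] by linarith
   qed
   moreover have "u <= sublinear_slice norm c"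
   proof -
    have "u <= p0" using ul[OF p0] by (simp add: le_fun_def)
    also have "p0 <= sublinear_slice norm c" using p0 CA by (auto simp: A_def)
    finally show ?thesis .
   qed
   ultimately have "u \<in> A" unfolding A_def sublinear_below_norm_def by blast
   then show ?thesis using ul by (auto simp: le_fun_def intro!: bexI[of _ u])
  qed
 qed
 then obtain m where mA: "m \<in> A" and min: "!!a. a \<in> A ==> a <= m ==> a = m" by blast
 have mS: "sublinear_below_norm m" and mc: "m <= sublinear_slice norm c" using mA by (auto simp: A_def)
 have sub: "m (x + y) <= m x + m y" and hom: "0 <= t ==> m (t *\<^sub>R x) = t * m x" and mn: "m x <= norm x" for x y t
  using mS unfolding sublinear_below_norm_def by blast+
 have m0: "m 0 = 0" using hom[of 0 0] by simp
 have neg: "m (- d) = - m d" for d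
 proof -
  have le: "sublinear_slice m d <= m" using sublinear_slice_le[OF mS, of 0 d] by (simp add: le_fun_def)
  have "sublinear_slice m d = m"
   using sublinear_slice_sublinear[OF mS, of d] le mc by (intro min) (auto simp: A_def intro: order_trans)
  then have "m (- d) <= m (- d + 1 *\<^sub>R d) - 1 * m d" using sublinear_slice_le[OF mS, of 1 d "-d"] by simp
  then have "m (- d) <= - m d" using m0 by simp
  moreover have "0 <= m d + m (- d)" using sub[of d "-d"] m0 by simp
  ultimately show ?thesis by linarith
 qed
 have add: "m (x + y) = m x + m y" for x y
  using sub[of x y] sub[of "x + y" "- y"] neg[of y] by simp
 have scale: "m (t *\<^sub>R x) = t * m x" for t x
 proof (cases "0 <= t")
  case False
  then have "m ((- t) *\<^sub>R x) = (- t) * m x" by (intro hom) simp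
  then show ?thesis using neg[of "t *\<^sub>R x"] by simp
 qed (rule hom)
 have abs: "\<bar>m x\<bar> <= norm x" for x using mn[of x] mn[of "-x"] neg[of x] by (simp add: abs_le_iff)
 have "bounded_linear m"
  by (rule bounded_linear_intro[of _ 1]) (auto simp: add scale abs)
 then obtain y :: "'e \<Rightarrow>\<^sub>L real" where y: "blinfun_apply y = m" by (metis bounded_linear_Blinfun_apply)
 have "m (- c) <= sublinear_slice norm c (- c)" using mc by (simp add: le_fun_def)
 also have "... <= norm (- c + 1 *\<^sub>R c) - 1 * norm c" by (rule sublinear_slice_le[OF nS]) simp
 finally have "norm c <= m c" using neg[of c] by simp
 then have "m c = norm c" using abs[of c] by linarith
 then show ?thesis using y abs by auto
qed

section \<open>Dyadic difference quotients\<close>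

text \<open>The absolute continuity of curves, for arbitrary maps on the line.\<close>
definition ac_on :: "real set => (real => 'a::metric_space) => bool" where
 "ac_on S f \<longleftrightarrow>
   (\<forall>\<epsilon>>0. \<exists>\<delta>>0. \<forall>(n::nat) a b.
    (\<forall>i<n. a i <= b i \<and> {a i..b i} \<subseteq> S) -->
    disjoint_family_on (%i. {a i<..<b i}) {..<n} -->
    (\<Sum>i<n. b i - a i) < \<delta> -->
    (\<Sum>i<n. dist (f (a i)) (f (b i))) < \<epsilon>)"

definition dyadic :: "nat => nat => real set" where
 "dyadic n k = {real k / 2 ^ n..<real (Suc k) / 2 ^ n}"

definition dyadic_increment :: "(real => 'e::real_normed_vector) => nat => nat => 'e" where
 "dyadic_increment f n k = f (real (Suc k) / 2 ^ n) - f (real k / 2 ^ n)"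

text \<open>The vector measure whose density is the difference quotient of \<open>f\<close> on the dyadic
  intervals of generation \<open>n\<close>.\<close>
definition dyadic_measure :: "(real => 'e::real_normed_vector) => nat => real set => 'e" where
 "dyadic_measure f n A = (\<Sum>k<2^n. (2 ^ n * measure lborel (A \<inter> dyadic n k)) *\<^sub>R dyadic_increment f n k)"

lemma dyadic_borel [measurable]: "dyadic n k \<in> sets borel"
 by (simp add: dyadic_def)

lemma measure_dyadic: "measure lborel (dyadic n k) = 1 / 2 ^ n"
 by (simp add: dyadic_def divide_right_mono diff_divide_distrib[symmetric])

lemma dyadic_disjoint: "k ~= l ==> dyadic n k \<inter> dyadic n l = {}"
proof -
 have "dyadic n k \<inter> dyadic n l = {}" if "k < l" for k l
 proof -
  have "real (Suc k) / 2 ^ n <= real l / 2 ^ n" using that by (intro divide_right_mono) auto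
  then show ?thesis by (auto simp: dyadic_def)
 qed
 then show "k ~= l ==> dyadic n k \<inter> dyadic n l = {}" by (metis Int_commute linorder_neqE_nat)
qed

lemma dyadic_subset_unit: "k < 2 ^ n ==> dyadic n k \<subseteq> {0..<1}"
proof -
 assume "k < 2 ^ n"
 then have "real (Suc k) <= 2 ^ n" by (metis Suc_leI of_nat_le_iff of_nat_numeral of_nat_power)
 then have "real (Suc k) / 2 ^ n <= 1" by simp
 then show ?thesis by (auto simp: dyadic_def intro: order_less_le_trans)
qed

lemma dyadic_cover_unit:
 assumes "x \<in> {0..<1}" obtains k where "k < 2 ^ n" "x \<in> dyadic n k"
proof -
 define k where "k = nat \<lfloor>2 ^ n * x\<rfloor>"
 have x: "0 <= 2 ^ n * x" "2 ^ n * x < 2 ^ n" using assms by auto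
 have k: "real k <= 2 ^ n * x" "2 ^ n * x < real (Suc k)"
  using x(1) unfolding k_def by (auto simp: of_nat_nat) linarith+
 then have "real k < 2 ^ n" using x by linarith
 then have "k < 2 ^ n" by (metis of_nat_less_iff of_nat_numeral of_nat_power)
 moreover have "x \<in> dyadic n k" using k by (auto simp: dyadic_def field_simps)
 ultimately show ?thesis using that by blast
qed

lemma dyadic_split: "dyadic n k = dyadic (Suc n) (2 * k) \<union> dyadic (Suc n) (Suc (2 * k))"
proof -
 have "real (Suc (2 * k)) / 2 ^ Suc n <= real (Suc k) / 2 ^ n" "real k / 2 ^ n <= real (Suc (2 * k)) / 2 ^ Suc n"
  by (simp_all add: field_simps)
 moreover have "real (2 * k) / 2 ^ Suc n = real k / 2 ^ n" "real (Suc (Suc (2 * k))) / 2 ^ Suc n = real (Suc k) / 2 ^ n"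
  by (simp_all add: field_simps)
 ultimately show ?thesis unfolding dyadic_def by auto
qed

lemma dyadic_increment_split:
 "dyadic_increment f n k = dyadic_increment f (Suc n) (2 * k) + dyadic_increment f (Suc n) (Suc (2 * k))"
proof -
 have "real (2 * k) / 2 ^ Suc n = real k / 2 ^ n" "real (Suc (Suc (2 * k))) / 2 ^ Suc n = real (Suc k) / 2 ^ n"
  by (simp_all add: field_simps)
 then show ?thesis by (simp add: dyadic_increment_def del: power_Suc)
qed

lemma sum_lessThan_double: "(\<Sum>k<2 * N. F k) = (\<Sum>k<N. F (2 * k) + F (Suc (2 * k)))"
 for F :: "nat => 'a::comm_monoid_add"
 by (induction N) (auto simp: add.assoc)

lemma measure_unit_dyadic_sum:
 assumes A: "A \<in> sets borel" "A \<subseteq> {0..<1}"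
 shows "measure lborel A = (\<Sum>k<2^n. measure lborel (A \<inter> dyadic n k))"
proof -
 have "A = (\<Union>k<2^n. A \<inter> dyadic n k)" using A(2) dyadic_cover_unit by blast
 then have "measure lborel A = measure lborel (\<Union>k<2^n. A \<inter> dyadic n k)" by simp
 also have "... = (\<Sum>k<2^n. measure lborel (A \<inter> dyadic n k))"
 proof (rule measure_finite_Union)
  show "disjoint_family_on (%k. A \<inter> dyadic n k) {..<2 ^ n}"
   using dyadic_disjoint unfolding disjoint_family_on_def by blast
  show "emeasure lborel (A \<inter> dyadic n k) ~= \<infinity>" for k
  proof -
   have "emeasure lborel (A \<inter> dyadic n k) <= emeasure lborel {0..<1::real}"
    using A by (intro emeasure_mono) auto
   then show ?thesis by (auto simp: top_unique)
  qed
 qed (use A in auto)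
 finally show ?thesis .
qed

lemma pigeonhole_increment:
 fixes f :: "real => 'a::metric_space"
 assumes m: "m > 0"
 shows "\<exists>i<m. dist (f p) (f (p + h)) / real m <= dist (f (p + real i * (h / real m))) (f (p + real (Suc i) * (h / real m)))"
proof (rule ccontr)
 assume "\<not> ?thesis"
 then have less: "dist (f (p + real i * (h / real m))) (f (p + real (Suc i) * (h / real m))) < dist (f p) (f (p + h)) / real m" if "i < m" for i
  using that by (auto simp: not_le)
 have tel: "dist (f p) (f (p + real N * (h / real m))) <= (\<Sum>i<N. dist (f (p + real i * (h / real m))) (f (p + real (Suc i) * (h / real m))))" for N
 proof (induction N)
  case (Suc N)
  have "dist (f p) (f (p + real (Suc N) * (h / real m))) <= dist (f p) (f (p + real N * (h / real m))) + dist (f (p + real N * (h / real m))) (f (p + real (Suc N) * (h / real m)))"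
   by (rule dist_triangle)
  then show ?case using Suc by simp
 qed simp
 have "dist (f p) (f (p + h)) = dist (f p) (f (p + real m * (h / real m)))" using m by simp
 also have "... <= (\<Sum>i<m. dist (f (p + real i * (h / real m))) (f (p + real (Suc i) * (h / real m))))" by (rule tel)
 also have "... < (\<Sum>i<m. dist (f p) (f (p + h)) / real m)"
  using m less by (intro sum_strict_mono) auto
 also have "... = dist (f p) (f (p + h))" using m by simp
 finally show False by simp
qed

text \<open>Absolute continuity controls increments over short intervals, whereas the left-hand side takes
  a fraction \<open>\<alpha> k\<close> of the increment over a full dyadic interval. By the
  pigeonhole principle, among about \<open>1 / \<alpha> k\<close> equal parts of the interval
  one carries at least this fraction, and the chosen parts have small total length.\<close>
lemma ac_dyadic_weights:
 fixes f :: "real => 'e::real_normed_vector"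
 assumes f: "ac_on {0..1} f" and e: "\<epsilon> > 0"
 shows "\<exists>\<delta>>0. \<forall>n \<alpha>. (\<forall>k<2^n. 0 <= \<alpha> k \<and> \<alpha> k <= 1) --> (\<Sum>k<2^n. \<alpha> k) / 2 ^ n < \<delta> -->
   (\<Sum>k<2^n. \<alpha> k * norm (dyadic_increment f n k)) <= \<epsilon>"
proof -
 obtain \<delta> where \<delta>: "\<delta> > 0" and ac: "!!(n::nat) a b. (\<forall>i<n. a i <= b i \<and> {a i..b i} \<subseteq> {0..1}) ==>
    disjoint_family_on (%i. {a i<..<b i}) {..<n} ==> (\<Sum>i<n. b i - a i) < \<delta> ==>
    (\<Sum>i<n. dist (f (a i)) (f (b i))) < \<epsilon>"
  using f e unfolding ac_on_def by blast
 show ?thesis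
 proof (intro exI[of _ "\<delta>/2"] conjI allI impI)
  show "\<delta>/2 > 0" using \<delta> by simp
  fix n :: nat and \<alpha> :: "nat => real"
  assume \<alpha>: "\<forall>k<2^n. 0 <= \<alpha> k \<and> \<alpha> k <= 1" and small: "(\<Sum>k<2^n. \<alpha> k) / 2 ^ n < \<delta>/2"
  define h :: real where "h = 1 / 2 ^ n"
  have h: "h > 0" by (simp add: h_def)
  have "\<exists>a b. a <= b \<and> {a..b} \<subseteq> {real k * h..real (Suc k) * h} \<and> b - a <= 2 * \<alpha> k * h \<and>
    \<alpha> k * norm (dyadic_increment f n k) <= dist (f a) (f b)" if k: "k < 2^n" for k
  proof (cases "\<alpha> k = 0")
   case True
   then show ?thesis using h by (intro exI[of _ "real k * h"] conjI) (auto simp: algebra_simps)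
  next
   case False
   then have a: "0 < \<alpha> k" "\<alpha> k <= 1" using \<alpha> k by (auto simp: less_le)
   \<comment> \<open>Then alpha k <= 1/m <= 2 * alpha k.\<close>
   define m where "m = nat \<lfloor>1 / \<alpha> k\<rfloor>"
   have one: "1 <= 1 / \<alpha> k" using a by simp
   have m1: "real m <= 1 / \<alpha> k" "1 / \<alpha> k < real m + 1" "m > 0"
    using one unfolding m_def by (auto simp: of_nat_nat) linarith+
   then have m2: "real m >= 1" by simp
   obtain i where i: "i < m" "dist (f (real k * h)) (f (real k * h + h)) / real m \<le>
    dist (f (real k * h + real i * (h / real m))) (f (real k * h + real (Suc i) * (h / real m)))"
    using pigeonhole_increment[OF m1(3), of f "real k * h" h] by blast
   have hm: "h / real m > 0" using h m1 by simp
   have "real (Suc i) * (h / real m) <= real m * (h / real m)" using i(1) hm by (intro mult_right_mono) auto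
   then have up: "real (Suc i) * (h / real m) <= h" using m1 by simp
   have "1 / real m <= 2 * \<alpha> k"
   proof -
    have "1 / \<alpha> k < 2 * real m" using m1(2) m2 by linarith
    then show ?thesis using a m2 by (simp add: field_simps)
   qed
   then have len: "h / real m <= 2 * \<alpha> k * h" using mult_left_mono[of "1 / real m" "2 * \<alpha> k" h] h by (simp add: mult_ac)
   have "\<alpha> k <= 1 / real m" using m1(1) a m2 by (simp add: field_simps)
   then have "\<alpha> k * norm (dyadic_increment f n k) <= (1 / real m) * norm (dyadic_increment f n k)"
    by (rule mult_right_mono) simp
   moreover have "norm (dyadic_increment f n k) = dist (f (real k * h)) (f (real k * h + h))"
    by (simp add: dyadic_increment_def h_def dist_norm norm_minus_commute add_divide_distrib add.commute)
   ultimately have "\<alpha> k * norm (dyadic_increment f n k) \<le>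
    dist (f (real k * h + real i * (h / real m))) (f (real k * h + real (Suc i) * (h / real m)))"
    using i(2) by simp
   moreover have "real k * h + real (Suc i) * (h / real m) - (real k * h + real i * (h / real m)) = h / real m"
    by (simp add: algebra_simps add_divide_distrib)
   moreover have "{real k * h + real i * (h / real m)..real k * h + real (Suc i) * (h / real m)} \<subseteq> {real k * h..real (Suc k) * h}"
   proof -
    have "0 <= real i * (h / real m)" using hm by (intro mult_nonneg_nonneg) auto
    moreover have "real (Suc k) * h = real k * h + h" by (simp add: algebra_simps)
    ultimately show ?thesis using up by auto
   qed
   ultimately show ?thesis using len hm
    by (intro exI[of _ "real k * h + real i * (h / real m)"] exI[of _ "real k * h + real (Suc i) * (h / real m)"]) auto
  qed
  then have "\<forall>k. \<exists>ab. k < 2^n --> fst ab <= snd ab \<and> {fst ab..snd ab} \<subseteq> {real k * h..real (Suc k) * h} \<and> snd ab - fst ab <= 2 * \<alpha> k * h \<and>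
    \<alpha> k * norm (dyadic_increment f n k) <= dist (f (fst ab)) (f (snd ab))" by (metis fst_conv snd_conv)
  from choice[OF this] obtain ab where ab: "!!k. k < 2^n ==> fst (ab k) <= snd (ab k) \<and> {fst (ab k)..snd (ab k)} \<subseteq> {real k * h..real (Suc k) * h} \<and> snd (ab k) - fst (ab k) <= 2 * \<alpha> k * h \<and>
    \<alpha> k * norm (dyadic_increment f n k) <= dist (f (fst (ab k))) (f (snd (ab k)))" by blast
  have unit: "{real k * h..real (Suc k) * h} \<subseteq> {0..1}" if "k < 2^n" for k
  proof -
   have "real (Suc k) <= 2 ^ n" using that by (metis Suc_leI of_nat_le_iff of_nat_numeral of_nat_power)
   then have "real (Suc k) * h <= 1" by (simp add: h_def)
   then show ?thesis using h by (auto intro: order_trans[of 0 "real k * h"])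
  qed
  have "(\<Sum>k<2^n. \<alpha> k * norm (dyadic_increment f n k)) <= (\<Sum>k<2^n. dist (f (fst (ab k))) (f (snd (ab k))))"
   using ab by (intro sum_mono) auto
  also have "... < \<epsilon>"
  proof (rule ac)
   show "\<forall>k<2^n. fst (ab k) <= snd (ab k) \<and> {fst (ab k)..snd (ab k)} \<subseteq> {0..1}"
    using ab unit by blast
   show "disjoint_family_on (%k. {fst (ab k)<..<snd (ab k)}) {..<2 ^ n}"
    unfolding disjoint_family_on_def
   proof (intro ballI impI)
    have aux: "{fst (ab k)<..<snd (ab k)} \<inter> {fst (ab l)<..<snd (ab l)} = {}" if "k < 2^n" "l < 2^n" "k < l" for k l
    proof -
    have "real (Suc k) * h <= real l * h" using that h by (intro mult_right_mono) auto
    moreover have "snd (ab k) \<in> {fst (ab k)..snd (ab k)}" "fst (ab l) \<in> {fst (ab l)..snd (ab l)}" using ab that by auto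
    then have "snd (ab k) <= real (Suc k) * h" "real l * h <= fst (ab l)"
    using ab[OF that(1)] ab[OF that(2)] by auto
    ultimately show ?thesis by auto
    qed
    fix k l :: nat assume "k \<in> {..<2^n}" "l \<in> {..<2^n}" "k ~= l"
    then show "{fst (ab k)<..<snd (ab k)} \<inter> {fst (ab l)<..<snd (ab l)} = {}"
    using aux[of k l] aux[of l k] by (cases "k < l") auto
   qed
   have "(\<Sum>k<2^n. snd (ab k) - fst (ab k)) <= (\<Sum>k<2^n. 2 * \<alpha> k * h)"
    using ab by (intro sum_mono) auto
   also have "... = 2 * ((\<Sum>k<2^n. \<alpha> k) / 2 ^ n)"
    by (simp add: h_def sum_distrib_left sum_divide_distrib mult.commute)
   also have "... < \<delta>" using small by linarith
   finally show "(\<Sum>k<2^n. snd (ab k) - fst (ab k)) < \<delta>" .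
  qed
  finally show "(\<Sum>k<2^n. \<alpha> k * norm (dyadic_increment f n k)) <= \<epsilon>" by simp
 qed
qed

lemma dyadic_coefficient_bounds:
 assumes "A \<in> sets borel"
 shows "0 <= 2 ^ n * measure lborel (A \<inter> dyadic n k)" "2 ^ n * measure lborel (A \<inter> dyadic n k) <= 1"
proof -
 have "measure lborel (A \<inter> dyadic n k) <= measure lborel (dyadic n k)"
  using assms by (intro measure_mono_fmeasurable) (auto simp: fmeasurable_def dyadic_def emeasure_lborel_Ico divide_right_mono)
 then show "2 ^ n * measure lborel (A \<inter> dyadic n k) <= 1" by (simp add: measure_dyadic field_simps)
qed simp

text \<open>Equi-integrability of the dyadic difference quotients: this makes the limit measure countably
  additive.\<close>
lemma dyadic_measure_small:
 fixes f :: "real => 'e::real_normed_vector"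
 assumes f: "ac_on {0..1} f" and e: "\<epsilon> > 0"
 obtains \<delta> where "\<delta> > 0" "!!n A. A \<in> sets borel ==> A \<subseteq> {0..<1} ==> measure lborel A < \<delta> ==>
   (\<Sum>k<2^n. 2 ^ n * measure lborel (A \<inter> dyadic n k) * norm (dyadic_increment f n k)) <= \<epsilon>"
proof -
 obtain \<delta> where \<delta>: "\<delta> > 0" "!!n \<alpha>. (\<forall>k<2^n. 0 <= \<alpha> k \<and> \<alpha> k <= 1) ==> (\<Sum>k<2^n. \<alpha> k) / 2 ^ n < \<delta> ==>
   (\<Sum>k<2^n. \<alpha> k * norm (dyadic_increment f n k)) <= \<epsilon>"
  using ac_dyadic_weights[OF f e] by blast
 show ?thesis
 proof (rule that[OF \<delta>(1)])
  fix n A assume A: "A \<in> sets borel" "A \<subseteq> {0..<1::real}" "measure lborel A < \<delta>"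
  have "(\<Sum>k<2^n. 2 ^ n * measure lborel (A \<inter> dyadic n k)) / 2 ^ n = measure lborel A"
   unfolding measure_unit_dyadic_sum[OF A(1,2), of n] by (simp add: sum_distrib_left[symmetric])
  then show "(\<Sum>k<2^n. 2 ^ n * measure lborel (A \<inter> dyadic n k) * norm (dyadic_increment f n k)) <= \<epsilon>"
   using dyadic_coefficient_bounds[OF A(1)] A(3) by (intro \<delta>(2)) auto
 qed
qed

definition dyadic_union :: "nat => real set => bool" where
 "dyadic_union n B \<longleftrightarrow> B \<in> sets borel \<and> (\<forall>k<2^n. dyadic n k \<subseteq> B \<or> dyadic n k \<inter> B = {})"

lemma dyadic_union_Suc:
 assumes "dyadic_union n B" shows "dyadic_union (Suc n) B"
 unfolding dyadic_union_def
proof (intro conjI allI impI)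
 show "B \<in> sets borel" using assms by (simp add: dyadic_union_def)
 fix k :: nat assume k: "k < 2 ^ Suc n"
 then have l: "k div 2 < 2 ^ n" by auto
 have "k = 2 * (k div 2) \<or> k = Suc (2 * (k div 2))" by presburger
 then have "dyadic (Suc n) k \<subseteq> dyadic n (k div 2)" using dyadic_split[of n "k div 2"] by (metis Un_upper1 Un_upper2)
 then show "dyadic (Suc n) k \<subseteq> B \<or> dyadic (Suc n) k \<inter> B = {}"
  using assms l unfolding dyadic_union_def by blast
qed

lemma dyadic_measure_union_Suc:
 assumes B: "dyadic_union n B"
 shows "dyadic_measure f (Suc n) B = dyadic_measure f n B"
proof -
 have coef: "2 ^ m * measure lborel (B \<inter> dyadic m k) = (if dyadic m k \<subseteq> B then 1 else 0)"
  if "dyadic m k \<subseteq> B \<or> dyadic m k \<inter> B = {}" for m k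
 proof (cases "dyadic m k \<subseteq> B")
  case True
  then have "B \<inter> dyadic m k = dyadic m k" by auto
  then show ?thesis using True by (simp add: measure_dyadic)
 next
  case False
  then have "B \<inter> dyadic m k = {}" using that by auto
  then show ?thesis using False by simp
 qed
 have ne: "real k / 2 ^ m \<in> dyadic m k" for m k by (simp add: dyadic_def divide_strict_right_mono)
 have "dyadic_measure f (Suc n) B = (\<Sum>k<2 * 2^n. (2 ^ Suc n * measure lborel (B \<inter> dyadic (Suc n) k)) *\<^sub>R dyadic_increment f (Suc n) k)"
  by (simp add: dyadic_measure_def)
 also have "... = (\<Sum>k<2^n. (2 ^ Suc n * measure lborel (B \<inter> dyadic (Suc n) (2 * k))) *\<^sub>R dyadic_increment f (Suc n) (2 * k) +
   (2 ^ Suc n * measure lborel (B \<inter> dyadic (Suc n) (Suc (2 * k)))) *\<^sub>R dyadic_increment f (Suc n) (Suc (2 * k)))"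
  by (rule sum_lessThan_double)
 also have "... = (\<Sum>k<2^n. (2 ^ n * measure lborel (B \<inter> dyadic n k)) *\<^sub>R dyadic_increment f n k)"
 proof (rule sum.cong[OF refl])
  fix k assume "k \<in> {..<2^n::nat}"
  then have k: "k < 2^n" by simp
  have d: "dyadic n k \<subseteq> B \<or> dyadic n k \<inter> B = {}" using B k by (simp add: dyadic_union_def)
  have s: "dyadic (Suc n) (2 * k) \<subseteq> dyadic n k" "dyadic (Suc n) (Suc (2 * k)) \<subseteq> dyadic n k"
   using dyadic_split[of n k] by auto
  have d1: "dyadic (Suc n) (2 * k) \<subseteq> B \<or> dyadic (Suc n) (2 * k) \<inter> B = {}" and
   d2: "dyadic (Suc n) (Suc (2 * k)) \<subseteq> B \<or> dyadic (Suc n) (Suc (2 * k)) \<inter> B = {}"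
   using d s by blast+
  have e: "dyadic (Suc n) (2 * k) \<subseteq> B \<longleftrightarrow> dyadic n k \<subseteq> B" "dyadic (Suc n) (Suc (2 * k)) \<subseteq> B \<longleftrightarrow> dyadic n k \<subseteq> B"
   using d s ne[of "2 * k" "Suc n"] ne[of "Suc (2 * k)" "Suc n"] by blast+
  show "(2 ^ Suc n * measure lborel (B \<inter> dyadic (Suc n) (2 * k))) *\<^sub>R dyadic_increment f (Suc n) (2 * k) +
   (2 ^ Suc n * measure lborel (B \<inter> dyadic (Suc n) (Suc (2 * k)))) *\<^sub>R dyadic_increment f (Suc n) (Suc (2 * k))
   = (2 ^ n * measure lborel (B \<inter> dyadic n k)) *\<^sub>R dyadic_increment f n k"
   unfolding coef[OF d] coef[OF d1] coef[OF d2] e by (simp add: dyadic_increment_split[of f n k])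
 qed
 also have "... = dyadic_measure f n B" by (simp add: dyadic_measure_def)
 finally show ?thesis .
qed

lemma dyadic_measure_union_eventually:
 assumes "dyadic_union n B" "m >= n"
 shows "dyadic_union m B" "dyadic_measure f m B = dyadic_measure f n B"
 using assms(2,1) by (induction m rule: dec_induct) (auto simp: dyadic_measure_union_Suc dyadic_union_Suc)

lemma measure_bounded_fmeasurable: "A \<in> sets borel ==> A \<subseteq> {0..<1::real} ==> A \<in> fmeasurable lborel"
 by (rule fmeasurableI2[of "{0..1}"]) (auto simp: fmeasurable_def)

lemma dyadic_union_approx:
 assumes A: "A \<in> sets borel" "A \<subseteq> {0..<1::real}" and d: "\<delta> > 0"
 shows "\<exists>n B. dyadic_union n B \<and> B \<subseteq> {0..<1} \<and> measure lborel (A - B) < \<delta> \<and> measure lborel (B - A) < \<delta>"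
proof -
 define M where "M = density lborel (indicator {0..<1::real})"
 have eM: "emeasure M S = emeasure lborel (S \<inter> {0..<1})" if "S \<in> sets borel" for S
  unfolding M_def using that by (subst emeasure_density) (auto simp: indicator_inter_arith[symmetric] Int_commute)
 have mM: "measure M S = measure lborel (S \<inter> {0..<1})" if "S \<in> sets borel" for S
  using eM[OF that] by (simp add: measure_def)
 have fM: "finite_measure M" by (rule finite_measureI) (use eM[of UNIV] in \<open>simp add: M_def\<close>)
 have sM: "sets M = sets borel" by (simp add: M_def)
 interpret finite_measure M by (rule fM)
 obtain C U where CU: "closed C" "open U" "C \<subseteq> A" "A \<subseteq> U" "measure M (U - C) < \<delta>"
  using finite_borel_regular[OF fM sM A(1) d] by auto
 have Cb[measurable]: "C \<in> sets borel" using CU by auto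
 have "measure M (A - C) <= measure M (U - C)" using CU A sM by (intro finite_measure_mono) auto
 then have AC: "measure lborel (A - C) < \<delta>"
  using CU(5) mM[of "A - C"] A Cb by (simp add: Int_absorb2 Diff_subset order_trans[OF Diff_subset])
 define S where "S = (%n. {k. k < 2^n \<and> C \<inter> dyadic n k ~= {}})"
 define B where "B = (%n. \<Union>k\<in>S n. dyadic n k)"
 have Bb[measurable]: "B n \<in> sets borel" for n unfolding B_def S_def by (intro sets.finite_UN) auto
 have B01: "B n \<subseteq> {0..<1}" for n unfolding B_def S_def using dyadic_subset_unit by blast
 have Bu: "dyadic_union n (B n)" for n
  unfolding dyadic_union_def
 proof (intro conjI allI impI)
  fix k :: nat assume "k < 2^n"
  show "dyadic n k \<subseteq> B n \<or> dyadic n k \<inter> B n = {}"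
  proof (cases "k \<in> S n")
   case False
   then have "dyadic n k \<inter> dyadic n l = {}" if "l \<in> S n" for l using that dyadic_disjoint by metis
   then show ?thesis unfolding B_def by blast
  qed (auto simp: B_def)
 qed simp
 have CB: "C \<subseteq> B n" for n
 proof
  fix x assume x: "x \<in> C"
  then have "x \<in> {0..<1}" using CU(3) A(2) by auto
  then obtain k where "k < 2^n" "x \<in> dyadic n k" by (rule dyadic_cover_unit)
  then show "x \<in> B n" using x unfolding B_def S_def by blast
 qed
 have "decseq B"
 proof (rule decseq_SucI)
  fix n show "B (Suc n) \<subseteq> B n"
  proof
   fix x assume "x \<in> B (Suc n)"
   then obtain k where k: "k < 2 ^ Suc n" "C \<inter> dyadic (Suc n) k ~= {}" "x \<in> dyadic (Suc n) k" unfolding B_def S_def by auto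
   have "k = 2 * (k div 2) \<or> k = Suc (2 * (k div 2))" by presburger
   then have "dyadic (Suc n) k \<subseteq> dyadic n (k div 2)" using dyadic_split[of n "k div 2"] by (metis Un_upper1 Un_upper2)
   moreover have "k div 2 < 2 ^ n" using k(1) by auto
   ultimately show "x \<in> B n" using k unfolding B_def S_def by blast
  qed
 qed
 then have dec: "decseq (%n. B n - C)" unfolding decseq_def by blast
 have int: "(\<Inter>n. B n - C) = {}"
 proof safe
  fix x assume x: "x \<in> (\<Inter>n. B n - C)"
  have "x \<in> closure C"
   unfolding closure_approachable
  proof (intro allI impI)
   fix e :: real assume "e > 0"
   then obtain n where n: "(1/2) ^ n < e" using real_arch_pow_inv[of e "1/2"] by auto
   have "x \<in> B n" using x by blast
   then obtain k where k: "C \<inter> dyadic n k ~= {}" "x \<in> dyadic n k" unfolding B_def S_def by auto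
   then obtain y where y: "y \<in> C" "y \<in> dyadic n k" by auto
   have "real (Suc k) / 2 ^ n = real k / 2 ^ n + (1/2) ^ n" by (simp add: field_simps power_divide)
   then have "dist y x < (1/2) ^ n" using y(2) k(2) unfolding dyadic_def dist_real_def by auto
   then show "\<exists>y\<in>C. dist y x < e" using y n by (intro bexI[of _ y]) auto
  qed
  then show "x \<in> {}" using x CU(1) by auto
 qed
 have "(%n. measure M (B n - C)) \<longlonglongrightarrow> measure M (\<Inter>n. B n - C)"
 proof (rule finite_Lim_measure_decseq[OF _ dec])
  have "B n - C \<in> sets M" for n unfolding sM by measurable
  then show "range (%n. B n - C) \<subseteq> sets M" by blast
 qed
 then have "(%n. measure M (B n - C)) \<longlonglongrightarrow> 0" unfolding int by simp
 then obtain n where n: "measure M (B n - C) < \<delta>" using d by (rule tendsto_zero_obtain_less)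
 have BC: "measure lborel (B n - C) < \<delta>"
  using n mM[of "B n - C"] B01[of n] by (simp add: Int_absorb2 order_trans[OF Diff_subset])
 have "measure lborel (A - B n) <= measure lborel (A - C)"
  using CB[of n] A by (intro measure_mono_fmeasurable measure_bounded_fmeasurable) auto
 moreover have "measure lborel (B n - A) <= measure lborel (B n - C)"
  using CU(3) A B01[of n] by (intro measure_mono_fmeasurable measure_bounded_fmeasurable) auto
 ultimately show ?thesis using AC BC Bu B01 by (meson le_less_trans)
qed

lemma dyadic_measure_diff_le:
 fixes f :: "real => 'e::real_normed_vector"
 assumes A: "A \<in> sets borel" "A \<subseteq> {0..<1}" and B: "B \<in> sets borel" "B \<subseteq> {0..<1}"
  and s1: "(\<Sum>k<2^n. 2 ^ n * measure lborel ((A - B) \<inter> dyadic n k) * norm (dyadic_increment f n k)) <= \<epsilon>"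
  and s2: "(\<Sum>k<2^n. 2 ^ n * measure lborel ((B - A) \<inter> dyadic n k) * norm (dyadic_increment f n k)) <= \<epsilon>"
 shows "norm (dyadic_measure f n A - dyadic_measure f n B) <= 2 * \<epsilon>"
proof -
 have m: "\<bar>measure lborel (A \<inter> D) - measure lborel (B \<inter> D)\<bar> <= measure lborel ((A - B) \<inter> D) + measure lborel ((B - A) \<inter> D)"
  if D: "D \<in> sets borel" for D
 proof -
  have aux: "measure lborel (A \<inter> D) <= measure lborel (B \<inter> D) + measure lborel ((A - B) \<inter> D)"
   if "A \<in> sets borel" "A \<subseteq> {0..<1}" "B \<in> sets borel" "B \<subseteq> {0..<1}" for A B
  proof -
   have "measure lborel (A \<inter> D) <= measure lborel ((B \<inter> D) \<union> ((A - B) \<inter> D))"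
    using that D by (intro measure_mono_fmeasurable measure_bounded_fmeasurable) auto
   also have "... <= measure lborel (B \<inter> D) + measure lborel ((A - B) \<inter> D)"
    using that D by (intro measure_Un_le) auto
   finally show ?thesis .
  qed
  show ?thesis using aux[OF A B] aux[OF B A] measure_nonneg[of lborel "(A - B) \<inter> D"] measure_nonneg[of lborel "(B - A) \<inter> D"] by linarith
 qed
 have "norm (dyadic_measure f n A - dyadic_measure f n B) =
  norm (\<Sum>k<2^n. (2 ^ n * (measure lborel (A \<inter> dyadic n k) - measure lborel (B \<inter> dyadic n k))) *\<^sub>R dyadic_increment f n k)"
  unfolding dyadic_measure_def sum_subtractf[symmetric] by (simp add: algebra_simps)
 also have "... <= (\<Sum>k<2^n. norm ((2 ^ n * (measure lborel (A \<inter> dyadic n k) - measure lborel (B \<inter> dyadic n k))) *\<^sub>R dyadic_increment f n k))"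
  by (rule norm_sum)
 also have "... <= (\<Sum>k<2^n. 2 ^ n * measure lborel ((A - B) \<inter> dyadic n k) * norm (dyadic_increment f n k) +
    2 ^ n * measure lborel ((B - A) \<inter> dyadic n k) * norm (dyadic_increment f n k))"
 proof (rule sum_mono)
  fix k
  have "norm ((2 ^ n * (measure lborel (A \<inter> dyadic n k) - measure lborel (B \<inter> dyadic n k))) *\<^sub>R dyadic_increment f n k)
   = 2 ^ n * \<bar>measure lborel (A \<inter> dyadic n k) - measure lborel (B \<inter> dyadic n k)\<bar> * norm (dyadic_increment f n k)"
   by (simp add: abs_mult)
  also have "... <= 2 ^ n * (measure lborel ((A - B) \<inter> dyadic n k) + measure lborel ((B - A) \<inter> dyadic n k)) * norm (dyadic_increment f n k)"
   by (intro mult_right_mono mult_left_mono m) auto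
  finally show "norm ((2 ^ n * (measure lborel (A \<inter> dyadic n k) - measure lborel (B \<inter> dyadic n k))) *\<^sub>R dyadic_increment f n k)
    <= 2 ^ n * measure lborel ((A - B) \<inter> dyadic n k) * norm (dyadic_increment f n k) +
    2 ^ n * measure lborel ((B - A) \<inter> dyadic n k) * norm (dyadic_increment f n k)"
   by (simp add: algebra_simps)
 qed
 also have "... <= 2 * \<epsilon>" using s1 s2 by (simp add: sum.distrib)
 finally show ?thesis .
qed

text \<open>On finite unions of dyadic intervals the sequence is eventually constant, and by
  equi-integrability such sets approximate all Borel sets uniformly in \<open>n\<close>.\<close>
lemma dyadic_measure_convergent:
 fixes f :: "real => 'e::banach"
 assumes f: "ac_on {0..1} f" and A: "A \<in> sets borel" "A \<subseteq> {0..<1}"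
 shows "convergent (%n. dyadic_measure f n A)"
proof (rule Cauchy_convergent, rule metric_CauchyI)
 fix e :: real assume e: "e > 0"
 obtain \<delta> where \<delta>: "\<delta> > 0" "!!n A. A \<in> sets borel ==> A \<subseteq> {0..<1} ==> measure lborel A < \<delta> ==>
   (\<Sum>k<2^n. 2 ^ n * measure lborel (A \<inter> dyadic n k) * norm (dyadic_increment f n k)) <= e / 8"
  by (rule dyadic_measure_small[OF f, of "e/8"]) (use e in auto)
 obtain N B where B: "dyadic_union N B" "B \<subseteq> {0..<1}" "measure lborel (A - B) < \<delta>" "measure lborel (B - A) < \<delta>"
  using dyadic_union_approx[OF A \<delta>(1)] by blast
 have Bb: "B \<in> sets borel" using B(1) by (simp add: dyadic_union_def)
 have "norm (dyadic_measure f n A - dyadic_measure f N B) <= 2 * (e / 8)" if "n >= N" for n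
 proof -
  have "norm (dyadic_measure f n A - dyadic_measure f n B) <= 2 * (e / 8)"
   by (rule dyadic_measure_diff_le[OF A Bb B(2)]; rule \<delta>(2)) (use A Bb B in auto)
  then show ?thesis using dyadic_measure_union_eventually(2)[OF B(1) that, of f] by simp
 qed
 then have "dist (dyadic_measure f m A) (dyadic_measure f n A) < e" if "m >= N" "n >= N" for m n
 proof -
  have "dist (dyadic_measure f m A) (dyadic_measure f n A) <= norm (dyadic_measure f m A - dyadic_measure f N B) + norm (dyadic_measure f n A - dyadic_measure f N B)"
   unfolding dist_norm[symmetric] by (rule dist_triangle2)
  also have "... <= e / 2" using \<open>!!n. n >= N ==> _\<close>[OF that(1)] \<open>!!n. n >= N ==> _\<close>[OF that(2)] by simp
  also have "... < e" using e by simp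
  finally show ?thesis .
 qed
 then show "\<exists>M. \<forall>m\<ge>M. \<forall>n\<ge>M. dist (dyadic_measure f m A) (dyadic_measure f n A) < e" by blast
qed

section \<open>The derivative measure of an absolutely continuous map\<close>

text \<open>The derivative measure of \<open>f\<close>, with \<open>dyadic_limit f {p..<q} = f q - f
  p\<close>.\<close>
definition dyadic_limit :: "(real => 'e::banach) => real set => 'e" where
 "dyadic_limit f A = lim (%n. dyadic_measure f n A)"

abbreviation lborel01 :: "real measure" where "lborel01 \<equiv> restrict_space lborel {0..<1}"

lemma sets_lborel01: "A \<in> sets lborel01 \<longleftrightarrow> A \<in> sets borel \<and> A \<subseteq> {0..<1}"
 by (subst sets_restrict_space_iff) auto

lemma emeasure_lborel01: "A \<subseteq> {0..<1} ==> emeasure lborel01 A = emeasure lborel A"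
 by (rule emeasure_restrict_space) auto

lemma finite_lborel01: "finite_measure lborel01"
 by (rule finite_measureI) (simp add: emeasure_lborel01 space_restrict_space)

lemma emeasure_bounded_finite:
 assumes "A \<in> sets borel" "A \<subseteq> {0..<1::real}" shows "emeasure lborel A ~= \<infinity>"
 using measure_bounded_fmeasurable[OF assms] by (auto simp: fmeasurable_def)

lemma dyadic_limit_tendsto:
 assumes "ac_on {0..1} f" "A \<in> sets borel" "A \<subseteq> {0..<1}"
 shows "(%n. dyadic_measure f n A) \<longlonglongrightarrow> dyadic_limit f A"
 unfolding dyadic_limit_def using dyadic_measure_convergent[OF assms] by (simp add: convergent_LIMSEQ_iff)

lemma dyadic_limit_Un:
 assumes f: "ac_on {0..1} f" and A: "A \<in> sets borel" "A \<subseteq> {0..<1}" and B: "B \<in> sets borel" "B \<subseteq> {0..<1}" "A \<inter> B = {}"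
 shows "dyadic_limit f (A \<union> B) = dyadic_limit f A + dyadic_limit f B"
proof -
 have "measure lborel ((A \<union> B) \<inter> D) = measure lborel (A \<inter> D) + measure lborel (B \<inter> D)" if "D \<in> sets borel" for D
 proof -
  have "(A \<union> B) \<inter> D = (A \<inter> D) \<union> (B \<inter> D)" by auto
  also have "measure lborel ... = measure lborel (A \<inter> D) + measure lborel (B \<inter> D)"
  proof (rule measure_Union)
   show "emeasure lborel (A \<inter> D) ~= \<infinity>" "emeasure lborel (B \<inter> D) ~= \<infinity>"
    using A B that by (intro emeasure_bounded_finite; auto)+
  qed (use A B that in auto)
  finally show ?thesis .
 qed
 then have eq: "dyadic_measure f n (A \<union> B) = dyadic_measure f n A + dyadic_measure f n B" for n
  unfolding dyadic_measure_def sum.distrib[symmetric] by (simp add: algebra_simps)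
 have "(%n. dyadic_measure f n (A \<union> B)) \<longlonglongrightarrow> dyadic_limit f A + dyadic_limit f B"
  unfolding eq by (intro tendsto_add dyadic_limit_tendsto f A B)
 moreover have "(%n. dyadic_measure f n (A \<union> B)) \<longlonglongrightarrow> dyadic_limit f (A \<union> B)"
  using A B by (intro dyadic_limit_tendsto f) auto
 ultimately show ?thesis using LIMSEQ_unique by blast
qed

lemma norm_dyadic_measure_le:
 "norm (dyadic_measure f n A) <= (\<Sum>k<2^n. 2 ^ n * measure lborel (A \<inter> dyadic n k) * norm (dyadic_increment f n k))"
 unfolding dyadic_measure_def by (rule order_trans[OF norm_sum]) simp

lemma dyadic_limit_small:
 assumes f: "ac_on {0..1} f" and e: "\<epsilon> > 0"
 obtains \<delta> where "\<delta> > 0" "!!A. A \<in> sets borel ==> A \<subseteq> {0..<1} ==> measure lborel A < \<delta> ==> norm (dyadic_limit f A) <= \<epsilon>"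
proof -
 obtain \<delta> where \<delta>: "\<delta> > 0" "!!n A. A \<in> sets borel ==> A \<subseteq> {0..<1} ==> measure lborel A < \<delta> ==>
   (\<Sum>k<2^n. 2 ^ n * measure lborel (A \<inter> dyadic n k) * norm (dyadic_increment f n k)) <= \<epsilon>"
  by (rule dyadic_measure_small[OF f e]) blast
 show ?thesis
 proof (rule that[OF \<delta>(1)])
  fix A assume A: "A \<in> sets borel" "A \<subseteq> {0..<1::real}" "measure lborel A < \<delta>"
  show "norm (dyadic_limit f A) <= \<epsilon>"
   by (rule LIMSEQ_le_const2[OF tendsto_norm[OF dyadic_limit_tendsto[OF f A(1,2)]]])
    (use order_trans[OF norm_dyadic_measure_le \<delta>(2)[OF A]] in blast)
 qed
qed

lemma dyadic_limit_vector_measure: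
 assumes f: "ac_on {0..1} f"
 shows "vector_measure lborel01 (dyadic_limit f)"
 unfolding vector_measure_def
proof (intro allI impI)
 fix A :: "nat => real set" assume r: "range A \<subseteq> sets lborel01" and d: "disjoint_family A"
 have "A i \<in> sets lborel01" for i using r by blast
 then have A: "A i \<in> sets borel" "A i \<subseteq> {0..<1}" for i unfolding sets_lborel01 by blast+
 define R where "R = (%n. (\<Union>i. A i) - (\<Union>i<n. A i))"
 have R: "R n \<in> sets borel" "R n \<subseteq> {0..<1}" for n using A unfolding R_def by (auto intro!: sets.Diff sets.countable_UN)
 have Us: "(\<Union>i<n. A i) \<in> sets borel" "(\<Union>i<n. A i) \<subseteq> {0..<1}" for n using A by (auto intro!: sets.finite_UN)
 have empty: "dyadic_limit f {} = 0" using dyadic_limit_Un[OF f, of "{}" "{}"] by simp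
 have fin: "(\<Sum>i<n. dyadic_limit f (A i)) = dyadic_limit f (\<Union>i<n. A i)" for n
 proof (induction n)
  case 0 then show ?case by (simp add: empty)
 next
  case (Suc n)
  have "A i \<inter> A n = {}" if "i < n" for i using d that by (simp add: disjoint_family_on_def)
  then have "(\<Union>i<n. A i) \<inter> A n = {}" by auto
  moreover have "(\<Union>i<Suc n. A i) = (\<Union>i<n. A i) \<union> A n" by (auto simp: lessThan_Suc)
  ultimately show ?case using dyadic_limit_Un[OF f Us(1,2)[of n] A(1,2)[of n]] Suc by simp
 qed
 have split: "dyadic_limit f (\<Union>i. A i) = dyadic_limit f (\<Union>i<n. A i) + dyadic_limit f (R n)" for n
 proof -
  have e: "(\<Union>i. A i) = (\<Union>i<n. A i) \<union> R n" by (auto simp: R_def)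
  have "(\<Union>i<n. A i) \<inter> R n = {}" by (auto simp: R_def)
  from dyadic_limit_Un[OF f Us(1,2)[of n] R(1,2)[of n] this] show ?thesis unfolding e .
 qed
 interpret finite_measure lborel01 by (rule finite_lborel01)
 have mR: "measure lborel01 (R n) = measure lborel (R n)" for n
  using emeasure_lborel01[OF R(2)] by (simp add: measure_def)
 have "(%n. measure lborel01 (R n)) \<longlonglongrightarrow> measure lborel01 (\<Inter>n. R n)"
 proof (rule finite_Lim_measure_decseq)
  show "range R \<subseteq> sets lborel01" using R by (auto simp: sets_lborel01)
  show "decseq R" unfolding decseq_def R_def by (auto simp: less_le_trans)
 qed
 moreover have "(\<Inter>n. R n) = {}" by (auto simp: R_def)
 ultimately have lim: "(%n. measure lborel (R n)) \<longlonglongrightarrow> 0" unfolding mR by simp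
 show "(%i. dyadic_limit f (A i)) sums dyadic_limit f (\<Union>i. A i)"
  unfolding sums_def fin
 proof (rule LIMSEQ_I)
  fix e :: real assume e: "e > 0"
  obtain \<delta> where \<delta>: "\<delta> > 0" "!!A. A \<in> sets borel ==> A \<subseteq> {0..<1} ==> measure lborel A < \<delta> ==> norm (dyadic_limit f A) <= e/2"
   using dyadic_limit_small[OF f half_gt_zero[OF e]] by blast
  obtain N where N: "!!n. n >= N ==> measure lborel (R n) < \<delta>"
   using order_tendstoD(2)[OF lim \<delta>(1)] by (auto simp: eventually_sequentially)
  have "norm (dyadic_limit f (\<Union>i<n. A i) - dyadic_limit f (\<Union>i. A i)) < e" if "n >= N" for n
   using \<delta>(2)[OF R N[OF that]] e split[of n] by simp
  then show "\<exists>no. \<forall>n\<ge>no. norm (dyadic_limit f (\<Union>i<n. A i) - dyadic_limit f (\<Union>i. A i)) < e" by blast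
 qed
qed

lemma ac_dyadic_variation_bounded:
 fixes f :: "real => 'e::real_normed_vector"
 assumes f: "ac_on {0..1} f"
 obtains C where "!!n. (\<Sum>k<2^n. norm (dyadic_increment f n k)) <= C"
proof -
 obtain \<delta> where \<delta>: "\<delta> > 0" "!!n A. A \<in> sets borel ==> A \<subseteq> {0..<1} ==> measure lborel A < \<delta> ==>
   (\<Sum>k<2^n. 2 ^ n * measure lborel (A \<inter> dyadic n k) * norm (dyadic_increment f n k)) <= 1"
  by (rule dyadic_measure_small[OF f, of 1]) auto
 obtain M where M: "(1/2) ^ M < \<delta>" using real_arch_pow_inv[OF \<delta>(1), of "1/2"] by auto
 have "(\<Sum>k<2^n. norm (dyadic_increment f n k)) <= 2 ^ M" for n
 proof -
  have one: "(\<Sum>j<2^M. 2 ^ n * measure lborel (dyadic M j \<inter> dyadic n k)) = 1" if "k < 2^n" for k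
   using measure_unit_dyadic_sum[OF dyadic_borel dyadic_subset_unit[OF that], of M, symmetric]
   by (simp add: sum_distrib_left[symmetric] measure_dyadic Int_commute)
  have "(\<Sum>k<2^n. norm (dyadic_increment f n k)) = (\<Sum>k<2^n. (\<Sum>j<2^M. 2 ^ n * measure lborel (dyadic M j \<inter> dyadic n k)) * norm (dyadic_increment f n k))"
   using one by simp
  also have "... = (\<Sum>j<2^M. \<Sum>k<2^n. 2 ^ n * measure lborel (dyadic M j \<inter> dyadic n k) * norm (dyadic_increment f n k))"
   unfolding sum_distrib_right by (rule sum.swap)
  also have "... <= (\<Sum>j<2^M::nat. 1)"
   using M by (intro sum_mono \<delta>(2) dyadic_subset_unit) (auto simp: measure_dyadic power_divide)
  finally show ?thesis by simp
 qed
 then show ?thesis by (rule that)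
qed

lemma dyadic_limit_finite_variation:
 assumes f: "ac_on {0..1} f"
 shows "finite_variation lborel01 (dyadic_limit f)"
proof -
 obtain C where C: "!!n. (\<Sum>k<2^n. norm (dyadic_increment f n k)) <= C"
  using ac_dyadic_variation_bounded[OF f] by blast
 show ?thesis
  unfolding finite_variation_def
 proof (intro exI[of _ C] allI impI)
  fix P assume P: "finite P" "P \<subseteq> sets lborel01" "disjoint P"
  have A: "A \<in> sets borel" "A \<subseteq> {0..<1}" if "A \<in> P" for A using subsetD[OF P(2) that] unfolding sets_lborel01 by blast+
  have le: "(\<Sum>A\<in>P. norm (dyadic_measure f n A)) <= C" for n
  proof -
   have one: "(\<Sum>A\<in>P. 2 ^ n * measure lborel (A \<inter> dyadic n k)) <= 1" if k: "k < 2^n" for k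
   proof -
    have "(\<Sum>A\<in>P. measure lborel (A \<inter> dyadic n k)) = measure lborel (\<Union>A\<in>P. A \<inter> dyadic n k)"
    proof (rule measure_finite_Union[symmetric])
    show "disjoint_family_on (%A. A \<inter> dyadic n k) P"
    using P(3) unfolding disjoint_family_on_def disjoint_def by blast
    show "emeasure lborel (A \<inter> dyadic n k) ~= \<infinity>" if "A \<in> P" for A
    using A[OF that] by (intro emeasure_bounded_finite) auto
    qed (use P A in auto)
    also have "... <= measure lborel (dyadic n k)"
    proof (rule measure_mono_fmeasurable)
    show "(\<Union>A\<in>P. A \<inter> dyadic n k) \<in> sets lborel" using A P(1) by (intro sets.finite_UN) auto
    qed (use dyadic_subset_unit[OF k] in \<open>auto intro: measure_bounded_fmeasurable\<close>)
    finally show ?thesis by (simp add: measure_dyadic sum_distrib_left[symmetric] field_simps)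
   qed
   have "(\<Sum>A\<in>P. norm (dyadic_measure f n A)) <= (\<Sum>A\<in>P. \<Sum>k<2^n. 2 ^ n * measure lborel (A \<inter> dyadic n k) * norm (dyadic_increment f n k))"
    by (intro sum_mono norm_dyadic_measure_le)
   also have "... = (\<Sum>k<2^n. \<Sum>A\<in>P. 2 ^ n * measure lborel (A \<inter> dyadic n k) * norm (dyadic_increment f n k))"
    by (rule sum.swap)
   also have "... = (\<Sum>k<2^n. (\<Sum>A\<in>P. 2 ^ n * measure lborel (A \<inter> dyadic n k)) * norm (dyadic_increment f n k))"
    by (simp add: sum_distrib_right)
   also have "... <= (\<Sum>k<2^n. 1 * norm (dyadic_increment f n k))"
    using one by (intro sum_mono mult_right_mono) auto
   also have "... <= C" using C[of n] by simp
   finally show ?thesis .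
  qed
  have "(%n. \<Sum>A\<in>P. norm (dyadic_measure f n A)) \<longlonglongrightarrow> (\<Sum>A\<in>P. norm (dyadic_limit f A))"
   by (intro tendsto_sum tendsto_norm dyadic_limit_tendsto[OF f] A)
  then show "(\<Sum>A\<in>P. norm (dyadic_limit f A)) <= C"
   by (rule LIMSEQ_le_const2) (use le in blast)
 qed
qed

lemma dyadic_limit_density:
 fixes f :: "real => 'e::banach"
 assumes rnp: "radon_nikodym_property TYPE('e)" and f: "ac_on {0..1} f"
 obtains g where "!!A. A \<in> sets lborel01 ==> has_strong_integral lborel01 (%w. indicat_real A w *\<^sub>R g w) (dyadic_limit f A)"
proof -
 have null: "dyadic_limit f A = 0" if "A \<in> null_sets lborel01" for A
 proof -
  have A: "A \<in> sets borel" "A \<subseteq> {0..<1}" using that by (auto simp: null_sets_def sets_lborel01)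
  have "emeasure lborel A = 0" using that emeasure_lborel01[OF A(2)] by (simp add: null_sets_def)
  then have "emeasure lborel (A \<inter> dyadic n k) = 0" for n k
   using A emeasure_mono[of "A \<inter> dyadic n k" A lborel] by simp
  then have "dyadic_measure f n A = 0" for n by (simp add: dyadic_measure_def measure_def)
  then show ?thesis using dyadic_limit_tendsto[OF f A] by (simp add: LIMSEQ_const_iff)
 qed
 show ?thesis
  using rnp[unfolded radon_nikodym_property_def, rule_format, OF finite_lborel01 dyadic_limit_vector_measure[OF f] dyadic_limit_finite_variation[OF f]] null that by blast
qed

lemma dyadic_limit_initial_interval:
 assumes f: "ac_on {0..1} f" and cont: "continuous_on {0..1} f" and q: "0 <= q" "q < 1"
 shows "dyadic_limit f {0..<q} = f q - f 0"
proof -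
 define K where "K = (%n::nat. nat \<lfloor>2 ^ n * q\<rfloor>)"
 have K: "real (K n) <= 2 ^ n * q" "2 ^ n * q < real (Suc (K n))" for n
  using q unfolding K_def by (auto simp: of_nat_nat) linarith+
 have Kn: "K n < 2 ^ n" for n
 proof -
  have "2 ^ n * q < 2 ^ n * 1" by (rule mult_strict_left_mono) (use q in auto)
  then have "real (K n) < 2 ^ n" using K(1)[of n] by linarith
  then show ?thesis by (metis of_nat_less_iff of_nat_numeral of_nat_power)
 qed
 have KS: "real (Suc (K n)) <= 2 ^ n" for n using Kn[of n] by (metis Suc_leI of_nat_le_iff of_nat_numeral of_nat_power)
 define \<alpha> where "\<alpha> = (%n. 2 ^ n * q - real (K n))"
 have \<alpha>: "0 <= \<alpha> n" "\<alpha> n <= 1" for n using K[of n] by (auto simp: \<alpha>_def)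
 have coef: "2 ^ n * measure lborel ({0..<q} \<inter> dyadic n k) = (if k < K n then 1 else if k = K n then \<alpha> n else 0)" for n k
 proof -
  consider "k < K n" | "k = K n" | "k > K n" by linarith
  then show ?thesis
  proof cases
   case 1
   then have "real (Suc k) <= real (K n)" by simp
   then have "real (Suc k) / 2 ^ n <= q" using K(1)[of n] by (simp add: field_simps)
   then have "{0..<q} \<inter> dyadic n k = dyadic n k" by (auto simp: dyadic_def intro: order_trans[of 0 "real k / 2^n"])
   then show ?thesis using 1 by (simp add: measure_dyadic)
  next
   case 2
   have "real k / 2 ^ n <= q" "q <= real (Suc k) / 2 ^ n" using K[of n] 2 by (auto simp: field_simps)
   then have "{0..<q} \<inter> dyadic n k = {real k / 2 ^ n..<q}" by (auto simp: dyadic_def intro: order_trans[of 0 "real k / 2^n"])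
   then have "measure lborel ({0..<q} \<inter> dyadic n k) = q - real k / 2 ^ n"
    using \<open>real k / 2 ^ n <= q\<close> by simp
   then show ?thesis using 2 by (simp add: \<alpha>_def field_simps)
  next
   case 3
   then have "real (Suc (K n)) <= real k" by simp
   then have "q <= real k / 2 ^ n" using K(2)[of n] by (simp add: field_simps)
   then have "{0..<q} \<inter> dyadic n k = {}" by (auto simp: dyadic_def)
   then show ?thesis using 3 by simp
  qed
 qed
 have tel: "(\<Sum>k<N. dyadic_increment f n k) = f (real N / 2 ^ n) - f 0" for n N
  by (induction N) (auto simp: dyadic_increment_def)
 have eq: "dyadic_measure f n {0..<q} = f (real (K n) / 2 ^ n) - f 0 + \<alpha> n *\<^sub>R (f (real (Suc (K n)) / 2 ^ n) - f (real (K n) / 2 ^ n))" for n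
 proof -
  have "dyadic_measure f n {0..<q} = (\<Sum>k<2^n. (if k < K n then 1 else if k = K n then \<alpha> n else 0) *\<^sub>R dyadic_increment f n k)"
   unfolding dyadic_measure_def coef ..
  also have "... = (\<Sum>k<Suc (K n). (if k < K n then 1 else if k = K n then \<alpha> n else 0) *\<^sub>R dyadic_increment f n k)"
   using Kn[of n] by (intro sum.mono_neutral_right) auto
  also have "... = (\<Sum>k<K n. dyadic_increment f n k) + \<alpha> n *\<^sub>R dyadic_increment f n (K n)"
   by simp
  finally show ?thesis unfolding tel by (simp add: dyadic_increment_def)
 qed
 have half: "(%n. (1/2::real) ^ n) \<longlonglongrightarrow> 0" by (rule LIMSEQ_realpow_zero) auto
 have l1: "(%n. real (K n) / 2 ^ n) \<longlonglongrightarrow> q"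
 proof (rule tendsto_sandwich[of "%n. q - (1/2) ^ n" _ _ "%_. q"])
  show "\<forall>\<^sub>F n in sequentially. q - (1/2) ^ n <= real (K n) / 2 ^ n"
  proof (intro always_eventually allI)
   fix n
   have "q < real (Suc (K n)) / 2 ^ n" using K(2)[of n] by (simp add: field_simps)
   also have "... = real (K n) / 2 ^ n + (1/2) ^ n" by (simp add: power_divide add_divide_distrib)
   finally show "q - (1/2) ^ n <= real (K n) / 2 ^ n" by simp
  qed
  show "\<forall>\<^sub>F n in sequentially. real (K n) / 2 ^ n <= q"
   using K(1) by (intro always_eventually allI) (simp add: field_simps)
  show "(%n. q - (1/2) ^ n) \<longlonglongrightarrow> q" using tendsto_diff[OF tendsto_const half, of q] by simp
 qed simp
 have l2: "(%n. real (Suc (K n)) / 2 ^ n) \<longlonglongrightarrow> q"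
 proof -
  have "(%n. real (K n) / 2 ^ n + (1/2) ^ n) \<longlonglongrightarrow> q" using tendsto_add[OF l1 half] by simp
  then show ?thesis by (simp add: field_simps power_divide)
 qed
 have c1: "(%n. f (real (K n) / 2 ^ n)) \<longlonglongrightarrow> f q"
 proof (rule continuous_on_tendsto_compose[OF cont l1])
  show "q \<in> {0..1}" using q by auto
  show "\<forall>\<^sub>F n in sequentially. real (K n) / 2 ^ n \<in> {0..1}"
   using Kn by (intro always_eventually allI) (auto simp: less_imp_le)
 qed
 have c2: "(%n. f (real (Suc (K n)) / 2 ^ n)) \<longlonglongrightarrow> f q"
 proof (rule continuous_on_tendsto_compose[OF cont l2])
  show "q \<in> {0..1}" using q by auto
  show "\<forall>\<^sub>F n in sequentially. real (Suc (K n)) / 2 ^ n \<in> {0..1}"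
   using KS by (intro always_eventually allI) (auto simp del: of_nat_Suc)
 qed
 have "(%n. \<alpha> n *\<^sub>R (f (real (Suc (K n)) / 2 ^ n) - f (real (K n) / 2 ^ n))) \<longlonglongrightarrow> 0"
 proof (rule Lim_null_comparison)
  show "\<forall>\<^sub>F n in sequentially. norm (\<alpha> n *\<^sub>R (f (real (Suc (K n)) / 2 ^ n) - f (real (K n) / 2 ^ n))) <= norm (f (real (Suc (K n)) / 2 ^ n) - f (real (K n) / 2 ^ n))"
   using \<alpha> by (intro always_eventually allI) (auto intro!: mult_left_le_one_le)
  show "(%n. norm (f (real (Suc (K n)) / 2 ^ n) - f (real (K n) / 2 ^ n))) \<longlonglongrightarrow> 0"
   using tendsto_norm[OF tendsto_diff[OF c2 c1]] by simp
 qed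
 then have "(%n. dyadic_measure f n {0..<q}) \<longlonglongrightarrow> f q - f 0 + 0"
  unfolding eq by (intro tendsto_intros c1)
 moreover have "(%n. dyadic_measure f n {0..<q}) \<longlonglongrightarrow> dyadic_limit f {0..<q}"
  using q by (intro dyadic_limit_tendsto[OF f]) auto
 ultimately show ?thesis using LIMSEQ_unique by fastforce
qed

lemma dyadic_limit_interval:
 assumes f: "ac_on {0..1} f" and cont: "continuous_on {0..1} f" and q: "0 <= p" "p <= q" "q < 1"
 shows "dyadic_limit f {p..<q} = f q - f p"
proof -
 have "{0..<q} = {0..<p} \<union> {p..<q}" using q by auto
 then have "dyadic_limit f {0..<q} = dyadic_limit f {0..<p} + dyadic_limit f {p..<q}"
  using dyadic_limit_Un[OF f, of "{0..<p}" "{p..<q}"] q by auto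
 then show ?thesis
  using dyadic_limit_initial_interval[OF f cont, of q] dyadic_limit_initial_interval[OF f cont, of p] q
  by (simp add: algebra_simps)
qed

lemma norm_diff_simple_measurable:
 fixes G :: "'w => 'e::real_normed_vector"
 assumes G: "G \<in> borel_measurable M" and s: "simple_function M s"
 shows "(%w. norm (G w - s w)) \<in> borel_measurable M"
proof (rule measurable_compose_countable'[where g=s and I="s ` space M" and f="%c w. norm (G w - c)"])
 have "(%x::'e. norm (x - c)) \<in> borel_measurable borel" for c
  by (intro borel_measurable_continuous_onI continuous_intros)
 then show "(%w. norm (G w - c)) \<in> borel_measurable M" for c by (rule measurable_compose[OF G])
 show "s \<in> measurable M (count_space (s ` space M))" using s by (subst measurable_count_space_eq2) (auto simp: simple_function_def)
 show "countable (s ` space M)" using s by (auto simp: simple_function_def intro: countable_finite)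
qed

text \<open>The estimate \<open>norm (\<integral>\<^sub>A (g - c)) \<le> \<integral>\<^sub>A norm (g -
  c)\<close> for an integral with values in a nonseparable space; only the scalar function
  \<open>norm (g - c)\<close> is used afterwards.\<close>
lemma has_strong_integral_norm_diff_le:
 fixes g :: "'w => 'e::real_normed_vector"
 assumes fin: "finite_measure M" and A: "A \<in> sets M"
  and int: "has_strong_integral M (%w. indicat_real A w *\<^sub>R g w) x" and g: "g \<in> borel_measurable M"
 shows "ennreal (norm (x - measure M A *\<^sub>R c)) <= (\<integral>\<^sup>+w. indicator A w * ennreal (norm (g w - c)) \<partial>M)"
proof -
 interpret finite_measure M by fact
 obtain s where s: "!!i::nat. Bochner_Integration.simple_bochner_integrable M (s i)"
  "(%i. \<integral>\<^sup>+w. ennreal (norm (indicat_real A w *\<^sub>R g w - s i w)) \<partial>M) \<longlonglongrightarrow> 0"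
  "(%i. Bochner_Integration.simple_bochner_integral M (s i)) \<longlonglongrightarrow> x" and G: "(%w. indicat_real A w *\<^sub>R g w) \<in> borel_measurable M"
  using int unfolding has_strong_integral_def by auto
 define a where "a = (%w. indicat_real A w *\<^sub>R c)"
 have sfa: "simple_function M a"
  unfolding a_def using A by (intro simple_function_compose1[where g="%r. r *\<^sub>R c"]) (auto intro: simple_function_indicator)
 have a: "Bochner_Integration.simple_bochner_integrable M a"
  by (rule simple_bochner_integrable.intros[OF sfa]) simp
 have ia: "Bochner_Integration.simple_bochner_integral M a = measure M A *\<^sub>R c"
 proof -
  have i: "Bochner_Integration.simple_bochner_integrable M (indicat_real A)"
   by (rule simple_bochner_integrable.intros) (use A in \<open>auto intro: simple_function_indicator\<close>)
  have "Bochner_Integration.simple_bochner_integral M a = (Bochner_Integration.simple_bochner_integral M (indicat_real A)) *\<^sub>R c"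
   unfolding a_def
   by (rule simple_bochner_integral_linear[OF _ i]) (unfold_locales, auto simp: algebra_simps)
  also have "Bochner_Integration.simple_bochner_integral M (indicat_real A) = measure M A"
  proof -
   have "ennreal (Bochner_Integration.simple_bochner_integral M (indicat_real A)) = emeasure M A"
    using A i by (subst simple_bochner_integral_eq_nn_integral) (auto simp: ennreal_indicator)
   then show ?thesis by (metis enn2real_ennreal measure_def simple_bochner_integral_nonneg indicator_pos_le)
  qed
  finally show ?thesis .
 qed
 have "ennreal (norm (Bochner_Integration.simple_bochner_integral M (s i) - measure M A *\<^sub>R c)) \<le>
   (\<integral>\<^sup>+w. ennreal (norm (indicat_real A w *\<^sub>R g w - s i w)) \<partial>M) + (\<integral>\<^sup>+w. indicator A w * ennreal (norm (g w - c)) \<partial>M)" for i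
 proof -
  have d: "Bochner_Integration.simple_bochner_integrable M (%w. s i w - a w)"
   by (rule simple_bochner_integrable_compose2[where p="%x y. x - y", OF _ s(1) a]) simp
  have dn: "Bochner_Integration.simple_bochner_integrable M (%w. norm (s i w - a w))"
   by (rule simple_bochner_integrable_compose2[where p="%x y. norm x", OF _ d d, simplified])
  have sfi: "simple_function M (s i)" using s(1)[of i] by (auto elim: simple_bochner_integrable.cases)
  have m1: "(%w. norm (indicat_real A w *\<^sub>R g w - s i w)) \<in> borel_measurable M"
   by (rule norm_diff_simple_measurable[OF G sfi])
  have m2: "(%w. norm (g w - c)) \<in> borel_measurable M"
   by (rule norm_diff_simple_measurable[OF g]) simp
  have "ennreal (norm (Bochner_Integration.simple_bochner_integral M (s i) - measure M A *\<^sub>R c)) = ennreal (norm (Bochner_Integration.simple_bochner_integral M (%w. s i w - a w)))"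
   using s(1) a by (simp add: simple_bochner_integral_diff ia)
  also have "... <= ennreal (Bochner_Integration.simple_bochner_integral M (%w. norm (s i w - a w)))"
   by (intro ennreal_leI simple_bochner_integral_norm_bound d)
  also have "... = (\<integral>\<^sup>+w. ennreal (norm (s i w - a w)) \<partial>M)"
   by (rule simple_bochner_integral_eq_nn_integral[OF dn]) simp
  also have "... <= (\<integral>\<^sup>+w. ennreal (norm (indicat_real A w *\<^sub>R g w - s i w)) + indicator A w * ennreal (norm (g w - c)) \<partial>M)"
  proof (rule nn_integral_mono)
   fix w
   have "norm (s i w - a w) <= norm (indicat_real A w *\<^sub>R g w - s i w) + norm (indicat_real A w *\<^sub>R g w - a w)"
    using dist_triangle3[of "s i w" "a w" "indicat_real A w *\<^sub>R g w"] by (simp add: dist_norm)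
   also have "norm (indicat_real A w *\<^sub>R g w - a w) = indicator A w * norm (g w - c)"
    by (auto simp: a_def indicator_def)
   finally have "ennreal (norm (s i w - a w)) <= ennreal (norm (indicat_real A w *\<^sub>R g w - s i w) + indicator A w * norm (g w - c))"
    by (rule ennreal_leI)
   then show "ennreal (norm (s i w - a w)) <= ennreal (norm (indicat_real A w *\<^sub>R g w - s i w)) + indicator A w * ennreal (norm (g w - c))"
    by (simp add: ennreal_mult ennreal_indicator)
  qed
  also have "... = (\<integral>\<^sup>+w. ennreal (norm (indicat_real A w *\<^sub>R g w - s i w)) \<partial>M) + (\<integral>\<^sup>+w. indicator A w * ennreal (norm (g w - c)) \<partial>M)"
   using m1 m2 A by (intro nn_integral_add) auto
  finally show ?thesis .
 qed
 note bound = this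
 have L1: "(%i. ennreal (norm (Bochner_Integration.simple_bochner_integral M (s i) - measure M A *\<^sub>R c))) \<longlonglongrightarrow> ennreal (norm (x - measure M A *\<^sub>R c))"
  by (intro tendsto_ennrealI tendsto_intros s(3))
 have L2: "(%i. (\<integral>\<^sup>+w. ennreal (norm (indicat_real A w *\<^sub>R g w - s i w)) \<partial>M) + (\<integral>\<^sup>+w. indicator A w * ennreal (norm (g w - c)) \<partial>M))
   \<longlonglongrightarrow> 0 + (\<integral>\<^sup>+w. indicator A w * ennreal (norm (g w - c)) \<partial>M)"
  by (intro tendsto_add s(2)) auto
 have "ennreal (norm (x - measure M A *\<^sub>R c)) <= 0 + (\<integral>\<^sup>+w. indicator A w * ennreal (norm (g w - c)) \<partial>M)"
  by (rule LIMSEQ_le[OF L1 L2]) (use bound in blast)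
 then show ?thesis by simp
qed

text \<open>The values of the approximating simple functions form a countable set.\<close>
lemma has_strong_integral_range:
 fixes g :: "'w => 'e::real_normed_vector"
 assumes int: "has_strong_integral M g x"
 obtains C where "countable C" "AE w in M. g w \<in> closure C" "(\<integral>\<^sup>+w. ennreal (norm (g w)) \<partial>M) < \<infinity>"
proof -
 obtain s where s: "!!i::nat. Bochner_Integration.simple_bochner_integrable M (s i)"
  "(%i. \<integral>\<^sup>+w. ennreal (norm (g w - s i w)) \<partial>M) \<longlonglongrightarrow> 0" and g: "g \<in> borel_measurable M"
  using int unfolding has_strong_integral_def by auto
 have sf: "simple_function M (s i)" for i using s(1)[of i] by (auto elim: simple_bochner_integrable.cases)
 have m[measurable]: "(%w. norm (g w - s i w)) \<in> borel_measurable M" for i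
  by (rule norm_diff_simple_measurable[OF g sf])
 define C where "C = (\<Union>i. s i ` space M)"
 have C: "countable C" unfolding C_def using sf by (auto simp: simple_function_def intro: countable_finite)
 have "(\<integral>\<^sup>+w. (INF i. ennreal (norm (g w - s i w))) \<partial>M) <= (\<integral>\<^sup>+w. ennreal (norm (g w - s i w)) \<partial>M)" for i
  by (intro nn_integral_mono INF_lower) auto
 then have "(\<integral>\<^sup>+w. (INF i. ennreal (norm (g w - s i w))) \<partial>M) <= 0"
  by (intro LIMSEQ_le_const[OF s(2)]) auto
 then have "AE w in M. (INF i. ennreal (norm (g w - s i w))) = 0"
  by (subst (asm) le_zero_eq, subst (asm) nn_integral_0_iff_AE) auto
 then have "AE w in M. g w \<in> closure C"
 proof (rule AE_mp[OF _ AE_I2], intro impI)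
  fix w assume w: "w \<in> space M" and z: "(INF i. ennreal (norm (g w - s i w))) = 0"
  show "g w \<in> closure C"
   unfolding closure_approachable
  proof (intro allI impI)
   fix e :: real assume "e > 0"
   then have "(INF i. ennreal (norm (g w - s i w))) < ennreal e" using z by simp
   then obtain i where "ennreal (norm (g w - s i w)) < ennreal e" by (auto simp: INF_less_iff)
   then have "dist (s i w) (g w) < e" by (simp add: dist_norm norm_minus_commute ennreal_less_iff)
   then show "\<exists>y\<in>C. dist y (g w) < e" using w unfolding C_def by blast
  qed
 qed
 moreover have "(\<integral>\<^sup>+w. ennreal (norm (g w)) \<partial>M) < \<infinity>"
 proof -
  have "\<forall>\<^sub>F i in sequentially. (\<integral>\<^sup>+w. ennreal (norm (g w - s i w)) \<partial>M) < 1"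
   using s(2) by (rule order_tendstoD) simp
  then obtain i where i: "(\<integral>\<^sup>+w. ennreal (norm (g w - s i w)) \<partial>M) < 1" by (auto simp: eventually_sequentially)
  have sn: "Bochner_Integration.simple_bochner_integrable M (%w. norm (s i w))"
   by (rule simple_bochner_integrable_compose2[where p="%x y. norm x", OF _ s(1) s(1), simplified])
  have "(\<integral>\<^sup>+w. ennreal (norm (g w)) \<partial>M) <= (\<integral>\<^sup>+w. ennreal (norm (g w - s i w)) + ennreal (norm (s i w)) \<partial>M)"
  proof (rule nn_integral_mono)
   fix w
   have "norm (g w) <= norm (g w - s i w) + norm (s i w)" using norm_triangle_sub by (metis add.commute)
   then show "ennreal (norm (g w)) <= ennreal (norm (g w - s i w)) + ennreal (norm (s i w))"
    by (simp flip: ennreal_plus add: ennreal_leI)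
  qed
  also have "... = (\<integral>\<^sup>+w. ennreal (norm (g w - s i w)) \<partial>M) + (\<integral>\<^sup>+w. ennreal (norm (s i w)) \<partial>M)"
  proof (rule nn_integral_add)
   have "simple_function M (%w. norm (s i w))" by (rule simple_function_compose1[OF sf])
   then show "(%w. ennreal (norm (s i w))) \<in> borel_measurable M"
    by (rule measurable_compose[OF borel_measurable_simple_function measurable_ennreal])
  qed auto
  also have "(\<integral>\<^sup>+w. ennreal (norm (s i w)) \<partial>M) = ennreal (Bochner_Integration.simple_bochner_integral M (%w. norm (s i w)))"
   using simple_bochner_integral_eq_nn_integral[OF sn] by simp
  also have "(\<integral>\<^sup>+w. ennreal (norm (g w - s i w)) \<partial>M) + ennreal (Bochner_Integration.simple_bochner_integral M (%w. norm (s i w))) < \<infinity>"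
   using i by (auto simp: less_top[symmetric])
  finally show ?thesis .
 qed
 ultimately show ?thesis using C that by blast
qed

lemma AE_imp_null_set:
 assumes "AE x in M. P x"
 shows "\<exists>N\<in>null_sets M. \<forall>x\<in>space M - N. P x"
proof -
 obtain N where "{x \<in> space M. \<not> P x} \<subseteq> N" "N \<in> null_sets M"
  using assms unfolding eventually_ae_filter by blast
 then show ?thesis by (intro bexI[of _ N]) auto
qed

text \<open>The one-sided differentiation theorem is applied to \<open>u\<close> and to its reflection.\<close>
lemma lebesgue_points_real:
 fixes u :: "real => real"
 assumes u: "integrable lborel u"
 shows "AE t in lborel. \<forall>e>0. \<exists>d>0. \<forall>h. 0 < h \<and> h < d -->
   \<bar>(\<integral>x\<in>{t..t+h}. u x \<partial>lborel) / h - u t\<bar> < e \<and> \<bar>(\<integral>x\<in>{t-h..t}. u x \<partial>lborel) / h - u t\<bar> < e"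
proof -
 have right: "AE t in lborel. \<forall>e>0. \<exists>d>0. \<forall>h. 0 < h \<and> h < d --> \<bar>(\<integral>x\<in>{t..t+h}. v x \<partial>lborel) / h - v t\<bar> < e"
  if v: "integrable lborel v" for v :: "real => real"
 proof -
  have si: "set_integrable lborel {a..b} v" for a b
   using v unfolding set_integrable_def by (rule integrable_mult_indicator[rotated]) simp
  have io: "v integrable_on cbox a b" for a b using set_borel_integral_eq_integral(1)[OF si] by simp
  obtain N where N: "negligible N" "!!x e. x \<notin> N ==> 0 < e ==>
    \<exists>d>0. \<forall>h. 0 < h \<and> h < d --> norm (integral (cbox x (x + h *\<^sub>R One)) v /\<^sub>R h ^ DIM(real) - v x) < e"
   using integrable_ccontinuous_explicit[of v, OF io] by blast
  have eq: "norm (integral (cbox x (x + h *\<^sub>R One)) v /\<^sub>R h ^ DIM(real) - v x) = \<bar>(\<integral>x\<in>{x..x+h}. v x \<partial>lborel) / h - v x\<bar>" for x h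
   using set_borel_integral_eq_integral(2)[OF si] by (simp add: divide_inverse mult.commute)
  note N2 = N(2)[unfolded eq]
  have "AE t in lebesgue. t \<notin> N" using N(1) AE_not_in by (simp add: negligible_iff_null_sets)
  then have "AE t in lborel. t \<notin> N" by (simp add: AE_completion_iff)
  then show ?thesis by eventually_elim (use N2 in blast)
 qed
 have u': "integrable lborel (%x. u (- x))"
  using lborel_integrable_real_affine[OF u, of "-1" 0] by simp
 have refl: "(\<integral>x\<in>{-t..-t+h}. u (- x) \<partial>lborel) = (\<integral>x\<in>{t-h..t}. u x \<partial>lborel)" for t h
 proof -
  have "(\<integral>x. indicator {t-h..t} x *\<^sub>R u x \<partial>lborel) = \<bar>-1\<bar> *\<^sub>R (\<integral>x. indicator {t-h..t} (0 + -1 * x) *\<^sub>R u (0 + -1 * x) \<partial>lborel)"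
   by (rule lborel_integral_real_affine) simp
  also have "... = (\<integral>x. indicator {-t..-t+h} x *\<^sub>R u (- x) \<partial>lborel)"
   by (auto intro!: Bochner_Integration.integral_cong simp: indicator_def)
  finally show ?thesis by (simp add: set_lebesgue_integral_def)
 qed
 have "AE t in lborel. \<forall>e>0. \<exists>d>0. \<forall>h. 0 < h \<and> h < d --> \<bar>(\<integral>x\<in>{t-h..t}. u x \<partial>lborel) / h - u t\<bar> < e"
 proof -
  have 1: "AE t in lborel. \<forall>e>0. \<exists>d>0. \<forall>h. 0 < h \<and> h < d --> \<bar>(\<integral>x\<in>{t..t+h}. u (- x) \<partial>lborel) / h - u (- t)\<bar> < e"
   by (rule right[OF u'])
  obtain N where N: "N \<in> null_sets lborel" and
   N2: "\<forall>t\<in>space lborel - N. \<forall>e>0. \<exists>d>0. \<forall>h. 0 < h \<and> h < d --> \<bar>(\<integral>x\<in>{t..t+h}. u (- x) \<partial>lborel) / h - u (- t)\<bar> < e"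
   using AE_imp_null_set[OF 1] by (rule bexE)
  have "AE t in distr lborel borel uminus. t \<notin> N"
   unfolding lborel_distr_uminus by (rule AE_not_in[OF N])
  then have "AE t in lborel. - t \<notin> N"
   using N by (subst (asm) AE_distr_iff) (auto simp: null_sets_def)
  then show ?thesis
  proof eventually_elim
   fix t assume "- t \<notin> N"
   then have "- t \<in> space lborel - N" by simp
   from bspec[OF N2 this] show "\<forall>e>0. \<exists>d>0. \<forall>h. 0 < h \<and> h < d --> \<bar>(\<integral>x\<in>{t-h..t}. u x \<partial>lborel) / h - u t\<bar> < e"
    unfolding refl by simp
  qed
 qed
 with right[OF u] show ?thesis
 proof eventually_elim
  fix t assume L: "\<forall>e>0. \<exists>d>0. \<forall>h. 0 < h \<and> h < d --> \<bar>(\<integral>x\<in>{t-h..t}. u x \<partial>lborel) / h - u t\<bar> < e"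
   and R: "\<forall>e>0. \<exists>d>0. \<forall>h. 0 < h \<and> h < d --> \<bar>(\<integral>x\<in>{t..t+h}. u x \<partial>lborel) / h - u t\<bar> < e"
  show "\<forall>e>0. \<exists>d>0. \<forall>h. 0 < h \<and> h < d -->
   \<bar>(\<integral>x\<in>{t..t+h}. u x \<partial>lborel) / h - u t\<bar> < e \<and> \<bar>(\<integral>x\<in>{t-h..t}. u x \<partial>lborel) / h - u t\<bar> < e"
  proof (intro allI impI)
   fix e :: real assume "e > 0"
   from L[rule_format, OF this] obtain d1 where d1: "d1 > 0" "\<forall>h. 0 < h \<and> h < d1 --> \<bar>(\<integral>x\<in>{t-h..t}. u x \<partial>lborel) / h - u t\<bar> < e"
    by blast
   from R[rule_format, OF \<open>e > 0\<close>] obtain d2 where d2: "d2 > 0" "\<forall>h. 0 < h \<and> h < d2 --> \<bar>(\<integral>x\<in>{t..t+h}. u x \<partial>lborel) / h - u t\<bar> < e"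
    by blast
   from d1 d2 show "\<exists>d>0. \<forall>h. 0 < h \<and> h < d -->
   \<bar>(\<integral>x\<in>{t..t+h}. u x \<partial>lborel) / h - u t\<bar> < e \<and> \<bar>(\<integral>x\<in>{t-h..t}. u x \<partial>lborel) / h - u t\<bar> < e"
    by (intro exI[of _ "min d1 d2"]) auto
  qed
 qed
qed

section \<open>Differentiability almost everywhere\<close>

text \<open>Let \<open>g\<close> be the Radon-Nikodym density of the derivative measure. For
  \<open>c\<close> in a countable set that is dense in the range of \<open>g\<close>, almost
  every \<open>t\<close> is a Lebesgue point of \<open>norm (g - c)\<close>. Choosing
  \<open>c\<close> close to \<open>g t\<close> shows that the difference quotients at
  \<open>t\<close> converge to \<open>g t\<close>.\<close>
lemma ac_unit_differentiable_AE:
 fixes f :: "real => 'e::banach"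
 assumes rnp: "radon_nikodym_property TYPE('e)" and f: "ac_on {0..1} f" and cont: "continuous_on {0..1} f"
 shows "AE t in lborel. t \<in> {0<..<1} --> (\<exists>v. (f has_vector_derivative v) (at t))"
proof -
 obtain g where g: "!!A. A \<in> sets lborel01 ==> has_strong_integral lborel01 (%w. indicat_real A w *\<^sub>R g w) (dyadic_limit f A)"
  using dyadic_limit_density[OF rnp f] by blast
 have sp: "space lborel01 = {0..<1}" by (simp add: space_restrict_space)
 have W: "{0..<1} \<in> sets lborel01" by (simp add: sets_lborel01)
 define g' where "g' = (%w. indicat_real {0..<1} w *\<^sub>R g w)"
 have gW: "has_strong_integral lborel01 g' (dyadic_limit f {0..<1})" unfolding g'_def by (rule g[OF W])
 have gm: "g' \<in> borel_measurable lborel01" using gW by (simp add: has_strong_integral_def)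
 have ind: "indicat_real A w *\<^sub>R g w = indicat_real A w *\<^sub>R g' w" if "A \<in> sets lborel01" for A w
  using that by (auto simp: sets_lborel01 g'_def indicator_def)
 have gA: "has_strong_integral lborel01 (%w. indicat_real A w *\<^sub>R g' w) (dyadic_limit f A)" if "A \<in> sets lborel01" for A
  using g[OF that] unfolding ind[OF that] .
 obtain C where C: "countable C" "AE w in lborel01. g' w \<in> closure C" "(\<integral>\<^sup>+w. ennreal (norm (g' w)) \<partial>lborel01) < \<infinity>"
  using has_strong_integral_range[OF gW] by blast
 define u where "u = (%c t. indicat_real {0..<1} t * norm (g' t - c))"
 have ncm: "(%w. norm (g' w - c)) \<in> borel_measurable lborel01" for c
  by (rule norm_diff_simple_measurable[OF gm]) simp
 have um[measurable]: "u c \<in> borel_measurable lborel" for c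
  using ncm[of c] unfolding u_def by (subst (asm) borel_measurable_restrict_space_iff) auto
 have u0: "0 <= u c t" for c t by (simp add: u_def)
 have ui: "integrable lborel (u c)" for c
 proof (rule integrableI_nonneg)
  have "(\<integral>\<^sup>+t. ennreal (u c t) \<partial>lborel) = (\<integral>\<^sup>+t. ennreal (norm (g' t - c)) * indicator {0..<1} t \<partial>lborel)"
   by (intro nn_integral_cong) (auto simp: u_def indicator_def)
  also have "... = (\<integral>\<^sup>+t. ennreal (norm (g' t - c)) \<partial>lborel01)"
   by (subst nn_integral_restrict_space) auto
  also have "... <= (\<integral>\<^sup>+t. ennreal (norm (g' t)) + ennreal (norm c) \<partial>lborel01)"
   by (intro nn_integral_mono) (simp flip: ennreal_plus add: ennreal_leI norm_triangle_ineq4)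
  also have "... = (\<integral>\<^sup>+t. ennreal (norm (g' t)) \<partial>lborel01) + ennreal (norm c) * emeasure lborel01 (space lborel01)"
   using ncm[of 0] by (subst nn_integral_add) auto
  also have "... < \<infinity>" using C(3) by (simp add: sp emeasure_lborel01 less_top[symmetric])
  finally show "(\<integral>\<^sup>+t. ennreal (u c t) \<partial>lborel) < \<infinity>" .
 qed (auto simp: u0)
 have est: "norm (f q - f p - (q - p) *\<^sub>R c) <= (\<integral>x\<in>{p..q}. u c x \<partial>lborel)" if pq: "0 <= p" "p <= q" "q < 1" for p q c
 proof -
  have A: "{p..<q} \<in> sets lborel01" using pq by (auto simp: sets_lborel01)
  have m: "measure lborel01 {p..<q} = q - p"
  proof -
   have "{p..<q} \<subseteq> {0..<1}" using pq by auto
   then show ?thesis using pq by (simp add: measure_def emeasure_lborel01)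
  qed
  have si: "integrable lborel (%x. indicat_real {p..q} x *\<^sub>R u c x)"
   by (rule integrable_mult_indicator[OF _ ui]) simp
  have "ennreal (norm (dyadic_limit f {p..<q} - measure lborel01 {p..<q} *\<^sub>R c))
    <= (\<integral>\<^sup>+w. indicator {p..<q} w * ennreal (norm (g' w - c)) \<partial>lborel01)"
   by (rule has_strong_integral_norm_diff_le[OF finite_lborel01 A gA[OF A] gm])
  also have "... = (\<integral>\<^sup>+w. (indicator {p..<q} w * ennreal (norm (g' w - c))) * indicator {0..<1} w \<partial>lborel)"
   by (subst nn_integral_restrict_space) auto
  also have "... <= (\<integral>\<^sup>+w. ennreal (indicat_real {p..q} w *\<^sub>R u c w) \<partial>lborel)"
   by (intro nn_integral_mono) (auto simp: u_def indicator_def)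
  also have "... = ennreal (\<integral>x\<in>{p..q}. u c x \<partial>lborel)"
   unfolding set_lebesgue_integral_def using u0 by (intro nn_integral_eq_integral si) auto
  finally have "norm (dyadic_limit f {p..<q} - measure lborel01 {p..<q} *\<^sub>R c) <= (\<integral>x\<in>{p..q}. u c x \<partial>lborel)"
   by (subst (asm) ennreal_le_iff) (auto simp: set_lebesgue_integral_def u0 intro!: integral_nonneg_AE)
  then show ?thesis unfolding dyadic_limit_interval[OF f cont pq] m .
 qed
 have leb: "AE t in lborel. \<forall>c\<in>C. \<forall>e>0. \<exists>d>0. \<forall>h. 0 < h \<and> h < d -->
   \<bar>(\<integral>x\<in>{t..t+h}. u c x \<partial>lborel) / h - u c t\<bar> < e \<and> \<bar>(\<integral>x\<in>{t-h..t}. u c x \<partial>lborel) / h - u c t\<bar> < e"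
  using lebesgue_points_real[OF ui] C(1) by (subst AE_ball_countable) auto
 have clo: "AE t in lborel. t \<in> {0..<1} --> g' t \<in> closure C"
  using C(2) by (subst (asm) AE_restrict_space_iff) auto
 from leb clo show ?thesis
 proof eventually_elim
  fix t assume L: "\<forall>c\<in>C. \<forall>e>0. \<exists>d>0. \<forall>h. 0 < h \<and> h < d -->
   \<bar>(\<integral>x\<in>{t..t+h}. u c x \<partial>lborel) / h - u c t\<bar> < e \<and> \<bar>(\<integral>x\<in>{t-h..t}. u c x \<partial>lborel) / h - u c t\<bar> < e"
   and cl: "t \<in> {0..<1} --> g' t \<in> closure C"
  show "t \<in> {0<..<1} --> (\<exists>v. (f has_vector_derivative v) (at t))"
  proof
   assume t: "t \<in> {0<..<1}"
   define v where "v = g' t"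
   have "(f has_vector_derivative v) (at t)"
    unfolding has_vector_derivative_def has_derivative_at_alt
   proof (intro conjI allI impI)
    show "bounded_linear (%x. x *\<^sub>R v)" by (rule bounded_linear_scaleR_left)
    fix e :: real assume e: "e > 0"
    have e4: "e / 4 > 0" using e by simp
    have "v \<in> closure C" using cl t by (simp add: v_def)
    then obtain c where c: "c \<in> C" "dist c v < e / 4" using e4 unfolding closure_approachable by blast
    have uc: "u c t < e / 4" using c(2) t by (simp add: u_def v_def dist_norm norm_minus_commute)
    from L[rule_format, OF c(1) e4] obtain d where d: "d > 0" "!!h. 0 < h ==> h < d ==>
    \<bar>(\<integral>x\<in>{t..t+h}. u c x \<partial>lborel) / h - u c t\<bar> < e / 4 \<and> \<bar>(\<integral>x\<in>{t-h..t}. u c x \<partial>lborel) / h - u c t\<bar> < e / 4"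
    by blast
    have main: "norm (f q - f p - (q - p) *\<^sub>R v) <= e * (q - p)"
    if pq: "0 <= p" "p < q" "q < 1" and I: "\<bar>(\<integral>x\<in>{p..q}. u c x \<partial>lborel) / (q - p) - u c t\<bar> < e / 4" for p q
    proof -
    have "(\<integral>x\<in>{p..q}. u c x \<partial>lborel) / (q - p) < e / 2" using I uc by linarith
    then have "(\<integral>x\<in>{p..q}. u c x \<partial>lborel) < e / 2 * (q - p)" using pq by (simp add: field_simps)
    then have 1: "norm (f q - f p - (q - p) *\<^sub>R c) <= e / 2 * (q - p)" using est[of p q c] pq by simp
    have 2: "norm ((q - p) *\<^sub>R c - (q - p) *\<^sub>R v) <= e / 4 * (q - p)"
    proof -
    have "norm ((q - p) *\<^sub>R c - (q - p) *\<^sub>R v) = (q - p) * dist c v"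
    using pq by (simp add: scaleR_diff_right[symmetric] dist_norm)
    also have "... <= (q - p) * (e / 4)" using c(2) pq by (intro mult_left_mono) auto
    finally show ?thesis by (simp add: mult.commute)
    qed
    have "f q - f p - (q - p) *\<^sub>R v = (f q - f p - (q - p) *\<^sub>R c) + ((q - p) *\<^sub>R c - (q - p) *\<^sub>R v)" by simp
    then have "norm (f q - f p - (q - p) *\<^sub>R v) <= e / 2 * (q - p) + e / 4 * (q - p)"
    using norm_triangle_le[OF add_mono[OF 1 2]] by simp
    also have "... = 3 / 4 * (e * (q - p))" by (simp add: field_simps)
    also have "... <= e * (q - p)" using mult_pos_pos[of e "q - p"] e pq by simp
    finally show ?thesis .
    qed
    show "\<exists>d>0. \<forall>y. norm (y - t) < d --> norm (f y - f t - (y - t) *\<^sub>R v) <= e * norm (y - t)"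
    proof (intro exI[of _ "min d (min t (1 - t))"] conjI allI impI)
    show "0 < min d (min t (1 - t))" using d(1) t by auto
    fix y assume y: "norm (y - t) < min d (min t (1 - t))"
    consider "y = t" | "y > t" | "y < t" by linarith
    then show "norm (f y - f t - (y - t) *\<^sub>R v) <= e * norm (y - t)"
    proof cases
    case 2
    have "\<bar>(\<integral>x\<in>{t..y}. u c x \<partial>lborel) / (y - t) - u c t\<bar> < e / 4"
    using d(2)[of "y - t"] 2 y by simp
    then show ?thesis using main[of t y] 2 y t by (auto simp: abs_less_iff)
    next
    case 3
    have "\<bar>(\<integral>x\<in>{y..t}. u c x \<partial>lborel) / (t - y) - u c t\<bar> < e / 4"
    using d(2)[of "t - y"] 3 y by simp
    then have "norm (f t - f y - (t - y) *\<^sub>R v) <= e * (t - y)" using main[of y t] 3 y t by (auto simp: abs_less_iff)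
    moreover have "norm (f y - f t - (y - t) *\<^sub>R v) = norm (f t - f y - (t - y) *\<^sub>R v)"
    by (subst norm_minus_commute[symmetric]) (simp add: algebra_simps norm_minus_commute)
    ultimately show ?thesis using 3 by simp
    qed simp
    qed
   qed
   then show "\<exists>v. (f has_vector_derivative v) (at t)" by blast
  qed
 qed
qed

lemma AE_lborel_shift:
 assumes "AE t in lborel. P (t::real)"
 shows "AE t in lborel. P (c + t)"
proof -
 obtain N where N: "N \<in> null_sets lborel" and N2: "\<forall>t\<in>space lborel - N. P t"
  using AE_imp_null_set[OF assms] by (rule bexE)
 have "AE t in distr lborel borel ((+) c). t \<notin> N"
  unfolding lborel_distr_plus by (rule AE_not_in[OF N])
 then have "AE t in lborel. c + t \<notin> N"
  using N by (subst (asm) AE_distr_iff) (auto simp: null_sets_def)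
 then show ?thesis by eventually_elim (use N2 in auto)
qed

lemma ac_on_shift:
 assumes f: "ac_on {0..k + 1} f" and k: "0 <= k"
 shows "ac_on {0..1} (%t. f (k + t))"
 unfolding ac_on_def
proof (intro allI impI)
 fix \<epsilon> :: real assume "\<epsilon> > 0"
 then obtain \<delta> where \<delta>: "\<delta> > 0" and ac: "!!(n::nat) a b. (\<forall>i<n. a i <= b i \<and> {a i..b i} \<subseteq> {0..k+1}) ==>
    disjoint_family_on (%i. {a i<..<b i}) {..<n} ==> (\<Sum>i<n. b i - a i) < \<delta> ==>
    (\<Sum>i<n. dist (f (a i)) (f (b i))) < \<epsilon>"
  using f unfolding ac_on_def by blast
 show "\<exists>\<delta>>0. \<forall>(n::nat) a b. (\<forall>i<n. a i <= b i \<and> {a i..b i} \<subseteq> {0..1}) -->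
    disjoint_family_on (%i. {a i<..<b i}) {..<n} --> (\<Sum>i<n. b i - a i) < \<delta> -->
    (\<Sum>i<n. dist (f (k + a i)) (f (k + b i))) < \<epsilon>"
 proof (intro exI[of _ \<delta>] conjI allI impI \<delta>)
  fix n :: nat and a b :: "nat => real"
  assume 1: "\<forall>i<n. a i <= b i \<and> {a i..b i} \<subseteq> {0..1}" and 2: "disjoint_family_on (%i. {a i<..<b i}) {..<n}"
   and 3: "(\<Sum>i<n. b i - a i) < \<delta>"
  show "(\<Sum>i<n. dist (f (k + a i)) (f (k + b i))) < \<epsilon>"
  proof (rule ac)
   show "\<forall>i<n. k + a i <= k + b i \<and> {k + a i..k + b i} \<subseteq> {0..k + 1}" using 1 k by auto
   have "{k + a i<..<k + b i} \<inter> {k + a j<..<k + b j} = {}" if "{a i<..<b i} \<inter> {a j<..<b j} = {}" for i j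
   proof (rule ccontr)
    assume "{k + a i<..<k + b i} \<inter> {k + a j<..<k + b j} ~= {}"
    then obtain x where "x \<in> {k + a i<..<k + b i}" "x \<in> {k + a j<..<k + b j}" by blast
    then have "x - k \<in> {a i<..<b i} \<inter> {a j<..<b j}" by auto
    then show False unfolding that by (rule emptyE)
   qed
   then show "disjoint_family_on (%i. {k + a i<..<k + b i}) {..<n}" using 2 unfolding disjoint_family_on_def by meson
   show "(\<Sum>i<n. (k + b i) - (k + a i)) < \<delta>" using 3 by simp
  qed
 qed
qed

lemma ac_differentiable_AE:
 fixes f :: "real => 'e::banach"
 assumes rnp: "radon_nikodym_property TYPE('e)" and f: "!!b. b >= 0 ==> ac_on {0..b} f" and cont: "continuous_on UNIV f"
 shows "AE t in lborel. t > 0 --> (\<exists>v. (f has_vector_derivative v) (at t))"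
proof -
 have k: "AE t in lborel. t \<in> {real k<..<real k + 1} --> (\<exists>v. (f has_vector_derivative v) (at t))" for k :: nat
 proof -
  have "AE t in lborel. t \<in> {0<..<1} --> (\<exists>v. ((%t. f (real k + t)) has_vector_derivative v) (at t))"
  proof (rule ac_unit_differentiable_AE[OF rnp])
   show "ac_on {0..1} (%t. f (real k + t))" by (rule ac_on_shift[OF f]) auto
   show "continuous_on {0..1} (%t. f (real k + t))"
    by (intro continuous_on_compose2[OF cont] continuous_intros) auto
  qed
  then have "AE t in lborel. - real k + t \<in> {0<..<1} --> (\<exists>v. ((%t. f (real k + t)) has_vector_derivative v) (at (- real k + t)))"
   by (rule AE_lborel_shift)
  then show ?thesis
  proof eventually_elim
   fix t assume a: "- real k + t \<in> {0<..<1} --> (\<exists>v. ((%t. f (real k + t)) has_vector_derivative v) (at (- real k + t)))"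
   show "t \<in> {real k<..<real k + 1} --> (\<exists>v. (f has_vector_derivative v) (at t))"
   proof
    assume "t \<in> {real k<..<real k + 1}"
    then obtain v where v: "((%t. f (real k + t)) has_vector_derivative v) (at (- real k + t))" using a by auto
    have "((%s. - real k + s) has_vector_derivative 1) (at t)" by (auto intro!: derivative_eq_intros)
    from vector_diff_chain_at[OF this, of "%t. f (real k + t)" v] v
    have "((%t. f (real k + t)) \<circ> (%s. - real k + s) has_vector_derivative v) (at t)" by simp
    then show "\<exists>v. (f has_vector_derivative v) (at t)" by (auto simp: o_def)
   qed
  qed
 qed
 have "AE t in lborel. \<forall>k::nat. t \<in> {real k<..<real k + 1} --> (\<exists>v. (f has_vector_derivative v) (at t))"
  unfolding AE_all_countable by (rule allI, rule k)
 moreover have "AE t in lborel. t \<notin> range real"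
  by (rule AE_not_in) (auto intro: countable_imp_null_set_lborel)
 ultimately show ?thesis
 proof eventually_elim
  fix t assume a: "\<forall>k::nat. t \<in> {real k<..<real k + 1} --> (\<exists>v. (f has_vector_derivative v) (at t))" and b: "t \<notin> range real"
  show "t > 0 --> (\<exists>v. (f has_vector_derivative v) (at t))"
  proof
   assume t: "t > 0"
   define k where "k = nat \<lfloor>t\<rfloor>"
   have k: "real k <= t" "t < real k + 1" using t unfolding k_def by (auto simp: of_nat_nat)
   moreover have "real k ~= t" using b by auto
   ultimately show "\<exists>v. (f has_vector_derivative v) (at t)" using a by (auto simp: less_le)
  qed
 qed
qed

lemma ac_on_lipschitz_image:
 fixes f :: "real => 'a::metric_space" and h :: "'a => 'b::metric_space"
 assumes f: "ac_on S f" and h: "L-lipschitz_on UNIV h"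
 shows "ac_on S (%t. h (f t))"
 unfolding ac_on_def
proof (intro allI impI)
 fix \<epsilon> :: real assume e: "\<epsilon> > 0"
 have L: "0 <= L" by (rule lipschitz_on_nonneg[OF h])
 have "\<epsilon> / (L + 1) > 0" using e L by simp
 then obtain \<delta> where \<delta>: "\<delta> > 0" and ac: "!!(n::nat) a b. (\<forall>i<n. a i <= b i \<and> {a i..b i} \<subseteq> S) ==>
    disjoint_family_on (%i. {a i<..<b i}) {..<n} ==> (\<Sum>i<n. b i - a i) < \<delta> ==>
    (\<Sum>i<n. dist (f (a i)) (f (b i))) < \<epsilon> / (L + 1)"
  using f unfolding ac_on_def by blast
 show "\<exists>\<delta>>0. \<forall>(n::nat) a b. (\<forall>i<n. a i <= b i \<and> {a i..b i} \<subseteq> S) -->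
    disjoint_family_on (%i. {a i<..<b i}) {..<n} --> (\<Sum>i<n. b i - a i) < \<delta> -->
    (\<Sum>i<n. dist (h (f (a i))) (h (f (b i)))) < \<epsilon>"
 proof (intro exI[of _ \<delta>] conjI allI impI \<delta>)
  fix n :: nat and a b :: "nat => real"
  assume 1: "\<forall>i<n. a i <= b i \<and> {a i..b i} \<subseteq> S" and 2: "disjoint_family_on (%i. {a i<..<b i}) {..<n}"
   and 3: "(\<Sum>i<n. b i - a i) < \<delta>"
  have "(\<Sum>i<n. dist (h (f (a i))) (h (f (b i)))) <= (\<Sum>i<n. L * dist (f (a i)) (f (b i)))"
   by (intro sum_mono lipschitz_onD[OF h]) auto
  also have "... <= (L + 1) * (\<Sum>i<n. dist (f (a i)) (f (b i)))"
   unfolding sum_distrib_left by (intro sum_mono mult_right_mono) auto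
  also have "... < (L + 1) * (\<epsilon> / (L + 1))"
   using ac[OF 1 2 3] L by (intro mult_strict_left_mono) auto
  also have "... = \<epsilon>" using L by simp
  finally show "(\<Sum>i<n. dist (h (f (a i))) (h (f (b i)))) < \<epsilon>" .
 qed
qed

text \<open>The real line embeds isometrically, up to a factor, into the line spanned by
  \<open>v0\<close>, so the Radon-Nikodym property of the space covers scalar functions as well.\<close>
lemma ac_real_differentiable_AE:
 fixes v0 :: "'e::banach" and f :: "real => real"
 assumes rnp: "radon_nikodym_property TYPE('e)" and v0: "v0 ~= 0"
  and f: "!!b. b >= 0 ==> ac_on {0..b} f" and cont: "continuous_on UNIV f"
 shows "AE t in lborel. t > 0 --> (\<exists>D. (f has_real_derivative D) (at t))"
proof -
 define F where "F = (%t. f t *\<^sub>R v0)"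
 have "(norm v0)-lipschitz_on UNIV (%r::real. r *\<^sub>R v0)"
  by (rule lipschitz_onI) (auto simp: dist_norm scaleR_diff_left[symmetric] mult.commute)
 then have "ac_on {0..b} F" if "b >= 0" for b
  unfolding F_def by (rule ac_on_lipschitz_image[OF f[OF that]])
 moreover have "continuous_on UNIV F" unfolding F_def by (intro continuous_intros cont)
 ultimately have "AE t in lborel. t > 0 --> (\<exists>v. (F has_vector_derivative v) (at t))"
  by (rule ac_differentiable_AE[OF rnp])
 then show ?thesis
 proof eventually_elim
  fix t assume a: "t > 0 --> (\<exists>v. (F has_vector_derivative v) (at t))"
  show "t > 0 --> (\<exists>D. (f has_real_derivative D) (at t))"
  proof
   assume "t > 0"
   then obtain v where v: "(F has_vector_derivative v) (at t)" using a by blast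
   obtain y :: "'e \<Rightarrow>\<^sub>L real" where y: "blinfun_apply y v0 = norm v0" using norming_functional_exists by blast
   have "((%t. blinfun_apply y (F t)) has_vector_derivative blinfun_apply y v) (at t)"
    by (rule bounded_linear.has_vector_derivative[OF blinfun.bounded_linear_right v])
   then have "((%t. blinfun_apply y (F t)) has_real_derivative blinfun_apply y v) (at t)"
    by (simp add: has_real_derivative_iff_has_vector_derivative)
   then have "((%t. blinfun_apply y (F t) / norm v0) has_real_derivative blinfun_apply y v / norm v0) (at t)"
    by (rule DERIV_cdivide)
   moreover have "(%t. blinfun_apply y (F t) / norm v0) = f"
    using v0 by (auto simp: F_def blinfun.scaleR_right y)
   ultimately show "\<exists>D. (f has_real_derivative D) (at t)" by auto
  qed
 qed
qed

section \<open>Speed, length and the space of curves\<close>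

text \<open>The derivative, as a limit of difference quotients along a fixed sequence: for continuous
  functions it is Borel, also as a function of a curve.\<close>
definition diff_lim :: "(real => real) => real => real" where
 "diff_lim g t = lim (%n. real (Suc n) * (g (t + 1 / real (Suc n)) - g t))"

text \<open>The metric speed, defined by a lower limit along a fixed sequence so that it is Borel in all
  variables and Fatou's lemma applies.\<close>
definition mspeed :: "(real => 'a::metric_space) => real => ennreal" where
 "mspeed f t = liminf (%n. ennreal (real (Suc n) * dist (f (t + 1 / real (Suc n))) (f t)))"

lemma inverse_Suc_filterlim: "filterlim (%n. 1 / real (Suc n)) (at 0) sequentially"
 unfolding filterlim_at using LIMSEQ_inverse_real_of_nat by (auto simp: inverse_eq_divide)

lemma has_vector_derivative_slopes:
 assumes "(f has_vector_derivative v) (at t)"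
 shows "(%n. real (Suc n) *\<^sub>R (f (t + 1 / real (Suc n)) - f t)) \<longlonglongrightarrow> v"
proof -
 have "((%h. norm (f (t + h) - f t - h *\<^sub>R v) / norm h) \<longlongrightarrow> 0) (at 0)"
  using assms unfolding has_vector_derivative_def has_derivative_at by blast
 from filterlim_compose[OF this inverse_Suc_filterlim]
 have "(%n. norm (f (t + 1 / real (Suc n)) - f t - (1 / real (Suc n)) *\<^sub>R v) / norm (1 / real (Suc n))) \<longlonglongrightarrow> 0" .
 moreover have "norm (x - (1 / s) *\<^sub>R v) / norm (1 / s) = norm (s *\<^sub>R x - v)" if s: "s > 0" for x and s :: real
 proof -
  have "norm (s *\<^sub>R x - v) = norm (s *\<^sub>R (x - (1 / s) *\<^sub>R v))" using s by (simp add: scaleR_diff_right)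
  also have "... = s * norm (x - (1 / s) *\<^sub>R v)" unfolding norm_scaleR using s by simp
  finally show ?thesis using s by (simp add: field_simps)
 qed
 ultimately have "(%n. norm (real (Suc n) *\<^sub>R (f (t + 1 / real (Suc n)) - f t) - v)) \<longlonglongrightarrow> 0" by simp
 then show ?thesis by (rule LIM_zero_cancel[OF tendsto_norm_zero_cancel])
qed

lemma diff_lim_eq:
 assumes "(g has_real_derivative D) (at t)"
 shows "diff_lim g t = D" "(%n. real (Suc n) * (g (t + 1 / real (Suc n)) - g t)) \<longlonglongrightarrow> D"
proof -
 show l: "(%n. real (Suc n) * (g (t + 1 / real (Suc n)) - g t)) \<longlonglongrightarrow> D"
  using has_vector_derivative_slopes[of g D t] assms by (simp add: has_real_derivative_iff_has_vector_derivative)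
 then show "diff_lim g t = D" unfolding diff_lim_def by (rule limI)
qed

lemma mspeed_eq:
 fixes f :: "real => 'e::real_normed_vector"
 assumes "(f has_vector_derivative v) (at t)"
 shows "mspeed f t = ennreal (norm v)"
proof -
 have "(%n. norm (real (Suc n) *\<^sub>R (f (t + 1 / real (Suc n)) - f t))) \<longlonglongrightarrow> norm v"
  by (rule tendsto_norm[OF has_vector_derivative_slopes[OF assms]])
 then have "(%n. ennreal (real (Suc n) * dist (f (t + 1 / real (Suc n))) (f t))) \<longlonglongrightarrow> ennreal (norm v)"
  by (intro tendsto_ennrealI) (simp add: dist_norm)
 then show ?thesis unfolding mspeed_def by (intro lim_imp_Liminf) auto
qed

lemma diff_lim_measurable:
 assumes "continuous_on UNIV g" shows "diff_lim g \<in> borel_measurable borel"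
 unfolding diff_lim_def[abs_def]
 by (intro borel_measurable_lim_metric borel_measurable_continuous_onI continuous_intros continuous_on_compose2[OF assms]) auto

text \<open>The difference quotients are bounded by \<open>L\<close>, so their integrals, which converge
  to \<open>g b - g a\<close>, also converge to the integral of the derivative.\<close>
lemma lipschitz_ftc:
 fixes g :: "real => real"
 assumes g: "L-lipschitz_on UNIV g" and ab: "a <= b"
  and d: "AE t in lborel. t \<in> {a..b} --> (g has_real_derivative D t) (at t)"
  and D: "D \<in> borel_measurable borel"
 shows "set_integrable lborel {a..b} D" "(LBINT t:{a..b}. D t) = g b - g a"
proof -
 have cg: "continuous_on UNIV g" by (rule lipschitz_on_continuous_on[OF g])
 have L0: "0 <= L" by (rule lipschitz_on_nonneg[OF g])
 define F where "F = (%n t. real (Suc n) * (g (t + 1 / real (Suc n)) - g t))"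
 have Fc: "continuous_on UNIV (F n)" for n
  unfolding F_def by (intro continuous_intros continuous_on_compose2[OF cg]) auto
 then have Fm[measurable]: "F n \<in> borel_measurable borel" for n by (rule borel_measurable_continuous_onI)
 have Dm[measurable]: "D \<in> borel_measurable borel" by (rule D)
 have Fb: "\<bar>F n t\<bar> <= L" for n t
 proof -
  have "\<bar>g (t + 1 / real (Suc n)) - g t\<bar> <= L * (1 / real (Suc n))"
   using lipschitz_onD[OF g, of "t + 1 / real (Suc n)" t] by (simp add: dist_real_def)
  then have "real (Suc n) * \<bar>g (t + 1 / real (Suc n)) - g t\<bar> <= real (Suc n) * (L * (1 / real (Suc n)))"
   by (intro mult_left_mono) auto
  then show ?thesis unfolding F_def by (simp add: abs_mult del: of_nat_Suc)
 qed
 have ae: "AE t in lborel. (%n. indicator {a..b} t *\<^sub>R F n t) \<longlonglongrightarrow> indicator {a..b} t *\<^sub>R D t"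
  using d
 proof eventually_elim
  fix t assume a: "t \<in> {a..b} --> (g has_real_derivative D t) (at t)"
  show "(%n. indicator {a..b} t *\<^sub>R F n t) \<longlonglongrightarrow> indicator {a..b} t *\<^sub>R D t"
  proof (cases "t \<in> {a..b}")
   case True
   then show ?thesis using diff_lim_eq(2)[of g "D t" t] a unfolding F_def by (intro tendsto_scaleR tendsto_const) auto
  qed simp
 qed
 have w: "integrable lborel (%t. indicator {a..b} t *\<^sub>R L)"
  using ab by (intro integrable_scaleR_left integrable_real_indicator) auto
 have b: "AE t in lborel. norm (indicator {a..b} t *\<^sub>R F n t) <= indicator {a..b} t *\<^sub>R L" for n
  using Fb by (intro AE_I2) (auto simp: indicator_def)
 have lim: "(%n. LBINT t. indicator {a..b} t *\<^sub>R F n t) \<longlonglongrightarrow> (LBINT t. indicator {a..b} t *\<^sub>R D t)"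
  by (rule integral_dominated_convergence[OF _ _ w ae b]) auto
 show "set_integrable lborel {a..b} D"
  unfolding set_integrable_def by (rule integrable_dominated_convergence[OF _ _ w ae b]) auto
 \<comment> \<open>The integrated difference quotients of g are difference quotients of its antiderivative.\<close>
 obtain G where G: "!!x. x \<in> {a - 1..b + 2} ==> (G has_vector_derivative g x) (at x within {a - 1..b + 2})"
  using antiderivative_continuous[OF continuous_on_subset[OF cg subset_UNIV]] by blast
 have Gd: "(G has_real_derivative g x) (at x)" if "x \<in> {a..b + 1}" for x
 proof -
  have "(G has_vector_derivative g x) (at x)"
  proof -
   have "x \<in> interior {a - 1..b + 2}" using that by (simp add: interior_atLeastAtMost_real)
   from at_within_interior[OF this] show ?thesis using G[of x] that by simp
  qed
  then show ?thesis by (simp add: has_real_derivative_iff_has_vector_derivative)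
 qed
 have eq: "(LBINT t. indicator {a..b} t *\<^sub>R F n t) = real (Suc n) * (G (b + 1 / real (Suc n)) - G b) - real (Suc n) * (G (a + 1 / real (Suc n)) - G a)" for n
 proof -
  have h: "1 / real (Suc n) <= 1" "0 < 1 / real (Suc n)" by auto
  have "(LBINT t. F n t * indicator {a..b} t) = real (Suc n) * (G (b + 1 / real (Suc n)) - G b) - real (Suc n) * (G (a + 1 / real (Suc n)) - G a)"
  proof (rule integral_FTC_Icc_real[OF ab, of "%t. real (Suc n) * (G (t + 1 / real (Suc n)) - G t)"])
   fix x assume x: "a <= x" "x <= b"
   have 1: "((%t. G (t + 1 / real (Suc n))) has_real_derivative g (x + 1 / real (Suc n))) (at x)"
    by (rule DERIV_shift[THEN iffD1, OF Gd]) (use x h in \<open>unfold atLeastAtMost_iff, linarith\<close>)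
   show "((%t. real (Suc n) * (G (t + 1 / real (Suc n)) - G t)) has_real_derivative F n x) (at x)"
    unfolding F_def by (intro DERIV_cmult DERIV_diff 1 Gd) (use x in auto)
   show "isCont (F n) x" using Fc[of n] by (simp add: continuous_on_eq_continuous_at)
  qed
  then show ?thesis by (simp add: mult.commute)
 qed
 have "(%n. LBINT t. indicator {a..b} t *\<^sub>R F n t) \<longlonglongrightarrow> g b - g a"
  unfolding eq by (intro tendsto_diff diff_lim_eq(2) Gd) (use ab in auto)
 then show "(LBINT t:{a..b}. D t) = g b - g a"
  using lim LIMSEQ_unique unfolding set_lebesgue_integral_def by blast
qed

lemma at_time_continuous: "continuous_on UNIV (at_time cv)" and at_time_neg: "t <= 0 ==> at_time cv t = at_time cv 0"
proof -
 have "continuous_on UNIV (at_time cv) \<and> (\<forall>t\<le>0. at_time cv t = at_time cv 0)"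
  using at_time[of cv] unfolding mem_Collect_eq .
 then show "continuous_on UNIV (at_time cv)" "t <= 0 ==> at_time cv t = at_time cv 0" by blast+
qed

lemma open_curve_tube:
 fixes cv :: "'a::metric_space curve"
 assumes "e > 0"
 shows "open {\<kappa>. \<forall>u\<in>{0..b}. dist (at_time cv u) (at_time \<kappa> u) < e}"
proof (cases "0 <= b")
 case False
 then have "{\<kappa>. \<forall>u\<in>{0..b}. dist (at_time cv u) (at_time \<kappa> u) < e} = UNIV" by auto
 then show ?thesis by simp
next
 case True
 show ?thesis
  unfolding open_curve_def
 proof
  fix \<kappa> assume k: "\<kappa> \<in> {\<kappa>. \<forall>u\<in>{0..b}. dist (at_time cv u) (at_time \<kappa> u) < e}"
  have "continuous_on {0..b} (%u. dist (at_time cv u) (at_time \<kappa> u))"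
   by (intro continuous_intros continuous_on_subset[OF at_time_continuous]) auto
  from continuous_attains_sup[OF compact_Icc _ this]
  obtain u where u: "u \<in> {0..b}" "!!w. w \<in> {0..b} ==> dist (at_time cv w) (at_time \<kappa> w) <= dist (at_time cv u) (at_time \<kappa> u)"
   using True by auto
  define d where "d = e - dist (at_time cv u) (at_time \<kappa> u)"
  have "d > 0" using k u(1) by (simp add: d_def)
  moreover have "\<zeta> \<in> {\<kappa>. \<forall>u\<in>{0..b}. dist (at_time cv u) (at_time \<kappa> u) < e}"
   if z: "\<forall>t\<in>{0..b}. dist (at_time \<kappa> t) (at_time \<zeta> t) < d" for \<zeta>
  proof (intro CollectI ballI)
   fix w assume w: "w \<in> {0..b}"
   have "dist (at_time cv w) (at_time \<zeta> w) <= dist (at_time cv w) (at_time \<kappa> w) + dist (at_time \<kappa> w) (at_time \<zeta> w)"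
    by (rule dist_triangle)
   also have "... < e" using u(2)[OF w] bspec[OF z w] unfolding d_def by linarith
   finally show "dist (at_time cv w) (at_time \<zeta> w) < e" .
  qed
  ultimately show "\<exists>b'. \<exists>\<epsilon>>0. \<forall>\<zeta>. (\<forall>t\<in>{0..b'}. dist (at_time \<kappa> t) (at_time \<zeta> t) < \<epsilon>) -->
    \<zeta> \<in> {\<kappa>. \<forall>u\<in>{0..b}. dist (at_time cv u) (at_time \<kappa> u) < e}"
   by blast
 qed
qed

text \<open>Joint continuity makes evaluation Borel and maps compact sets of curves and times to compact
  sets, which is what tightness of image measures needs.\<close>
lemma evaluation_continuous: "continuous_on UNIV (%p::'a::metric_space curve \<times> real. at_time (fst p) (snd p))"
 unfolding continuous_on_topological
proof (intro ballI allI impI)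
 fix p :: "'a curve \<times> real" and B assume B: "open B" "at_time (fst p) (snd p) \<in> B"
 obtain cv t where p: "p = (cv, t)" by force
 obtain e where e: "e > 0" "ball (at_time cv t) e \<subseteq> B" using B openE unfolding p by auto
 define W where "W = at_time cv -` ball (at_time cv t) (e/2) \<inter> {t - 1<..<t + 1}"
 have oW: "open W" unfolding W_def
  by (intro open_Int open_vimage at_time_continuous) auto
 define U where "U = {\<kappa>. \<forall>u\<in>{0..\<bar>t\<bar> + 1}. dist (at_time cv u) (at_time \<kappa> u) < e/2}"
 have oU: "open U" unfolding U_def by (rule open_curve_tube) (use e in simp)
 have "p \<in> U \<times> W" using e by (auto simp: p U_def W_def)
 moreover have "at_time (fst q) (snd q) \<in> B" if "q \<in> U \<times> W" for q
 proof -
  obtain \<kappa> s where q: "q = (\<kappa>, s)" "\<kappa> \<in> U" "s \<in> W" using \<open>q \<in> U \<times> W\<close> by auto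
  have "dist (at_time cv s) (at_time \<kappa> s) < e/2"
  proof (cases "s >= 0")
   case True
   then have "s \<in> {0..\<bar>t\<bar> + 1}" using q(3) by (auto simp: W_def)
   then show ?thesis using q(2) by (auto simp: U_def)
  next
   case False
   have "dist (at_time cv 0) (at_time \<kappa> 0) < e/2" using q(2) by (auto simp: U_def)
   then show ?thesis using False at_time_neg[of s cv] at_time_neg[of s \<kappa>] by simp
  qed
  moreover have "dist (at_time cv t) (at_time cv s) < e/2" using q(3) by (auto simp: W_def)
  ultimately have "dist (at_time cv t) (at_time \<kappa> s) < e"
   using dist_triangle[of "at_time cv t" "at_time \<kappa> s" "at_time cv s"] by linarith
  then show ?thesis using e by (auto simp: q)
 qed
 ultimately show "\<exists>A. open A \<and> p \<in> A \<and> (\<forall>q\<in>UNIV. q \<in> A --> at_time (fst q) (snd q) \<in> B)"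
  using open_Times[OF oU oW] by blast
qed

lemma at_time_curve_continuous: "continuous_on S (%cv::'a::metric_space curve. at_time cv t)"
proof -
 have "continuous_on UNIV (%cv::'a curve. at_time (fst (cv, t)) (snd (cv, t)))"
  by (rule continuous_on_compose2[OF evaluation_continuous]) (auto intro!: continuous_intros)
 then show ?thesis using continuous_on_subset[OF _ subset_UNIV] by simp
qed

lemma at_time_measurable [measurable]: "(%cv::'a::metric_space curve. at_time cv t) \<in> borel_measurable borel"
 by (rule borel_measurable_continuous_onI[OF at_time_curve_continuous])

lemma at_time_borel: "at_time cv \<in> borel_measurable borel"
 by (rule borel_measurable_continuous_onI[OF at_time_continuous])

lemma beta_continuous: "continuous_on UNIV (beta t)"
proof -
 have "continuous_on UNIV (%p::'a curve \<times> real. at_time (fst (fst p, t + snd p)) (snd (fst p, t + snd p)))"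
  by (rule continuous_on_compose2[OF evaluation_continuous]) (auto intro!: continuous_intros)
 then show ?thesis by (simp add: beta_def case_prod_beta)
qed

lemma beta_measurable: "beta t \<in> borel_measurable borel"
 by (rule borel_measurable_continuous_onI[OF beta_continuous])

text \<open>Rounding the time to multiples of \<open>1/n\<close> gives countably many values of the second
  variable, so that no topology on the first one is involved.\<close>
lemma caratheodory_measurable:
 fixes \<Phi> :: "'w => real => 'b::metric_space"
 assumes m: "!!t. (%w. \<Phi> w t) \<in> borel_measurable M" and c: "!!w. w \<in> space M ==> continuous_on UNIV (\<Phi> w)"
 shows "(%(w, t). \<Phi> w t) \<in> borel_measurable (M \<Otimes>\<^sub>M borel)"
proof (rule borel_measurable_LIMSEQ_metric[where f="%n p. \<Phi> (fst p) (real_of_int \<lfloor>real (Suc n) * snd p\<rfloor> / real (Suc n))"])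
 fix n :: nat
 have "(%p. (%k p. \<Phi> (fst p) (real_of_int k / real (Suc n))) \<lfloor>real (Suc n) * snd p\<rfloor> p) \<in> borel_measurable (M \<Otimes>\<^sub>M borel)"
 proof (rule measurable_compose_countable[where f="%k p. \<Phi> (fst p) (real_of_int k / real (Suc n))" and g="%p. \<lfloor>real (Suc n) * snd p\<rfloor>"])
  show "(%p. \<Phi> (fst p) (real_of_int k / real (Suc n))) \<in> borel_measurable (M \<Otimes>\<^sub>M borel)" for k
   by (rule measurable_compose[OF measurable_fst m])
  show "(%p. \<lfloor>real (Suc n) * snd p\<rfloor>) \<in> measurable (M \<Otimes>\<^sub>M borel) (count_space UNIV)"
   by measurable
 qed
 then show "(%p. \<Phi> (fst p) (real_of_int \<lfloor>real (Suc n) * snd p\<rfloor> / real (Suc n))) \<in> borel_measurable (M \<Otimes>\<^sub>M borel)" .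
next
 fix p :: "'w \<times> real" assume p: "p \<in> space (M \<Otimes>\<^sub>M borel)"
 obtain w t where wt: "p = (w, t)" by force
 have w: "w \<in> space M" using p by (simp add: wt space_pair_measure)
 have "(%n. real_of_int \<lfloor>real (Suc n) * t\<rfloor> / real (Suc n)) \<longlonglongrightarrow> t"
 proof (rule tendsto_sandwich[of "%n. t - 1 / real (Suc n)" _ _ "%_. t"])
  show "\<forall>\<^sub>F n in sequentially. t - 1 / real (Suc n) <= real_of_int \<lfloor>real (Suc n) * t\<rfloor> / real (Suc n)"
  proof (intro always_eventually allI)
   fix n
   have "real (Suc n) * t - 1 <= real_of_int \<lfloor>real (Suc n) * t\<rfloor>" by linarith
   then have "(real (Suc n) * t - 1) / real (Suc n) <= real_of_int \<lfloor>real (Suc n) * t\<rfloor> / real (Suc n)"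
    by (rule divide_right_mono) simp
   then show "t - 1 / real (Suc n) <= real_of_int \<lfloor>real (Suc n) * t\<rfloor> / real (Suc n)"
    by (simp add: diff_divide_distrib del: of_nat_Suc)
  qed
  show "\<forall>\<^sub>F n in sequentially. real_of_int \<lfloor>real (Suc n) * t\<rfloor> / real (Suc n) <= t"
  proof (intro always_eventually allI)
   fix n
   have "real_of_int \<lfloor>real (Suc n) * t\<rfloor> <= real (Suc n) * t" by linarith
   then have "real_of_int \<lfloor>real (Suc n) * t\<rfloor> / real (Suc n) <= (real (Suc n) * t) / real (Suc n)"
    by (rule divide_right_mono) simp
   then show "real_of_int \<lfloor>real (Suc n) * t\<rfloor> / real (Suc n) <= t" by (simp del: of_nat_Suc)
  qed
  show "(%n. t - 1 / real (Suc n)) \<longlonglongrightarrow> t"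
   using tendsto_diff[OF tendsto_const LIMSEQ_inverse_real_of_nat, of t] by (simp add: inverse_eq_divide)
 qed simp
 then show "(%n. \<Phi> (fst p) (real_of_int \<lfloor>real (Suc n) * snd p\<rfloor> / real (Suc n))) \<longlonglongrightarrow> (case p of (w, t) => \<Phi> w t)"
  using c[OF w] unfolding wt by (auto intro: continuous_on_tendsto_compose)
qed

lemma curve_length_measurable: "(curve_length :: 'a::metric_space curve => ennreal) \<in> borel_measurable borel"
proof (rule borel_measurableI_greater)
 fix c :: ennreal
 have "{cv::'a curve. c < curve_length cv} = (\<Union>(n, t)\<in>{(n::nat, t::nat => real). mono_on {..n} t \<and> t ` {..n} \<subseteq> {0..}}.
   {cv. c < (\<Sum>i<n. ennreal (dist (at_time cv (t i)) (at_time cv (t (Suc i)))))})"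
  unfolding length_on_def by (auto simp: less_SUP_iff)
 moreover have "open {cv::'a curve. c < (\<Sum>i<n. ennreal (dist (at_time cv (t i)) (at_time cv (t (Suc i)))))}" for n and t :: "nat => real"
  by (intro open_Collect_less continuous_intros continuous_on_ennreal at_time_curve_continuous)
 ultimately have "open {cv::'a curve. c < curve_length cv}" by (auto intro!: open_UN)
 then show "{cv \<in> space borel. c < curve_length (cv :: 'a curve)} \<in> sets borel" by simp
qed

text \<open>For fixed step \<open>h\<close>, the integral of \<open>dist (\<theta> (t + h)) (\<theta> t) /
  h\<close> over all \<open>t\<close> is the mean over \<open>t\<close> in
  \<open>{0..<h}\<close> of the length of the polygon with vertices \<open>\<theta> (t + k
  h)\<close>. Fatou's lemma does the rest.\<close>
lemma mspeed_integral_le_length: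
 fixes cv :: "'a::metric_space curve"
 shows "(\<integral>\<^sup>+t. mspeed (at_time cv) t * indicator {0..} t \<partial>lborel) <= curve_length cv"
proof -
 define F where "F = (%n t. ennreal (real (Suc n) * dist (at_time cv (t + 1 / real (Suc n))) (at_time cv t)))"
 have Fm[measurable]: "F n \<in> borel_measurable borel" for n
  unfolding F_def
  by (intro measurable_compose[OF _ measurable_ennreal] borel_measurable_continuous_onI continuous_intros
    continuous_on_compose2[OF at_time_continuous]) auto
 have est: "(\<integral>\<^sup>+t. F n t * indicator {0..} t \<partial>lborel) <= curve_length cv" for n
 proof -
  define h where "h = 1 / real (Suc n)"
  have h: "h > 0" by (simp add: h_def)
  have ind: "indicator {0..} t = (\<Sum>k. indicator {real k * h..<real (Suc k) * h} t :: ennreal)" for t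
  proof (cases "t >= 0")
   case True
   define m where "m = nat \<lfloor>t / h\<rfloor>"
   have m: "real m <= t / h" "t / h < real m + 1" using True h unfolding m_def by (auto simp: of_nat_nat)
   have "(\<Sum>k. indicator {real k * h..<real (Suc k) * h} t :: ennreal) = (\<Sum>k\<in>{m}. indicator {real k * h..<real (Suc k) * h} t)"
   proof (rule suminf_finite)
    fix k assume k: "k \<notin> {m}"
    show "indicator {real k * h..<real (Suc k) * h} t = (0::ennreal)"
    proof (rule ccontr)
    assume "indicator {real k * h..<real (Suc k) * h} t ~= (0::ennreal)"
    then have "real k * h <= t" "t < real (Suc k) * h" by (auto simp: indicator_def split: if_splits)
    then have "real k <= t / h" "t / h < real k + 1" using h by (auto simp: field_simps)
    then have "real k < real m + 1" "real m < real k + 1" using m by linarith+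
    then show False using k by simp
    qed
   qed simp
   also have "... = 1" using m h by (auto simp: indicator_def field_simps)
   finally show ?thesis using True by simp
  next
   case False
   have "indicator {real k * h..<real (Suc k) * h} t = (0::ennreal)" for k
    using False h by (auto simp: indicator_def) (meson mult_nonneg_nonneg of_nat_0_le_iff order_less_imp_le order_trans)
   then show ?thesis using False by simp
  qed
  have shift: "(\<integral>\<^sup>+t. F n t * indicator {real k * h..<real (Suc k) * h} t \<partial>lborel) = (\<integral>\<^sup>+t. F n (real k * h + t) * indicator {0..<h} t \<partial>lborel)" for k
  proof -
   have "(\<integral>\<^sup>+t. F n t * indicator {real k * h..<real (Suc k) * h} t \<partial>lborel)
    = (\<integral>\<^sup>+t. F n (real k * h + 1 * t) * indicator {real k * h..<real (Suc k) * h} (real k * h + 1 * t) \<partial>lborel)"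
    using nn_integral_real_affine[of "%t. F n t * indicator {real k * h..<real (Suc k) * h} t" 1 "real k * h"] by simp
   also have "... = (\<integral>\<^sup>+t. F n (real k * h + t) * indicator {0..<h} t \<partial>lborel)"
    by (intro nn_integral_cong) (auto simp: indicator_def algebra_simps)
   finally show ?thesis .
  qed
  have "(\<integral>\<^sup>+t. F n t * indicator {0..} t \<partial>lborel) = (\<integral>\<^sup>+t. (\<Sum>k. F n t * indicator {real k * h..<real (Suc k) * h} t) \<partial>lborel)"
   unfolding ind by (simp add: ennreal_suminf_cmult)
  also have "... = (\<Sum>k. \<integral>\<^sup>+t. F n t * indicator {real k * h..<real (Suc k) * h} t \<partial>lborel)"
   by (rule nn_integral_suminf) measurable
  also have "... = (\<Sum>k. \<integral>\<^sup>+t. F n (real k * h + t) * indicator {0..<h} t \<partial>lborel)"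
   unfolding shift ..
  also have "... = (\<integral>\<^sup>+t. (\<Sum>k. F n (real k * h + t) * indicator {0..<h} t) \<partial>lborel)"
   by (rule nn_integral_suminf[symmetric]) measurable
  also have "... <= (\<integral>\<^sup>+t. (ennreal (real (Suc n)) * curve_length cv) * indicator {0..<h} t \<partial>lborel)"
  proof (rule nn_integral_mono)
   fix t :: real
   show "(\<Sum>k. F n (real k * h + t) * indicator {0..<h} t) <= (ennreal (real (Suc n)) * curve_length cv) * indicator {0..<h} t"
   proof (cases "t \<in> {0..<h}")
    case True
    have "(\<Sum>k<N. F n (real k * h + t)) <= ennreal (real (Suc n)) * curve_length cv" for N
    proof -
    define \<tau> where "\<tau> = (%k. real k * h + t)"
    have \<tau>S: "\<tau> (Suc k) = \<tau> k + h" for k by (simp add: \<tau>_def algebra_simps)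
    have "F n (\<tau> k) = ennreal (real (Suc n)) * ennreal (dist (at_time cv (\<tau> k)) (at_time cv (\<tau> (Suc k))))" for k
    unfolding F_def h_def[symmetric] \<tau>S by (simp add: ennreal_mult dist_commute del: of_nat_Suc)
    then have "(\<Sum>k<N. F n (real k * h + t)) = (\<Sum>k<N. ennreal (real (Suc n)) * ennreal (dist (at_time cv (\<tau> k)) (at_time cv (\<tau> (Suc k)))))"
    by (simp only: \<tau>_def)
    also have "... = ennreal (real (Suc n)) * (\<Sum>k<N. ennreal (dist (at_time cv (\<tau> k)) (at_time cv (\<tau> (Suc k)))))"
    by (rule sum_distrib_left[symmetric])
    also have "... <= ennreal (real (Suc n)) * curve_length cv"
    proof (rule mult_left_mono)
    have "(N, \<tau>) \<in> {(n::nat, t::nat => real). mono_on {..n} t \<and> t ` {..n} \<subseteq> {0..}}"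
    using h True by (auto simp: \<tau>_def mono_on_def mult_right_mono)
    then show "(\<Sum>k<N. ennreal (dist (at_time cv (\<tau> k)) (at_time cv (\<tau> (Suc k))))) <= curve_length cv"
    unfolding length_on_def by (rule SUP_upper2) simp
    qed simp
    finally show ?thesis .
    qed
    then have "(\<Sum>k. F n (real k * h + t)) <= ennreal (real (Suc n)) * curve_length cv"
    by (intro suminf_le_const) auto
    then show ?thesis using True by simp
   qed simp
  qed
  also have "... = (ennreal (real (Suc n)) * curve_length cv) * ennreal h"
   using h by (subst nn_integral_cmult_indicator) auto
  also have "... = (ennreal (real (Suc n)) * ennreal h) * curve_length cv" by (simp add: ac_simps)
  also have "ennreal (real (Suc n)) * ennreal h = 1" by (simp add: h_def ennreal_mult[symmetric] del: of_nat_Suc)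
  finally show ?thesis by simp
 qed
 have "(\<integral>\<^sup>+t. mspeed (at_time cv) t * indicator {0..} t \<partial>lborel) = (\<integral>\<^sup>+t. liminf (%n. F n t * indicator {0..} t) \<partial>lborel)"
  by (intro nn_integral_cong) (auto simp: mspeed_def F_def indicator_def Liminf_const)
 also have "... <= liminf (%n. \<integral>\<^sup>+t. F n t * indicator {0..} t \<partial>lborel)"
  by (rule nn_integral_liminf) measurable
 also have "... <= liminf (%n. curve_length cv)"
  by (rule Liminf_mono) (use est in auto)
 also have "... = curve_length cv" by (simp add: Liminf_const)
 finally show ?thesis .
qed

section \<open>Currents decomposed into curves\<close>

text \<open>This and the next three lemmas reduce integrals over a completion to Borel functions.\<close>
lemma measurable_completion_AE:
 fixes f g :: "'a => real"
 assumes g: "g \<in> borel_measurable M" and ae: "AE x in M. f x = g x"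
 shows "f \<in> borel_measurable (completion M)"
proof (rule measurableI)
 fix S :: "real set" assume S: "S \<in> sets borel"
 obtain N where N: "N \<in> null_sets M" and eq: "\<forall>x\<in>space M - N. f x = g x"
  using AE_imp_null_set[OF ae] by (rule bexE)
 have 1: "(g -` S \<inter> space M) - N \<in> sets (completion M)"
  using measurable_sets[OF g S] N by (intro sets.Diff sets_completionI_sets) auto
 have 2: "f -` S \<inter> space M \<inter> N \<in> null_sets (completion M)"
  by (rule null_sets_completion_subset[OF _ null_sets_completionI[OF N]]) auto
 have "f -` S \<inter> space (completion M) = ((g -` S \<inter> space M) - N) \<union> (f -` S \<inter> space M \<inter> N)"
  using eq by auto
 then show "f -` S \<inter> space (completion M) \<in> sets (completion M)"
  using sets.Un[OF 1 null_setsD2[OF 2]] by simp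
qed auto

lemma integral_completion_AE:
 fixes f g :: "'a => real"
 assumes g: "g \<in> borel_measurable M" and ae: "AE x in M. f x = g x"
 shows "integral\<^sup>L (completion M) f = integral\<^sup>L M g"
proof -
 have "integral\<^sup>L (completion M) f = integral\<^sup>L (completion M) g"
  using measurable_completion_AE[OF assms] measurable_completion[OF g] ae
  by (intro integral_cong_AE) (auto simp: AE_completion_iff)
 then show ?thesis using integral_completion[OF g] by simp
qed

lemma integrable_completion_AE:
 fixes f g :: "'a => real"
 assumes g: "integrable M g" and ae: "AE x in M. f x = g x"
 shows "integrable (completion M) f"
proof -
 have gm: "g \<in> borel_measurable M" using g by simp
 have "integrable (completion M) g" using g integrable_completion[OF gm] by simp
 then show ?thesis
  using measurable_completion_AE[OF gm ae] measurable_completion[OF gm] ae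
  by (subst integrable_cong_AE[of _ _ g]) (auto simp: AE_completion_iff)
qed

lemma has_bochner_integral_completion_AE:
 fixes f g :: "'a => real"
 assumes g: "has_bochner_integral M g c" and ae: "AE x in M. f x = g x"
 shows "has_bochner_integral (completion M) f c"
 using integrable_completion_AE[OF _ ae] integral_completion_AE[OF _ ae] g
 by (auto simp: has_bochner_integral_iff)

lemma Lip_lipschitz:
 assumes "lipschitz_fun \<pi>"
 shows "(Lip \<pi>)-lipschitz_on UNIV \<pi>"
proof (rule lipschitz_onI)
 have ne: "{L. L-lipschitz_on UNIV \<pi>} ~= {}" using assms by (auto simp: lipschitz_fun_def)
 show "0 <= Lip \<pi>" unfolding Lip_def using ne by (intro cInf_greatest) (auto dest: lipschitz_on_nonneg)
 fix x y
 show "dist (\<pi> x) (\<pi> y) <= Lip \<pi> * dist x y"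
 proof (cases "x = y")
  case False
  have "dist (\<pi> x) (\<pi> y) / dist x y <= Lip \<pi>"
   unfolding Lip_def using ne
  proof (rule cInf_greatest)
   fix L assume "L \<in> {L. L-lipschitz_on UNIV \<pi>}"
   then have "dist (\<pi> x) (\<pi> y) <= L * dist x y" by (auto dest: lipschitz_onD)
   then show "dist (\<pi> x) (\<pi> y) / dist x y <= L" using False by (simp add: divide_le_eq)
  qed
  then show ?thesis using False by (simp add: divide_le_eq)
 qed simp
qed

lemma Lip_le: "L-lipschitz_on UNIV \<pi> ==> Lip \<pi> <= L"
 unfolding Lip_def by (rule cInf_lower) (auto intro!: bdd_belowI[of _ 0] dest: lipschitz_on_nonneg)

definition ev :: "'a::metric_space curve \<times> real => 'a" where
 "ev p = at_time (fst p) (snd p)"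

definition rho :: "'a::metric_space curve \<times> real => ennreal" where
 "rho p = mspeed (at_time (fst p)) (snd p) * indicator {0..} (snd p)"

definition slope :: "('a::metric_space => real) => 'a curve \<times> real => real" where
 "slope \<pi> p = indicator {0..} (snd p) * diff_lim (%s. \<pi> (at_time (fst p) s)) (snd p)"

lemma ev_measurable: "(ev :: 'a::metric_space curve \<times> real => 'a) \<in> borel_measurable (borel \<Otimes>\<^sub>M borel)"
 using caratheodory_measurable[of "at_time :: 'a curve => _" borel, OF at_time_measurable at_time_continuous]
 by (simp add: ev_def[abs_def] case_prod_beta')

lemma rho_measurable: "(rho :: 'a::metric_space curve \<times> real => ennreal) \<in> borel_measurable (borel \<Otimes>\<^sub>M borel)"
proof -
 have "(%(cv::'a curve, t). real (Suc n) * dist (at_time cv (t + 1 / real (Suc n))) (at_time cv t)) \<in> borel_measurable (borel \<Otimes>\<^sub>M borel)"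
  for n :: nat
 proof (rule caratheodory_measurable)
  show "(%cv::'a curve. real (Suc n) * dist (at_time cv (t + 1 / real (Suc n))) (at_time cv t)) \<in> borel_measurable borel" for t
   by (intro borel_measurable_continuous_onI continuous_intros at_time_curve_continuous)
  show "continuous_on UNIV (%t. real (Suc n) * dist (at_time cv (t + 1 / real (Suc n))) (at_time cv t))" for cv :: "'a curve"
   by (intro continuous_intros continuous_on_compose2[OF at_time_continuous]) auto
 qed
 then have [measurable]: "(%p::'a curve \<times> real. real (Suc n) * dist (at_time (fst p) (snd p + 1 / real (Suc n))) (at_time (fst p) (snd p))) \<in> borel_measurable (borel \<Otimes>\<^sub>M borel)" for n
  by (simp add: case_prod_beta')
 show ?thesis unfolding rho_def[abs_def] mspeed_def by measurable
qed

lemma slope_measurable: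
 fixes \<pi> :: "'a::metric_space => real"
 assumes "lipschitz_fun \<pi>"
 shows "slope \<pi> \<in> borel_measurable (borel \<Otimes>\<^sub>M borel)"
proof -
 have c: "continuous_on UNIV \<pi>" using assms lipschitz_on_continuous_on unfolding lipschitz_fun_def by blast
 have "(%(cv::'a curve, t). real (Suc n) * (\<pi> (at_time cv (t + 1 / real (Suc n))) - \<pi> (at_time cv t))) \<in> borel_measurable (borel \<Otimes>\<^sub>M borel)"
  for n :: nat
 proof (rule caratheodory_measurable)
  show "(%cv::'a curve. real (Suc n) * (\<pi> (at_time cv (t + 1 / real (Suc n))) - \<pi> (at_time cv t))) \<in> borel_measurable borel" for t
   by (intro borel_measurable_continuous_onI continuous_intros continuous_on_compose2[OF c at_time_curve_continuous]) auto
  show "continuous_on UNIV (%t. real (Suc n) * (\<pi> (at_time cv (t + 1 / real (Suc n))) - \<pi> (at_time cv t)))" for cv :: "'a curve"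
   by (intro continuous_intros continuous_on_compose2[OF c] continuous_on_compose2[OF at_time_continuous]) auto
 qed
 then have [measurable]: "(%p::'a curve \<times> real. real (Suc n) * (\<pi> (at_time (fst p) (snd p + 1 / real (Suc n))) - \<pi> (at_time (fst p) (snd p)))) \<in> borel_measurable (borel \<Otimes>\<^sub>M borel)" for n
  by (simp add: case_prod_beta')
 show ?thesis unfolding slope_def[abs_def] diff_lim_def by measurable
qed

lemma curve_ac_differentiable_AE:
 fixes cv :: "'e::banach curve"
 assumes rnp: "radon_nikodym_property TYPE('e)" and ac: "!!b. b >= 0 ==> absolutely_continuous_curve_on {0..b} cv"
 shows "AE t in lborel. t > 0 --> (\<exists>v. (at_time cv has_vector_derivative v) (at t))"
 by (rule ac_differentiable_AE[OF rnp _ at_time_continuous])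
   (use ac in \<open>simp add: ac_on_def absolutely_continuous_curve_on_def\<close>)

lemma curve_ac_real_differentiable_AE:
 fixes cv :: "'e::banach curve" and \<pi> :: "'e => real"
 assumes rnp: "radon_nikodym_property TYPE('e)" and ac: "!!b. b >= 0 ==> absolutely_continuous_curve_on {0..b} cv"
  and \<pi>: "lipschitz_fun \<pi>"
 shows "AE t in lborel. t > 0 --> (\<exists>D. ((%s. \<pi> (at_time cv s)) has_real_derivative D) (at t))"
proof (cases "\<exists>v0::'e. v0 ~= 0")
 case True
 then obtain v0 :: 'e where v0: "v0 ~= 0" by blast
 obtain L where L: "L-lipschitz_on UNIV \<pi>" using \<pi> by (auto simp: lipschitz_fun_def)
 show ?thesis
 proof (rule ac_real_differentiable_AE[OF rnp v0])
  show "ac_on {0..b} (%s. \<pi> (at_time cv s))" if "b >= 0" for b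
   by (rule ac_on_lipschitz_image[OF _ L]) (use ac[OF that] in \<open>simp add: ac_on_def absolutely_continuous_curve_on_def\<close>)
  show "continuous_on UNIV (%s. \<pi> (at_time cv s))"
   by (rule continuous_on_compose2[OF lipschitz_on_continuous_on[OF L] at_time_continuous]) auto
 qed
next
 case False
 then have "at_time cv s = 0" for s by blast
 then have "(%s. \<pi> (at_time cv s)) = (%s. \<pi> 0)" by simp
 then have "((%s. \<pi> (at_time cv s)) has_real_derivative 0) (at t)" for t by simp
 then show ?thesis by (intro AE_I2) blast
qed

lemma absolutely_continuous_curve_mono:
 "absolutely_continuous_curve_on S cv ==> R \<subseteq> S ==> absolutely_continuous_curve_on R cv"
 unfolding absolutely_continuous_curve_on_def by (meson order_trans)

text \<open>A Lipschitz function has the same difference quotients along \<open>\<theta>\<close> and along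
  its tangent line.\<close>
lemma lipschitz_chain_derivative:
 fixes cv :: "real => 'e::real_normed_vector" and \<pi> :: "'e => real"
 assumes \<pi>: "L-lipschitz_on UNIV \<pi>" and v: "(cv has_vector_derivative v) (at t)"
  and D: "((%s. \<pi> (cv s)) has_real_derivative D) (at t)"
 shows "((%h. (\<pi> (cv t + h *\<^sub>R v) - \<pi> (cv t)) / h) \<longlongrightarrow> D) (at 0)" "\<bar>D\<bar> <= L * norm v"
proof -
 have 1: "((%h. (\<pi> (cv (t + h)) - \<pi> (cv t)) / h) \<longlongrightarrow> D) (at 0)"
  using D by (simp add: DERIV_def)
 have 2: "((%h. norm (cv (t + h) - cv t - h *\<^sub>R v) / norm h) \<longlongrightarrow> 0) (at 0)"
  using v unfolding has_vector_derivative_def has_derivative_at by blast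
 have 3: "((%h. (\<pi> (cv (t + h)) - \<pi> (cv t + h *\<^sub>R v)) / h) \<longlongrightarrow> 0) (at 0)"
 proof (rule Lim_null_comparison)
  show "((%h. L * (norm (cv (t + h) - cv t - h *\<^sub>R v) / norm h)) \<longlongrightarrow> 0) (at 0)"
   using tendsto_mult_left[OF 2, of L] by simp
  show "\<forall>\<^sub>F h in at 0. norm ((\<pi> (cv (t + h)) - \<pi> (cv t + h *\<^sub>R v)) / h) <= L * (norm (cv (t + h) - cv t - h *\<^sub>R v) / norm h)"
  proof (intro always_eventually allI)
   fix h
   have "\<bar>\<pi> (cv (t + h)) - \<pi> (cv t + h *\<^sub>R v)\<bar> <= L * norm (cv (t + h) - (cv t + h *\<^sub>R v))"
    using lipschitz_onD[OF \<pi>, of "cv (t + h)" "cv t + h *\<^sub>R v"] by (simp add: dist_real_def dist_norm)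
   then have "\<bar>\<pi> (cv (t + h)) - \<pi> (cv t + h *\<^sub>R v)\<bar> / \<bar>h\<bar> <= L * norm (cv (t + h) - (cv t + h *\<^sub>R v)) / \<bar>h\<bar>"
    by (rule divide_right_mono) simp
   then show "norm ((\<pi> (cv (t + h)) - \<pi> (cv t + h *\<^sub>R v)) / h) <= L * (norm (cv (t + h) - cv t - h *\<^sub>R v) / norm h)"
    by (simp add: abs_divide diff_diff_eq)
  qed
 qed
 have "(%h. (\<pi> (cv (t + h)) - \<pi> (cv t)) / h - (\<pi> (cv (t + h)) - \<pi> (cv t + h *\<^sub>R v)) / h) = (%h. (\<pi> (cv t + h *\<^sub>R v) - \<pi> (cv t)) / h)"
  by (auto simp: diff_divide_distrib)
 then show 4: "((%h. (\<pi> (cv t + h *\<^sub>R v) - \<pi> (cv t)) / h) \<longlongrightarrow> D) (at 0)"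
  using tendsto_diff[OF 1 3] by simp
 show "\<bar>D\<bar> <= L * norm v"
 proof (rule tendsto_upperbound[OF tendsto_rabs[OF 4]])
  show "\<forall>\<^sub>F h in at 0. \<bar>(\<pi> (cv t + h *\<^sub>R v) - \<pi> (cv t)) / h\<bar> <= L * norm v"
   unfolding eventually_at_filter
  proof (intro always_eventually allI impI)
   fix h :: real assume h: "h ~= 0"
   have "\<bar>\<pi> (cv t + h *\<^sub>R v) - \<pi> (cv t)\<bar> <= L * (\<bar>h\<bar> * norm v)"
    using lipschitz_onD[OF \<pi>, of "cv t + h *\<^sub>R v" "cv t"] by (simp add: dist_real_def dist_norm)
   then show "\<bar>(\<pi> (cv t + h *\<^sub>R v) - \<pi> (cv t)) / h\<bar> <= L * norm v" using h by (simp add: abs_divide field_simps)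
  qed
 qed simp
qed

text \<open>Replaces \<open>deriv\<close> by a function that is Borel in the curve as well.\<close>
lemma curve_current_eq:
 fixes cv :: "'a::metric_space curve"
 assumes d: "AE t in lborel. t > 0 --> (\<exists>D. ((%s. \<pi> (at_time cv s)) has_real_derivative D) (at t))"
  and f: "bounded_lipschitz f" and \<pi>: "lipschitz_fun \<pi>"
 shows "curve_current cv f \<pi> = (\<integral>t. f (at_time cv t) * slope \<pi> (cv, t) \<partial>lborel)"
 unfolding curve_current_def set_lebesgue_integral_def
proof (rule integral_completion_AE)
 have "slope \<pi> (cv, t) = indicator {0..} t * diff_lim (%s. \<pi> (at_time cv s)) t" for t by (simp add: slope_def)
 moreover have "diff_lim (%s. \<pi> (at_time cv s)) \<in> borel_measurable borel"
  using \<pi> unfolding lipschitz_fun_def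
  by (intro diff_lim_measurable continuous_on_compose2[OF _ at_time_continuous]) (auto dest: lipschitz_on_continuous_on)
 moreover have "(%t. f (at_time cv t)) \<in> borel_measurable borel"
  by (rule measurable_compose[OF at_time_borel bounded_lipschitz_borel[OF f]])
 ultimately show "(%t. f (at_time cv t) * slope \<pi> (cv, t)) \<in> borel_measurable lborel" by simp
 have "AE t in lborel. t ~= (0::real)" by (rule AE_lborel_singleton)
 with d show "AE t in lborel. indicator {0..} t *\<^sub>R (f (at_time cv t) * deriv (%s. \<pi> (at_time cv s)) t) = f (at_time cv t) * slope \<pi> (cv, t)"
 proof eventually_elim
  fix t :: real assume a: "t > 0 --> (\<exists>D. ((%s. \<pi> (at_time cv s)) has_real_derivative D) (at t))" and t: "t ~= 0"
  show "indicator {0..} t *\<^sub>R (f (at_time cv t) * deriv (%s. \<pi> (at_time cv s)) t) = f (at_time cv t) * slope \<pi> (cv, t)"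
  proof (cases "t > 0")
   case True
   then obtain D where D: "((%s. \<pi> (at_time cv s)) has_real_derivative D) (at t)" using a by blast
   show ?thesis using diff_lim_eq(1)[OF D] DERIV_imp_deriv[OF D] True by (simp add: slope_def)
  next
   case False
   then show ?thesis using t by (simp add: slope_def)
  qed
 qed
qed

text \<open>Evaluation maps a compact set of curves, taken over a bounded time interval, to a compact set;
  so the tightness of \<open>\<eta>\<close> is passed on.\<close>
lemma finite_borel_distr_evaluation:
 fixes N :: "('a::metric_space curve \<times> real) measure" and \<eta> :: "'a curve measure"
 assumes tb: "tight_borel \<eta>" and sN: "sets N = sets (borel \<Otimes>\<^sub>M borel)" and fin: "emeasure N (space N) < \<infinity>"
  and ae: "!!S. S \<in> sets borel ==> (AE cv in \<eta>. cv \<in> S) ==> (AE p in N. fst p \<in> S)"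
 shows "finite_borel (distr N borel ev)"
proof -
 have evm: "ev \<in> borel_measurable N" using ev_measurable by (simp add: measurable_cong_sets[OF sN refl])
 have f: "finite_measure (distr N borel ev)"
  by (rule finite_measureI) (use fin evm in \<open>simp add: emeasure_distr less_top[symmetric]\<close>)
 obtain K :: "nat => 'a curve set" where K: "!!n. compact (K n)" "AE cv in \<eta>. cv \<in> (\<Union>n. K n)"
  using tb unfolding tight_borel_def by auto
 have Kb: "(\<Union>n. K n) \<in> sets borel" using compact_imp_closed[OF K(1)] by auto
 have aeN: "AE p in N. fst p \<in> (\<Union>n. K n)" by (rule ae[OF Kb K(2)])
 define C where "C = (%i. case prod_decode i of (n, m) => ev ` (K n \<times> {- real m..real m}))"
 have cC: "compact (C i)" for i
 proof -
  have "compact (ev ` (K n \<times> {- real m..real m}))" for n m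
   unfolding ev_def
   by (intro compact_continuous_image continuous_on_subset[OF evaluation_continuous] compact_Times K compact_Icc) auto
  then show ?thesis unfolding C_def by (auto split: prod.split)
 qed
 define S where "S = (\<Union>i. C i)"
 have Cb: "S \<in> sets borel" unfolding S_def using compact_imp_closed[OF cC] by auto
 have "AE p in N. ev p \<in> S"
  using aeN
 proof eventually_elim
  fix p :: "'a curve \<times> real" assume "fst p \<in> (\<Union>n. K n)"
  then obtain n where n: "fst p \<in> K n" by blast
  obtain m :: nat where "\<bar>snd p\<bar> <= real m" using real_arch_simple by blast
  then have "ev p \<in> C (prod_encode (n, m))" unfolding C_def using n by (auto intro!: imageI simp: mem_Times_iff)
  then show "ev p \<in> S" unfolding S_def by blast
 qed
 then have "AE x in distr N borel ev. x \<in> S"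
  using evm Cb by (subst AE_distr_iff) auto
 then show ?thesis using f cC unfolding S_def finite_borel_def tight_borel_def by auto
qed

locale decomposed_current =
 fixes T :: "'e::banach functional" and \<eta> :: "'e curve measure"
 assumes rnp: "radon_nikodym_property TYPE('e)" and mc: "metric_current T"
  and tb: "tight_borel \<eta>" and sfin: "sigma_finite_measure \<eta>"
  and acE: "AE cv in \<eta>. absolutely_continuous_curve_on {0..} cv"
  and rep: "represents_current \<eta> T" and mass_eq: "mass T = (\<integral>\<^sup>+cv. curve_length cv \<partial>\<eta>)"
begin

abbreviation "P \<equiv> \<eta> \<Otimes>\<^sub>M (lborel :: real measure)"
abbreviation "\<mu>T \<equiv> mass_measure T"

lemma sets_\<eta>: "sets \<eta> = sets borel" using tb by (simp add: tight_borel_def)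
lemma space_\<eta>: "space \<eta> = UNIV" using sets_eq_imp_space_eq[OF sets_\<eta>] by simp
lemma sets_P: "sets P = sets (borel \<Otimes>\<^sub>M borel)" by (rule sets_pair_measure_cong[OF sets_\<eta>]) simp
lemma space_P: "space P = UNIV" by (simp add: space_pair_measure space_\<eta>)

lemma measurable_P: "f \<in> borel_measurable (borel \<Otimes>\<^sub>M borel) ==> f \<in> borel_measurable P"
 by (simp add: measurable_cong_sets[OF sets_P refl])

lemmas ev_P [measurable] = measurable_P[OF ev_measurable]
lemmas rho_P [measurable] = measurable_P[OF rho_measurable]
lemmas slope_P = measurable_P[OF slope_measurable]

sublocale pair_sigma_finite \<eta> lborel
 using sfin lborel.sigma_finite_measure_axioms by (simp add: pair_sigma_finite_def)

lemma \<mu>T_bound: "mass_bound T \<mu>T" by (rule mass_measure_minimal(1)[OF mc])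
lemma \<mu>T_finite_borel: "finite_borel \<mu>T" using \<mu>T_bound by (simp add: mass_bound_def)
lemma sets_\<mu>T: "sets \<mu>T = sets borel" and space_\<mu>T: "space \<mu>T = UNIV" and finite_\<mu>T: "finite_measure \<mu>T"
 using finite_borelD[OF \<mu>T_finite_borel] by auto

lemma measurable_\<mu>T: "f \<in> borel_measurable borel ==> f \<in> borel_measurable \<mu>T"
 by (simp add: measurable_cong_sets[OF sets_\<mu>T refl])

lemma curve_differentiable:
 "AE cv in \<eta>. AE t in lborel. t > 0 --> (\<exists>v. (at_time cv has_vector_derivative v) (at t))"
 using acE by eventually_elim (rule curve_ac_differentiable_AE[OF rnp absolutely_continuous_curve_mono], auto)

lemma curve_real_differentiable:
 assumes "lipschitz_fun \<pi>"
 shows "AE cv in \<eta>. AE t in lborel. t > 0 --> (\<exists>D. ((%s. \<pi> (at_time cv s)) has_real_derivative D) (at t))"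
 using acE by eventually_elim (rule curve_ac_real_differentiable_AE[OF rnp absolutely_continuous_curve_mono assms], auto)

lemma rho_integral: "(\<integral>\<^sup>+p. rho p \<partial>P) <= emeasure \<mu>T UNIV" "(\<integral>\<^sup>+p. rho p \<partial>P) < \<infinity>"
proof -
 have "(\<integral>\<^sup>+p. rho p \<partial>P) = (\<integral>\<^sup>+cv. \<integral>\<^sup>+t. rho (cv, t) \<partial>lborel \<partial>\<eta>)"
  by (rule lborel.nn_integral_fst[symmetric]) measurable
 also have "... <= (\<integral>\<^sup>+cv. curve_length cv \<partial>\<eta>)"
  using mspeed_integral_le_length by (intro nn_integral_mono) (simp add: rho_def)
 also have "... = emeasure \<mu>T UNIV" using mass_eq by (simp add: mass_def)
 finally show le: "(\<integral>\<^sup>+p. rho p \<partial>P) <= emeasure \<mu>T UNIV" .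
 interpret finite_measure \<mu>T by (rule finite_\<mu>T)
 show "(\<integral>\<^sup>+p. rho p \<partial>P) < \<infinity>" using le by (rule le_less_trans) (simp add: less_top[symmetric])
qed

definition rhor :: "'e curve \<times> real => real" where "rhor p = enn2real (rho p)"

lemma rhor_P [measurable]: "rhor \<in> borel_measurable P" unfolding rhor_def[abs_def] by measurable
lemma rhor_nonneg: "0 <= rhor p" by (simp add: rhor_def)
lemma rho_rhor: "AE p in P. rho p = ennreal (rhor p)"
proof -
 have "AE p in P. rho p ~= \<infinity>" using rho_integral(2) by (intro nn_integral_PInf_AE) auto
 then show ?thesis by eventually_elim (simp add: rhor_def less_top[symmetric])
qed
lemma rhor_integrable: "integrable P rhor"
proof (rule integrableI_nonneg)
 show "(\<integral>\<^sup>+p. ennreal (rhor p) \<partial>P) < \<infinity>"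
  using rho_integral(2) nn_integral_cong_AE[OF rho_rhor] by simp
qed (auto simp: rhor_nonneg)

lemma slope_le_rho:
 assumes \<pi>: "lipschitz_fun \<pi>"
 shows "AE p in P. \<bar>slope \<pi> p\<bar> <= Lip \<pi> * rhor p"
proof (rule AE_pair_measure)
 note [measurable] = slope_P[OF \<pi>]
 show "{p \<in> space P. \<bar>slope \<pi> p\<bar> <= Lip \<pi> * rhor p} \<in> sets P" by measurable
 note L = Lip_lipschitz[OF \<pi>]
 show "AE cv in \<eta>. AE t in lborel. \<bar>slope \<pi> (cv, t)\<bar> <= Lip \<pi> * rhor (cv, t)"
  using curve_differentiable curve_real_differentiable[OF \<pi>]
 proof eventually_elim
  fix cv assume 1: "AE t in lborel. t > 0 --> (\<exists>v. (at_time cv has_vector_derivative v) (at t))"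
   and 2: "AE t in lborel. t > 0 --> (\<exists>D. ((%s. \<pi> (at_time cv s)) has_real_derivative D) (at t))"
  have "AE t in lborel. t ~= (0::real)" by (rule AE_lborel_singleton)
  with 1 2 show "AE t in lborel. \<bar>slope \<pi> (cv, t)\<bar> <= Lip \<pi> * rhor (cv, t)"
  proof eventually_elim
   fix t :: real
   assume a: "t > 0 --> (\<exists>v. (at_time cv has_vector_derivative v) (at t))"
    and b: "t > 0 --> (\<exists>D. ((%s. \<pi> (at_time cv s)) has_real_derivative D) (at t))" and t: "t ~= 0"
   show "\<bar>slope \<pi> (cv, t)\<bar> <= Lip \<pi> * rhor (cv, t)"
   proof (cases "t > 0")
    case True
    obtain v where v: "(at_time cv has_vector_derivative v) (at t)" using a True by blast
    obtain D where D: "((%s. \<pi> (at_time cv s)) has_real_derivative D) (at t)" using b True by blast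
    show ?thesis using lipschitz_chain_derivative(2)[OF L v D] True
    by (simp add: slope_def rhor_def rho_def mspeed_eq[OF v] diff_lim_eq(1)[OF D])
   next
    case False
    then show ?thesis using t by (simp add: slope_def rhor_def rho_def)
   qed
  qed
 qed
qed

lemma slope_integrable:
 assumes f: "f \<in> borel_measurable borel" "!!x. \<bar>f x\<bar> <= B" and \<pi>: "lipschitz_fun \<pi>"
 shows "integrable P (%p. f (ev p) * slope \<pi> p)"
proof (rule Bochner_Integration.integrable_bound[OF integrable_mult_right[OF rhor_integrable, of "B * Lip \<pi>"]])
 note [measurable] = slope_P[OF \<pi>] f(1)
 show "(%p. f (ev p) * slope \<pi> p) \<in> borel_measurable P" by measurable
 have "0 <= B" using f(2)[of undefined] by linarith
 show "AE p in P. norm (f (ev p) * slope \<pi> p) <= norm (B * Lip \<pi> * rhor p)"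
  using slope_le_rho[OF \<pi>]
 proof eventually_elim
  fix p assume "\<bar>slope \<pi> p\<bar> <= Lip \<pi> * rhor p"
  then have "\<bar>f (ev p)\<bar> * \<bar>slope \<pi> p\<bar> <= B * (Lip \<pi> * rhor p)"
   using f(2) \<open>0 <= B\<close> by (intro mult_mono) auto
  also have "... <= \<bar>B * Lip \<pi> * rhor p\<bar>" by (simp add: mult.assoc)
  finally show "norm (f (ev p) * slope \<pi> p) <= norm (B * Lip \<pi> * rhor p)" by (simp add: abs_mult)
 qed
qed

lemma bounded_lipschitzE:
 fixes f :: "'a::metric_space => real"
 assumes "bounded_lipschitz f" obtains B where "f \<in> borel_measurable borel" "!!x. \<bar>f x\<bar> <= B"
proof -
 obtain B where "!!x. \<bar>f x\<bar> <= B" using assms unfolding bounded_lipschitz_def bounded_iff by auto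
 then show ?thesis using bounded_lipschitz_borel[OF assms] that by blast
qed

lemma T_as_integral:
 assumes f: "bounded_lipschitz f" and \<pi>: "lipschitz_fun \<pi>"
 shows "T f \<pi> = (\<integral>p. f (ev p) * slope \<pi> p \<partial>P)"
proof -
 obtain B where B: "f \<in> borel_measurable borel" "!!x. \<bar>f x\<bar> <= B" using bounded_lipschitzE[OF f] by blast
 have i: "integrable P (%p. f (ev p) * slope \<pi> p)" by (rule slope_integrable[OF B \<pi>])
 have "AE cv in \<eta>. curve_current cv f \<pi> = (\<integral>t. f (ev (cv, t)) * slope \<pi> (cv, t) \<partial>lborel)"
  using curve_real_differentiable[OF \<pi>] by eventually_elim (simp add: curve_current_eq[OF _ f \<pi>] ev_def)
 then have "integral\<^sup>L (completion \<eta>) (%cv. curve_current cv f \<pi>) = (\<integral>cv. \<integral>t. f (ev (cv, t)) * slope \<pi> (cv, t) \<partial>lborel \<partial>\<eta>)"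
  using integrable_fst'[OF i] by (intro integral_completion_AE) auto
 also have "... = (\<integral>p. f (ev p) * slope \<pi> p \<partial>P)" by (rule integral_fst'[OF i])
 finally show ?thesis
  using rep f \<pi> unfolding represents_current_def by (metis has_bochner_integral_integral_eq)
qed

text \<open>The measure \<open>|\<theta>'(t)| dt d\<eta>(\<theta>)\<close>, transported to the space by
  evaluation.\<close>
definition image_measure :: "'e measure" where "image_measure = distr (density P rho) borel ev"

lemma emeasure_image: "A \<in> sets borel ==> emeasure image_measure A = (\<integral>\<^sup>+p. rho p * indicator A (ev p) \<partial>P)"
proof -
 assume A: "A \<in> sets borel"
 have "ev -` A \<inter> space P \<in> sets P" by (rule measurable_sets[OF ev_P A])
 then show ?thesis
  unfolding image_measure_def using A
  by (subst emeasure_distr) (auto simp: emeasure_density intro!: nn_integral_cong simp: indicator_def space_P)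
qed

lemma finite_borel_image: "finite_borel image_measure"
 unfolding image_measure_def
proof (rule finite_borel_distr_evaluation[OF tb])
 show "sets (density P rho) = sets (borel \<Otimes>\<^sub>M borel)" by (simp only: sets_density sets_P)
 have "emeasure (density P rho) UNIV = (\<integral>\<^sup>+p. rho p \<partial>P)"
  using sets.top[of P] by (subst emeasure_density) (auto simp: space_P)
 then show "emeasure (density P rho) (space (density P rho)) < \<infinity>" using rho_integral(2) by (simp add: space_P)
 fix S :: "'e curve set" assume S: "S \<in> sets borel" and ae: "AE cv in \<eta>. cv \<in> S"
 have [measurable]: "S \<in> sets \<eta>" using S sets_\<eta> by simp
 have "AE p in P. fst p \<in> S"
 proof (rule AE_pair_measure)
  show "{p \<in> space P. fst p \<in> S} \<in> sets P" by measurable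
  show "AE cv in \<eta>. AE t in lborel. fst (cv, t) \<in> S" using ae by eventually_elim simp
 qed
 then show "AE p in density P rho. fst p \<in> S"
  by (subst AE_density) (auto elim: eventually_mono)
qed

lemma integral_image:
 fixes f :: "'e => real"
 assumes f: "f \<in> borel_measurable borel"
 shows "(\<integral>x. f x \<partial>image_measure) = (\<integral>p. rhor p * f (ev p) \<partial>P)"
proof -
 have [measurable]: "f \<in> borel_measurable borel" by (rule f)
 have "density P rho = density P (%p. ennreal (rhor p))" using rho_rhor by (intro density_cong) auto
 then have "image_measure = distr (density P (%p. ennreal (rhor p))) borel ev" by (simp add: image_measure_def)
 then show ?thesis by (simp add: integral_distr integral_density rhor_nonneg)
qed

lemma mass_bound_image: "mass_bound T image_measure"
 unfolding mass_bound_def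
proof (intro conjI allI impI finite_borel_image)
 fix f \<pi> :: "'e => real" assume f: "bounded_lipschitz f" and \<pi>: "lipschitz_fun \<pi>"
 obtain B where B: "f \<in> borel_measurable borel" "!!x. \<bar>f x\<bar> <= B" using bounded_lipschitzE[OF f] by blast
 have [measurable]: "f \<in> borel_measurable borel" by (rule B)
 have L0: "0 <= Lip \<pi>" by (rule lipschitz_on_nonneg[OF Lip_lipschitz[OF \<pi>]])
 have i: "integrable P (%p. rhor p * \<bar>f (ev p)\<bar>)"
  by (rule integral_dominated(1)[OF integrable_mult_left[OF rhor_integrable, of B]])
    (use B(2) rhor_nonneg in \<open>auto simp: abs_mult intro!: AE_I2 mult_left_mono\<close>)
 have "AE p in P. \<bar>f (ev p) * slope \<pi> p\<bar> <= Lip \<pi> * (rhor p * \<bar>f (ev p)\<bar>)"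
  using slope_le_rho[OF \<pi>]
 proof eventually_elim
  fix p assume "\<bar>slope \<pi> p\<bar> <= Lip \<pi> * rhor p"
  then have "\<bar>f (ev p)\<bar> * \<bar>slope \<pi> p\<bar> <= \<bar>f (ev p)\<bar> * (Lip \<pi> * rhor p)" by (intro mult_left_mono) auto
  then show "\<bar>f (ev p) * slope \<pi> p\<bar> <= Lip \<pi> * (rhor p * \<bar>f (ev p)\<bar>)" by (simp add: abs_mult mult_ac)
 qed
 from integral_dominated(2)[OF integrable_mult_right[OF i] borel_measurable_integrable[OF slope_integrable[OF B \<pi>]] this]
 have "\<bar>T f \<pi>\<bar> <= (\<integral>p. Lip \<pi> * (rhor p * \<bar>f (ev p)\<bar>) \<partial>P)" unfolding T_as_integral[OF f \<pi>] .
 also have "... = Lip \<pi> * (\<integral>x. \<bar>f x\<bar> \<partial>image_measure)"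
  using integral_image[of "%x. \<bar>f x\<bar>"] by simp
 finally show "\<bar>T f \<pi>\<bar> <= Lip \<pi> * (\<integral>x. \<bar>f x\<bar> \<partial>image_measure)" .
qed

text \<open>The image measure bounds \<open>T\<close>, so it is at least the mass measure; its total mass
  is at most the integral of the lengths, which is the mass of \<open>T\<close>.\<close>
lemma mass_measure_eq_image: "\<mu>T = image_measure"
proof (rule measure_eqI)
 note I = finite_borelD[OF finite_borel_image]
 interpret I: finite_measure image_measure by (rule I)
 interpret M: finite_measure \<mu>T by (rule finite_\<mu>T)
 show "sets \<mu>T = sets image_measure" by (simp add: sets_\<mu>T I)
 fix A assume "A \<in> sets \<mu>T"
 then have A: "A \<in> sets borel" "- A \<in> sets borel" by (auto simp: sets_\<mu>T)
 have le: "measure \<mu>T S <= measure image_measure S" if "S \<in> sets borel" for S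
  using mass_measure_minimal(2)[OF mc mass_bound_image that] by (simp add: M.emeasure_eq_measure I.emeasure_eq_measure)
 have "emeasure image_measure UNIV <= emeasure \<mu>T UNIV" using rho_integral(1) by (subst emeasure_image) auto
 then have "measure image_measure UNIV <= measure \<mu>T UNIV" by (simp add: M.emeasure_eq_measure I.emeasure_eq_measure)
 moreover have "measure image_measure (A \<union> - A) = measure image_measure A + measure image_measure (- A)"
  using A I by (intro I.finite_measure_Union) auto
 moreover have "measure \<mu>T (A \<union> - A) = measure \<mu>T A + measure \<mu>T (- A)"
  using A sets_\<mu>T by (intro M.finite_measure_Union) auto
 ultimately have "measure image_measure A <= measure \<mu>T A" using le[OF A(2)] by (simp add: Compl_partition)
 then show "emeasure \<mu>T A = emeasure image_measure A"
  using le[OF A(1)] by (simp add: M.emeasure_eq_measure I.emeasure_eq_measure)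
qed

end

section \<open>The curves follow the field\<close>

lemma quasi_deriv_eq:
 fixes \<phi> :: "'e::real_normed_vector => real"
 assumes D: "has_quasi_derivative \<phi> D x"
 shows "quasi_deriv \<phi> x = D"
 unfolding quasi_deriv_def
proof (rule the_equality)
 show "has_quasi_derivative \<phi> D x" by (rule D)
 fix D' assume D': "has_quasi_derivative \<phi> D' x"
 show "D' = D"
 proof (rule blinfun_eqI)
  fix v
  have c: "continuous_on UNIV (%s::real. x + s *\<^sub>R v)" by (intro continuous_intros)
  have d: "((%s::real. x + s *\<^sub>R v) has_vector_derivative v) (at 0)" by (auto intro!: derivative_eq_intros)
  have "((%s. \<phi> (x + s *\<^sub>R v)) has_real_derivative blinfun_apply D v) (at 0)"
   using D c d unfolding has_quasi_derivative_def by force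
  moreover have "((%s. \<phi> (x + s *\<^sub>R v)) has_real_derivative blinfun_apply D' v) (at 0)"
   using D' c d unfolding has_quasi_derivative_def by force
  ultimately show "blinfun_apply D' v = blinfun_apply D v" by (rule DERIV_unique[symmetric])
 qed
qed

lemma blinfun_has_quasi_derivative: "has_quasi_derivative (blinfun_apply y) y x"
 unfolding has_quasi_derivative_def has_real_derivative_iff_has_vector_derivative
 by (auto intro: bounded_linear.has_vector_derivative[OF blinfun.bounded_linear_right])

lemma blinfun_Q1:
 fixes y :: "'e::real_normed_vector \<Rightarrow>\<^sub>L real"
 shows "blinfun_apply y \<in> Q1" "quasi_deriv (blinfun_apply y) x = y"
proof -
 show q: "quasi_deriv (blinfun_apply y) x = y" for x by (rule quasi_deriv_eq[OF blinfun_has_quasi_derivative])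
 have "continuous_on UNIV (%p::'e \<times> 'e. blinfun_apply y (snd p))" by (intro continuous_intros)
 moreover have "bounded (range (%x::'e. y))" by (simp add: image_constant_conv)
 ultimately show "blinfun_apply y \<in> Q1"
  unfolding Q1_def using blinfun_has_quasi_derivative by (auto simp: q case_prod_beta' cong: image_cong)
qed

lemma blinfun_lipschitz: "(norm y)-lipschitz_on UNIV (blinfun_apply y)"
proof (rule lipschitz_onI)
 fix u v show "dist (blinfun_apply y u) (blinfun_apply y v) <= norm y * dist u v"
  unfolding dist_norm blinfun.diff_right[symmetric] by (rule norm_blinfun)
qed simp

text \<open>A functional that almost norms \<open>V\<close> and the direction of \<open>v\<close> shows
  that the norm of their midpoint is almost one.\<close>
lemma strictly_convex_direction:
 fixes v V :: "'e::real_normed_vector"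
 assumes sc: "strictly_convex_norm TYPE('e)" and V: "norm V = 1"
  and y: "!!\<epsilon>. \<epsilon> > 0 ==> \<exists>y::'e \<Rightarrow>\<^sub>L real. (\<forall>x. \<bar>blinfun_apply y x\<bar> <= norm x) \<and> norm v - blinfun_apply y v < \<epsilon> \<and> blinfun_apply y V >= 1 - \<epsilon>"
 shows "v = norm v *\<^sub>R V"
proof (cases "v = 0")
 case False
 define u where "u = (1 / norm v) *\<^sub>R v"
 have u: "norm u = 1" using False by (simp add: u_def)
 have "u = V"
 proof (rule ccontr)
  assume ne: "u ~= V"
  define w where "w = (1 - 1/2) *\<^sub>R u + (1/2) *\<^sub>R V"
  have w: "norm w < 1" using sc[unfolded strictly_convex_norm_def, rule_format, OF u V ne, of "1/2"] by (simp add: w_def)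
  define a where "a = 1 + 1 / norm v"
  have a: "a > 0" using False by (simp add: a_def add_pos_pos)
  define \<epsilon> where "\<epsilon> = (1 - norm w) / a"
  have e: "\<epsilon> > 0" using w a by (simp add: \<epsilon>_def)
  obtain y :: "'e \<Rightarrow>\<^sub>L real" where yy: "!!x. \<bar>blinfun_apply y x\<bar> <= norm x" "norm v - blinfun_apply y v < \<epsilon>" "blinfun_apply y V >= 1 - \<epsilon>"
   using y[OF e] by blast
  have "blinfun_apply y u = blinfun_apply y v / norm v" by (simp add: u_def blinfun.scaleR_right)
  moreover have "blinfun_apply y v / norm v >= (norm v - \<epsilon>) / norm v" using yy(2) by (intro divide_right_mono) auto
  ultimately have yu: "blinfun_apply y u >= 1 - \<epsilon> / norm v" using False by (simp add: diff_divide_distrib)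
  have yw: "2 * blinfun_apply y w = blinfun_apply y u + blinfun_apply y V"
   by (simp add: w_def blinfun.add_right blinfun.scaleR_right)
  have "\<epsilon> / norm v + \<epsilon> = \<epsilon> * a" by (simp add: a_def algebra_simps)
  also have "\<epsilon> * a = 1 - norm w" using a by (simp add: \<epsilon>_def)
  finally have "2 * blinfun_apply y w >= 2 - (1 - norm w)" using yw yu yy(3) by (simp only:)
  moreover have "blinfun_apply y w <= norm w" using yy(1)[of w] by (rule order_trans[OF abs_ge_self])
  ultimately show False using w by simp
 qed
 then have "norm v *\<^sub>R V = norm v *\<^sub>R u" by simp
 then show ?thesis using False by (simp add: u_def)
qed simp

locale decomposed_field = decomposed_current T \<eta> for T :: "'e::banach functional" and \<eta> +
 fixes V :: "'e => 'e"
 assumes sc: "strictly_convex_norm TYPE('e)" and Vm: "V \<in> borel_measurable borel"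
  and V1: "AE x in mass_measure T. norm (V x) = 1" and Vfield: "current_has_field T V"
begin

lemma functional_of_field_measurable: "(%x. blinfun_apply y (V x)) \<in> borel_measurable borel"
proof (rule measurable_compose[OF Vm])
 show "blinfun_apply y \<in> borel_measurable borel"
  by (rule borel_measurable_continuous_onI) (intro continuous_intros)
qed

lemma T_of_functional:
 assumes f: "bounded_lipschitz f"
 shows "T f (blinfun_apply y) = (\<integral>x. f x * blinfun_apply y (V x) \<partial>\<mu>T)"
proof -
 have l: "lipschitz_fun (blinfun_apply y)" using blinfun_lipschitz unfolding lipschitz_fun_def by blast
 have m: "(%x. f x * blinfun_apply y (V x)) \<in> borel_measurable \<mu>T"
  by (intro measurable_\<mu>T borel_measurable_times bounded_lipschitz_borel[OF f] functional_of_field_measurable)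
 have "has_bochner_integral (completion \<mu>T) (%x. f x * blinfun_apply (quasi_deriv (blinfun_apply y) x) (V x)) (T f (blinfun_apply y))"
  using Vfield f l blinfun_Q1(1) unfolding current_has_field_def by blast
 then show ?thesis unfolding blinfun_Q1(2) using integral_completion[OF m] by (simp add: has_bochner_integral_iff)
qed

text \<open>For the linear function \<open>y\<close>, the value \<open>T (f dy)\<close> is computed from
  the field and from the curves. The identity passes from bounded Lipschitz \<open>f\<close> to
  indicators since both sides are bounded by \<open>norm y\<close> times the integral of
  \<open>|f|\<close>.\<close>
lemma field_average:
 assumes A: "A \<in> sets borel"
 shows "(\<integral>x. indicator A x * blinfun_apply y (V x) \<partial>\<mu>T) = (\<integral>p. indicator A (ev p) * slope (blinfun_apply y) p \<partial>P)"
proof -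
 interpret M: finite_measure \<mu>T by (rule finite_\<mu>T)
 define u where "u = (%x. blinfun_apply y (V x))"
 define s where "s = slope (blinfun_apply y)"
 have l: "lipschitz_fun (blinfun_apply y)" using blinfun_lipschitz unfolding lipschitz_fun_def by blast
 have um[measurable]: "u \<in> borel_measurable \<mu>T" unfolding u_def by (rule measurable_\<mu>T[OF functional_of_field_measurable])
 have sm[measurable]: "s \<in> borel_measurable P" unfolding s_def by (rule slope_P[OF l])
 have U: "integrable \<mu>T (%x. g x * u x)" "\<bar>\<integral>x. g x * u x \<partial>\<mu>T\<bar> <= norm y * (\<integral>x. \<bar>g x\<bar> \<partial>\<mu>T)"
  and S: "integrable P (%p. g (ev p) * s p)" "\<bar>\<integral>p. g (ev p) * s p \<partial>P\<bar> <= norm y * (\<integral>x. \<bar>g x\<bar> \<partial>\<mu>T)"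
  if g[measurable]: "g \<in> borel_measurable borel" and g1: "!!x. \<bar>g x\<bar> <= 1" for g :: "'e => real"
 proof -
  have gT[measurable]: "g \<in> borel_measurable \<mu>T" by (rule measurable_\<mu>T[OF g])
  have ig: "integrable \<mu>T (%x. norm y * \<bar>g x\<bar>)"
   using g1 by (intro integrable_mult_right M.integrable_const_bound[of _ 1]) auto
  have "AE x in \<mu>T. \<bar>g x * u x\<bar> <= norm y * \<bar>g x\<bar>"
   using V1
  proof eventually_elim
   fix x assume "norm (V x) = 1"
   then have "\<bar>g x\<bar> * \<bar>u x\<bar> <= \<bar>g x\<bar> * norm y" using norm_blinfun[of y "V x"] by (intro mult_left_mono) (auto simp: u_def)
   then show "\<bar>g x * u x\<bar> <= norm y * \<bar>g x\<bar>" by (simp add: abs_mult mult.commute)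
  qed
  from integral_dominated[OF ig _ this]
  show "integrable \<mu>T (%x. g x * u x)" "\<bar>\<integral>x. g x * u x \<partial>\<mu>T\<bar> <= norm y * (\<integral>x. \<bar>g x\<bar> \<partial>\<mu>T)" by simp_all
  have ir: "integrable P (%p. rhor p * \<bar>g (ev p)\<bar>)"
   by (rule integral_dominated(1)[OF rhor_integrable]) (use g1 rhor_nonneg in \<open>auto simp: abs_mult intro!: AE_I2 mult_left_le\<close>)
  have "AE p in P. \<bar>g (ev p) * s p\<bar> <= norm y * (rhor p * \<bar>g (ev p)\<bar>)"
   using slope_le_rho[OF l]
  proof eventually_elim
   fix p assume "\<bar>slope (blinfun_apply y) p\<bar> <= Lip (blinfun_apply y) * rhor p"
   also have "... <= norm y * rhor p" by (intro mult_right_mono Lip_le blinfun_lipschitz rhor_nonneg)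
   finally have "\<bar>g (ev p)\<bar> * \<bar>s p\<bar> <= \<bar>g (ev p)\<bar> * (norm y * rhor p)" unfolding s_def by (intro mult_left_mono) auto
   then show "\<bar>g (ev p) * s p\<bar> <= norm y * (rhor p * \<bar>g (ev p)\<bar>)" by (simp add: abs_mult mult_ac)
  qed
  from integral_dominated[OF integrable_mult_right[OF ir] _ this]
  show "integrable P (%p. g (ev p) * s p)" "\<bar>\<integral>p. g (ev p) * s p \<partial>P\<bar> <= norm y * (\<integral>x. \<bar>g x\<bar> \<partial>\<mu>T)"
   using integral_image[of "%x. \<bar>g x\<bar>"] by (simp_all add: mass_measure_eq_image)
 qed
 have close: "\<bar>(\<integral>x. indicator A x * u x \<partial>\<mu>T) - (\<integral>p. indicator A (ev p) * s p \<partial>P)\<bar> <= 2 * norm y * e" if e: "e > 0" for e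
 proof -
  obtain h where h: "bounded_lipschitz h" "!!x. 0 <= h x \<and> h x <= 1" "(\<integral>x. \<bar>h x - indicator A x\<bar> \<partial>\<mu>T) < e"
   using lipschitz_approx_indicator[OF finite_\<mu>T sets_\<mu>T finite_\<mu>T sets_\<mu>T A e] by blast
  have [measurable]: "h \<in> borel_measurable borel" "A \<in> sets borel" by (rule bounded_lipschitz_borel[OF h(1)], rule A)
  have b: "\<bar>h x\<bar> <= 1" "\<bar>h x - indicator A x\<bar> <= 1" "\<bar>indicator A x :: real\<bar> <= 1" for x using h(2)[of x] by (auto simp: indicator_def)
  have m: "h \<in> borel_measurable borel" "(%x. h x - indicator A x) \<in> borel_measurable borel" "(indicator A :: 'e => real) \<in> borel_measurable borel" by measurable
  have "(\<integral>x. (h x - indicator A x) * u x \<partial>\<mu>T) = (\<integral>x. h x * u x \<partial>\<mu>T) - (\<integral>x. indicator A x * u x \<partial>\<mu>T)"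
   using U(1)[OF m(1) b(1)] U(1)[OF m(3) b(3)] by (simp add: left_diff_distrib)
  moreover have "(\<integral>p. (h (ev p) - indicator A (ev p)) * s p \<partial>P) = (\<integral>p. h (ev p) * s p \<partial>P) - (\<integral>p. indicator A (ev p) * s p \<partial>P)"
   using S(1)[OF m(1) b(1)] S(1)[OF m(3) b(3)] by (simp add: left_diff_distrib)
  moreover have "(\<integral>x. h x * u x \<partial>\<mu>T) = (\<integral>p. h (ev p) * s p \<partial>P)"
   using T_of_functional[OF h(1), of y] T_as_integral[OF h(1) l] by (simp add: u_def s_def)
  moreover have "norm y * (\<integral>x. \<bar>h x - indicator A x\<bar> \<partial>\<mu>T) <= norm y * e" using h(3) by (intro mult_left_mono) auto
  ultimately show ?thesis using U(2)[OF m(2) b(2)] S(2)[OF m(2) b(2)] by linarith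
 qed
 have "\<bar>(\<integral>x. indicator A x * u x \<partial>\<mu>T) - (\<integral>p. indicator A (ev p) * s p \<partial>P)\<bar> <= 0"
 proof (rule field_le_epsilon)
  fix e :: real assume e: "e > 0"
  define d where "d = e / (2 * norm y + 1)"
  have "2 * norm y + 1 > 0" by (simp add: add_nonneg_pos)
  then have "d > 0" "(2 * norm y + 1) * d = e" using e by (simp_all add: d_def)
  then show "\<bar>(\<integral>x. indicator A x * u x \<partial>\<mu>T) - (\<integral>p. indicator A (ev p) * s p \<partial>P)\<bar> <= 0 + e"
   using close[of d] unfolding distrib_right by linarith
 qed
 then show ?thesis by (simp add: u_def s_def)
qed

lemma image_null:
 assumes "N \<in> null_sets \<mu>T"
 shows "AE p in P. rho p = 0 \<or> ev p \<notin> N"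
proof -
 have N: "N \<in> sets borel" using assms sets_\<mu>T by auto
 then have [measurable]: "N \<in> sets borel" .
 have "(\<integral>\<^sup>+p. rho p * indicator N (ev p) \<partial>P) = 0"
  using assms emeasure_image[OF N] unfolding mass_measure_eq_image[symmetric] by auto
 then have "AE p in P. rho p * indicator N (ev p) = 0" by (subst (asm) nn_integral_0_iff_AE) auto
 then show ?thesis by eventually_elim (auto simp: indicator_def split: if_splits)
qed

text \<open>Let \<open>y i\<close> norm the \<open>i\<close>-th point \<open>c i\<close> of a countable
  set that is dense in the range of \<open>V\<close>, and let \<open>A k i\<close> be the part
  of the space where \<open>c i\<close> is the first point at distance less than
  \<open>1/(k+1)\<close> from \<open>V\<close>. There \<open>y i (V x)\<close> is almost 1, so
  the deficit \<open>|\<theta>'| - y i (\<theta>')\<close>, which is nonnegative, has a small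
  integral. Hence along a curve some functional almost norms both \<open>\<theta>'\<close> and
  \<open>V\<close>, and strict convexity gives the direction of \<open>\<theta>'\<close>.\<close>
lemma curves_tangent_to_field:
 "AE cv in \<eta>. AE t in lborel. t > 0 -->
   (\<exists>v. (at_time cv has_vector_derivative v) (at t) \<and> v = norm v *\<^sub>R V (at_time cv t))"
proof -
 interpret M: finite_measure \<mu>T by (rule finite_\<mu>T)
 obtain C0 where C0: "countable C0" "AE x in \<mu>T. V x \<in> closure C0"
  using borel_map_essentially_separable[OF \<mu>T_finite_borel Vm] by blast
 define C where "C = insert 0 C0"
 have C: "countable C" "C ~= {}" "closure C0 \<subseteq> closure C" using C0(1) by (auto simp: C_def intro!: closure_mono)
 define c where "c = from_nat_into C"
 have rc: "range c = C" unfolding c_def by (rule range_from_nat_into[OF C(2,1)])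
 have "\<forall>i. \<exists>y::'e \<Rightarrow>\<^sub>L real. (\<forall>x. \<bar>blinfun_apply y x\<bar> <= norm x) \<and> blinfun_apply y (c i) = norm (c i)"
  using norming_functional_exists by blast
 from choice[OF this] obtain y where y: "!!i x. \<bar>blinfun_apply (y i) x\<bar> <= norm x" "!!i. blinfun_apply (y i) (c i) = norm (c i)" by blast
 have yl: "1-lipschitz_on UNIV (blinfun_apply (y i))" for i
  by (rule lipschitz_onI) (use y(1) in \<open>auto simp: dist_norm blinfun.diff_right[symmetric]\<close>)
 have ylf: "lipschitz_fun (blinfun_apply (y i))" for i using yl unfolding lipschitz_fun_def by blast
 have yL: "Lip (blinfun_apply (y i)) <= 1" for i by (rule Lip_le[OF yl])
 define A where "A = (%k i. {x. dist (V x) (c i) < 1 / real (Suc k) \<and> (\<forall>j<i. \<not> dist (V x) (c j) < 1 / real (Suc k))})"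
 have [measurable]: "(%x. dist (V x) (c i)) \<in> borel_measurable borel" for i
  by (rule measurable_compose[OF Vm]) (intro borel_measurable_continuous_onI continuous_intros)
 have Ab: "A k i \<in> sets borel" for k i
 proof -
  have "{x\<in>space borel. dist (V x) (c i) < 1 / real (Suc k) \<and> (\<forall>j\<in>{..<i}. \<not> dist (V x) (c j) < 1 / real (Suc k))} \<in> sets borel"
   by measurable
  then show ?thesis by (simp add: A_def lessThan_def)
 qed
 have disj: "disjoint_family (A k)" for k
  unfolding disjoint_family_on_def A_def by (auto; metis linorder_neqE_nat)
 define r where "r = (%k i p. indicator (A k i) (ev p) * ennreal (rhor p - slope (blinfun_apply (y i)) p))"
 note [measurable] = slope_P[OF ylf]
 have rm[measurable]: "r k i \<in> borel_measurable P" for k i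
  unfolding r_def using Ab[of k i] by measurable
 have rint: "(\<integral>\<^sup>+p. r k i p \<partial>P) <= ennreal (2 / real (Suc k)) * emeasure \<mu>T (A k i)" for k i
 proof -
  note Am[measurable] = Ab[of k i]
  have AmT[measurable]: "A k i \<in> sets \<mu>T" using Ab sets_\<mu>T by simp
  have i1: "integrable P (%p. indicator (A k i) (ev p) * slope (blinfun_apply (y i)) p)"
   by (rule slope_integrable[where B=1, OF _ _ ylf]) (auto simp: indicator_def)
  have i2: "integrable P (%p. rhor p * indicator (A k i) (ev p))"
   by (rule Bochner_Integration.integrable_bound[OF rhor_integrable]) (auto simp: indicator_def rhor_nonneg)
  have nn: "AE p in P. 0 <= rhor p - slope (blinfun_apply (y i)) p"
   using slope_le_rho[OF ylf[of i]]
  proof eventually_elim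
   fix p assume "\<bar>slope (blinfun_apply (y i)) p\<bar> <= Lip (blinfun_apply (y i)) * rhor p"
   moreover have "Lip (blinfun_apply (y i)) * rhor p <= 1 * rhor p" by (rule mult_right_mono[OF yL rhor_nonneg])
   ultimately show "0 <= rhor p - slope (blinfun_apply (y i)) p" by linarith
  qed
  have "(\<integral>\<^sup>+p. r k i p \<partial>P) = (\<integral>\<^sup>+p. ennreal (rhor p * indicator (A k i) (ev p) - indicator (A k i) (ev p) * slope (blinfun_apply (y i)) p) \<partial>P)"
   by (intro nn_integral_cong) (auto simp: r_def indicator_def)
  also have "... = ennreal (\<integral>p. rhor p * indicator (A k i) (ev p) - indicator (A k i) (ev p) * slope (blinfun_apply (y i)) p \<partial>P)"
  proof (rule nn_integral_eq_integral)
   show "AE p in P. 0 <= rhor p * indicator (A k i) (ev p) - indicator (A k i) (ev p) * slope (blinfun_apply (y i)) p"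
    using nn by eventually_elim (auto simp: indicator_def)
  qed (use i1 i2 in auto)
  also have "(\<integral>p. rhor p * indicator (A k i) (ev p) - indicator (A k i) (ev p) * slope (blinfun_apply (y i)) p \<partial>P)
   = (\<integral>x. indicator (A k i) x \<partial>\<mu>T) - (\<integral>x. indicator (A k i) x * blinfun_apply (y i) (V x) \<partial>\<mu>T)"
   unfolding field_average[OF Ab] using i1 i2 integral_image[of "indicator (A k i)"]
   by (simp add: mass_measure_eq_image[symmetric] indicator_def)
  also have "... <= 2 / real (Suc k) * measure \<mu>T (A k i)"
  proof -
   have um: "(%x. blinfun_apply (y i) (V x)) \<in> borel_measurable \<mu>T" by (rule measurable_\<mu>T[OF functional_of_field_measurable])
   have j1: "integrable \<mu>T (%x. indicator (A k i) x * blinfun_apply (y i) (V x))"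
   proof (rule M.integrable_const_bound[of _ 1])
    show "AE x in \<mu>T. norm (indicator (A k i) x * blinfun_apply (y i) (V x)) <= 1"
    using V1
    proof eventually_elim
    fix x assume "norm (V x) = 1"
    then show "norm (indicator (A k i) x * blinfun_apply (y i) (V x)) <= 1" using y(1)[of i "V x"] by (auto simp: indicator_def)
    qed
   qed (use um in measurable)
   have j2: "integrable \<mu>T (indicator (A k i) :: _ => real)" by (rule integrable_real_indicator) (auto simp: M.emeasure_eq_measure)
   have "(\<integral>x. indicator (A k i) x \<partial>\<mu>T) - (\<integral>x. indicator (A k i) x * blinfun_apply (y i) (V x) \<partial>\<mu>T)
    = (\<integral>x. indicator (A k i) x - indicator (A k i) x * blinfun_apply (y i) (V x) \<partial>\<mu>T)"
    using j1 j2 by simp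
   also have "... <= (\<integral>x. 2 / real (Suc k) * indicator (A k i) x \<partial>\<mu>T)"
   proof (rule integral_mono_AE)
    show "AE x in \<mu>T. indicator (A k i) x - indicator (A k i) x * blinfun_apply (y i) (V x) <= 2 / real (Suc k) * indicator (A k i) x"
    using V1
    proof eventually_elim
    fix x assume V1x: "norm (V x) = 1"
    show "indicator (A k i) x - indicator (A k i) x * blinfun_apply (y i) (V x) <= 2 / real (Suc k) * indicator (A k i) x"
    proof (cases "x \<in> A k i")
    case True
    then have d: "norm (V x - c i) < 1 / real (Suc k)" by (simp add: A_def dist_norm)
    have "blinfun_apply (y i) (V x) = norm (c i) + blinfun_apply (y i) (V x - c i)" by (simp add: blinfun.diff_right y(2))
    moreover have "\<bar>blinfun_apply (y i) (V x - c i)\<bar> <= norm (V x - c i)" by (rule y(1))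
    moreover have "norm (V x) <= norm (c i) + norm (V x - c i)" by (rule norm_triangle_sub)
    ultimately have "blinfun_apply (y i) (V x) >= 1 - 2 * (1 / real (Suc k))" using d V1x by linarith
    then show ?thesis using True by simp
    qed simp
    qed
   qed (use j1 j2 in auto)
   also have "... = 2 / real (Suc k) * measure \<mu>T (A k i)" by simp
   finally show ?thesis .
  qed
  finally have "(\<integral>\<^sup>+p. r k i p \<partial>P) <= ennreal (2 / real (Suc k) * measure \<mu>T (A k i))" by (simp add: ennreal_leI)
  then show ?thesis by (simp add: M.emeasure_eq_measure ennreal_mult[symmetric])
 qed
 define R where "R = (%k p. \<Sum>i. r k i p)"
 have Rm[measurable]: "R k \<in> borel_measurable P" for k unfolding R_def by measurable
 have Rint: "(\<integral>\<^sup>+p. R k p \<partial>P) <= ennreal (2 / real (Suc k) * measure \<mu>T UNIV)" for k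
 proof -
  have "(\<integral>\<^sup>+p. R k p \<partial>P) = (\<Sum>i. \<integral>\<^sup>+p. r k i p \<partial>P)" unfolding R_def by (rule nn_integral_suminf) simp
  also have "... <= (\<Sum>i. ennreal (2 / real (Suc k)) * emeasure \<mu>T (A k i))" by (intro suminf_le rint) auto
  also have "... = ennreal (2 / real (Suc k)) * (\<Sum>i. emeasure \<mu>T (A k i))" by simp
  also have "(\<Sum>i. emeasure \<mu>T (A k i)) = emeasure \<mu>T (\<Union>i. A k i)"
   using Ab sets_\<mu>T disj by (intro suminf_emeasure) auto
  also have "... <= emeasure \<mu>T UNIV" using sets_\<mu>T by (intro emeasure_mono) auto
  finally show ?thesis by (simp add: M.emeasure_eq_measure ennreal_mult[symmetric] mult_left_mono)
 qed
 have "(\<integral>\<^sup>+p. liminf (%k. R k p) \<partial>P) <= liminf (%k. \<integral>\<^sup>+p. R k p \<partial>P)"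
  by (rule nn_integral_liminf) simp
 also have "... <= liminf (%k. ennreal (2 / real (Suc k) * measure \<mu>T UNIV))"
  by (rule Liminf_mono) (use Rint in auto)
 also have "... = 0"
 proof -
  have "(%k. 2 * (1 / real (Suc k)) * measure \<mu>T UNIV) \<longlonglongrightarrow> 2 * 0 * measure \<mu>T UNIV"
   using LIMSEQ_inverse_real_of_nat by (intro tendsto_intros) (simp add: inverse_eq_divide)
  then have "(%k. ennreal (2 / real (Suc k) * measure \<mu>T UNIV)) \<longlonglongrightarrow> ennreal 0"
   by (intro tendsto_ennrealI) simp
  then show ?thesis using lim_imp_Liminf[OF sequentially_bot] by fastforce
 qed
 finally have "(\<integral>\<^sup>+p. liminf (%k. R k p) \<partial>P) = 0" by simp
 then have R0: "AE p in P. liminf (%k. R k p) = 0" by (subst (asm) nn_integral_0_iff_AE) auto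
 define good where "good = {x. norm (V x) = 1 \<and> V x \<in> closure C}"
 have "AE x in \<mu>T. x \<in> good" using V1 C0(2) C(3) unfolding good_def by (auto elim: eventually_elim2)
 from AE_imp_null_set[OF this] obtain N where N: "N \<in> null_sets \<mu>T" and Ng: "\<forall>x\<in>space \<mu>T - N. x \<in> good" by (rule bexE)
 have Ng: "x \<in> good" if "x \<notin> N" for x using Ng that by (simp add: space_\<mu>T)
 have "AE p in P. liminf (%k. R k p) = 0 \<and> (rho p = 0 \<or> ev p \<notin> N)" using R0 image_null[OF N] by eventually_elim auto
 then have "AE cv in \<eta>. AE t in lborel. liminf (%k. R k (cv, t)) = 0 \<and> (rho (cv, t) = 0 \<or> ev (cv, t) \<notin> N)"
  by (rule AE_pair)
 with curve_differentiable show ?thesis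
 proof eventually_elim
  fix cv assume 1: "AE t in lborel. t > 0 --> (\<exists>v. (at_time cv has_vector_derivative v) (at t))"
   and 2: "AE t in lborel. liminf (%k. R k (cv, t)) = 0 \<and> (rho (cv, t) = 0 \<or> ev (cv, t) \<notin> N)"
  show "AE t in lborel. t > 0 --> (\<exists>v. (at_time cv has_vector_derivative v) (at t) \<and> v = norm v *\<^sub>R V (at_time cv t))"
   using 1 2
  proof eventually_elim
   fix t assume d: "t > 0 --> (\<exists>v. (at_time cv has_vector_derivative v) (at t))"
    and g: "liminf (%k. R k (cv, t)) = 0 \<and> (rho (cv, t) = 0 \<or> ev (cv, t) \<notin> N)"
   show "t > 0 --> (\<exists>v. (at_time cv has_vector_derivative v) (at t) \<and> v = norm v *\<^sub>R V (at_time cv t))"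
   proof
    assume t: "t > 0"
    then obtain v where v: "(at_time cv has_vector_derivative v) (at t)" using d by blast
    have rv: "rho (cv, t) = ennreal (norm v)" using t by (simp add: rho_def mspeed_eq[OF v])
    have "v = norm v *\<^sub>R V (at_time cv t)"
    proof (cases "v = 0")
    case False
    then have "ev (cv, t) \<notin> N" using g rv by auto
    then have gd: "norm (V (at_time cv t)) = 1" "V (at_time cv t) \<in> closure C" using Ng by (auto simp: good_def ev_def)
    show ?thesis
    proof (rule strictly_convex_direction[OF sc gd(1)])
    fix \<epsilon> :: real assume e: "\<epsilon> > 0"
    then obtain K where K: "1 / real (Suc K) < \<epsilon> / 2" using nat_approx_posE[of "\<epsilon>/2"] by auto
    \<comment> \<open>A lower limit zero gives arbitrarily fine scales at which the deficit is small.\<close>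
    have "\<exists>k\<ge>K. R k (cv, t) < ennreal \<epsilon>"
    proof (rule ccontr)
    assume "\<not> ?thesis"
    then have "\<forall>\<^sub>F k in sequentially. ennreal \<epsilon> <= R k (cv, t)" by (auto intro!: eventually_sequentiallyI[of K] simp: not_less)
    then have "ennreal \<epsilon> <= liminf (%k. R k (cv, t))" by (rule Liminf_bounded)
    then show False using g e by simp
    qed
    then obtain k where k: "k >= K" "R k (cv, t) < ennreal \<epsilon>" by blast
    have "1 / real (Suc k) <= 1 / real (Suc K)" using k(1) by (simp add: frac_le)
    then have kk: "1 / real (Suc k) < \<epsilon> / 2" using K by linarith
    have ex: "\<exists>i. dist (V (at_time cv t)) (c i) < 1 / real (Suc k)"
    proof -
    have "1 / real (Suc k) > 0" by simp
    then obtain z where "z \<in> C" "dist z (V (at_time cv t)) < 1 / real (Suc k)" using gd(2) unfolding closure_approachable by blast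
    then show ?thesis using rc by (metis dist_commute rangeE)
    qed
    define i where "i = (LEAST i. dist (V (at_time cv t)) (c i) < 1 / real (Suc k))"
    have i1: "dist (V (at_time cv t)) (c i) < 1 / real (Suc k)" unfolding i_def by (rule LeastI_ex[OF ex])
    have i2: "\<not> dist (V (at_time cv t)) (c j) < 1 / real (Suc k)" if "j < i" for j using that unfolding i_def by (rule not_less_Least)
    have iA: "ev (cv, t) \<in> A k i" using i1 i2 by (auto simp: A_def ev_def)
    have "r k i (cv, t) <= R k (cv, t)"
    unfolding R_def using sum_le_suminf[of "%i. r k i (cv, t)" "{i}"] by simp
    then have lt: "ennreal (rhor (cv, t) - slope (blinfun_apply (y i)) (cv, t)) < ennreal \<epsilon>"
    using k(2) iA by (simp add: r_def)
    have "rhor (cv, t) - slope (blinfun_apply (y i)) (cv, t) < \<epsilon>"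
    proof (rule ccontr)
    assume "\<not> ?thesis"
    then have "ennreal \<epsilon> <= ennreal (rhor (cv, t) - slope (blinfun_apply (y i)) (cv, t))" by (intro ennreal_leI) simp
    from leD[OF this] lt show False by (rule notE)
    qed
    moreover have "rhor (cv, t) = norm v" by (simp add: rhor_def rv)
    moreover have "slope (blinfun_apply (y i)) (cv, t) = blinfun_apply (y i) v"
    proof -
    have "((%s. blinfun_apply (y i) (at_time cv s)) has_real_derivative blinfun_apply (y i) v) (at t)"
    unfolding has_real_derivative_iff_has_vector_derivative
    by (rule bounded_linear.has_vector_derivative[OF blinfun.bounded_linear_right v])
    then show ?thesis using t by (simp add: slope_def diff_lim_eq(1))
    qed
    ultimately have a: "norm v - blinfun_apply (y i) v < \<epsilon>" by simp
    have "blinfun_apply (y i) (V (at_time cv t)) = norm (c i) + blinfun_apply (y i) (V (at_time cv t) - c i)" by (simp add: blinfun.diff_right y(2))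
    moreover have "\<bar>blinfun_apply (y i) (V (at_time cv t) - c i)\<bar> <= norm (V (at_time cv t) - c i)" by (rule y(1))
    moreover have "norm (V (at_time cv t)) <= norm (c i) + norm (V (at_time cv t) - c i)" by (rule norm_triangle_sub)
    ultimately have "blinfun_apply (y i) (V (at_time cv t)) >= 1 - \<epsilon>" using i1 kk gd(1) by (simp add: dist_norm)
    then show "\<exists>y::'e \<Rightarrow>\<^sub>L real. (\<forall>x. \<bar>blinfun_apply y x\<bar> <= norm x) \<and> norm v - blinfun_apply y v < \<epsilon> \<and> blinfun_apply y (V (at_time cv t)) >= 1 - \<epsilon>"
    using a y(1) by blast
    qed
    qed simp
    then show "\<exists>v. (at_time cv has_vector_derivative v) (at t) \<and> v = norm v *\<^sub>R V (at_time cv t)" using v by blast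
   qed
  qed
 qed
qed

end

section \<open>Directional derivatives and restriction of the current\<close>

text \<open>A modification of \<open>V\<close> on a null set with separable range. For a nonseparable
  range, the sum of two Borel maps need not be Borel.\<close>
definition sep_field :: "'e::real_normed_vector set => ('e => 'e) => 'e => 'e" where
 "sep_field C V x = (if V x \<in> closure C then V x else 0)"

text \<open>The derivative of \<open>\<pi>\<close> at \<open>x\<close> in the direction \<open>W
  x\<close>, taken along a fixed sequence: a Borel function of the point.\<close>
definition dird :: "('e::real_normed_vector => 'e) => ('e => real) => 'e => real" where
 "dird W \<pi> x = lim (%n. real (Suc n) * (\<pi> (x + (1 / real (Suc n)) *\<^sub>R W x) - \<pi> x))"

lemma add_sep_field_measurable:
 fixes V :: "'e::real_normed_vector => 'e"
 assumes V: "V \<in> borel_measurable borel" and C: "countable C"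
 shows "(%x. x + a *\<^sub>R sep_field C V x) \<in> borel_measurable borel"
proof -
 define C' where "C' = insert 0 C"
 have C': "countable C'" "C' ~= {}" using C by (auto simp: C'_def)
 define c where "c = from_nat_into C'"
 have rc: "range c = C'" unfolding c_def by (rule range_from_nat_into[OF C'(2,1)])
 have mV: "(%x. dist (V x) z) \<in> borel_measurable borel" for z
  by (rule measurable_compose[OF V]) (intro borel_measurable_continuous_onI continuous_intros)
 have "V -` closure C \<in> sets borel" using measurable_sets[OF V, of "closure C"] by simp
 then have [measurable]: "V -` closure C \<in> sets borel" .
 have "(%x. dist (sep_field C V x) z) = (%x. if x \<in> V -` closure C then dist (V x) z else dist 0 z)" for z
  by (auto simp: sep_field_def)
 then have [measurable]: "(%x. dist (sep_field C V x) z) \<in> borel_measurable borel" for z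
  by (simp only:) (rule measurable_If_set, use mV[of z] \<open>V -` closure C \<in> sets borel\<close> in \<open>simp_all only: borel_measurable_const space_borel Int_UNIV_right\<close>)
 have ex: "\<exists>i. dist (sep_field C V x) (c i) < 1 / real (Suc m)" for x m
 proof -
  have "sep_field C V x \<in> closure C'"
   using closure_mono[of C C'] closure_subset[of C'] by (auto simp: sep_field_def C'_def)
  moreover have "1 / real (Suc m) > 0" by simp
  ultimately obtain z where "z \<in> C'" "dist z (sep_field C V x) < 1 / real (Suc m)" unfolding closure_approachable by blast
  then show ?thesis using rc by (metis dist_commute rangeE)
 qed
 define i where "i = (%m x. LEAST i. dist (sep_field C V x) (c i) < 1 / real (Suc m))"
 have i: "dist (sep_field C V x) (c (i m x)) < 1 / real (Suc m)" for m x
  unfolding i_def by (rule LeastI_ex[OF ex])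
 have im: "i m \<in> measurable borel (count_space UNIV)" for m
  unfolding i_def by measurable
 show ?thesis
 proof (rule borel_measurable_LIMSEQ_metric[where f="%m x. x + a *\<^sub>R c (i m x)"])
  fix m
  show "(%x. x + a *\<^sub>R c (i m x)) \<in> borel_measurable borel"
  proof (rule measurable_compose_countable[where f="%k x. x + a *\<^sub>R c k" and g="i m"])
   show "(%x. x + a *\<^sub>R c k) \<in> borel_measurable borel" for k
    by (intro borel_measurable_continuous_onI continuous_intros)
  qed (rule im)
 next
  fix x
  have "(%m. c (i m x)) \<longlonglongrightarrow> sep_field C V x"
  proof (rule metric_tendsto_imp_tendsto[OF LIMSEQ_inverse_real_of_nat])
   show "\<forall>\<^sub>F m in sequentially. dist (c (i m x)) (sep_field C V x) <= dist (inverse (real (Suc m))) 0"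
    using i[of x] by (intro always_eventually allI) (simp add: dist_commute inverse_eq_divide less_imp_le)
  qed
  then show "(%m. x + a *\<^sub>R c (i m x)) \<longlonglongrightarrow> x + a *\<^sub>R sep_field C V x" by (intro tendsto_intros)
 qed
qed

lemma dird_measurable:
 fixes V :: "'e::real_normed_vector => 'e"
 assumes V: "V \<in> borel_measurable borel" and C: "countable C" and \<pi>: "lipschitz_fun \<pi>"
 shows "dird (sep_field C V) \<pi> \<in> borel_measurable borel"
proof -
 note pm = lipschitz_fun_borel[OF \<pi>]
 have [measurable]: "(%x. \<pi> (x + (1 / real (Suc n)) *\<^sub>R sep_field C V x)) \<in> borel_measurable borel" for n
  by (rule measurable_compose[OF add_sep_field_measurable[OF V C] pm])
 note [measurable] = pm
 show ?thesis unfolding dird_def[abs_def] by measurable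
qed

lemma dird_eq:
 assumes "((%h. (\<pi> (x + h *\<^sub>R W x) - \<pi> x) / h) \<longlongrightarrow> D) (at 0)"
 shows "dird W \<pi> x = D"
proof -
 have "(%n. (\<pi> (x + (1 / real (Suc n)) *\<^sub>R W x) - \<pi> x) / (1 / real (Suc n))) \<longlonglongrightarrow> D"
  by (rule filterlim_compose[OF assms inverse_Suc_filterlim])
 then have "(%n. real (Suc n) * (\<pi> (x + (1 / real (Suc n)) *\<^sub>R W x) - \<pi> x)) \<longlonglongrightarrow> D"
  by (simp add: mult.commute del: of_nat_Suc)
 then show ?thesis unfolding dird_def by (rule limI)
qed

text \<open>The derivative along a curve with velocity \<open>c W\<close> depends only on the point and on
  \<open>c\<close>. This turns integrals over curves into integrals over space.\<close>
lemma dird_along_curve: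
 fixes cv :: "real => 'e::real_normed_vector"
 assumes \<pi>: "L-lipschitz_on UNIV \<pi>" and v: "(cv has_vector_derivative v) (at t)"
  and D: "((%s. \<pi> (cv s)) has_real_derivative D) (at t)" and c: "0 <= c" "v = c *\<^sub>R W (cv t)"
 shows "D = c * dird W \<pi> (cv t)"
proof (cases "c = 0")
 case True
 then show ?thesis using lipschitz_chain_derivative(2)[OF \<pi> v D] c by simp
next
 case False
 then have c0: "c > 0" using c by simp
 have 1: "((%h. (\<pi> (cv t + h *\<^sub>R v) - \<pi> (cv t)) / h) \<longlongrightarrow> D) (at 0)"
  by (rule lipschitz_chain_derivative(1)[OF \<pi> v D])
 have 2: "filterlim (%k. k / c) (at 0) (at 0)"
  unfolding filterlim_at using c0 by (auto simp: eventually_at_filter intro!: tendsto_eq_intros)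
 have "((%k. (\<pi> (cv t + (k / c) *\<^sub>R v) - \<pi> (cv t)) / (k / c)) \<longlongrightarrow> D) (at 0)"
  by (rule filterlim_compose[OF 1 2])
 then have "((%k. (1 / c) * ((\<pi> (cv t + (k / c) *\<^sub>R v) - \<pi> (cv t)) / (k / c))) \<longlongrightarrow> (1 / c) * D) (at 0)"
  by (intro tendsto_intros)
 moreover have "(%k. (1 / c) * ((\<pi> (cv t + (k / c) *\<^sub>R v) - \<pi> (cv t)) / (k / c))) = (%k. (\<pi> (cv t + k *\<^sub>R W (cv t)) - \<pi> (cv t)) / k)"
  using c0 by (auto simp: c(2) fun_eq_iff)
 ultimately have "dird W \<pi> (cv t) = (1 / c) * D" by (intro dird_eq) simp
 then show ?thesis using c0 by simp
qed

lemma dird_locally_constant: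
 fixes W :: "'e::real_normed_vector => 'e"
 assumes U: "open U" "x \<in> U" and c: "!!y. y \<in> U ==> \<pi> y = c"
 shows "dird W \<pi> x = 0"
proof (rule dird_eq)
 have "((%h. x + h *\<^sub>R W x) \<longlongrightarrow> x) (at 0)" by (auto intro!: tendsto_eq_intros)
 then have "\<forall>\<^sub>F h in at 0. x + h *\<^sub>R W x \<in> U" using U by (rule topological_tendstoD)
 then have "\<forall>\<^sub>F h in at 0. (\<pi> (x + h *\<^sub>R W x) - \<pi> x) / h = 0" by eventually_elim (simp add: c U)
 then show "((%h. (\<pi> (x + h *\<^sub>R W x) - \<pi> x) / h) \<longlongrightarrow> 0) (at 0)" by (rule tendsto_eventually)
qed

lemma dird_quasi_deriv:
 fixes W :: "'e::real_normed_vector => 'e"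
 assumes "has_quasi_derivative \<pi> D x"
 shows "dird W \<pi> x = blinfun_apply D (W x)"
proof (rule dird_eq)
 have "((%s::real. x + s *\<^sub>R W x) has_vector_derivative W x) (at 0)" by (auto intro!: derivative_eq_intros)
 moreover have "continuous_on UNIV (%s::real. x + s *\<^sub>R W x)" by (intro continuous_intros)
 ultimately have "((%s. \<pi> (x + s *\<^sub>R W x)) has_real_derivative blinfun_apply D (W x)) (at 0)"
  using assms unfolding has_quasi_derivative_def by force
 then show "((%h. (\<pi> (x + h *\<^sub>R W x) - \<pi> x) / h) \<longlongrightarrow> blinfun_apply D (W x)) (at 0)" by (simp add: DERIV_def)
qed

locale separated_field = decomposed_field T \<eta> V for T :: "'e::banach functional" and \<eta> and V :: "'e => 'e" +
 fixes C :: "'e set"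
 assumes cC: "countable C" and VC: "AE x in mass_measure T. V x \<in> closure C"
begin

abbreviation "W \<equiv> sep_field C V"

lemma dirdW_measurable: "lipschitz_fun \<pi> ==> dird W \<pi> \<in> borel_measurable borel"
 by (rule dird_measurable[OF Vm cC])

lemma dirdW_\<mu>T: "lipschitz_fun \<pi> ==> dird W \<pi> \<in> borel_measurable \<mu>T"
 by (rule measurable_\<mu>T[OF dirdW_measurable])

text \<open>On the exceptional null set of points the curves have speed zero.\<close>
lemma slope_eq_dird:
 assumes \<pi>: "lipschitz_fun \<pi>"
 shows "AE p in P. slope \<pi> p = rhor p * dird W \<pi> (ev p)"
proof (rule AE_pair_measure)
 note [measurable] = slope_P[OF \<pi>] dirdW_measurable[OF \<pi>]
 show "{p \<in> space P. slope \<pi> p = rhor p * dird W \<pi> (ev p)} \<in> sets P" by measurable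
 obtain N where N: "N \<in> null_sets \<mu>T" "\<forall>x\<in>space \<mu>T - N. V x \<in> closure C"
  using AE_imp_null_set[OF VC] by (rule bexE)
 have WV: "W x = V x" if "x \<notin> N" for x using N(2) that by (simp add: space_\<mu>T sep_field_def)
 have n: "AE cv in \<eta>. AE t in lborel. rho (cv, t) = 0 \<or> ev (cv, t) \<notin> N"
  using AE_pair[of "%p. rho p = 0 \<or> ev p \<notin> N"] image_null[OF N(1)] by blast
 show "AE cv in \<eta>. AE t in lborel. slope \<pi> (cv, t) = rhor (cv, t) * dird W \<pi> (ev (cv, t))"
  using curves_tangent_to_field curve_real_differentiable[OF \<pi>] n
 proof eventually_elim
  fix cv
  assume 1: "AE t in lborel. t > 0 --> (\<exists>v. (at_time cv has_vector_derivative v) (at t) \<and> v = norm v *\<^sub>R V (at_time cv t))"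
   and 2: "AE t in lborel. t > 0 --> (\<exists>D. ((%s. \<pi> (at_time cv s)) has_real_derivative D) (at t))"
   and 3: "AE t in lborel. rho (cv, t) = 0 \<or> ev (cv, t) \<notin> N"
  have 4: "AE t in lborel. t ~= (0::real)" by (rule AE_lborel_singleton)
  show "AE t in lborel. slope \<pi> (cv, t) = rhor (cv, t) * dird W \<pi> (ev (cv, t))"
   using 1 2 3 4
  proof eventually_elim
   fix t :: real
   assume a: "t > 0 --> (\<exists>v. (at_time cv has_vector_derivative v) (at t) \<and> v = norm v *\<^sub>R V (at_time cv t))"
    and b: "t > 0 --> (\<exists>D. ((%s. \<pi> (at_time cv s)) has_real_derivative D) (at t))"
    and c: "rho (cv, t) = 0 \<or> ev (cv, t) \<notin> N" and t: "t ~= 0"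
   show "slope \<pi> (cv, t) = rhor (cv, t) * dird W \<pi> (ev (cv, t))"
   proof (cases "t > 0")
    case True
    obtain v where v: "(at_time cv has_vector_derivative v) (at t)" "v = norm v *\<^sub>R V (at_time cv t)" using a True by blast
    obtain D where D: "((%s. \<pi> (at_time cv s)) has_real_derivative D) (at t)" using b True by blast
    have rv: "rho (cv, t) = ennreal (norm v)" using True by (simp add: rho_def mspeed_eq[OF v(1)])
    have vW: "v = norm v *\<^sub>R W (at_time cv t)"
    proof (cases "v = 0")
    case False
    then have "at_time cv t \<notin> N" using c rv by (auto simp: ev_def)
    then show ?thesis using v(2) WV by simp
    qed simp
    have "D = norm v * dird W \<pi> (at_time cv t)"
    by (rule dird_along_curve[where W=W and c="norm v", OF Lip_lipschitz[OF \<pi>] v(1) D _ vW]) simp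
    then show ?thesis using True by (simp add: slope_def diff_lim_eq(1)[OF D] rhor_def rv ev_def)
   next
    case False
    then show ?thesis using t by (simp add: slope_def rhor_def rho_def)
   qed
  qed
 qed
qed

text \<open>Where \<open>T\<close> has mass, the field is the unit velocity of a curve on which
  \<open>\<pi>\<close> is differentiable.\<close>
lemma dird_bound:
 assumes \<pi>: "lipschitz_fun \<pi>"
 shows "AE x in \<mu>T. \<bar>dird W \<pi> x\<bar> <= Lip \<pi>"
proof -
 note [measurable] = dirdW_measurable[OF \<pi>]
 define B where "B = {x. \<not> \<bar>dird W \<pi> x\<bar> <= Lip \<pi>}"
 have "{x\<in>space borel. \<not> \<bar>dird W \<pi> x\<bar> <= Lip \<pi>} \<in> sets borel" by measurable
 then have B: "B \<in> sets borel" by (simp add: B_def)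
 have "AE p in P. rho p * indicator B (ev p) = 0"
  using rho_rhor slope_le_rho[OF \<pi>] slope_eq_dird[OF \<pi>]
 proof eventually_elim
  fix p assume r: "rho p = ennreal (rhor p)" and a: "\<bar>slope \<pi> p\<bar> <= Lip \<pi> * rhor p" and b: "slope \<pi> p = rhor p * dird W \<pi> (ev p)"
  show "rho p * indicator B (ev p) = 0"
  proof (cases "rhor p = 0")
   case False
   then have pos: "rhor p > 0" using rhor_nonneg[of p] by simp
   have "rhor p * \<bar>dird W \<pi> (ev p)\<bar> <= rhor p * Lip \<pi>" using a b pos by (simp add: abs_mult mult.commute)
   then have "\<bar>dird W \<pi> (ev p)\<bar> <= Lip \<pi>" using pos by simp
   then show ?thesis by (simp add: B_def)
  qed (simp add: r)
 qed
 then have "(\<integral>\<^sup>+p. rho p * indicator B (ev p) \<partial>P) = (\<integral>\<^sup>+p. 0 \<partial>P)" by (rule nn_integral_cong_AE)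
 then have "emeasure \<mu>T B = 0" unfolding mass_measure_eq_image emeasure_image[OF B] by simp
 then have "B \<in> null_sets \<mu>T" using B sets_\<mu>T by auto
 from AE_not_in[OF this] show ?thesis by eventually_elim (simp add: B_def)
qed

lemma
 assumes g: "integrable \<mu>T g" and \<pi>: "lipschitz_fun \<pi>"
 shows integrable_dird: "integrable \<mu>T (%x. g x * dird W \<pi> x)"
  and integral_dird_bound: "\<bar>\<integral>x. g x * dird W \<pi> x \<partial>\<mu>T\<bar> <= Lip \<pi> * (\<integral>x. \<bar>g x\<bar> \<partial>\<mu>T)"
proof -
 have m: "(%x. g x * dird W \<pi> x) \<in> borel_measurable \<mu>T" using g dirdW_\<mu>T[OF \<pi>] by auto
 have "AE x in \<mu>T. \<bar>g x * dird W \<pi> x\<bar> <= Lip \<pi> * \<bar>g x\<bar>"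
  using dird_bound[OF \<pi>]
 proof eventually_elim
  fix x assume "\<bar>dird W \<pi> x\<bar> <= Lip \<pi>"
  then have "\<bar>dird W \<pi> x\<bar> * \<bar>g x\<bar> <= Lip \<pi> * \<bar>g x\<bar>" by (rule mult_right_mono) simp
  then show "\<bar>g x * dird W \<pi> x\<bar> <= Lip \<pi> * \<bar>g x\<bar>" by (simp add: abs_mult mult.commute)
 qed
 from integral_dominated[OF integrable_mult_right[OF integrable_abs[OF g]] m this]
 show "integrable \<mu>T (%x. g x * dird W \<pi> x)" "\<bar>\<integral>x. g x * dird W \<pi> x \<partial>\<mu>T\<bar> <= Lip \<pi> * (\<integral>x. \<bar>g x\<bar> \<partial>\<mu>T)"
  by simp_all
qed

lemma T_eq_integral_dird:
 assumes f: "bounded_lipschitz f" and \<pi>: "lipschitz_fun \<pi>"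
 shows "T f \<pi> = (\<integral>x. f x * dird W \<pi> x \<partial>\<mu>T)"
proof -
 note [measurable] = bounded_lipschitz_borel[OF f] dirdW_measurable[OF \<pi>] slope_P[OF \<pi>]
 have "T f \<pi> = (\<integral>p. f (ev p) * slope \<pi> p \<partial>P)" by (rule T_as_integral[OF f \<pi>])
 also have "... = (\<integral>p. rhor p * (f (ev p) * dird W \<pi> (ev p)) \<partial>P)"
 proof (rule integral_cong_AE)
  show "AE p in P. f (ev p) * slope \<pi> p = rhor p * (f (ev p) * dird W \<pi> (ev p))"
   using slope_eq_dird[OF \<pi>] by eventually_elim simp
 qed auto
 also have "... = (\<integral>x. f x * dird W \<pi> x \<partial>\<mu>T)"
  unfolding mass_measure_eq_image by (rule integral_image[symmetric]) measurable
 finally show ?thesis .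
qed

lemma current_limit:
 assumes f: "!!n::nat. bounded_lipschitz (f n)" and g: "integrable \<mu>T g"
  and lim: "(%n. \<integral>x. \<bar>f n x - g x\<bar> \<partial>\<mu>T) \<longlonglongrightarrow> 0" and \<pi>: "lipschitz_fun \<pi>"
 shows "(%n. T (f n) \<pi>) \<longlonglongrightarrow> (\<integral>x. g x * dird W \<pi> x \<partial>\<mu>T)"
proof (rule LIM_zero_cancel, rule Lim_null_comparison)
 show "(%n. Lip \<pi> * (\<integral>x. \<bar>f n x - g x\<bar> \<partial>\<mu>T)) \<longlonglongrightarrow> 0" using tendsto_mult_left[OF lim, of "Lip \<pi>"] by simp
 show "\<forall>\<^sub>F n in sequentially. norm (T (f n) \<pi> - (\<integral>x. g x * dird W \<pi> x \<partial>\<mu>T)) <= Lip \<pi> * (\<integral>x. \<bar>f n x - g x\<bar> \<partial>\<mu>T)"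
 proof (intro always_eventually allI)
  fix n
  have i: "integrable \<mu>T (f n)" by (rule bounded_lipschitz_integrable[OF f finite_\<mu>T sets_\<mu>T])
  have "T (f n) \<pi> - (\<integral>x. g x * dird W \<pi> x \<partial>\<mu>T) = (\<integral>x. (f n x - g x) * dird W \<pi> x \<partial>\<mu>T)"
   unfolding T_eq_integral_dird[OF f \<pi>]
   using integrable_dird[OF i \<pi>] integrable_dird[OF g \<pi>] by (simp add: left_diff_distrib)
  then show "norm (T (f n) \<pi> - (\<integral>x. g x * dird W \<pi> x \<partial>\<mu>T)) <= Lip \<pi> * (\<integral>x. \<bar>f n x - g x\<bar> \<partial>\<mu>T)"
   using integral_dird_bound[of "%x. f n x - g x", OF _ \<pi>] i g by simp
 qed
qed

text \<open>All approximating sequences lead to the same limit, so the extension is well defined.\<close>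
lemma current_ext_eq:
 assumes g: "integrable \<mu>T g" and \<pi>: "lipschitz_fun \<pi>"
 shows "current_ext T g \<pi> = (\<integral>x. g x * dird W \<pi> x \<partial>\<mu>T)"
 unfolding current_ext_def
proof (rule the_equality)
 have nn: "(\<integral>\<^sup>+x. ennreal \<bar>f x - g x\<bar> \<partial>\<mu>T) = ennreal (\<integral>x. \<bar>f x - g x\<bar> \<partial>\<mu>T)" if "bounded_lipschitz f" for f
  using bounded_lipschitz_integrable[OF that finite_\<mu>T sets_\<mu>T] g by (intro nn_integral_eq_integral) auto
 show "\<exists>f. (\<forall>n::nat. bounded_lipschitz (f n)) \<and> (%n. \<integral>\<^sup>+x. ennreal \<bar>f n x - g x\<bar> \<partial>\<mu>T) \<longlonglongrightarrow> 0 \<and>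
   (%n. T (f n) \<pi>) \<longlonglongrightarrow> (\<integral>x. g x * dird W \<pi> x \<partial>\<mu>T)"
 proof -
  obtain f where f: "!!n::nat. bounded_lipschitz (f n)" "(%n. \<integral>x. \<bar>f n x - g x\<bar> \<partial>\<mu>T) \<longlonglongrightarrow> 0"
   using bounded_lipschitz_dense[OF finite_\<mu>T sets_\<mu>T g] by blast
  have "(%n. \<integral>\<^sup>+x. ennreal \<bar>f n x - g x\<bar> \<partial>\<mu>T) \<longlonglongrightarrow> 0"
   unfolding nn[OF f(1)] using tendsto_ennrealI[OF f(2)] by simp
  then show ?thesis using f(1) current_limit[OF f(1) g f(2) \<pi>] by blast
 qed
 fix c assume "\<exists>f. (\<forall>n::nat. bounded_lipschitz (f n)) \<and> (%n. \<integral>\<^sup>+x. ennreal \<bar>f n x - g x\<bar> \<partial>\<mu>T) \<longlonglongrightarrow> 0 \<and> (%n. T (f n) \<pi>) \<longlonglongrightarrow> c"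
 then obtain f where f: "!!n::nat. bounded_lipschitz (f n)" "(%n. \<integral>\<^sup>+x. ennreal \<bar>f n x - g x\<bar> \<partial>\<mu>T) \<longlonglongrightarrow> 0" "(%n. T (f n) \<pi>) \<longlonglongrightarrow> c" by blast
 have "(%n. ennreal (\<integral>x. \<bar>f n x - g x\<bar> \<partial>\<mu>T)) \<longlonglongrightarrow> ennreal 0" using f(2) unfolding nn[OF f(1)] by simp
 then have "(%n. \<integral>x. \<bar>f n x - g x\<bar> \<partial>\<mu>T) \<longlonglongrightarrow> 0" by (subst (asm) tendsto_ennreal_iff) (auto intro!: integral_nonneg_AE)
 from current_limit[OF f(1) g this \<pi>] f(3) show "c = (\<integral>x. g x * dird W \<pi> x \<partial>\<mu>T)" by (rule LIMSEQ_unique[rotated])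
qed

lemma integrable_mult_bounded_lipschitz:
 assumes g: "integrable \<mu>T g" and f: "bounded_lipschitz f"
 shows "integrable \<mu>T (%x. g x * f x)"
proof -
 obtain B where B: "f \<in> borel_measurable borel" "!!x. \<bar>f x\<bar> <= B" using bounded_lipschitzE[OF f] by blast
 show ?thesis
 proof (rule Bochner_Integration.integrable_bound[OF integrable_mult_right[OF g, of B]])
  show "(%x. g x * f x) \<in> borel_measurable \<mu>T" using g measurable_\<mu>T[OF B(1)] by auto
  show "AE x in \<mu>T. norm (g x * f x) <= norm (B * g x)"
  proof (rule AE_I2)
   fix x
   have "\<bar>g x\<bar> * \<bar>f x\<bar> <= \<bar>g x\<bar> * \<bar>B\<bar>" using B(2)[of x] by (intro mult_left_mono) auto
   then show "norm (g x * f x) <= norm (B * g x)" by (simp add: abs_mult mult.commute)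
  qed
 qed
qed

lemma current_restrict_eq:
 assumes g: "integrable \<mu>T \<gamma>" and f: "bounded_lipschitz f" and \<pi>: "lipschitz_fun \<pi>"
 shows "current_restrict T \<gamma> f \<pi> = (\<integral>x. \<gamma> x * f x * dird W \<pi> x \<partial>\<mu>T)"
 unfolding current_restrict_def by (rule current_ext_eq[OF integrable_mult_bounded_lipschitz[OF g f] \<pi>])

text \<open>Continuity in \<open>\<pi>\<close> is inherited from \<open>T\<close>, by approximation of
  \<open>\<gamma> f\<close> with bounded Lipschitz functions in the \<open>L\<^sup>1\<close>
  norm.\<close>
lemma metric_current_restrict:
 assumes g: "integrable \<mu>T \<gamma>"
 shows "metric_current (current_restrict T \<gamma>)"
 unfolding metric_current_def
proof (intro conjI)
 note eq = current_restrict_eq[OF g]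
 have bil: "bilinear_on_D1 T" using mc by (simp add: metric_current_def)
 show "bilinear_on_D1 (current_restrict T \<gamma>)"
  unfolding bilinear_on_D1_def
 proof (intro conjI allI impI)
  fix f h \<pi> :: "'e => real" and a b :: real
  assume f: "bounded_lipschitz f" and h: "bounded_lipschitz h" and \<pi>: "lipschitz_fun \<pi>"
  have i: "integrable \<mu>T (%x. \<gamma> x * f x * dird W \<pi> x)" "integrable \<mu>T (%x. \<gamma> x * h x * dird W \<pi> x)"
   using integrable_dird[OF integrable_mult_bounded_lipschitz[OF g] \<pi>] f h by auto
  have "(\<integral>x. \<gamma> x * (a * f x + b * h x) * dird W \<pi> x \<partial>\<mu>T) = (\<integral>x. a * (\<gamma> x * f x * dird W \<pi> x) + b * (\<gamma> x * h x * dird W \<pi> x) \<partial>\<mu>T)"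
   by (intro Bochner_Integration.integral_cong) (auto simp: algebra_simps)
  also have "... = a * (\<integral>x. \<gamma> x * f x * dird W \<pi> x \<partial>\<mu>T) + b * (\<integral>x. \<gamma> x * h x * dird W \<pi> x \<partial>\<mu>T)"
   using i by simp
  finally show "current_restrict T \<gamma> (%x. a * f x + b * h x) \<pi> = a * current_restrict T \<gamma> f \<pi> + b * current_restrict T \<gamma> h \<pi>"
   unfolding eq[OF bounded_lipschitz_linear[OF f h] \<pi>] eq[OF f \<pi>] eq[OF h \<pi>] .
 next
  fix f \<pi> \<rho> :: "'e => real" and a b :: real
  assume f: "bounded_lipschitz f" and \<pi>: "lipschitz_fun \<pi>" and \<rho>: "lipschitz_fun \<rho>"
  have i: "integrable \<mu>T (%x. \<gamma> x * f x)" by (rule integrable_mult_bounded_lipschitz[OF g f])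
  have l: "lipschitz_fun (%x. a * \<pi> x + b * \<rho> x)" by (rule lipschitz_fun_linear[OF \<pi> \<rho>])
  obtain u where u: "!!n::nat. bounded_lipschitz (u n)" "(%n. \<integral>x. \<bar>u n x - \<gamma> x * f x\<bar> \<partial>\<mu>T) \<longlonglongrightarrow> 0"
   using bounded_lipschitz_dense[OF finite_\<mu>T sets_\<mu>T i] by blast
  note lim = current_limit[OF u(1) i u(2)]
  have "T (u n) (%x. a * \<pi> x + b * \<rho> x) = a * T (u n) \<pi> + b * T (u n) \<rho>" for n
   using bil[unfolded bilinear_on_D1_def, THEN conjunct2, rule_format, OF u(1) \<pi> \<rho>] .
  then have "(%n. a * T (u n) \<pi> + b * T (u n) \<rho>) \<longlonglongrightarrow> (\<integral>x. \<gamma> x * f x * dird W (%x. a * \<pi> x + b * \<rho> x) x \<partial>\<mu>T)"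
   using lim[OF l] by simp
  moreover have "(%n. a * T (u n) \<pi> + b * T (u n) \<rho>) \<longlonglongrightarrow> a * (\<integral>x. \<gamma> x * f x * dird W \<pi> x \<partial>\<mu>T) + b * (\<integral>x. \<gamma> x * f x * dird W \<rho> x \<partial>\<mu>T)"
   by (intro tendsto_intros lim \<pi> \<rho>)
  ultimately show "current_restrict T \<gamma> f (%x. a * \<pi> x + b * \<rho> x) = a * current_restrict T \<gamma> f \<pi> + b * current_restrict T \<gamma> f \<rho>"
   unfolding eq[OF f l] eq[OF f \<pi>] eq[OF f \<rho>] by (rule LIMSEQ_unique)
 qed
 show "\<forall>f \<pi> U c. bounded_lipschitz f --> lipschitz_fun \<pi> --> open U --> {x. f x ~= 0} \<subseteq> U --> (\<forall>x\<in>U. \<pi> x = c) --> current_restrict T \<gamma> f \<pi> = 0"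
 proof (intro allI impI)
  fix f \<pi> :: "'e => real" and U c
  assume f: "bounded_lipschitz f" and \<pi>: "lipschitz_fun \<pi>" and U: "open U" "{x. f x ~= 0} \<subseteq> U" and c: "\<forall>x\<in>U. \<pi> x = c"
  have "f x * dird W \<pi> x = 0" for x
   using dird_locally_constant[OF U(1), of x \<pi> c W] U(2) c by (cases "f x = 0") auto
  then have "(%x. \<gamma> x * f x * dird W \<pi> x) = (%x. 0)" by (auto simp: mult.assoc)
  then show "current_restrict T \<gamma> f \<pi> = 0" unfolding eq[OF f \<pi>] by simp
 qed
 show "\<forall>f \<pi> \<pi>s L. bounded_lipschitz f --> (\<forall>n::nat. L-lipschitz_on UNIV (\<pi>s n)) --> (\<forall>x. (%n. \<pi>s n x) \<longlonglongrightarrow> \<pi> x) -->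
   (%n. current_restrict T \<gamma> f (\<pi>s n)) \<longlonglongrightarrow> current_restrict T \<gamma> f \<pi>"
 proof (intro allI impI)
  fix f \<pi> :: "'e => real" and \<pi>s :: "nat => 'e => real" and L
  assume f: "bounded_lipschitz f" and L: "\<forall>n::nat. L-lipschitz_on UNIV (\<pi>s n)" and lim: "\<forall>x. (%n. \<pi>s n x) \<longlonglongrightarrow> \<pi> x"
  have L0: "0 <= L" using L lipschitz_on_nonneg by blast
  have Ln: "L-lipschitz_on UNIV (\<pi>s n)" for n using L by simp
  have L\<pi>: "L-lipschitz_on UNIV \<pi>"
  proof (rule lipschitz_onI[OF _ L0])
   fix x y
   have "(%n. dist (\<pi>s n x) (\<pi>s n y)) \<longlonglongrightarrow> dist (\<pi> x) (\<pi> y)" using lim by (intro tendsto_dist) auto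
   then show "dist (\<pi> x) (\<pi> y) <= L * dist x y"
    by (rule LIMSEQ_le_const2) (use lipschitz_onD[OF Ln] in auto)
  qed
  have l: "lipschitz_fun (\<pi>s n)" "lipschitz_fun \<pi>" for n using Ln L\<pi> unfolding lipschitz_fun_def by blast+
  have i: "integrable \<mu>T (%x. \<gamma> x * f x)" by (rule integrable_mult_bounded_lipschitz[OF g f])
  show "(%n. current_restrict T \<gamma> f (\<pi>s n)) \<longlonglongrightarrow> current_restrict T \<gamma> f \<pi>"
  proof (rule LIMSEQ_I)
   fix e :: real assume e: "e > 0"
   define d where "d = e / (3 * (L + 1))"
   have d: "d > 0" using e L0 by (simp add: d_def)
   obtain u where u: "bounded_lipschitz u" "(\<integral>x. \<bar>u x - \<gamma> x * f x\<bar> \<partial>\<mu>T) < d"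
    using bounded_lipschitz_dense_real[OF finite_\<mu>T sets_\<mu>T i] d by blast
   have iu: "integrable \<mu>T u" by (rule bounded_lipschitz_integrable[OF u(1) finite_\<mu>T sets_\<mu>T])
   have close: "\<bar>T u \<rho> - current_restrict T \<gamma> f \<rho>\<bar> < e / 3" if \<rho>: "L-lipschitz_on UNIV \<rho>" for \<rho>
   proof -
    have lr: "lipschitz_fun \<rho>" using \<rho> unfolding lipschitz_fun_def by blast
    have "T u \<rho> - current_restrict T \<gamma> f \<rho> = (\<integral>x. (u x - \<gamma> x * f x) * dird W \<rho> x \<partial>\<mu>T)"
    unfolding T_eq_integral_dird[OF u(1) lr] eq[OF f lr]
    using integrable_dird[OF iu lr] integrable_dird[OF i lr] by (simp add: left_diff_distrib)
    also have "\<bar>...\<bar> <= Lip \<rho> * (\<integral>x. \<bar>u x - \<gamma> x * f x\<bar> \<partial>\<mu>T)"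
    using iu i by (intro integral_dird_bound lr) auto
    also have "... <= L * (\<integral>x. \<bar>u x - \<gamma> x * f x\<bar> \<partial>\<mu>T)" by (intro mult_right_mono Lip_le \<rho>) simp
    also have "... <= L * d" using u(2) L0 by (intro mult_left_mono) auto
    also have "... < (L + 1) * d" using d by simp
    also have "... = e / 3" using L0 by (simp add: d_def field_simps)
    finally show ?thesis .
   qed
   have "(%n. T u (\<pi>s n)) \<longlonglongrightarrow> T u \<pi>" using mc u(1) L lim unfolding metric_current_def by blast
   then obtain N where N: "!!n. n >= N ==> norm (T u (\<pi>s n) - T u \<pi>) < e / 3"
    using LIMSEQ_D[of _ _ "e/3"] e by (metis divide_pos_pos zero_less_numeral)
   have "norm (current_restrict T \<gamma> f (\<pi>s n) - current_restrict T \<gamma> f \<pi>) < e" if "n >= N" for n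
    using N[OF that] close[OF Ln[of n]] close[OF L\<pi>] unfolding real_norm_def by linarith
   then show "\<exists>no. \<forall>n\<ge>no. norm (current_restrict T \<gamma> f (\<pi>s n) - current_restrict T \<gamma> f \<pi>) < e" by blast
  qed
 qed
 show "\<exists>\<mu>. mass_bound (current_restrict T \<gamma>) \<mu>"
 proof (intro exI[of _ "density \<mu>T (%x. ennreal \<bar>\<gamma> x\<bar>)"])
  have gm: "\<gamma> \<in> borel_measurable \<mu>T" using g by simp
  have fin: "finite_borel (density \<mu>T (%x. ennreal \<bar>\<gamma> x\<bar>))"
  proof (rule finite_borel_density[OF \<mu>T_finite_borel])
   show "(\<integral>\<^sup>+x. ennreal \<bar>\<gamma> x\<bar> \<partial>\<mu>T) < \<infinity>" using g by (simp add: integrable_iff_bounded)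
  qed (use gm in measurable)
  show "mass_bound (current_restrict T \<gamma>) (density \<mu>T (%x. ennreal \<bar>\<gamma> x\<bar>))"
   unfolding mass_bound_def
  proof (intro conjI allI impI fin)
   fix f \<pi> :: "'e => real" assume f: "bounded_lipschitz f" and \<pi>: "lipschitz_fun \<pi>"
   have fm: "f \<in> borel_measurable \<mu>T" by (rule measurable_\<mu>T[OF bounded_lipschitz_borel[OF f]])
   have "\<bar>current_restrict T \<gamma> f \<pi>\<bar> <= Lip \<pi> * (\<integral>x. \<bar>\<gamma> x * f x\<bar> \<partial>\<mu>T)"
    unfolding eq[OF f \<pi>] by (rule integral_dird_bound[OF integrable_mult_bounded_lipschitz[OF g f] \<pi>])
   also have "(\<integral>x. \<bar>\<gamma> x * f x\<bar> \<partial>\<mu>T) = (\<integral>x. \<bar>f x\<bar> \<partial>density \<mu>T (%x. ennreal \<bar>\<gamma> x\<bar>))"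
    using gm fm by (subst integral_density) (auto simp: abs_mult)
   finally show "\<bar>current_restrict T \<gamma> f \<pi>\<bar> <= Lip \<pi> * (\<integral>x. \<bar>f x\<bar> \<partial>density \<mu>T (%x. ennreal \<bar>\<gamma> x\<bar>))" .
  qed
 qed
qed

end

section \<open>Curves of the flow\<close>

lemma mspeed_le_lipschitz:
 assumes "1-lipschitz_on UNIV f"
 shows "mspeed f t <= 1"
proof -
 have "real (Suc n) * dist (f (t + 1 / real (Suc n))) (f t) <= 1" for n
 proof -
  have "real (Suc n) * dist (f (t + 1 / real (Suc n))) (f t) <= real (Suc n) * (1 * dist (t + 1 / real (Suc n)) t)"
   by (intro mult_left_mono lipschitz_onD[OF assms]) auto
  then show ?thesis by (simp add: dist_real_def del: of_nat_Suc)
 qed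
 then have "mspeed f t <= liminf (%n. 1)"
  unfolding mspeed_def by (intro Liminf_mono always_eventually allI) (metis ennreal_1 ennreal_leI)
 then show ?thesis by (simp add: Liminf_const)
qed

lemma mspeed_measurable: "mspeed (at_time cv) \<in> borel_measurable borel"
 unfolding mspeed_def[abs_def]
 by (intro borel_measurable_liminf measurable_compose[OF _ measurable_ennreal] borel_measurable_continuous_onI continuous_intros
   continuous_on_compose2[OF at_time_continuous]) auto

lemma arclength_lipschitz:
 assumes arc: "arclength_parameterized cv" and l: "curve_length cv = ennreal len" "0 <= len"
 shows "1-lipschitz_on UNIV (at_time cv)" "!!t. t >= len ==> at_time cv t = at_time cv len"
proof -
 show const: "at_time cv t = at_time cv len" if "t >= len" for t
  using arc[unfolded arclength_parameterized_def, THEN conjunct2, rule_format, of t len] l that by (simp add: ennreal_leI)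
 have le: "dist (at_time cv s) (at_time cv t) <= t - s" if st: "0 <= s" "s <= t" "t < len" for s t
 proof -
  define u where "u = (%i::nat. if i = 0 then s else t)"
  have "(1, u) \<in> {(n::nat, t'::nat => real). mono_on {..n} t' \<and> t' ` {..n} \<subseteq> {s..t}}"
   using st by (auto simp: u_def mono_on_def)
  then have "(\<Sum>i<1. ennreal (dist (at_time cv (u i)) (at_time cv (u (Suc i))))) <= length_on {s..t} cv"
   unfolding length_on_def by (rule SUP_upper2) simp
  also have "... = ennreal (t - s)" using arc st l unfolding arclength_parameterized_def by (simp add: ennreal_lessI)
  finally show ?thesis using st by (simp add: u_def)
 qed
 have "1-lipschitz_on {0..<len} (at_time cv)"
 proof (rule lipschitz_onI)
  fix s t assume "s \<in> {0..<len}" "t \<in> {0..<len}"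
  then show "dist (at_time cv s) (at_time cv t) <= 1 * dist s t"
   using le[of s t] le[of t s] by (cases "s <= t") (auto simp: dist_real_def dist_commute)
 qed simp
 then have "1-lipschitz_on (closure {0..<len}) (at_time cv)"
  by (rule lipschitz_on_closure) (rule continuous_on_subset[OF at_time_continuous], simp)
 then have L: "1-lipschitz_on {0..len} (at_time cv)"
  using l(2) by (cases "len = 0") (auto simp: lipschitz_on_def closure_atLeastLessThan)
 have clamp: "at_time cv t = at_time cv (max 0 (min len t))" for t
  using const[of t] at_time_neg[of t cv] l(2) by (cases "t <= 0"; cases "len <= t") (auto simp: max_def min_def)
 show "1-lipschitz_on UNIV (at_time cv)"
 proof (rule lipschitz_onI)
  fix s t :: real
  have "dist (at_time cv s) (at_time cv t) <= 1 * dist (max 0 (min len s)) (max 0 (min len t))"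
   unfolding clamp[of s] clamp[of t] by (rule lipschitz_onD[OF L]) (use l(2) in auto)
  also have "... <= 1 * dist s t" unfolding dist_real_def by (auto simp: max_def min_def)
  finally show "dist (at_time cv s) (at_time cv t) <= 1 * dist s t" .
 qed simp
qed

text \<open>The speed is at most one up to the end of the curve and zero afterwards, and its integral is
  the length.\<close>
lemma arclength_unit_speed:
 fixes cv :: "'a::metric_space curve"
 assumes arc: "arclength_parameterized cv" and l: "curve_length cv = ennreal len" "0 <= len"
  and speed: "(\<integral>\<^sup>+t. mspeed (at_time cv) t * indicator {0..} t \<partial>lborel) = curve_length cv"
 shows "AE t in lborel. 0 < t \<and> t < len --> mspeed (at_time cv) t = 1"
proof -
 note [measurable] = mspeed_measurable[of cv]
 note al = arclength_lipschitz[OF arc l]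
 have "mspeed (at_time cv) t = 0" if "t >= len" for t
  using al(2)[of t] al(2)[of "t + 1 / real (Suc _)"] that unfolding mspeed_def by (simp add: add_nonneg_nonneg add_increasing2 Liminf_const)
 then have le: "mspeed (at_time cv) t * indicator {0..} t <= indicator {0..len} t" for t
  using mspeed_le_lipschitz[OF al(1), of t] by (cases "t <= len") (auto simp: indicator_def)
 have "AE t in lborel. mspeed (at_time cv) t * indicator {0..} t = indicator {0..len} t"
  by (rule AE_eq_of_nn_integral_eq[OF _ _ le]) (use l speed in auto)
 then show ?thesis by eventually_elim auto
qed

context decomposed_current begin

text \<open>The integral of the speed never exceeds the length, and the two have the same finite integral
  over all curves, namely the mass of \<open>T\<close>.\<close>
lemma curve_length_eq_speed:
 "AE cv in \<eta>. (\<integral>\<^sup>+t. mspeed (at_time cv) t * indicator {0..} t \<partial>lborel) = curve_length cv"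
proof (rule AE_eq_of_nn_integral_eq)
 interpret M: finite_measure \<mu>T by (rule finite_\<mu>T)
 have eq: "(\<integral>\<^sup>+t. rho (cv, t) \<partial>lborel) = (\<integral>\<^sup>+t. mspeed (at_time cv) t * indicator {0..} t \<partial>lborel)" for cv :: "'e curve" by (simp add: rho_def)
 show "(%cv. \<integral>\<^sup>+t. mspeed (at_time cv) t * indicator {0..} t \<partial>lborel) \<in> borel_measurable \<eta>"
  using lborel.borel_measurable_nn_integral_fst[OF rho_P] unfolding eq .
 show "curve_length \<in> borel_measurable \<eta>" unfolding measurable_cong_sets[OF sets_\<eta> refl] by (rule curve_length_measurable)
 show "(\<integral>\<^sup>+t. mspeed (at_time cv) t * indicator {0..} t \<partial>lborel) <= curve_length cv" for cv :: "'e curve" by (rule mspeed_integral_le_length)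
 have r: "(\<integral>\<^sup>+cv. \<integral>\<^sup>+t. mspeed (at_time cv) t * indicator {0..} t \<partial>lborel \<partial>\<eta>) = emeasure \<mu>T UNIV"
  using lborel.nn_integral_fst[OF rho_P] emeasure_image[of UNIV] unfolding eq mass_measure_eq_image by simp
 show "(\<integral>\<^sup>+cv. curve_length cv \<partial>\<eta>) <= (\<integral>\<^sup>+cv. \<integral>\<^sup>+t. mspeed (at_time cv) t * indicator {0..} t \<partial>lborel \<partial>\<eta>)"
  unfolding r using mass_eq by (simp add: mass_def)
 show "(\<integral>\<^sup>+cv. \<integral>\<^sup>+t. mspeed (at_time cv) t * indicator {0..} t \<partial>lborel \<partial>\<eta>) < \<infinity>" unfolding r by (simp add: less_top[symmetric])
qed

end

text \<open>The density is at most one almost everywhere, since otherwise it would violate the inequality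
  on a set of finite measure; truncation makes the bound hold everywhere.\<close>
lemma submeasure_density:
 assumes M: "sigma_finite_measure M" and N: "finite_measure N" "sets N = sets M" and le: "!!A. A \<in> sets M ==> emeasure N A <= emeasure M A"
 obtains D :: "'a => real" where "D \<in> borel_measurable M" "!!x. 0 <= D x" "!!x. D x <= 1" "N = density M (%x. ennreal (D x))"
proof -
 interpret sigma_finite_measure M by (rule M)
 have ac: "absolutely_continuous M N"
  unfolding absolutely_continuous_def using le N(2) by (auto simp: null_sets_def) (metis le_zero_eq)
 obtain D :: "'a => real" where Dm[measurable]: "D \<in> borel_measurable M" and D0: "!!x. 0 <= D x" and ND: "N = density M (%x. ennreal (D x))"
  by (rule finite_measure_density[OF M N ac]) blast
 obtain A :: "nat => 'a set" where A: "range A \<subseteq> sets M" "(\<Union>i. A i) = space M" "!!i. emeasure M (A i) ~= \<infinity>"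
  using sigma_finite by metis
 have "AE x in M. x \<in> A i --> D x <= 1" for i
 proof -
  \<comment> \<open>The set where the density violates the inequality, cut down to finite measure.\<close>
  define B where "B = {x\<in>space M. D x > 1} \<inter> A i"
  have "A i \<in> sets M" using A(1) by auto
  then have Bs[measurable]: "B \<in> sets M" unfolding B_def by (rule sets.Int[rotated]) measurable
  have finB: "emeasure M B < \<infinity>"
   using A(3)[of i] A(1) le_less_trans[OF emeasure_mono[of B "A i" M]] by (auto simp: B_def less_top)
  have "AE x in M. indicator B x = ennreal (D x) * indicator B x"
  proof (rule AE_eq_of_nn_integral_eq)
   show "indicator B x <= ennreal (D x) * indicator B x" for x by (auto simp: B_def indicator_def)
   show "(\<integral>\<^sup>+x. ennreal (D x) * indicator B x \<partial>M) <= (\<integral>\<^sup>+x. indicator B x \<partial>M)"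
    using le[OF Bs] unfolding ND by (simp add: emeasure_density)
  qed (use finB in auto)
  then show ?thesis using AE_space
  proof eventually_elim
   fix x assume "indicator B x = ennreal (D x) * indicator B x" "x \<in> space M"
   then show "x \<in> A i --> D x <= 1" by (cases "D x > 1") (auto simp: B_def)
  qed
 qed
 then have "AE x in M. \<forall>i. x \<in> A i --> D x <= 1" unfolding AE_all_countable by blast
 then have "AE x in M. D x <= 1" using AE_space by eventually_elim (use A(2) in auto)
 then have "N = density M (%x. ennreal (min 1 (D x)))"
  unfolding ND by (intro density_cong) (auto elim!: eventually_mono)
 then show ?thesis using D0 by (intro that[of "%x. min 1 (D x)"]) auto
qed

definition pos :: "('a::metric_space curve \<times> real) \<times> real => 'a" where "pos q = beta (snd q) (fst q)"

text \<open>The pairs \<open>((\<theta>, s), t)\<close> such that the particle that starts at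
  \<open>\<theta> s\<close> has not reached the end of its curve at time \<open>t\<close>.\<close>
definition alive :: "(('a::metric_space curve \<times> real) \<times> real) set" where
 "alive = {(p, t). 0 <= t \<and> ennreal (t + snd p) < curve_length (fst p)}"

lemma curve_pair_measurable:
 fixes \<sigma> :: "('a::metric_space curve \<times> real) measure"
 assumes s: "sets \<sigma> = sets borel"
 shows "fst \<in> measurable \<sigma> borel" "snd \<in> borel_measurable \<sigma>"
  "pos \<in> borel_measurable (\<sigma> \<Otimes>\<^sub>M lborel)" "alive \<in> sets (\<sigma> \<Otimes>\<^sub>M lborel)"
proof -
 have ms: "borel_measurable \<sigma> = borel_measurable borel" "measurable \<sigma> borel = (borel_measurable borel :: (_ => 'a curve) set)"
  by (rule measurable_cong_sets[OF s refl])+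
 show f: "fst \<in> measurable \<sigma> borel" unfolding ms by (intro borel_measurable_continuous_onI continuous_intros)
 show g: "snd \<in> borel_measurable \<sigma>"
  unfolding measurable_cong_sets[OF s refl] by (intro borel_measurable_continuous_onI continuous_intros)
 have "(%(p, t). beta t p) \<in> borel_measurable (\<sigma> \<Otimes>\<^sub>M borel)"
 proof (rule caratheodory_measurable)
  show "beta t \<in> borel_measurable \<sigma>" for t :: real unfolding measurable_cong_sets[OF s refl] by (rule beta_measurable)
  show "continuous_on UNIV (%t. beta t p)" for p :: "'a curve \<times> real"
   unfolding beta_def case_prod_beta by (intro continuous_on_compose2[OF at_time_continuous] continuous_intros) auto
 qed
 moreover have sP: "sets (\<sigma> \<Otimes>\<^sub>M lborel) = sets (\<sigma> \<Otimes>\<^sub>M (borel :: real measure))" by (intro sets_pair_measure_cong) auto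
 ultimately show "pos \<in> borel_measurable (\<sigma> \<Otimes>\<^sub>M lborel)"
  by (simp add: pos_def[abs_def] case_prod_beta' measurable_cong_sets[OF sP refl])
 have sp: "space \<sigma> = UNIV" using sets_eq_imp_space_eq[OF s] by simp
 have [measurable]: "(%q. curve_length (fst (fst q))) \<in> borel_measurable (\<sigma> \<Otimes>\<^sub>M lborel)" "(%q. snd (fst q)) \<in> borel_measurable (\<sigma> \<Otimes>\<^sub>M lborel)"
  by (rule measurable_compose[OF measurable_compose[OF measurable_fst f] curve_length_measurable], rule measurable_compose[OF measurable_fst g])
 have "{q\<in>space (\<sigma> \<Otimes>\<^sub>M lborel). 0 <= snd q \<and> ennreal (snd q + snd (fst q)) < curve_length (fst (fst q))} \<in> sets (\<sigma> \<Otimes>\<^sub>M lborel)"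
  by measurable
 moreover have "{q\<in>space (\<sigma> \<Otimes>\<^sub>M lborel). 0 <= snd q \<and> ennreal (snd q + snd (fst q)) < curve_length (fst (fst q))} = alive"
  by (auto simp: alive_def space_pair_measure sp)
 ultimately show "alive \<in> sets (\<sigma> \<Otimes>\<^sub>M lborel)" by simp
qed

text \<open>A weight turns the product measure into a finite one; its image under the flow is tight,
  because the curves come from a tight measure.\<close>
lemma flow_field_separable:
 fixes \<sigma> :: "('a::metric_space curve \<times> real) measure" and V :: "'a => 'b::metric_space"
 assumes tb: "tight_borel \<eta>" and \<sigma>: "finite_borel \<sigma>" and ac: "absolutely_continuous \<eta> (distr \<sigma> borel fst)"
  and V: "V \<in> borel_measurable borel"
 obtains C where "countable C" "AE q in \<sigma> \<Otimes>\<^sub>M lborel. V (pos q) \<in> closure C"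
proof -
 note D = finite_borelD[OF \<sigma>]
 note m = curve_pair_measurable[OF D(2)]
 interpret \<sigma>: finite_measure \<sigma> by (rule D)
 interpret Q: pair_sigma_finite \<sigma> "lborel :: real measure" by standard
 have s\<eta>: "sets (distr \<sigma> borel fst) = sets \<eta>" using tb by (simp add: tight_borel_def)
 obtain h where h: "h \<in> borel_measurable (\<sigma> \<Otimes>\<^sub>M (lborel :: real measure))" "integral\<^sup>N (\<sigma> \<Otimes>\<^sub>M lborel) h ~= \<infinity>" "!!q. q \<in> space (\<sigma> \<Otimes>\<^sub>M lborel) ==> 0 < h q"
  using Q.P.Ex_finite_integrable_function by blast
 note [measurable] = h(1)
 define g where "g = (%q::('a curve \<times> real) \<times> real. (fst (fst q), snd q + snd (fst q)))"
 have g: "g \<in> measurable (\<sigma> \<Otimes>\<^sub>M lborel) (borel \<Otimes>\<^sub>M borel)"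
  unfolding g_def using measurable_compose[OF measurable_fst m(1)] measurable_compose[OF measurable_fst m(2)] by measurable
 define N where "N = distr (density (\<sigma> \<Otimes>\<^sub>M lborel) h) (borel \<Otimes>\<^sub>M borel) g"
 have "finite_borel (distr N borel ev)"
 proof (rule finite_borel_distr_evaluation[OF tb])
  show "sets N = sets (borel \<Otimes>\<^sub>M borel)" by (simp add: N_def)
  show "emeasure N (space N) < \<infinity>"
  proof -
   have gd: "g \<in> measurable (density (\<sigma> \<Otimes>\<^sub>M lborel) h) (borel \<Otimes>\<^sub>M borel)" using g by simp
   have "emeasure N (space N) = emeasure (density (\<sigma> \<Otimes>\<^sub>M lborel) h) (space (\<sigma> \<Otimes>\<^sub>M lborel))"
    unfolding N_def space_distr emeasure_distr[OF gd sets.top] by (simp add: space_pair_measure)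
   also have "... = integral\<^sup>N (\<sigma> \<Otimes>\<^sub>M lborel) h" unfolding emeasure_density[OF h(1) sets.top] by (auto intro!: nn_integral_cong)
   finally show ?thesis using h(2) by (simp add: less_top)
  qed
  fix S :: "'a curve set" assume S: "S \<in> sets borel" and ae: "AE cv in \<eta>. cv \<in> S"
  have "AE cv in distr \<sigma> borel fst. cv \<in> S" by (rule absolutely_continuous_AE[OF s\<eta> ac ae])
  then have aes: "AE p in \<sigma>. fst p \<in> S" by (rule AE_distrD[OF m(1)])
  have "AE q in \<sigma> \<Otimes>\<^sub>M (lborel :: real measure). fst (fst q) \<in> S"
  proof (rule Q.AE_pair_measure)
   show "{q \<in> space (\<sigma> \<Otimes>\<^sub>M (lborel :: real measure)). fst (fst q) \<in> S} \<in> sets (\<sigma> \<Otimes>\<^sub>M lborel)"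
    using measurable_sets[OF measurable_compose[OF measurable_fst[of \<sigma> "lborel :: real measure"] m(1)] S] unfolding vimage_def Int_def by (simp only: mem_Collect_eq conj_commute)
   show "AE p in \<sigma>. AE t in lborel. fst (fst (p, t :: real)) \<in> S" using aes by eventually_elim simp
  qed
  then have "AE q in density (\<sigma> \<Otimes>\<^sub>M lborel) h. fst (g q) \<in> S"
   by (subst AE_density) (auto simp: g_def elim!: eventually_mono)
  then show "AE p in N. fst p \<in> S"
   unfolding N_def using g S by (subst AE_distr_iff) auto
 qed
 from borel_map_essentially_separable[OF this V] obtain C where C: "countable C" "AE x in distr N borel ev. V x \<in> closure C" by blast
 have evN: "ev \<in> measurable N borel" unfolding N_def using ev_measurable by simp
 have "AE p in N. V (ev p) \<in> closure C" by (rule AE_distrD[OF evN C(2)])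
 then have "AE q in density (\<sigma> \<Otimes>\<^sub>M lborel) h. V (ev (g q)) \<in> closure C"
  unfolding N_def by (rule AE_distrD[rotated]) (use g in simp)
 then have "AE q in \<sigma> \<Otimes>\<^sub>M lborel. 0 < h q --> V (ev (g q)) \<in> closure C" by (subst (asm) AE_density) auto
 then have "AE q in \<sigma> \<Otimes>\<^sub>M lborel. V (pos q) \<in> closure C"
  using AE_space by eventually_elim (use h(3) in \<open>auto simp: g_def ev_def pos_def beta_def case_prod_beta\<close>)
 with C(1) show ?thesis by (rule that)
qed

locale field_flow = separated_field T \<eta> V C for T :: "'e::banach functional" and \<eta> V C +
 fixes \<sigma> :: "('e curve \<times> real) measure"
 assumes fb\<sigma>: "finite_borel \<sigma>" and start: "AE p in \<sigma>. 0 <= snd p"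
  and ac: "absolutely_continuous \<eta> (distr \<sigma> borel fst)"
  and finite_length: "(\<integral>\<^sup>+cv. curve_length cv \<partial>distr \<sigma> borel fst) < \<infinity>"
  and arc: "AE cv in distr \<sigma> borel fst. arclength_parameterized cv"
  and VC\<sigma>: "AE q in \<sigma> \<Otimes>\<^sub>M lborel. V (pos q) \<in> closure C"
begin

abbreviation "Q \<equiv> \<sigma> \<Otimes>\<^sub>M (lborel :: real measure)"

lemmas sets_\<sigma> = finite_borelD(2)[OF fb\<sigma>] and space_\<sigma> = finite_borelD(3)[OF fb\<sigma>]
lemma space_Q: "space Q = UNIV" by (simp add: space_pair_measure space_\<sigma>)
lemmas pair_measurable [measurable] = curve_pair_measurable[OF sets_\<sigma>]

sublocale \<sigma>: finite_measure \<sigma> by (rule finite_borelD(1)[OF fb\<sigma>])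
sublocale Q: pair_sigma_finite \<sigma> lborel by standard

lemma transfer_curves: "AE cv in \<eta>. R cv ==> AE p in \<sigma>. R (fst p)"
 by (rule AE_distrD[OF pair_measurable(1) absolutely_continuous_AE[OF _ ac]]) (simp_all add: sets_\<eta>)

text \<open>Null sets of curves for \<open>\<eta>\<close> are null for the flow, so the particles move
  with unit velocity \<open>V\<close> while they are alive, and rest afterwards. As their speed
  is one, they spend no time in a \<open>\<mu>T\<close>-null set.\<close>
lemma flow_curve:
 assumes N: "N \<in> null_sets \<mu>T" and \<pi>: "lipschitz_fun \<pi>"
 shows "AE p in \<sigma>. 0 <= snd p \<and> 1-lipschitz_on UNIV (at_time (fst p)) \<and> curve_length (fst p) < \<infinity> \<and>
  (AE t in lborel. 0 < t --> ((p, t) \<in> alive --> pos (p, t) \<notin> N) \<and>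
    ((%t. \<pi> (pos (p, t))) has_real_derivative indicator alive (p, t) * dird W \<pi> (pos (p, t))) (at t))"
proof -
 obtain N' where N': "N' \<in> null_sets \<mu>T" "\<forall>x\<in>space \<mu>T - N'. V x \<in> closure C"
  using AE_imp_null_set[OF VC] by (rule bexE)
 define M where "M = N \<union> N'"
 have M: "M \<in> null_sets \<mu>T" unfolding M_def by (rule null_sets.Un[OF N N'(1)])
 have WV: "W x = V x" if "x \<notin> M" for x using N'(2) that by (simp add: space_\<mu>T sep_field_def M_def)
 have n: "AE cv in \<eta>. AE t in lborel. rho (cv, t) = 0 \<or> ev (cv, t) \<notin> M"
  using AE_pair[of "%p. rho p = 0 \<or> ev p \<notin> M"] image_null[OF M] by blast
 have fin: "AE p in \<sigma>. curve_length (fst p) ~= \<infinity>"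
 proof (rule AE_distrD[OF pair_measurable(1)])
  show "AE cv in distr \<sigma> borel fst. curve_length cv ~= \<infinity>"
   by (rule nn_integral_PInf_AE) (use finite_length curve_length_measurable in auto)
 qed
 show ?thesis
  using start fin AE_distrD[OF pair_measurable(1) arc] transfer_curves[OF n]
   transfer_curves[OF curves_tangent_to_field] transfer_curves[OF curve_real_differentiable[OF \<pi>]] transfer_curves[OF curve_length_eq_speed]
 proof eventually_elim
  fix p :: "'e curve \<times> real"
  obtain cv s where p: "p = (cv, s)" by force
  assume s: "0 <= snd p" and "curve_length (fst p) ~= \<infinity>" and arc: "arclength_parameterized (fst p)"
   and 1: "AE t in lborel. rho (fst p, t) = 0 \<or> ev (fst p, t) \<notin> M"
   and 2: "AE t in lborel. t > 0 --> (\<exists>v. (at_time (fst p) has_vector_derivative v) (at t) \<and> v = norm v *\<^sub>R V (at_time (fst p) t))"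
   and 3: "AE t in lborel. t > 0 --> (\<exists>D. ((%s. \<pi> (at_time (fst p) s)) has_real_derivative D) (at t))"
   and sp: "(\<integral>\<^sup>+t. mspeed (at_time (fst p)) t * indicator {0..} t \<partial>lborel) = curve_length (fst p)"
  then obtain len where l: "curve_length cv = ennreal len" "0 <= len" by (cases "curve_length cv") (auto simp: p)
  note arc = arc[unfolded p fst_conv] and sp = sp[unfolded p fst_conv] and 1 = 1[unfolded p fst_conv] and 2 = 2[unfolded p fst_conv] and 3 = 3[unfolded p fst_conv]
  note al = arclength_lipschitz[OF arc l]
  have 4: "AE t in lborel. 0 < t \<and> t < len --> mspeed (at_time cv) t = 1"
   by (rule arclength_unit_speed[OF arc l sp])
  have "AE u in lborel. u > 0 \<and> u ~= len --> (u < len --> at_time cv u \<notin> N) \<and>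
    ((%u. \<pi> (at_time cv u)) has_real_derivative (if u < len then dird W \<pi> (at_time cv u) else 0)) (at u)"
   using 1 2 3 4
  proof (eventually_elim, intro impI)
   fix u assume n: "rho (cv, u) = 0 \<or> ev (cv, u) \<notin> M"
    and d: "u > 0 --> (\<exists>v. (at_time cv has_vector_derivative v) (at u) \<and> v = norm v *\<^sub>R V (at_time cv u))"
    and e: "u > 0 --> (\<exists>D. ((%s. \<pi> (at_time cv s)) has_real_derivative D) (at u))"
    and m: "0 < u \<and> u < len --> mspeed (at_time cv) u = 1" and u: "u > 0 \<and> u ~= len"
   show "(u < len --> at_time cv u \<notin> N) \<and>
    ((%u. \<pi> (at_time cv u)) has_real_derivative (if u < len then dird W \<pi> (at_time cv u) else 0)) (at u)"
   proof (cases "u < len")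
    case True
    obtain v where v: "(at_time cv has_vector_derivative v) (at u)" "v = norm v *\<^sub>R V (at_time cv u)" using d u by blast
    obtain D where D: "((%s. \<pi> (at_time cv s)) has_real_derivative D) (at u)" using e u by blast
    have "mspeed (at_time cv) u = 1" using m u True by blast
    then have nM: "at_time cv u \<notin> M" using n u by (simp add: rho_def ev_def)
    have "norm v = 1" using \<open>mspeed (at_time cv) u = 1\<close> mspeed_eq[OF v(1)] by (simp add: ennreal_eq_1)
    then have "v = 1 *\<^sub>R W (at_time cv u)" using v(2) WV[OF nM] by simp
    from dird_along_curve[where W=W and c=1, OF Lip_lipschitz[OF \<pi>] v(1) D _ this]
    show ?thesis using D True nM by (simp add: M_def)
   next
    case False
    then have "u > len" using u by simp
    have "((%u. \<pi> (at_time cv u)) has_real_derivative 0) (at u)"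
    proof (rule has_field_derivative_transform_within_open[where f="%_. \<pi> (at_time cv len)" and S="{len<..}"])
    show "\<pi> (at_time cv len) = \<pi> (at_time cv x)" if "x \<in> {len<..}" for x using al(2)[of x] that by simp
    qed (use \<open>u > len\<close> in auto)
    then show ?thesis using False by simp
   qed
  qed
  from AE_lborel_shift[OF this, of s]
  have "AE t in lborel. 0 < t --> ((p, t) \<in> alive --> pos (p, t) \<notin> N) \<and>
    ((%t. \<pi> (pos (p, t))) has_real_derivative indicator alive (p, t) * dird W \<pi> (pos (p, t))) (at t)"
   using AE_lborel_singleton[of "len - s"]
  proof (eventually_elim, intro impI)
   fix t assume "s + t > 0 \<and> s + t ~= len --> (s + t < len --> at_time cv (s + t) \<notin> N) \<and>
    ((%u. \<pi> (at_time cv u)) has_real_derivative (if s + t < len then dird W \<pi> (at_time cv (s + t)) else 0)) (at (s + t))"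
    and t: "t ~= len - s" "0 < t"
   then have "(s + t < len --> at_time cv (s + t) \<notin> N) \<and>
    ((%u. \<pi> (at_time cv u)) has_real_derivative (if s + t < len then dird W \<pi> (at_time cv (s + t)) else 0)) (at (s + t))"
    using s by (auto simp: p)
   moreover have "(p, t) \<in> alive \<longleftrightarrow> s + t < len" using t s l by (auto simp: alive_def p ennreal_less_iff add.commute simp del: ennreal_plus)
   ultimately show "((p, t) \<in> alive --> pos (p, t) \<notin> N) \<and>
    ((%t. \<pi> (pos (p, t))) has_real_derivative indicator alive (p, t) * dird W \<pi> (pos (p, t))) (at t)"
    using DERIV_shift[of "%u. \<pi> (at_time cv u)" "if s + t < len then dird W \<pi> (at_time cv (s + t)) else 0" t s]
    by (auto simp: pos_def beta_def p indicator_def add.commute)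
  qed
  then show "0 <= snd p \<and> 1-lipschitz_on UNIV (at_time (fst p)) \<and> curve_length (fst p) < \<infinity> \<and>
   (AE t in lborel. 0 < t --> ((p, t) \<in> alive --> pos (p, t) \<notin> N) \<and>
    ((%t. \<pi> (pos (p, t))) has_real_derivative indicator alive (p, t) * dird W \<pi> (pos (p, t))) (at t))"
   using s l al by (auto simp: p)
 qed
qed

end

section \<open>Survival and occupation densities\<close>

lemma integral_push_forward:
 fixes h :: "'b => real"
 assumes B: "B \<in> sets M" and g: "g \<in> measurable M N" and h: "h \<in> borel_measurable N"
 shows "integrable (distr (density M (indicator B)) N g) h \<longleftrightarrow> integrable M (%q. indicator B q * h (g q))"
  "integral\<^sup>L (distr (density M (indicator B)) N g) h = (\<integral>q. indicator B q * h (g q) \<partial>M)"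
proof -
 have i: "(indicator B :: 'a => ennreal) = (%q. ennreal (indicator B q))" by (auto simp: indicator_def)
 have g': "g \<in> measurable (density M (indicator B)) N" using g by simp
 have hg: "(%q. h (g q)) \<in> borel_measurable M" by (rule measurable_compose[OF g h])
 show "integrable (distr (density M (indicator B)) N g) h \<longleftrightarrow> integrable M (%q. indicator B q * h (g q))"
  unfolding integrable_distr_eq[OF g' h] unfolding i by (subst integrable_density) (use hg B in auto)
 show "integral\<^sup>L (distr (density M (indicator B)) N g) h = (\<integral>q. indicator B q * h (g q) \<partial>M)"
  unfolding integral_distr[OF g' h] unfolding i by (subst integral_density) (use hg B in auto)
qed

lemma emeasure_push_forward:
 assumes B: "B \<in> sets M" and g: "g \<in> measurable M N" and A: "A \<in> sets N"
 shows "emeasure (distr (density M (indicator B)) N g) A = (\<integral>\<^sup>+q. indicator B q * indicator A (g q) \<partial>M)"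
proof -
 have g': "g \<in> measurable (density M (indicator B)) N" using g by simp
 have "g -` A \<inter> space (density M (indicator B)) \<in> sets M" using measurable_sets[OF g A] by simp
 then show ?thesis unfolding emeasure_distr[OF g' A] using B
  by (subst emeasure_density) (auto intro!: nn_integral_cong simp: indicator_def)
qed

text \<open>Countably many continuous images of compact sets cover the image.\<close>
lemma finite_borel_distr_countable:
 fixes F :: "nat => 'a::topological_space => 'b::t2_space"
 assumes M: "finite_borel M" and f: "f \<in> borel_measurable M"
  and F: "!!n. continuous_on UNIV (F n)" "!!p. \<exists>n. f p = F n p"
 shows "finite_borel (distr M borel f)"
proof -
 interpret finite_measure M by (rule finite_borelD(1)[OF M])
 obtain K :: "nat => 'a set" where K: "!!n. compact (K n)" "AE x in M. x \<in> (\<Union>n. K n)"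
  using M unfolding finite_borel_def tight_borel_def by auto
 define C where "C = (%i. case prod_decode i of (n, m) => F n ` K m)"
 have C: "compact (C i)" for i unfolding C_def
  by (cases "prod_decode i") (auto intro!: compact_continuous_image continuous_on_subset[OF F(1)] K)
 define S where "S = (\<Union>i. C i)"
 have "S \<in> sets borel" unfolding S_def using compact_imp_closed[OF C] by auto
 moreover have "AE x in M. f x \<in> S"
  using K(2)
 proof eventually_elim
  fix x assume "x \<in> (\<Union>n. K n)"
  then obtain m where "x \<in> K m" by blast
  moreover obtain n where "f x = F n x" using F(2) by blast
  ultimately have "f x \<in> C (prod_encode (n, m))" by (simp add: C_def)
  then show "f x \<in> S" unfolding S_def by blast
 qed
 ultimately have "AE x in distr M borel f. x \<in> S" using f by (subst AE_distr_iff) auto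
 then show ?thesis unfolding S_def finite_borel_def tight_borel_def using C finite_measure_distr[OF f] by auto
qed

text \<open>Mean value theorem along segments.\<close>
lemma Q1_lipschitz:
 fixes \<pi> :: "'e::real_normed_vector => real"
 assumes "\<pi> \<in> Q1" shows "lipschitz_fun \<pi>" "has_quasi_derivative \<pi> (quasi_deriv \<pi> x) x"
proof -
 show q: "has_quasi_derivative \<pi> (quasi_deriv \<pi> x) x" for x
 proof -
  obtain D where D: "has_quasi_derivative \<pi> D x" using assms unfolding Q1_def by auto
  then show ?thesis by (simp add: quasi_deriv_eq[OF D])
 qed
 obtain B where B: "!!x. norm (quasi_deriv \<pi> x) <= B" using assms unfolding Q1_def bounded_iff by auto
 have "B-lipschitz_on UNIV \<pi>"
 proof (rule lipschitz_onI)
  fix x y :: 'e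
  define g where "g = (%s::real. \<pi> (y + s *\<^sub>R (x - y)))"
  have d: "(g has_real_derivative blinfun_apply (quasi_deriv \<pi> (y + s *\<^sub>R (x - y))) (x - y)) (at s)" for s
  proof -
   have "((%s::real. y + s *\<^sub>R (x - y)) has_vector_derivative x - y) (at s)" by (auto intro!: derivative_eq_intros)
   moreover have "continuous_on UNIV (%s::real. y + s *\<^sub>R (x - y))" by (intro continuous_intros)
   ultimately show ?thesis using q[of "y + s *\<^sub>R (x - y)"] unfolding has_quasi_derivative_def g_def by blast
  qed
  obtain z where "g 1 - g 0 = (1 - 0) * blinfun_apply (quasi_deriv \<pi> (y + z *\<^sub>R (x - y))) (x - y)"
   using MVT2[of 0 1 g "%s. blinfun_apply (quasi_deriv \<pi> (y + s *\<^sub>R (x - y))) (x - y)"] d by auto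
  moreover have "\<bar>blinfun_apply (quasi_deriv \<pi> (y + z *\<^sub>R (x - y))) (x - y)\<bar> <= B * norm (x - y)"
   using norm_blinfun[of "quasi_deriv \<pi> (y + z *\<^sub>R (x - y))" "x - y"] mult_right_mono[OF B norm_ge_zero, of "y + z *\<^sub>R (x - y)" "x - y"] by simp
  ultimately show "dist (\<pi> x) (\<pi> y) <= B * dist x y" by (simp add: g_def dist_norm)
 qed (rule order_trans[OF norm_ge_zero B])
 then show "lipschitz_fun \<pi>" unfolding lipschitz_fun_def by blast
qed

lemma test_functionE:
 assumes "test_function \<psi>"
 obtains a b K where "0 < a" "a <= b" "!!t. t \<notin> {a..b} ==> \<psi> t = 0 \<and> deriv \<psi> t = 0" "!!t. (\<psi> has_real_derivative deriv \<psi> t) (at t)"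
  "deriv \<psi> \<in> borel_measurable borel" "\<psi> \<in> borel_measurable borel" "!!t. \<bar>\<psi> t\<bar> <= K" "!!t. \<bar>deriv \<psi> t\<bar> <= K" "K-lipschitz_on UNIV \<psi>"
proof -
 have d: "((deriv ^^ k) \<psi>) differentiable (at t)" for k t using assms by (simp add: test_function_def)
 obtain a b' where ab': "0 < a" "!!t. t \<notin> {a..b'} ==> \<psi> t = 0" using assms by (auto simp: test_function_def)
 define b where "b = max a b'"
 have z: "\<psi> t = 0" if "t \<notin> {a..b}" for t by (rule ab'(2)) (use that in \<open>auto simp: b_def\<close>)
 have D: "(\<psi> has_real_derivative deriv \<psi> t) (at t)" for t
  using d[of 0 t] by (simp add: DERIV_deriv_iff_real_differentiable)
 have z': "deriv \<psi> t = 0" if "t \<notin> {a..b}" for t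
 proof (rule DERIV_imp_deriv, rule has_field_derivative_transform_within_open[where f="%_. 0" and S="- {a..b}"])
  show "0 = \<psi> x" if "x \<in> - {a..b}" for x using z[of x] that by simp
 qed (use that in auto)
 have c: "continuous_on UNIV \<psi>" "continuous_on UNIV (deriv \<psi>)"
  using d[of 0] d[of 1] by (auto simp: continuous_on_eq_continuous_within intro!: differentiable_imp_continuous_within)
 have "bounded (\<psi> ` {a..b})" "bounded (deriv \<psi> ` {a..b})"
  by (intro compact_imp_bounded compact_continuous_image continuous_on_subset[OF c(1)] continuous_on_subset[OF c(2)] compact_Icc; simp)+
 then obtain K1 K2 where K: "\<forall>y\<in>\<psi> ` {a..b}. norm y <= K1" "\<forall>y\<in>deriv \<psi> ` {a..b}. norm y <= K2" unfolding bounded_iff by blast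
 define K where "K = max 0 (max K1 K2)"
 have K1: "\<bar>\<psi> t\<bar> <= K" and K2: "\<bar>deriv \<psi> t\<bar> <= K" for t
  using K z[of t] z'[of t] by (cases "t \<in> {a..b}"; force simp: K_def)+
 have "K-lipschitz_on UNIV \<psi>"
 proof (rule lipschitz_onI)
  have le: "dist (\<psi> s) (\<psi> t) <= K * dist s t" if st: "s < t" for s t
  proof -
   obtain w where "\<psi> t - \<psi> s = (t - s) * deriv \<psi> w" using MVT2[OF st, of \<psi> "deriv \<psi>"] D by blast
   moreover have "dist (\<psi> s) (\<psi> t) = \<bar>\<psi> t - \<psi> s\<bar>" by (simp add: dist_real_def)
   ultimately have "dist (\<psi> s) (\<psi> t) = (t - s) * \<bar>deriv \<psi> w\<bar>" using st by (simp add: abs_mult)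
   also have "... <= (t - s) * K" using st by (intro mult_left_mono K2) simp
   finally show ?thesis using st by (simp add: dist_real_def mult.commute)
  qed
  show "dist (\<psi> s) (\<psi> t) <= K * dist s t" for s t
   using le[of s t] le[of t s] by (cases s t rule: linorder_cases) (auto simp: dist_commute)
 qed (simp add: K_def)
 then show ?thesis
  using ab'(1) z z' D c K1 K2 by (intro that[of a b K]) (auto simp: b_def intro: borel_measurable_continuous_onI)
qed

text \<open>The product of \<open>u\<close> with the test function is Lipschitz with compact support in
  the open half-line.\<close>
lemma lipschitz_integration_by_parts:
 fixes u D :: "real => real"
 assumes u: "L-lipschitz_on UNIV u" "!!t. \<bar>u t\<bar> <= B" and D: "AE t in lborel. 0 < t --> (u has_real_derivative D t) (at t)"
  and Dm: "D \<in> borel_measurable borel" and \<psi>: "test_function \<psi>"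
 shows "(\<integral>t. \<psi> t * D t \<partial>lborel) = - (\<integral>t. deriv \<psi> t * u t \<partial>lborel)"
proof -
 obtain a b K where ab: "0 < a" "a <= b" "!!t. t \<notin> {a..b} ==> \<psi> t = 0 \<and> deriv \<psi> t = 0" "!!t. (\<psi> has_real_derivative deriv \<psi> t) (at t)"
  and m: "deriv \<psi> \<in> borel_measurable borel" "\<psi> \<in> borel_measurable borel"
  and K: "!!t. \<bar>\<psi> t\<bar> <= K" "!!t. \<bar>deriv \<psi> t\<bar> <= K" "K-lipschitz_on UNIV \<psi>" by (rule test_functionE[OF \<psi>]) blast
 have L0: "0 <= L" and K0: "0 <= K" and B0: "0 <= B" using lipschitz_on_nonneg[OF u(1)] lipschitz_on_nonneg[OF K(3)] u(2)[of 0] by auto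
 have um[measurable]: "u \<in> borel_measurable borel" by (rule borel_measurable_continuous_onI[OF lipschitz_on_continuous_on[OF u(1)]])
 note [measurable] = Dm m
 define E where "E = (%t. deriv \<psi> t * u t + \<psi> t * D t)"
 have G: "(K * L + B * K)-lipschitz_on UNIV (%t. \<psi> t * u t)"
 proof (rule lipschitz_onI)
  fix s t :: real
  have "\<psi> s * u s - \<psi> t * u t = \<psi> s * (u s - u t) + u t * (\<psi> s - \<psi> t)" by (simp add: algebra_simps)
  also have "\<bar>...\<bar> <= \<bar>\<psi> s\<bar> * \<bar>u s - u t\<bar> + \<bar>u t\<bar> * \<bar>\<psi> s - \<psi> t\<bar>" by (rule order_trans[OF abs_triangle_ineq]) (simp add: abs_mult)
  also have "... <= K * (L * dist s t) + B * (K * dist s t)"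
   using lipschitz_onD[OF u(1), of s t] lipschitz_onD[OF K(3), of s t] K0 B0
   by (intro add_mono mult_mono K u(2)) (auto simp: dist_real_def)
  finally show "dist (\<psi> s * u s) (\<psi> t * u t) <= (K * L + B * K) * dist s t" by (simp add: dist_real_def algebra_simps)
 qed (use L0 K0 B0 in simp)
 \<comment> \<open>The product vanishes at both ends of this interval, which avoids the time 0.\<close>
 have ae: "AE t in lborel. t \<in> {a/2..b+1} --> ((%t. \<psi> t * u t) has_real_derivative E t) (at t)"
  using D
 proof eventually_elim
  fix t assume "0 < t --> (u has_real_derivative D t) (at t)"
  then show "t \<in> {a/2..b+1} --> ((%t. \<psi> t * u t) has_real_derivative E t) (at t)"
   using DERIV_mult[OF ab(4)[of t], of u "D t"] ab(1) by (auto simp: E_def mult.commute)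
 qed
 have "a/2 <= b+1" using ab by simp
 note ftc = lipschitz_ftc[OF G this ae]
 have Em: "E \<in> borel_measurable borel" unfolding E_def by measurable
 have EE: "(%t. indicator {a/2..b+1} t *\<^sub>R E t) = E"
 proof
  show "indicator {a/2..b+1} t *\<^sub>R E t = E t" for t using ab(1,2) ab(3)[of t] by (cases "t \<in> {a..b}") (auto simp: E_def)
 qed
 have iE: "integrable lborel E" and E0: "integral\<^sup>L lborel E = 0"
  using ftc[OF Em] ab unfolding set_integrable_def set_lebesgue_integral_def EE by auto
 have iu: "integrable lborel (%t. deriv \<psi> t * u t)"
 proof (rule Bochner_Integration.integrable_bound[of _ "%t. (K * B) * indicator {a..b} t"])
  have "\<bar>deriv \<psi> t\<bar> * \<bar>u t\<bar> <= K * B" for t using K0 by (intro mult_mono K u(2)) auto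
  then show "AE t in lborel. norm (deriv \<psi> t * u t) <= norm ((K * B) * indicator {a..b} t)"
   using ab K0 B0 by (intro AE_I2) (auto simp: indicator_def abs_mult)
 qed (use ab in auto)
 have "(%t. \<psi> t * D t) = (%t. E t - deriv \<psi> t * u t)" by (simp add: E_def)
 then show ?thesis using iE iu E0 by simp
qed

lemma AE_lebesgue_on_iff:
 assumes "S \<in> sets borel"
 shows "(AE t in lebesgue_on S. R t) \<longleftrightarrow> (AE t::'a::euclidean_space in lborel. t \<in> S --> R t)"
 using assms by (subst AE_restrict_space_iff) (auto simp: AE_completion_iff)

context field_flow begin

abbreviation "spacetime \<equiv> (%q. (pos q, snd q)) :: ('e curve \<times> real) \<times> real => 'e \<times> real"
abbreviation "future \<equiv> {q :: ('e curve \<times> real) \<times> real. 0 <= snd q}"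

lemma spacetime_measurable [measurable]: "spacetime \<in> measurable Q (borel \<Otimes>\<^sub>M borel)"
 by (intro measurable_Pair pair_measurable(3)) simp

lemma future_sets: "future \<in> sets Q"
proof -
 have "{q \<in> space Q. 0 <= snd q} \<in> sets Q" by measurable
 then show ?thesis by (simp add: space_Q)
qed

text \<open>A particle is alive for at most the length of its curve.\<close>
lemma total_life_finite: "(\<integral>\<^sup>+q. indicator alive q \<partial>Q) < \<infinity>"
proof -
 have "(\<integral>\<^sup>+q. indicator alive q \<partial>Q) = (\<integral>\<^sup>+p. \<integral>\<^sup>+t. indicator alive (p, t) \<partial>lborel \<partial>\<sigma>)"
  by (rule lborel.nn_integral_fst[symmetric]) simp
 also have "... <= (\<integral>\<^sup>+p. curve_length (fst p) \<partial>\<sigma>)"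
 proof (rule nn_integral_mono_AE)
  show "AE p in \<sigma>. (\<integral>\<^sup>+t. indicator alive (p, t) \<partial>lborel) <= curve_length (fst p)"
   using start
  proof eventually_elim
   fix p :: "'e curve \<times> real" assume p: "0 <= snd p"
   show "(\<integral>\<^sup>+t. indicator alive (p, t) \<partial>lborel) <= curve_length (fst p)"
   proof (cases "curve_length (fst p)")
    case (real r)
    have "indicator alive (p, t) <= (indicator {0..r} t :: ennreal)" for t
    using p real by (auto simp: alive_def indicator_def ennreal_less_iff simp del: ennreal_plus)
    then have "(\<integral>\<^sup>+t. indicator alive (p, t) \<partial>lborel) <= (\<integral>\<^sup>+t. indicator {0..r} t \<partial>lborel)" by (intro nn_integral_mono)
    then show ?thesis using real by simp
   qed simp
  qed
 qed
 also have "... = (\<integral>\<^sup>+cv. curve_length cv \<partial>distr \<sigma> borel fst)"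
  by (rule nn_integral_distr[OF pair_measurable(1), symmetric]) (simp add: curve_length_measurable)
 also have "... < \<infinity>" by (rule finite_length)
 finally show ?thesis .
qed

text \<open>The mass that is alive, as a measure on space-time, is part of the mass of the whole flow. The
  value \<open>\<zeta> (x, t)\<close> is the fraction of the particles at \<open>x\<close> at
  time \<open>t\<close> that still move.\<close>
lemma survival_density:
 obtains \<zeta> :: "'e \<times> real => real" where "\<zeta> \<in> borel_measurable (borel \<Otimes>\<^sub>M borel)" "!!y. 0 <= \<zeta> y" "!!y. \<zeta> y <= 1"
  "distr (density Q (indicator alive)) (borel \<Otimes>\<^sub>M borel) spacetime = density (distr (density Q (indicator future)) (borel \<Otimes>\<^sub>M borel) spacetime) (%y. ennreal (\<zeta> y))"
proof -
 let ?A = "distr (density Q (indicator alive)) (borel \<Otimes>\<^sub>M borel) spacetime"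
 let ?F = "distr (density Q (indicator future)) (borel \<Otimes>\<^sub>M borel) spacetime"
 note eA = emeasure_push_forward[OF pair_measurable(4) spacetime_measurable]
 note eF = emeasure_push_forward[OF future_sets spacetime_measurable]
 have fA: "finite_measure ?A"
 proof (rule finite_measureI)
  have "emeasure ?A (space ?A) <= (\<integral>\<^sup>+q. indicator alive q \<partial>Q)"
   unfolding space_distr eA[OF sets.top] by (intro nn_integral_mono) (auto simp: indicator_def)
  then show "emeasure ?A (space ?A) ~= \<infinity>" using total_life_finite by (auto simp: top_unique)
 qed
 have sF: "sigma_finite_measure ?F"
 proof
  define S where "S = (%n::nat. (UNIV :: 'e set) \<times> {- real n..real n})"
  have S: "S n \<in> sets (borel \<Otimes>\<^sub>M borel)" for n unfolding S_def by (intro pair_measureI) auto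
  have "emeasure ?F (S n) ~= \<infinity>" for n
  proof -
   have "emeasure ?F (S n) <= (\<integral>\<^sup>+q. indicator (UNIV \<times> {- real n..real n}) q \<partial>Q)"
    unfolding eF[OF S] by (intro nn_integral_mono) (auto simp: S_def indicator_def)
   also have "... = emeasure Q (space \<sigma> \<times> {- real n..real n})"
    using pair_measureI[OF sets.top[of \<sigma>], of "{- real n..real n}" "lborel :: real measure"] unfolding space_\<sigma> by (subst nn_integral_indicator) simp_all
   also have "... = emeasure \<sigma> (space \<sigma>) * ennreal (2 * real n)"
    by (subst lborel.emeasure_pair_measure_Times) auto
   also have "... < \<infinity>" by (simp add: \<sigma>.emeasure_eq_measure ennreal_mult[symmetric])
   finally show ?thesis by simp
  qed
  moreover have "\<Union> (range S) = space ?F"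
   unfolding S_def by (auto simp: space_pair_measure) (metis abs_le_iff minus_le_iff real_arch_simple)
  ultimately show "\<exists>A. countable A \<and> A \<subseteq> sets ?F \<and> \<Union> A = space ?F \<and> (\<forall>a\<in>A. emeasure ?F a ~= \<infinity>)"
   using S by (intro exI[of _ "range S"]) auto
 qed
 have le: "emeasure ?A A <= emeasure ?F A" if "A \<in> sets ?F" for A
  using that unfolding sets_distr eA[OF that[unfolded sets_distr]] eF[OF that[unfolded sets_distr]]
  by (intro nn_integral_mono) (auto simp: indicator_def alive_def)
 show ?thesis
 proof (rule submeasure_density[OF sF fA _ le])
  show "sets ?A = sets ?F" by simp
  fix D :: "'e \<times> real => real" assume "D \<in> borel_measurable ?F" "!!x. 0 <= D x" "!!x. D x <= 1" "?A = density ?F (%x. ennreal (D x))"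
  then show thesis by (intro that[of D]) (simp_all only: measurable_distr_eq1)
 qed
qed

text \<open>The time that living particles spend in a set is a finite measure, which does not charge
  \<open>\<mu>T\<close>-null sets.\<close>
lemma occupation_density:
 obtains \<gamma> :: "'e => real" where "integrable \<mu>T \<gamma>" "!!x. 0 <= \<gamma> x"
  "distr (density Q (indicator alive)) borel pos = density \<mu>T (%x. ennreal (\<gamma> x))"
proof -
 let ?K = "distr (density Q (indicator alive)) borel pos"
 note eK = emeasure_push_forward[OF pair_measurable(4,3)]
 interpret M: finite_measure \<mu>T by (rule finite_\<mu>T)
 have fin: "finite_measure ?K"
 proof (rule finite_measureI)
  have "emeasure ?K (space ?K) <= (\<integral>\<^sup>+q. indicator alive q \<partial>Q)"
   unfolding space_distr eK[OF sets.top] by (intro nn_integral_mono) (auto simp: indicator_def)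
  then show "emeasure ?K (space ?K) ~= \<infinity>" using total_life_finite by (auto simp: top_unique)
 qed
 have ac: "absolutely_continuous \<mu>T ?K"
  unfolding absolutely_continuous_def
 proof
  fix N assume N: "N \<in> null_sets \<mu>T"
  then have Nb: "N \<in> sets borel" using sets_\<mu>T by auto
  have "lipschitz_fun (%_::'e. 0)" using bounded_lipschitz_const unfolding bounded_lipschitz_def by blast
  from flow_curve[OF N this] have ae: "AE p in \<sigma>. (\<integral>\<^sup>+t. indicator alive (p, t) * indicator N (pos (p, t)) \<partial>lborel) = 0"
  proof (elim eventually_mono conjE)
   fix p assume "AE t in lborel. 0 < t --> ((p, t) \<in> alive --> pos (p, t) \<notin> N) \<and>
    ((%t. 0) has_real_derivative indicator alive (p, t) * dird W (%_. 0) (pos (p, t))) (at t)"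
   then have "AE t in lborel. indicator alive (p, t) * indicator N (pos (p, t)) = (0::ennreal)"
    using AE_lborel_singleton[of 0] by eventually_elim (auto simp: indicator_def alive_def)
   then have "(\<integral>\<^sup>+t. indicator alive (p, t) * indicator N (pos (p, t)) \<partial>lborel) = (\<integral>\<^sup>+t. 0 \<partial>(lborel :: real measure))" by (rule nn_integral_cong_AE)
   then show "(\<integral>\<^sup>+t. indicator alive (p, t) * indicator N (pos (p, t)) \<partial>lborel) = 0" by simp
  qed
  have [measurable]: "N \<in> sets borel" by (rule Nb)
  have "emeasure ?K N = (\<integral>\<^sup>+p. \<integral>\<^sup>+t. indicator alive (p, t) * indicator N (pos (p, t)) \<partial>lborel \<partial>\<sigma>)"
   unfolding eK[OF Nb] by (subst lborel.nn_integral_fst) auto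
  also have "... = (\<integral>\<^sup>+p. 0 \<partial>\<sigma>)" by (rule nn_integral_cong_AE[OF ae])
  finally show "N \<in> null_sets ?K" using Nb by auto
 qed
 have sK: "sets ?K = sets \<mu>T" using sets_\<mu>T by simp
 show ?thesis by (rule finite_measure_density[OF M.sigma_finite_measure_axioms fin sK ac]) (rule that)
qed

end

locale flow_densities = field_flow T \<eta> V C \<sigma> for T :: "'e::banach functional" and \<eta> V C \<sigma> +
 fixes \<zeta> :: "'e \<times> real => real" and \<gamma> :: "'e => real"
 assumes \<zeta>m [measurable]: "\<zeta> \<in> borel_measurable (borel \<Otimes>\<^sub>M borel)" and \<zeta>0: "!!y. 0 <= \<zeta> y"
  and \<zeta>_density: "distr (density Q (indicator alive)) (borel \<Otimes>\<^sub>M borel) spacetime = density (distr (density Q (indicator future)) (borel \<Otimes>\<^sub>M borel) spacetime) (%y. ennreal (\<zeta> y))"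
  and \<gamma>i: "integrable \<mu>T \<gamma>" and \<gamma>0: "!!x. 0 <= \<gamma> x"
  and \<gamma>_density: "distr (density Q (indicator alive)) borel pos = density \<mu>T (%x. ennreal (\<gamma> x))"
begin

lemma survival_integral:
 fixes h :: "'e \<times> real => real"
 assumes h: "h \<in> borel_measurable (borel \<Otimes>\<^sub>M borel)"
 shows "integrable Q (%q. indicator future q * (\<zeta> (spacetime q) * h (spacetime q))) \<longleftrightarrow> integrable Q (%q. indicator alive q * h (spacetime q))"
  "(\<integral>q. indicator future q * (\<zeta> (spacetime q) * h (spacetime q)) \<partial>Q) = (\<integral>q. indicator alive q * h (spacetime q) \<partial>Q)"
proof -
 have h': "(%y. \<zeta> y * h y) \<in> borel_measurable (borel \<Otimes>\<^sub>M borel)" using h by measurable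
 note F = integral_push_forward[OF future_sets spacetime_measurable h']
 note A = integral_push_forward[OF pair_measurable(4) spacetime_measurable h]
 show "integrable Q (%q. indicator future q * (\<zeta> (spacetime q) * h (spacetime q))) \<longleftrightarrow> integrable Q (%q. indicator alive q * h (spacetime q))"
  unfolding A(1)[symmetric] F(1)[symmetric] \<zeta>_density using h \<zeta>0 by (subst integrable_density) auto
 show "(\<integral>q. indicator future q * (\<zeta> (spacetime q) * h (spacetime q)) \<partial>Q) = (\<integral>q. indicator alive q * h (spacetime q) \<partial>Q)"
  unfolding A(2)[symmetric] F(2)[symmetric] \<zeta>_density using h \<zeta>0 by (subst integral_density) auto
qed

lemma occupation_integral:
 fixes h :: "'e => real"
 assumes h: "h \<in> borel_measurable borel"
 shows "integrable Q (%q. indicator alive q * h (pos q)) \<longleftrightarrow> integrable \<mu>T (%x. \<gamma> x * h x)"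
  "(\<integral>q. indicator alive q * h (pos q) \<partial>Q) = (\<integral>x. \<gamma> x * h x \<partial>\<mu>T)"
proof -
 note A = integral_push_forward[OF pair_measurable(4,3) h]
 show "integrable Q (%q. indicator alive q * h (pos q)) \<longleftrightarrow> integrable \<mu>T (%x. \<gamma> x * h x)"
  unfolding A(1)[symmetric] \<gamma>_density using measurable_\<mu>T[OF h] \<gamma>i \<gamma>0 by (subst integrable_density) auto
 show "(\<integral>q. indicator alive q * h (pos q) \<partial>Q) = (\<integral>x. \<gamma> x * h x \<partial>\<mu>T)"
  unfolding A(2)[symmetric] \<gamma>_density using measurable_\<mu>T[OF h] \<gamma>i \<gamma>0 by (subst integral_density) auto
qed

lemma alive_dird_integrable:
 assumes \<pi>: "lipschitz_fun \<pi>"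
 shows "integrable Q (%q. indicator alive q * dird W \<pi> (pos q))"
 unfolding occupation_integral(1)[OF dirdW_measurable[OF \<pi>]] by (rule integrable_dird[OF \<gamma>i \<pi>])

lemma alive_weighted_integrable:
 assumes \<pi>: "lipschitz_fun \<pi>" and h: "h \<in> borel_measurable (borel \<Otimes>\<^sub>M borel)" "!!y. \<bar>h y\<bar> <= B"
 shows "integrable Q (%q. indicator alive q * (h (spacetime q) * dird W \<pi> (pos q)))"
proof (rule Bochner_Integration.integrable_bound[OF integrable_mult_right[OF alive_dird_integrable[OF \<pi>], of B]])
 note [measurable] = h(1) dirdW_measurable[OF \<pi>]
 show "(%q. indicator alive q * (h (spacetime q) * dird W \<pi> (pos q))) \<in> borel_measurable Q" by measurable
 have "\<bar>h y\<bar> * d <= \<bar>B\<bar> * d" if "0 <= d" for y and d :: real using h(2)[of y] that by (intro mult_right_mono) auto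
 then show "AE q in Q. norm (indicator alive q * (h (spacetime q) * dird W \<pi> (pos q))) <= norm (B * (indicator alive q * dird W \<pi> (pos q)))"
  by (intro AE_I2) (auto simp: indicator_def abs_mult)
qed

text \<open>What is needed of a single path for integration over time.\<close>
lemma flow_path_derivative:
 assumes \<pi>: "lipschitz_fun \<pi>"
 shows "AE p in \<sigma>. 0 <= snd p \<and> curve_length (fst p) < \<infinity> \<and> (Lip \<pi>)-lipschitz_on UNIV (%t. \<pi> (pos (p, t))) \<and>
  (%t. indicator alive (p, t) * dird W \<pi> (pos (p, t))) \<in> borel_measurable borel \<and>
  (AE t in lborel. 0 < t --> ((%t. \<pi> (pos (p, t))) has_real_derivative indicator alive (p, t) * dird W \<pi> (pos (p, t))) (at t))"
 using flow_curve[OF null_sets.empty_sets \<pi>]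
proof (elim eventually_mono conjE, intro conjI)
 note [measurable] = dirdW_measurable[OF \<pi>]
 fix p :: "'e curve \<times> real" assume 1: "1-lipschitz_on UNIV (at_time (fst p))"
 note L = Lip_lipschitz[OF \<pi>]
 have pos: "pos (p, t) = at_time (fst p) (t + snd p)" for t by (simp add: pos_def beta_def case_prod_beta)
 show "(Lip \<pi>)-lipschitz_on UNIV (%t. \<pi> (pos (p, t)))"
 proof (rule lipschitz_onI[OF _ lipschitz_on_nonneg[OF L]])
  fix s t
  have "dist (\<pi> (pos (p, s))) (\<pi> (pos (p, t))) <= Lip \<pi> * dist (pos (p, s)) (pos (p, t))" by (rule lipschitz_onD[OF L]) auto
  also have "... <= Lip \<pi> * (1 * dist (s + snd p) (t + snd p))"
   unfolding pos using lipschitz_on_nonneg[OF L] by (intro mult_left_mono lipschitz_onD[OF 1]) auto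
  finally show "dist (\<pi> (pos (p, s))) (\<pi> (pos (p, t))) <= Lip \<pi> * dist s t" by (simp add: dist_real_def)
 qed
 have "(%q. indicator alive q * dird W \<pi> (pos q)) \<in> borel_measurable Q" by measurable
 from measurable_Pair2[OF this, of p] show "(%t. indicator alive (p, t) * dird W \<pi> (pos (p, t))) \<in> borel_measurable borel"
  by (simp add: space_\<sigma>)
qed (auto elim: eventually_mono)

text \<open>The end of the curve, which has been reached at the first integer time not less than the
  length.\<close>
definition stop :: "'e curve \<times> real => 'e" where
 "stop p = beta (real (LEAST n::nat. curve_length (fst p) <= of_nat n)) p"

lemma stop_measurable: "stop \<in> borel_measurable \<sigma>"
 unfolding stop_def[abs_def]
proof (rule measurable_compose_countable[where f="%n p. beta (real n) p" and g="%p. LEAST n. curve_length (fst p) <= of_nat n"])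
 show "beta (real n) \<in> borel_measurable \<sigma>" for n
  unfolding measurable_cong_sets[OF sets_\<sigma> refl] by (rule beta_measurable)
 have [measurable]: "(%p. curve_length (fst p)) \<in> borel_measurable \<sigma>" by (rule measurable_compose[OF pair_measurable(1) curve_length_measurable])
 show "(%p. LEAST n. curve_length (fst p) <= of_nat n) \<in> measurable \<sigma> (count_space UNIV)" by measurable
qed

text \<open>By the fundamental theorem of calculus along each particle's path, the boundary consists of
  the end points minus the starting points.\<close>
lemma boundary_of_restriction:
 assumes \<pi>: "bounded_lipschitz \<pi>"
 shows "(\<integral>x. \<gamma> x * dird W \<pi> x \<partial>\<mu>T) = (\<integral>x. \<pi> x \<partial>distr \<sigma> borel stop) - (\<integral>x. \<pi> x \<partial>distr \<sigma> borel (beta 0))"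
proof -
 obtain B where B: "\<pi> \<in> borel_measurable borel" "!!x. \<bar>\<pi> x\<bar> <= B" using bounded_lipschitzE[OF \<pi>] by blast
 have l: "lipschitz_fun \<pi>" using \<pi> by (simp add: bounded_lipschitz_def)
 have b0: "beta 0 \<in> borel_measurable \<sigma>" unfolding measurable_cong_sets[OF sets_\<sigma> refl] by (rule beta_measurable)
 have i: "integrable \<sigma> (%p. \<pi> (g p))" if "g \<in> borel_measurable \<sigma>" for g
  by (rule \<sigma>.integrable_const_bound[of _ B]) (use B measurable_compose[OF that B(1)] in auto)
 have "(\<integral>x. \<gamma> x * dird W \<pi> x \<partial>\<mu>T) = (\<integral>p. \<integral>t. indicator alive (p, t) * dird W \<pi> (pos (p, t)) \<partial>lborel \<partial>\<sigma>)"
  unfolding occupation_integral(2)[OF dirdW_measurable[OF l], symmetric] by (rule Q.integral_fst'[OF alive_dird_integrable[OF l], symmetric])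
 also have "... = (\<integral>p. \<pi> (stop p) - \<pi> (beta 0 p) \<partial>\<sigma>)"
 proof (rule integral_cong_AE)
  show "(%p. \<integral>t. indicator alive (p, t) * dird W \<pi> (pos (p, t)) \<partial>lborel) \<in> borel_measurable \<sigma>"
   using Q.integrable_fst'[OF alive_dird_integrable[OF l]] by simp
  show "(%p. \<pi> (stop p) - \<pi> (beta 0 p)) \<in> borel_measurable \<sigma>" using i[OF stop_measurable] i[OF b0] by simp
  show "AE p in \<sigma>. (\<integral>t. indicator alive (p, t) * dird W \<pi> (pos (p, t)) \<partial>lborel) = \<pi> (stop p) - \<pi> (beta 0 p)"
   using flow_path_derivative[OF l]
  proof (elim eventually_mono conjE)
   fix p :: "'e curve \<times> real"
   assume s: "0 <= snd p" and len: "curve_length (fst p) < \<infinity>" and L: "(Lip \<pi>)-lipschitz_on UNIV (%t. \<pi> (pos (p, t)))"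
    and Dm: "(%t. indicator alive (p, t) * dird W \<pi> (pos (p, t))) \<in> borel_measurable borel"
    and D: "AE t in lborel. 0 < t --> ((%t. \<pi> (pos (p, t))) has_real_derivative indicator alive (p, t) * dird W \<pi> (pos (p, t))) (at t)"
   define n where "n = (LEAST n::nat. curve_length (fst p) <= of_nat n)"
   obtain r where r: "0 <= r" "curve_length (fst p) = ennreal r" using len by (cases "curve_length (fst p)") auto
   have "\<exists>n::nat. curve_length (fst p) <= of_nat n"
    using real_arch_simple[of r] unfolding r(2) ennreal_of_nat_eq_real_of_nat by (auto intro: ennreal_leI)
   then have "curve_length (fst p) <= of_nat n" unfolding n_def by (rule LeastI_ex)
   then have rn: "r <= real n" using r by (simp add: ennreal_of_nat_eq_real_of_nat)
   have "AE t in lborel. t \<in> {0..real n} --> ((%t. \<pi> (pos (p, t))) has_real_derivative indicator alive (p, t) * dird W \<pi> (pos (p, t))) (at t)"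
    using D AE_lborel_singleton[of 0] by eventually_elim auto
   from lipschitz_ftc(2)[OF L _ this Dm]
   have "(LBINT t:{0..real n}. indicator alive (p, t) * dird W \<pi> (pos (p, t))) = \<pi> (pos (p, real n)) - \<pi> (pos (p, 0))" by simp
   moreover have "indicator {0..real n} t *\<^sub>R (indicator alive (p, t) * dird W \<pi> (pos (p, t))) = indicator alive (p, t) * dird W \<pi> (pos (p, t))" for t
    using s rn r by (auto simp: indicator_def alive_def ennreal_less_iff simp del: ennreal_plus)
   moreover have st: "stop p = pos (p, real n)" "beta 0 p = pos (p, 0)" by (simp_all add: pos_def stop_def n_def)
   ultimately show "(\<integral>t. indicator alive (p, t) * dird W \<pi> (pos (p, t)) \<partial>lborel) = \<pi> (stop p) - \<pi> (beta 0 p)"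
    unfolding st set_lebesgue_integral_def by (simp only:)
  qed
 qed
 also have "... = (\<integral>p. \<pi> (stop p) \<partial>\<sigma>) - (\<integral>p. \<pi> (beta 0 p) \<partial>\<sigma>)" by (rule Bochner_Integration.integral_diff[OF i[OF stop_measurable] i[OF b0]])
 finally show ?thesis by (simp add: integral_distr[OF stop_measurable B(1)] integral_distr[OF b0 B(1)])
qed

lemma normal_restriction: "normal_current (current_restrict T \<gamma>)"
 unfolding normal_current_def
proof (intro conjI exI allI impI)
 show "metric_current (current_restrict T \<gamma>)" by (rule metric_current_restrict[OF \<gamma>i])
 show "finite_borel (distr \<sigma> borel stop)"
  by (rule finite_borel_distr_countable[OF fb\<sigma> stop_measurable, where F="%n. beta (real n)"]) (auto simp: beta_continuous stop_def)
 show "finite_borel (distr \<sigma> borel (beta 0))"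
  by (rule finite_borel_distr_countable[OF fb\<sigma>, where F="%n. beta 0"])
    (auto simp: beta_continuous measurable_cong_sets[OF sets_\<sigma> refl] beta_measurable)
 fix \<pi> :: "'e => real" assume \<pi>: "bounded_lipschitz \<pi>"
 then have "lipschitz_fun \<pi>" by (simp add: bounded_lipschitz_def)
 from current_restrict_eq[OF \<gamma>i bounded_lipschitz_const this, of 1]
 show "current_restrict T \<gamma> (%_. 1) \<pi> = (\<integral>x. \<pi> x \<partial>distr \<sigma> borel stop) - (\<integral>x. \<pi> x \<partial>distr \<sigma> borel (beta 0))"
  unfolding boundary_of_restriction[OF \<pi>, symmetric] by simp
qed

end

section \<open>The continuity equation and the representing measures\<close>

context flow_densities begin

text \<open>Weighting with \<open>\<zeta>\<close> on the whole flow is the same as integrating over the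
  living particles.\<close>
lemma future_dird_integrable:
 assumes \<pi>: "lipschitz_fun \<pi>" and h: "h \<in> borel_measurable (borel \<Otimes>\<^sub>M borel)" "!!y. \<bar>h y\<bar> <= B"
 shows "integrable Q (%q. indicator future q * (\<zeta> (spacetime q) * (h (spacetime q) * dird W \<pi> (pos q))))"
  "(\<integral>q. indicator future q * (\<zeta> (spacetime q) * (h (spacetime q) * dird W \<pi> (pos q))) \<partial>Q)
   = (\<integral>q. indicator alive q * (h (spacetime q) * dird W \<pi> (pos q)) \<partial>Q)"
proof -
 note [measurable] = h(1) dirdW_measurable[OF \<pi>]
 have m: "(%y. h y * dird W \<pi> (fst y)) \<in> borel_measurable (borel \<Otimes>\<^sub>M borel)" by measurable
 note s = survival_integral[OF m, unfolded fst_conv]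
 show "integrable Q (%q. indicator future q * (\<zeta> (spacetime q) * (h (spacetime q) * dird W \<pi> (pos q))))"
  unfolding s(1) by (rule alive_weighted_integrable[OF \<pi> h])
 show "(\<integral>q. indicator future q * (\<zeta> (spacetime q) * (h (spacetime q) * dird W \<pi> (pos q))) \<partial>Q)
   = (\<integral>q. indicator alive q * (h (spacetime q) * dird W \<pi> (pos q)) \<partial>Q)" by (rule s(2))
qed

lemma closure_sets: "{x. V x \<in> closure C} \<in> sets borel"
 using measurable_sets[OF Vm, of "closure C"] by (simp add: vimage_def)

lemma flow_field: "AE t in lborel. AE x in flow \<sigma> t. V x \<in> closure C"
proof -
 have "{q \<in> space Q. V (pos (fst q, snd q)) \<in> closure C} \<in> sets Q"
  using measurable_sets[OF pair_measurable(3) closure_sets] by (simp add: vimage_def Int_def conj_commute)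
 then have "(AE p in \<sigma>. AE t in lborel. V (pos (p, t)) \<in> closure C) \<longleftrightarrow> (AE t in lborel. AE p in \<sigma>. V (pos (p, t)) \<in> closure C)"
  by (rule Q.AE_commute)
 moreover have "AE p in \<sigma>. AE t in lborel. V (pos (p, t)) \<in> closure C" by (rule Q.AE_pair[OF VC\<sigma>])
 ultimately have "AE t in lborel. AE p in \<sigma>. V (pos (p, t)) \<in> closure C" by blast
 then show ?thesis
 proof eventually_elim
  fix t assume "AE p in \<sigma>. V (pos (p, t)) \<in> closure C"
  moreover have "beta t \<in> borel_measurable \<sigma>" unfolding measurable_cong_sets[OF sets_\<sigma> refl] by (rule beta_measurable)
  ultimately show "AE x in flow \<sigma> t. V x \<in> closure C"
   unfolding flow_def using closure_sets by (subst AE_distr_iff) (auto simp: pos_def)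
 qed
qed

lemma flow_integral:
 fixes h :: "'e => real"
 assumes h: "h \<in> borel_measurable borel"
 shows "(\<integral>x. h x \<partial>flow \<sigma> t) = (\<integral>p. h (pos (p, t)) \<partial>\<sigma>)" "integrable (flow \<sigma> t) h \<longleftrightarrow> integrable \<sigma> (%p. h (pos (p, t)))"
proof -
 have b: "beta t \<in> measurable \<sigma> borel" unfolding measurable_cong_sets[OF sets_\<sigma> refl] by (rule beta_measurable)
 show "(\<integral>x. h x \<partial>flow \<sigma> t) = (\<integral>p. h (pos (p, t)) \<partial>\<sigma>)" "integrable (flow \<sigma> t) h \<longleftrightarrow> integrable \<sigma> (%p. h (pos (p, t)))"
  by (simp_all add: flow_def integral_distr[OF b h] integrable_distr_eq[OF b h] pos_def)
qed

text \<open>Test the flow with \<open>\<psi>(t) \<pi>(x)\<close>, integrate by parts along each path, and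
  express the velocity term, which comes from the living particles, by \<open>\<zeta>\<close>.\<close>
lemma continuity_equation: "weak_continuity_equation (flow \<sigma>) (%t x. \<zeta> (x, t) *\<^sub>R V x)"
 unfolding weak_continuity_equation_def
proof (intro ballI impI)
 fix \<pi> :: "'e => real" assume \<pi>Q: "\<pi> \<in> Q1" and bd: "bounded (range \<pi>)"
 note \<pi> = Q1_lipschitz(1)[OF \<pi>Q] and qd = Q1_lipschitz(2)[OF \<pi>Q]
 obtain B where B: "!!x. \<bar>\<pi> x\<bar> <= B" using bd unfolding bounded_iff by auto
 have \<pi>m: "\<pi> \<in> borel_measurable borel" by (rule lipschitz_fun_borel[OF \<pi>])
 note [measurable] = \<pi>m dirdW_measurable[OF \<pi>]
 define h where "h = (%x t. \<zeta> (x, t) * dird W \<pi> x)"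
 define R where "R = (%t. \<integral>x. blinfun_apply (quasi_deriv \<pi> x) (\<zeta> (x, t) *\<^sub>R V x) \<partial>completion (flow \<sigma> t))"
 define M where "M = (%t. \<integral>p. indicator future (p, t) * h (pos (p, t)) t \<partial>\<sigma>)"
 have hm: "(%x. h x t) \<in> borel_measurable borel" for t unfolding h_def by measurable
 have field: "blinfun_apply (quasi_deriv \<pi> x) (\<zeta> (x, t) *\<^sub>R V x) = h x t" if "V x \<in> closure C" for x t
  using dird_quasi_deriv[OF qd, of W x] that by (simp add: h_def blinfun.scaleR_right sep_field_def)
 have iQ: "integrable Q (%(p, t). indicator future (p, t) * h (pos (p, t)) t)"
  using future_dird_integrable(1)[OF \<pi>, of "%_. 1" 1] by (simp add: h_def case_prod_beta')
 have iM: "integrable lborel M" unfolding M_def by (rule Q.integrable_snd[OF iQ])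
 have ae: "AE t in lborel. 0 < t --> integrable (completion (flow \<sigma> t)) (%x. blinfun_apply (quasi_deriv \<pi> x) (\<zeta> (x, t) *\<^sub>R V x)) \<and> R t = M t"
  using flow_field Q.AE_integrable_snd[OF iQ]
 proof (eventually_elim, intro impI)
  fix t :: real assume f: "AE x in flow \<sigma> t. V x \<in> closure C" and i: "integrable \<sigma> (%p. indicator future (p, t) * h (pos (p, t)) t)" and t: "0 < t"
  have f': "AE x in flow \<sigma> t. blinfun_apply (quasi_deriv \<pi> x) (\<zeta> (x, t) *\<^sub>R V x) = h x t" using f by eventually_elim (rule field)
  have i': "integrable (flow \<sigma> t) (%x. h x t)" unfolding flow_integral(2)[OF hm] using i t by simp
  have "R t = M t" unfolding R_def integral_completion_AE[OF borel_measurable_integrable[OF i'] f'] flow_integral(1)[OF hm] M_def using t by simp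
  with integrable_completion_AE[OF i' f']
  show "integrable (completion (flow \<sigma> t)) (%x. blinfun_apply (quasi_deriv \<pi> x) (\<zeta> (x, t) *\<^sub>R V x)) \<and> R t = M t" by blast
 qed
 have RM: "AE t in lborel. 0 < t --> R t = M t" using ae by eventually_elim blast
 have wk: "- (LINT t:{0<..}|lebesgue. deriv \<psi> t * (\<integral>x. \<pi> x \<partial>flow \<sigma> t)) = (LINT t:{0<..}|lebesgue. \<psi> t * R t)" if \<psi>: "test_function \<psi>" for \<psi>
 proof -
  obtain a b K where ab: "0 < a" "a <= b" "!!t. t \<notin> {a..b} ==> \<psi> t = 0 \<and> deriv \<psi> t = 0"
   and m[measurable]: "deriv \<psi> \<in> borel_measurable borel" "\<psi> \<in> borel_measurable borel"
   and K: "!!t. \<bar>\<psi> t\<bar> <= K" "!!t. \<bar>deriv \<psi> t\<bar> <= K" by (rule test_functionE[OF \<psi>]) blast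
  have z: "\<psi> t = 0" "deriv \<psi> t = 0" if "t <= 0" for t using ab(1) ab(3)[of t] that by auto
  have i1: "integrable Q (%(p, t). deriv \<psi> t * \<pi> (pos (p, t)))"
  proof (rule Bochner_Integration.integrable_bound[of _ "%q. (K * B) * indicator (UNIV \<times> {a..b}) q"])
   have "UNIV \<times> {a..b} \<in> sets Q" using pair_measureI[OF sets.top[of \<sigma>], of "{a..b}" "lborel :: real measure"] unfolding space_\<sigma> by simp
   moreover have "emeasure Q (space \<sigma> \<times> {a..b}) < \<infinity>"
    by (subst lborel.emeasure_pair_measure_Times) (use ab in \<open>auto simp: \<sigma>.emeasure_eq_measure ennreal_mult[symmetric]\<close>)
   ultimately show "integrable Q (%q. (K * B) * indicator (UNIV \<times> {a..b}) q)"
    unfolding space_\<sigma> by (intro integrable_mult_right integrable_real_indicator)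
   show "(%(p, t). deriv \<psi> t * \<pi> (pos (p, t))) \<in> borel_measurable Q" unfolding case_prod_beta' by simp
   have "\<bar>deriv \<psi> t\<bar> * \<bar>\<pi> x\<bar> <= \<bar>K\<bar> * \<bar>B\<bar>" for t x using K(2)[of t] B[of x] by (intro mult_mono) auto
   then show "AE q in Q. norm (case q of (p, t) => deriv \<psi> t * \<pi> (pos (p, t))) <= norm ((K * B) * indicator (UNIV \<times> {a..b}) q)"
    using ab(3) by (intro AE_I2) (auto simp: indicator_def abs_mult split: prod.split)
  qed
  have \<psi>m: "(%y::'e \<times> real. \<psi> (snd y)) \<in> borel_measurable (borel \<Otimes>\<^sub>M borel)" by measurable
  note F = future_dird_integrable[OF \<pi> \<psi>m K(1), unfolded snd_conv]
  have i2: "integrable Q (%(p, t). \<psi> t * (indicator future (p, t) * h (pos (p, t)) t))"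
   using F(1) by (simp add: h_def case_prod_beta' mult.left_commute)
  have i3: "integrable Q (%(p, t). \<psi> t * (indicator alive (p, t) * dird W \<pi> (pos (p, t))))"
   using alive_weighted_integrable[OF \<pi> \<psi>m K(1)] by (simp add: case_prod_beta' mult.left_commute)
  have Um: "(%t. \<integral>x. \<pi> x \<partial>flow \<sigma> t) \<in> borel_measurable lborel"
   unfolding flow_integral(1)[OF \<pi>m] by (rule \<sigma>.borel_measurable_lebesgue_integral) (simp add: measurable_split_conv)
  have "(LINT t:{0<..}|lebesgue. deriv \<psi> t * (\<integral>x. \<pi> x \<partial>flow \<sigma> t)) = (\<integral>t. deriv \<psi> t * (\<integral>x. \<pi> x \<partial>flow \<sigma> t) \<partial>lborel)"
   unfolding set_lebesgue_integral_def by (rule integral_completion_AE) (use Um z in \<open>auto simp: indicator_def not_less\<close>)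
  also have "... = (\<integral>t. \<integral>p. deriv \<psi> t * \<pi> (pos (p, t)) \<partial>\<sigma> \<partial>lborel)" unfolding flow_integral(1)[OF \<pi>m] by simp
  also have "... = (\<integral>p. \<integral>t. deriv \<psi> t * \<pi> (pos (p, t)) \<partial>lborel \<partial>\<sigma>)" using Q.integral_snd[OF i1] Q.integral_fst[OF i1] by simp
  finally have L: "(LINT t:{0<..}|lebesgue. deriv \<psi> t * (\<integral>x. \<pi> x \<partial>flow \<sigma> t)) = (\<integral>p. \<integral>t. deriv \<psi> t * \<pi> (pos (p, t)) \<partial>lborel \<partial>\<sigma>)" .
  have "(LINT t:{0<..}|lebesgue. \<psi> t * R t) = (\<integral>t. \<psi> t * M t \<partial>lborel)"
   unfolding set_lebesgue_integral_def
  proof (rule integral_completion_AE)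
   show "(%t. \<psi> t * M t) \<in> borel_measurable lborel" using iM by simp
   show "AE t in lborel. indicator {0<..} t *\<^sub>R (\<psi> t * R t) = \<psi> t * M t" using RM by eventually_elim (auto simp: indicator_def z)
  qed
  also have "... = (\<integral>t. \<integral>p. \<psi> t * (indicator future (p, t) * h (pos (p, t)) t) \<partial>\<sigma> \<partial>lborel)" unfolding M_def by simp
  also have "... = (\<integral>q. indicator future q * (\<zeta> (spacetime q) * (\<psi> (snd q) * dird W \<pi> (pos q))) \<partial>Q)"
   unfolding Q.integral_snd[OF i2] by (simp add: h_def case_prod_beta' mult.left_commute)
  also have "... = (\<integral>(p, t). \<psi> t * (indicator alive (p, t) * dird W \<pi> (pos (p, t))) \<partial>Q)"
   unfolding F(2) by (simp add: case_prod_beta' mult.left_commute)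
  also have "... = (\<integral>p. \<integral>t. \<psi> t * (indicator alive (p, t) * dird W \<pi> (pos (p, t))) \<partial>lborel \<partial>\<sigma>)" by (rule Q.integral_fst[OF i3, symmetric])
  also have "... = (\<integral>p. - (\<integral>t. deriv \<psi> t * \<pi> (pos (p, t)) \<partial>lborel) \<partial>\<sigma>)"
  proof (rule integral_cong_AE)
   show "AE p in \<sigma>. (\<integral>t. \<psi> t * (indicator alive (p, t) * dird W \<pi> (pos (p, t))) \<partial>lborel) = - (\<integral>t. deriv \<psi> t * \<pi> (pos (p, t)) \<partial>lborel)"
    using flow_path_derivative[OF \<pi>] by (elim eventually_mono conjE) (rule lipschitz_integration_by_parts[OF _ B _ _ \<psi>])
  qed (use Q.integrable_fst[OF i3] Q.integrable_fst[OF i1] in simp_all)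
  finally show ?thesis unfolding L by simp
 qed
 have "AE t in lebesgue_on {0<..}. integrable (completion (flow \<sigma> t)) (%x. blinfun_apply (quasi_deriv \<pi> x) (\<zeta> (x, t) *\<^sub>R V x))"
  unfolding AE_lebesgue_on_iff[OF borel_open[OF open_greaterThan]] using ae by eventually_elim auto
 moreover have "set_integrable lebesgue {a..b} R" if a: "0 < a" for a b
  unfolding set_integrable_def
 proof (rule integrable_completion_AE)
  show "integrable lborel (%t. indicator {a..b} t *\<^sub>R M t)" by (rule integrable_mult_indicator[OF _ iM]) simp
  show "AE t in lborel. indicator {a..b} t *\<^sub>R R t = indicator {a..b} t *\<^sub>R M t" using RM by eventually_elim (use a in \<open>auto simp: indicator_def\<close>)
 qed
 ultimately show "(AE t in lebesgue_on {0<..}. integrable (completion (flow \<sigma> t)) (%x. blinfun_apply (quasi_deriv \<pi> x) (\<zeta> (x, t) *\<^sub>R V x))) \<and>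
  (\<forall>a b. 0 < a --> set_integrable lebesgue {a..b} (%t. \<integral>x. blinfun_apply (quasi_deriv \<pi> x) (\<zeta> (x, t) *\<^sub>R V x) \<partial>completion (flow \<sigma> t))) \<and>
  (\<forall>\<psi>. test_function \<psi> --> - (LINT t:{0<..}|lebesgue. deriv \<psi> t * (\<integral>x. \<pi> x \<partial>flow \<sigma> t)) =
    (LINT t:{0<..}|lebesgue. \<psi> t * (\<integral>x. blinfun_apply (quasi_deriv \<pi> x) (\<zeta> (x, t) *\<^sub>R V x) \<partial>completion (flow \<sigma> t))))"
  using wk unfolding R_def by blast
qed

text \<open>A measure on curves with the same marginals as the flow has the same image in space-time.
  Since its curves have velocity \<open>\<zeta> V\<close>, the derivative of
  \<open>\<pi>\<close> along them is a function of space-time, so the integral over the curves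
  equals that of the flow.\<close>
lemma representation:
 fixes \<xi> :: "'e curve measure"
 assumes fb: "finite_borel \<xi>" and acx: "AE cv in \<xi>. \<forall>b\<ge>0. absolutely_continuous_curve_on {0..b} cv"
  and marg: "!!t. t >= 0 ==> distr \<xi> borel (%cv. at_time cv t) = flow \<sigma> t"
  and ode: "AE cv in \<xi>. AE t in lebesgue_on {0..}. (at_time cv has_vector_derivative \<zeta> (at_time cv t, t) *\<^sub>R V (at_time cv t)) (at t)"
 shows "represents_current \<xi> (current_restrict T \<gamma>)"
 unfolding represents_current_def
proof (intro allI impI)
 fix f \<pi> :: "'e => real" assume f: "bounded_lipschitz f" and \<pi>: "lipschitz_fun \<pi>"
 obtain B where B: "f \<in> borel_measurable borel" "!!x. \<bar>f x\<bar> <= B" using bounded_lipschitzE[OF f] by blast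
 note sx = finite_borelD(2)[OF fb] and spx = finite_borelD(3)[OF fb]
 interpret x: finite_measure \<xi> by (rule finite_borelD(1)[OF fb])
 interpret X: pair_sigma_finite \<xi> "lborel :: real measure" by standard
 note [measurable] = B(1) dirdW_measurable[OF \<pi>]
 have sX: "sets (\<xi> \<Otimes>\<^sub>M (lborel :: real measure)) = sets (borel \<Otimes>\<^sub>M borel)" by (rule sets_pair_measure_cong[OF sx]) simp
 have evX[measurable]: "ev \<in> borel_measurable (\<xi> \<Otimes>\<^sub>M lborel)" using ev_measurable by (simp only: measurable_cong_sets[OF sX refl])
 define g where "g = (%q. (ev q, snd q :: real) :: 'e \<times> real)"
 have gm: "g \<in> measurable (\<xi> \<Otimes>\<^sub>M lborel) (borel \<Otimes>\<^sub>M borel)" unfolding g_def by (intro measurable_Pair evX) simp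
 define G :: "('e curve \<times> real) set" where "G = {q. 0 <= snd q}"
 have "{q \<in> space (\<xi> \<Otimes>\<^sub>M lborel). 0 <= snd q} \<in> sets (\<xi> \<Otimes>\<^sub>M (lborel :: real measure))" by measurable
 then have G: "G \<in> sets (\<xi> \<Otimes>\<^sub>M lborel)" by (simp add: G_def space_pair_measure spx)
 \<comment> \<open>Both measures have the same time slices.\<close>
 have same: "distr (density (\<xi> \<Otimes>\<^sub>M lborel) (indicator G)) (borel \<Otimes>\<^sub>M borel) g = distr (density Q (indicator future)) (borel \<Otimes>\<^sub>M borel) spacetime"
  (is "?X = ?F")
 proof (rule measure_eqI)
  fix A assume "A \<in> sets ?X"
  then have A[measurable]: "A \<in> sets (borel \<Otimes>\<^sub>M borel)" by simp
  have slice: "{x. (x, t) \<in> A} \<in> sets borel" for t using sets_Pair2[OF A, of t] by (simp add: vimage_def)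
  have "emeasure ?X A = (\<integral>\<^sup>+t. \<integral>\<^sup>+cv. indicator G (cv, t) * indicator A (g (cv, t)) \<partial>\<xi> \<partial>lborel)"
   unfolding emeasure_push_forward[OF G gm A] by (rule X.nn_integral_snd[symmetric]) (use G gm in measurable)
  also have "... = (\<integral>\<^sup>+t. \<integral>\<^sup>+p. indicator future (p, t) * indicator A (spacetime (p, t)) \<partial>\<sigma> \<partial>lborel)"
  proof (rule nn_integral_cong)
   fix t :: real
   show "(\<integral>\<^sup>+cv. indicator G (cv, t) * indicator A (g (cv, t)) \<partial>\<xi>) = (\<integral>\<^sup>+p. indicator future (p, t) * indicator A (spacetime (p, t)) \<partial>\<sigma>)"
   proof (cases "0 <= t")
    case True
    have at: "(%cv. at_time cv t) \<in> measurable \<xi> borel" using at_time_measurable by (simp only: measurable_cong_sets[OF sx refl])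
    have b: "beta t \<in> measurable \<sigma> borel" unfolding measurable_cong_sets[OF sets_\<sigma> refl] by (rule beta_measurable)
    have i: "indicator {x. (x, t) \<in> A} \<in> borel_measurable borel" using slice[of t] by simp
    have "(\<integral>\<^sup>+cv. indicator {x. (x, t) \<in> A} (at_time cv t) \<partial>\<xi>) = (\<integral>\<^sup>+x. indicator {x. (x, t) \<in> A} x \<partial>flow \<sigma> t)"
    unfolding marg[OF True, symmetric] by (rule nn_integral_distr[OF at, symmetric]) (use i in simp)
    also have "... = (\<integral>\<^sup>+p. indicator {x. (x, t) \<in> A} (beta t p) \<partial>\<sigma>)"
    unfolding flow_def by (rule nn_integral_distr[OF b]) (use i in simp)
    finally show ?thesis using True by (simp add: g_def G_def ev_def pos_def indicator_def)
   qed (simp add: G_def)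
  qed
  also have "... = emeasure ?F A"
   unfolding emeasure_push_forward[OF future_sets spacetime_measurable A] by (rule Q.nn_integral_snd) (use future_sets in measurable)
  finally show "emeasure ?X A = emeasure ?F A" .
 qed simp
 define k where "k = (%y::'e \<times> real. \<zeta> y * (f (fst y) * dird W \<pi> (fst y)))"
 have km: "k \<in> borel_measurable (borel \<Otimes>\<^sub>M borel)" unfolding k_def by measurable
 note pX = integral_push_forward[OF G gm km, unfolded same]
 note pF = integral_push_forward[OF future_sets spacetime_measurable km]
 have fm: "(%y::'e \<times> real. f (fst y)) \<in> borel_measurable (borel \<Otimes>\<^sub>M borel)" by measurable
 note F = future_dird_integrable[OF \<pi> fm B(2), unfolded fst_conv]
 have iX: "integrable (\<xi> \<Otimes>\<^sub>M lborel) (%q. indicator G q * k (g q))"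
  unfolding pX(1)[symmetric] pF(1) using F(1) by (simp add: k_def)
 have "(\<integral>q. indicator G q * k (g q) \<partial>(\<xi> \<Otimes>\<^sub>M lborel)) = (\<integral>q. indicator alive q * (f (pos q) * dird W \<pi> (pos q)) \<partial>Q)"
  unfolding pX(2)[symmetric] pF(2) using F(2) by (simp add: k_def)
 also have "... = current_restrict T \<gamma> f \<pi>"
  unfolding current_restrict_eq[OF \<gamma>i f \<pi>] by (subst occupation_integral(2)) (auto simp: mult.assoc)
 finally have vX: "(\<integral>q. indicator G q * k (g q) \<partial>(\<xi> \<Otimes>\<^sub>M lborel)) = current_restrict T \<gamma> f \<pi>" .
 have "has_bochner_integral \<xi> (%cv. \<integral>t. indicator G (cv, t) * k (g (cv, t)) \<partial>lborel) (current_restrict T \<gamma> f \<pi>)"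
  using X.integrable_fst'[OF iX] X.integral_fst'[OF iX] vX by (simp add: has_bochner_integral_iff)
 moreover have "AE cv in \<xi>. curve_current cv f \<pi> = (\<integral>t. indicator G (cv, t) * k (g (cv, t)) \<partial>lborel)"
 proof -
  have "{q \<in> space (\<xi> \<Otimes>\<^sub>M lborel). 0 <= snd q --> V (ev (fst q, snd q)) \<in> closure C} \<in> sets (\<xi> \<Otimes>\<^sub>M (lborel :: real measure))"
  proof -
   have [measurable]: "closure C \<in> sets borel" by simp
   note [measurable] = Vm
   show ?thesis unfolding prod.collapse by measurable
  qed
  from X.AE_commute[OF this]
  have "(AE cv in \<xi>. AE t in lborel. 0 <= t --> V (ev (cv, t)) \<in> closure C) \<longleftrightarrow> (AE t in lborel. AE cv in \<xi>. 0 <= t --> V (ev (cv, t)) \<in> closure C)" .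
  moreover have "AE t in lborel. AE cv in \<xi>. 0 <= t --> V (ev (cv, t)) \<in> closure C"
   using flow_field
  proof eventually_elim
   fix t assume a: "AE x in flow \<sigma> t. V x \<in> closure C"
   show "AE cv in \<xi>. 0 <= t --> V (ev (cv, t)) \<in> closure C"
   proof (cases "0 <= t")
    case True
    have at: "(%cv. at_time cv t) \<in> measurable \<xi> borel" using at_time_measurable by (simp only: measurable_cong_sets[OF sx refl])
    from AE_distrD[OF at a[folded marg[OF True]]] show ?thesis by eventually_elim (simp add: ev_def)
   qed simp
  qed
  ultimately have "AE cv in \<xi>. AE t in lborel. 0 <= t --> V (ev (cv, t)) \<in> closure C" by blast
  then show ?thesis using acx ode
  proof eventually_elim
   fix cv assume c: "AE t in lborel. 0 <= t --> V (ev (cv, t)) \<in> closure C" and accv: "\<forall>b\<ge>0. absolutely_continuous_curve_on {0..b} cv"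
    and o: "AE t in lebesgue_on {0..}. (at_time cv has_vector_derivative \<zeta> (at_time cv t, t) *\<^sub>R V (at_time cv t)) (at t)"
   have d: "AE t in lborel. t > 0 --> (\<exists>D. ((%s. \<pi> (at_time cv s)) has_real_derivative D) (at t))"
    by (rule curve_ac_real_differentiable_AE[OF rnp _ \<pi>]) (use accv in blast)
   have "curve_current cv f \<pi> = (\<integral>t. f (at_time cv t) * slope \<pi> (cv, t) \<partial>lborel)" by (rule curve_current_eq[OF d f \<pi>])
   also have "... = (\<integral>t. indicator G (cv, t) * k (g (cv, t)) \<partial>lborel)"
   proof (rule integral_cong_AE)
    have [measurable]: "slope \<pi> \<in> borel_measurable (\<xi> \<Otimes>\<^sub>M lborel)"
    using slope_measurable[OF \<pi>] by (simp only: measurable_cong_sets[OF sX refl])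
    have "(%q. f (ev q) * slope \<pi> q) \<in> borel_measurable (\<xi> \<Otimes>\<^sub>M lborel)" by measurable
    from measurable_Pair2[OF this, of cv] show "(%t. f (at_time cv t) * slope \<pi> (cv, t)) \<in> borel_measurable lborel" by (simp add: spx ev_def)
    from measurable_Pair2[OF borel_measurable_integrable[OF iX], of cv]
    show "(%t. indicator G (cv, t) * k (g (cv, t))) \<in> borel_measurable lborel" by (simp add: spx)
    show "AE t in lborel. f (at_time cv t) * slope \<pi> (cv, t) = indicator G (cv, t) * k (g (cv, t))"
    using c d o[unfolded AE_lebesgue_on_iff[OF borel_closed[OF closed_atLeast]]] AE_lborel_singleton[of 0]
    proof eventually_elim
    fix t :: real assume c: "0 <= t --> V (ev (cv, t)) \<in> closure C" and d: "t > 0 --> (\<exists>D. ((%s. \<pi> (at_time cv s)) has_real_derivative D) (at t))"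
    and o: "t \<in> {0..} --> (at_time cv has_vector_derivative \<zeta> (at_time cv t, t) *\<^sub>R V (at_time cv t)) (at t)" and t: "t ~= 0"
    show "f (at_time cv t) * slope \<pi> (cv, t) = indicator G (cv, t) * k (g (cv, t))"
    proof (cases "0 < t")
    case True
    obtain D where D: "((%s. \<pi> (at_time cv s)) has_real_derivative D) (at t)" using d True by blast
    have v: "(at_time cv has_vector_derivative \<zeta> (at_time cv t, t) *\<^sub>R V (at_time cv t)) (at t)" using o True by simp
    have "V (at_time cv t) = W (at_time cv t)" using c True by (simp add: sep_field_def ev_def)
    then have "D = \<zeta> (at_time cv t, t) * dird W \<pi> (at_time cv t)"
    by (intro dird_along_curve[where W=W, OF Lip_lipschitz[OF \<pi>] v D \<zeta>0]) simp
    then show ?thesis using True by (simp add: slope_def diff_lim_eq(1)[OF D] G_def k_def g_def ev_def)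
    next
    case False
    then show ?thesis using t by (simp add: slope_def G_def)
    qed
    qed
   qed
   finally show "curve_current cv f \<pi> = (\<integral>t. indicator G (cv, t) * k (g (cv, t)) \<partial>lborel)" .
  qed
 qed
 ultimately show "has_bochner_integral (completion \<xi>) (%cv. curve_current cv f \<pi>) (current_restrict T \<gamma> f \<pi>)"
  by (rule has_bochner_integral_completion_AE)
qed

end

theorem corollary5p1:
  fixes T :: "'e::banach functional"
    and V :: "'e \<Rightarrow> 'e"
    and \<mu> :: "'e measure"
    and \<sigma> :: "('e curve \<times> real) measure"
  assumes "radon_nikodym_property TYPE('e)"
    and "strictly_convex_norm TYPE('e)"
    and "metric_current T"
    and "V \<in> borel_measurable borel"
    and "AE x in mass_measure T. norm (V x) = 1"
    and "current_has_field T V"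
    and "transportable_through T \<mu> \<sigma>"
    and "(\<integral>\<^sup>+\<theta>. curve_length \<theta> \<partial>distr \<sigma> borel fst) < \<infinity>"
    and "AE \<theta> in distr \<sigma> borel fst. arclength_parameterized \<theta>"
  shows "\<exists>\<phi> :: 'e \<times> real \<Rightarrow> real.
    \<phi> \<in> borel_measurable (restrict_space borel (UNIV \<times> {0..})) \<and>
    (\<forall>x. \<forall>t\<ge>0. \<phi> (x, t) \<in> {0..1}) \<and>
    weak_continuity_equation (flow \<sigma>) (\<lambda>t x. (1 - \<phi> (x, t)) *\<^sub>R V x) \<and>
    (\<exists>\<gamma>. integrable (mass_measure T) \<gamma> \<and>
       normal_current (current_restrict T \<gamma>) \<and>
       (\<forall>\<eta> :: 'e curve measure.
          finite_borel \<eta> \<longrightarrow>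
          (AE \<theta> in \<eta>. \<forall>b\<ge>0. absolutely_continuous_curve_on {0..b} \<theta>) \<longrightarrow>
          (\<forall>t\<ge>0. distr \<eta> borel (\<lambda>\<theta>. at_time \<theta> t) = flow \<sigma> t) \<longrightarrow>
          (AE \<theta> in \<eta>. AE t in lebesgue_on {0..}.
             (at_time \<theta> has_vector_derivative (1 - \<phi> (at_time \<theta> t, t)) *\<^sub>R V (at_time \<theta> t)) (at t)) \<longrightarrow>
          represents_current \<eta> (current_restrict T \<gamma>)))"
proof -
 obtain \<eta> where \<eta>: "tight_borel \<eta>" "sigma_finite_measure \<eta>" "AE cv in \<eta>. absolutely_continuous_curve_on {0..} cv \<and> nonconstant_curve cv"
   "represents_current \<eta> T" "mass T = (\<integral>\<^sup>+cv. curve_length cv \<partial>\<eta>)"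
  and \<sigma>: "finite_borel \<sigma>" "AE p in \<sigma>. 0 <= snd p" "absolutely_continuous \<eta> (distr \<sigma> borel fst)"
  using assms(7) unfolding transportable_through_def by blast
 have fT: "finite_borel (mass_measure T)" using mass_measure_minimal(1)[OF assms(3)] by (simp add: mass_bound_def)
 obtain C1 where C1: "countable C1" "AE x in mass_measure T. V x \<in> closure C1"
  by (rule borel_map_essentially_separable[OF fT assms(4)])
 obtain C2 where C2: "countable C2" "AE q in \<sigma> \<Otimes>\<^sub>M lborel. V (pos q) \<in> closure C2"
  by (rule flow_field_separable[OF \<eta>(1) \<sigma>(1,3) assms(4)])
 \<comment> \<open>One modification of V has to serve the mass measure and the flow.\<close>
 define C where "C = C1 \<union> C2"
 interpret field_flow T \<eta> V C \<sigma>
 proof unfold_locales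
  show "AE cv in \<eta>. absolutely_continuous_curve_on {0..} cv" using \<eta>(3) by eventually_elim simp
  show "countable C" using C1(1) C2(1) by (simp add: C_def)
  show "AE x in mass_measure T. V x \<in> closure C" using C1(2) by eventually_elim (simp add: C_def)
  show "AE q in \<sigma> \<Otimes>\<^sub>M lborel. V (pos q) \<in> closure C" using C2(2) by eventually_elim (simp add: C_def)
 qed (fact assms \<eta> \<sigma> sigma_finite_measure.sigma_finite_countable[OF \<eta>(2)])+
 show ?thesis
 proof (rule survival_density, rule occupation_density)
 fix \<zeta> :: "'e \<times> real => real" and \<gamma> :: "'e => real"
 assume \<zeta>: "\<zeta> \<in> borel_measurable (borel \<Otimes>\<^sub>M borel)" "!!y. 0 <= \<zeta> y" "!!y. \<zeta> y <= 1"
  "distr (density Q (indicator alive)) (borel \<Otimes>\<^sub>M borel) spacetime = density (distr (density Q (indicator future)) (borel \<Otimes>\<^sub>M borel) spacetime) (%y. ennreal (\<zeta> y))"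
  and \<gamma>: "integrable \<mu>T \<gamma>" "!!x. 0 <= \<gamma> x"
  "distr (density Q (indicator alive)) borel pos = density \<mu>T (%x. ennreal (\<gamma> x))"
 interpret flow_densities T \<eta> V C \<sigma> \<zeta> \<gamma> by unfold_locales (fact \<zeta> \<gamma>)+
 have "(%y. y) \<in> measurable (borel :: ('e \<times> real) measure) (borel \<Otimes>\<^sub>M borel)"
  by (rule measurable_pair) (auto intro!: borel_measurable_continuous_onI continuous_intros simp: comp_def)
 from measurable_compose[OF this \<zeta>(1)] have "(%y. 1 - \<zeta> y) \<in> borel_measurable borel" by simp
 then have "(%y. 1 - \<zeta> y) \<in> borel_measurable (restrict_space borel (UNIV \<times> {0..}))" by (rule measurable_restrict_space1)
 then show ?thesis
  using \<zeta>(2,3) continuity_equation \<gamma>(1) normal_restriction representation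
  by (intro exI[of _ "%y. 1 - \<zeta> y"] conjI exI[of _ \<gamma>]) simp_all
 qed
qed

end
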